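(* Let $F_m$ be a free group of finite rank $m$, let $\varphi\in\mathrm{Aut}(F_m)$, and let $\Gamma=F_m\rtimes_\varphi\mathbb{Z}$. If $\varphi$ is polynomially growing, then for every Farber sequence $(\Gamma_n)_{n\in\mathbb{N}}$ of $\Gamma$ and every integer $j\geq 0$, $$t^{(2)}_j(\Gamma;\Gamma_n)=\limsup_{n\to\infty}\frac{\log|H_j(\Gamma_n;\mathbb{Z})_{\mathrm{tors}}|}{|\Gamma:\Gamma_n|}=0 .$$
   Context: Growth. Fix a free generating set of the finite rank free group $F=F_m$. For a conjugacy class $\bar g$ of $g\in F$, let $|\bar g|$ be the minimal length of a cyclically reduced word representing a conjugate of $g$. An outer automorphism $\Phi\in\mathrm{Out}(F)$ acts on conjugacy classes. A non-trivial conjugacy class $\bar g$ grows polynomially of degree $d$ under $\Phi$ if there are constants $C_1,C_2>0$ with $C_1n^d\leq|\Phi^n(\bar g)|\leq C_2n^d$ for all $n\geq 1$. $\Phi$ is polynomially growing of degree $d$ if every non-trivial conjugacy class grows polynomially of degree at most $d$ and some conjugacy class grows polynomially of degree exactly $d$. $\Phi$ is polynomially growing if this holds for some integer $d\geq0$. An automorphism $\varphi\in\mathrm{Aut}(F)$ is polynomially growing (of degree $d$) if the outer automorphism $\Phi$ it represents is. Farber sequences. A sequence $(\Gamma_n)_{n\in\mathbb{N}}$ of subgroups of a countable group $\Gamma$ is a Farber sequence if each $\Gamma_n$ has finite index in $\Gamma$ and for every $\gamma\in\Gamma\setminus\{1\}$, $$\lim_{n\to\infty}\frac{|\{g\Gamma_n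 : \gamma g\Gamma_n=g\Gamma_n\}|}{|\Gamma:\Gamma_n|}=0 .$$ For a finitely generated abelian group $A$, $A_{\mathrm{tors}}$ denotes its torsion subgroup. *)

theory Defs
  imports
    "HOL-Algebra.Algebra"
    "HOL-Library.Extended_Real"
begin

text \<open>A letter \<open>(s, True)\<close> stands for \<open>s\<close> and \<open>(s, False)\<close> for its formal inverse.\<close>

definition flip_letter :: "'a \<times> bool \<Rightarrow> 'a \<times> bool" where
  "flip_letter l = (fst l, \<not> snd l)"

definition word_eval :: "('a, 'b) monoid_scheme \<Rightarrow> ('a \<times> bool) list \<Rightarrow> 'a" where
  "word_eval G w =
     foldr (\<lambda>l x. (if snd l then fst l else inv\<^bsub>G\<^esub> (fst l)) \<otimes>\<^bsub>G\<^esub> x) w \<one>\<^bsub>G\<^esub>"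

definition reduced_words :: "'a set \<Rightarrow> ('a \<times> bool) list set" where
  "reduced_words S =
     {w. set w \<subseteq> S \<times> UNIV \<and> successively (\<lambda>k l. l \<noteq> flip_letter k) w}"

definition cyclically_reduced_words :: "'a set \<Rightarrow> ('a \<times> bool) list set" where
  "cyclically_reduced_words S =
     {w \<in> reduced_words S. w \<noteq> [] \<longrightarrow> hd w \<noteq> flip_letter (last w)}"

text \<open>\<open>S\<close> is a free generating set of \<open>G\<close>: every element is represented by exactly one
  reduced word over \<open>S\<close>.\<close>

definition free_basis :: "('a, 'b) monoid_scheme \<Rightarrow> 'a set \<Rightarrow> bool" where
  "free_basis G S \<longleftrightarrow>
     S \<subseteq> carrier G \<and> bij_betw (word_eval G) (reduced_words S) (carrier G)"

definition conj_class :: "('a, 'b) monoid_scheme \<Rightarrow> 'a \<Rightarrow> 'a set" where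
  "conj_class G g = {h \<otimes>\<^bsub>G\<^esub> g \<otimes>\<^bsub>G\<^esub> inv\<^bsub>G\<^esub> h | h. h \<in> carrier G}"

definition conj_classes :: "('a, 'b) monoid_scheme \<Rightarrow> 'a set set" where
  "conj_classes G = conj_class G ` carrier G"

definition conj_length :: "('a, 'b) monoid_scheme \<Rightarrow> 'a set \<Rightarrow> 'a set \<Rightarrow> nat" where
  "conj_length G S C =
     (LEAST n. \<exists>w \<in> cyclically_reduced_words S. word_eval G w \<in> C \<and> length w = n)"

definition inner_autos :: "('a, 'b) monoid_scheme \<Rightarrow> ('a \<Rightarrow> 'a) set" where
  "inner_autos G =
     (\<lambda>g. \<lambda>x \<in> carrier G. g \<otimes>\<^bsub>G\<^esub> x \<otimes>\<^bsub>G\<^esub> inv\<^bsub>G\<^esub> g) ` carrier G"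

definition OutGroup :: "('a, 'b) monoid_scheme \<Rightarrow> ('a \<Rightarrow> 'a) set monoid" where
  "OutGroup G = AutoGroup G Mod inner_autos G"

definition outer_class :: "('a, 'b) monoid_scheme \<Rightarrow> ('a \<Rightarrow> 'a) \<Rightarrow> ('a \<Rightarrow> 'a) set" where
  "outer_class G \<phi> = inner_autos G #>\<^bsub>AutoGroup G\<^esub> \<phi>"

text \<open>All representatives of an outer automorphism map a given conjugacy class to the same
  conjugacy class, so the union below is a union of equal sets.\<close>

definition outer_action :: "('a \<Rightarrow> 'a) set \<Rightarrow> 'a set \<Rightarrow> 'a set" where
  "outer_action \<Phi> C = (\<Union>\<psi>\<in>\<Phi>. \<psi> ` C)"

definition class_grows_poly ::
    "('a, 'b) monoid_scheme \<Rightarrow> 'a set \<Rightarrow> ('a \<Rightarrow> 'a) set \<Rightarrow> 'a set \<Rightarrow> nat \<Rightarrow> bool" where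
  "class_grows_poly G S \<Phi> C d \<longleftrightarrow>
     (\<exists>c\<^sub>1 c\<^sub>2 :: real. c\<^sub>1 > 0 \<and> c\<^sub>2 > 0 \<and>
        (\<forall>n \<ge> 1::nat.
           c\<^sub>1 * real n ^ d \<le> real (conj_length G S (outer_action (\<Phi> [^]\<^bsub>OutGroup G\<^esub> n) C)) \<and>
           real (conj_length G S (outer_action (\<Phi> [^]\<^bsub>OutGroup G\<^esub> n) C)) \<le> c\<^sub>2 * real n ^ d))"

definition outer_poly_growing_of_degree ::
    "('a, 'b) monoid_scheme \<Rightarrow> 'a set \<Rightarrow> ('a \<Rightarrow> 'a) set \<Rightarrow> nat \<Rightarrow> bool" where
  "outer_poly_growing_of_degree G S \<Phi> d \<longleftrightarrow>
     (\<forall>C \<in> conj_classes G - {{\<one>\<^bsub>G\<^esub>}}. \<exists>d' \<le> d. class_grows_poly G S \<Phi> C d') \<and>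
     (\<exists>C \<in> conj_classes G - {{\<one>\<^bsub>G\<^esub>}}. class_grows_poly G S \<Phi> C d)"

definition polynomially_growing ::
    "('a, 'b) monoid_scheme \<Rightarrow> 'a set \<Rightarrow> ('a \<Rightarrow> 'a) \<Rightarrow> bool" where
  "polynomially_growing G S \<phi> \<longleftrightarrow>
     (\<exists>d. outer_poly_growing_of_degree G S (outer_class G \<phi>) d)"

definition semidirect_product ::
    "('a, 'c) monoid_scheme \<Rightarrow> ('b, 'd) monoid_scheme \<Rightarrow> ('b \<Rightarrow> 'a \<Rightarrow> 'a) \<Rightarrow> ('a \<times> 'b) monoid" where
  "semidirect_product N H \<theta> =
     \<lparr>carrier = carrier N \<times> carrier H,
      monoid.mult = (\<lambda>(x, h) (y, k). (x \<otimes>\<^bsub>N\<^esub> \<theta> h y, h \<otimes>\<^bsub>H\<^esub> k)),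
      one = (\<one>\<^bsub>N\<^esub>, \<one>\<^bsub>H\<^esub>)\<rparr>"

definition semidirect_Z :: "('a, 'b) monoid_scheme \<Rightarrow> ('a \<Rightarrow> 'a) \<Rightarrow> ('a \<times> int) monoid" where
  "semidirect_Z G \<phi> =
     semidirect_product G integer_group (\<lambda>k::int. \<phi> [^]\<^bsub>AutoGroup G\<^esub> k)"

definition subgroup_index :: "('a, 'b) monoid_scheme \<Rightarrow> 'a set \<Rightarrow> nat" where
  "subgroup_index G H = card (lcosets\<^bsub>G\<^esub> H)"

definition farber_sequence :: "('a, 'b) monoid_scheme \<Rightarrow> (nat \<Rightarrow> 'a set) \<Rightarrow> bool" where
  "farber_sequence G H \<longleftrightarrow>
     (\<forall>n. subgroup (H n) G \<and> finite (lcosets\<^bsub>G\<^esub> (H n))) \<and>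
     (\<forall>\<gamma> \<in> carrier G - {\<one>\<^bsub>G\<^esub>}.
        (\<lambda>n. real (card {C \<in> lcosets\<^bsub>G\<^esub> (H n). \<gamma> <#\<^bsub>G\<^esub> C = C}) / real (subgroup_index G (H n)))
          \<longlonglongrightarrow> 0)"

text \<open>
  \<open>H\<^sub>n(G; \<int>)\<close> is the homology of the inhomogeneous bar complex with trivial integer
  coefficients: \<open>C\<^sub>n\<close> is free abelian on \<open>G\<^sup>n\<close>, and
  \<open>\<partial>[g\<^sub>1|\<dots>|g\<^sub>n] = [g\<^sub>2|\<dots>|g\<^sub>n] + (\<Sum>i=1..n-1. (-1)\<^sup>i [g\<^sub>1|\<dots>|g\<^sub>i g\<^sub>i\<^sub>+\<^sub>1|\<dots>|g\<^sub>n]) + (-1)\<^sup>n [g\<^sub>1|\<dots>|g\<^sub>n\<^sub>-\<^sub>1]\<close>.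
\<close>

definition bar_chain_group :: "nat \<Rightarrow> ('a, 'b) monoid_scheme \<Rightarrow> ('a list \<Rightarrow>\<^sub>0 int) monoid" where
  "bar_chain_group n G = free_Abelian_group {xs. length xs = n \<and> set xs \<subseteq> carrier G}"

definition bar_face :: "('a, 'b) monoid_scheme \<Rightarrow> nat \<Rightarrow> 'a list \<Rightarrow> 'a list" where
  "bar_face G i xs =
     (if i = 0 then tl xs
      else if i = length xs then butlast xs
      else take (i - 1) xs @ [xs ! (i - 1) \<otimes>\<^bsub>G\<^esub> xs ! i] @ drop (i + 1) xs)"

definition bar_boundary ::
    "nat \<Rightarrow> ('a, 'b) monoid_scheme \<Rightarrow> ('a list \<Rightarrow>\<^sub>0 int) \<Rightarrow> ('a list \<Rightarrow>\<^sub>0 int)" where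
  "bar_boundary n G c =
     (if n = 0 then 0
      else frag_extend (\<lambda>xs. \<Sum>i\<le>n. frag_cmul ((-1) ^ i) (frag_of (bar_face G i xs))) c)"

definition bar_cycles :: "nat \<Rightarrow> ('a, 'b) monoid_scheme \<Rightarrow> ('a list \<Rightarrow>\<^sub>0 int) set" where
  "bar_cycles n G = {c \<in> carrier (bar_chain_group n G). bar_boundary n G c = 0}"

definition bar_boundaries :: "nat \<Rightarrow> ('a, 'b) monoid_scheme \<Rightarrow> ('a list \<Rightarrow>\<^sub>0 int) set" where
  "bar_boundaries n G = bar_boundary (Suc n) G ` carrier (bar_chain_group (Suc n) G)"

definition integral_homology ::
    "nat \<Rightarrow> ('a, 'b) monoid_scheme \<Rightarrow> ('a list \<Rightarrow>\<^sub>0 int) set monoid" where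
  "integral_homology n G =
     subgroup_generated (bar_chain_group n G) (bar_cycles n G) Mod bar_boundaries n G"

definition torsion_subgroup :: "('a, 'b) monoid_scheme \<Rightarrow> 'a set" where
  "torsion_subgroup A = {x \<in> carrier A. \<exists>k::nat. k > 0 \<and> x [^]\<^bsub>A\<^esub> k = \<one>\<^bsub>A\<^esub>}"

text \<open>\<open>card\<close> is \<open>0\<close> on infinite sets, hence the explicit value \<open>\<infinity>\<close> in that case.\<close>

definition log_card :: "'a set \<Rightarrow> ereal" where
  "log_card A = (if finite A then ereal (ln (real (card A))) else \<infinity>)"

definition torsion_growth ::
    "nat \<Rightarrow> ('a, 'b) monoid_scheme \<Rightarrow> (nat \<Rightarrow> 'a set) \<Rightarrow> ereal" where
  "torsion_growth j G H =
     limsup (\<lambda>n. log_card (torsion_subgroup (integral_homology j (G\<lparr>carrier := H n\<rparr>)))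
                  / ereal (real (subgroup_index G (H n))))"

end

theory Submission
  imports Defs "Jordan_Normal_Form.Schur_Decomposition"
begin

text \<open>
  Write \<open>T\<close> for the Fox Jacobian of \<open>\<phi>\<close> composed with the stable letter.  In a finite cover with \<open>d\<close>
  sheets the first homology is computed by an integer matrix containing the square block \<open>1 - T\<close>,
  and its torsion is at most the square root of \<open>det (a + (1 - T)\<^sup>* (1 - T)) (1 + C / a)\<^sup>\<nu>\<close>, where
  \<open>\<nu>\<close> is the corank of \<open>1 - T\<close>; higher homology has no torsion.  For fixed \<open>a > 0\<close> the logarithm of
  this determinant divided by \<open>d\<close> is determined up to \<open>o(1)\<close> by traces, hence by the Farber condition
  it may be computed in the further cyclic cover of degree \<open>k\<close>, where \<open>1 - T\<close> becomes unipotent after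
  changing one \<open>k\<close>-th of the rows.  The inverse is the sum of the \<open>T\<^sup>j\<close> with \<open>j < k\<close>, of norm
  polynomial in \<open>k\<close> as \<open>\<phi>\<close> grows polynomially.  So for \<open>a = k\<^sup>-\<^sup>p\<close> and \<open>k\<close> large the logarithm is
  \<open>o(d)\<close>, the corank \<open>\<nu>\<close> is \<open>o(d)\<close>, and therefore so is the logarithm of the torsion.
\<close>

section \<open>Reduced words in free groups\<close>

text \<open>No limit of \<open>ln det\<close> is taken at \<open>a = 0\<close>: traces control
  polynomials of the spectrum, and \<open>ln\<close> is uniformly close to polynomials only away
  from zero. The regularization pays for this with the corank. At scale \<open>a\<close> the rows
  cut in the cyclic cover cost \<open>ln (1 / a) / k\<close> per sheet, and the unipotent part costs
  \<open>a\<close> times the squared norm of its inverse. A power of \<open>1 / k\<close> for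
  \<open>a\<close> makes both small; with an inverse of exponential norm the two demands on
  \<open>a\<close> would conflict in this estimate. The corank is bounded by a second, far smaller
  parameter: each zero eigenvalue contributes that parameter as a factor, and the lower bound for
  \<open>ln det\<close> allows only few of them. The growth hypothesis concerns conjugacy lengths,
  but the matrices involve the lengths of the \<open>\<phi>\<^sup>k(s)\<close> themselves.
  Conjugators for consecutive \<open>k\<close> are therefore compared in the Cayley tree. Homology
  is defined by the bar complex. The two-dimensional complex of the presentation enters through a
  chain endomorphism that is homotopic to the identity and vanishes above dimension two.\<close>

lemma flip_letter_flip_letter [simp]: "flip_letter (flip_letter l) = l"
  by (simp add: flip_letter_def)

lemma flip_letter_eq_iff [simp]: "flip_letter k = flip_letter l \<longleftrightarrow> k = l"
  by (metis flip_letter_flip_letter)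

lemma flip_letter_neq [simp]: "flip_letter k \<noteq> k" "k \<noteq> flip_letter k"
  by (auto simp: flip_letter_def prod_eq_iff)

lemma flip_letter_Pair [simp]: "flip_letter (s, b) = (s, \<not> b)"
  by (simp add: flip_letter_def)

lemma flip_letter_in [simp]: "flip_letter l \<in> S \<times> UNIV \<longleftrightarrow> l \<in> S \<times> UNIV"
  by (auto simp: flip_letter_def mem_Times_iff)

definition word_inv :: "('a \<times> bool) list \<Rightarrow> ('a \<times> bool) list" where
  "word_inv w = rev (map flip_letter w)"

lemma word_inv_simps [simp]:
  "word_inv [] = []" "word_inv (l # w) = word_inv w @ [flip_letter l]"
  "word_inv (u @ v) = word_inv v @ word_inv u" "length (word_inv w) = length w"
  by (simp_all add: word_inv_def)

lemma set_word_inv: "set (word_inv w) = flip_letter ` set w"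
  by (simp add: word_inv_def)

lemma set_word_inv_subset [simp]: "set (word_inv w) \<subseteq> S \<times> UNIV \<longleftrightarrow> set w \<subseteq> S \<times> UNIV"
  by (simp only: set_word_inv subset_eq ball_simps flip_letter_in)

lemma reduced_words_Nil [simp]: "[] \<in> reduced_words S"
  by (simp add: reduced_words_def)

lemma reduced_words_append:
  "u @ v \<in> reduced_words S \<longleftrightarrow>
     u \<in> reduced_words S \<and> v \<in> reduced_words S \<and> (u \<noteq> [] \<longrightarrow> v \<noteq> [] \<longrightarrow> hd v \<noteq> flip_letter (last u))"
  unfolding reduced_words_def by (auto simp: successively_append_iff)

lemma reduced_words_Cons:
  "l # w \<in> reduced_words S \<longleftrightarrow>
     l \<in> S \<times> UNIV \<and> w \<in> reduced_words S \<and> (w \<noteq> [] \<longrightarrow> hd w \<noteq> flip_letter l)"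
  unfolding reduced_words_def by (auto simp: successively_Cons)

lemma reduced_words_subset: "w \<in> reduced_words S \<Longrightarrow> set w \<subseteq> S \<times> UNIV"
  by (simp add: reduced_words_def)

lemma word_inv_reduced: "w \<in> reduced_words S \<Longrightarrow> word_inv w \<in> reduced_words S"
proof (induction w)
  case (Cons l w)
  have "last (word_inv w) = flip_letter (hd w)" if "w \<noteq> []"
    using that by (cases w) auto
  with Cons show ?case
    by (auto simp: reduced_words_append reduced_words_Cons) (metis flip_letter_flip_letter word_inv_simps(1))
qed simp

text \<open>Letters of \<open>u\<close> are peeled off from the right while they cancel against the
  head of \<open>v\<close>; \<open>c\<close> is the part that disappears, and what remains meets
  without cancellation.\<close>

lemma reduced_words_cancel:
  assumes "u \<in> reduced_words S" "v \<in> reduced_words S"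
  shows "\<exists>u\<^sub>1 c v\<^sub>1. u = u\<^sub>1 @ c \<and> v = word_inv c @ v\<^sub>1 \<and> u\<^sub>1 @ v\<^sub>1 \<in> reduced_words S"
  using assms
proof (induction u arbitrary: v rule: rev_induct)
  case (snoc x u)
  show ?case
  proof (cases "v = [] \<or> hd v \<noteq> flip_letter x")
    case True
    then have "(u @ [x]) @ v \<in> reduced_words S"
      using snoc.prems by (subst reduced_words_append) auto
    then show ?thesis by (metis append.right_neutral append_Nil word_inv_simps(1))
  next
    case False
    then obtain v' where v: "v = flip_letter x # v'" by (cases v) auto
    from snoc.IH[of v'] snoc.prems v obtain u\<^sub>1 c v\<^sub>1 where
      "u = u\<^sub>1 @ c" "v' = word_inv c @ v\<^sub>1" "u\<^sub>1 @ v\<^sub>1 \<in> reduced_words S"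
      by (auto simp: reduced_words_append reduced_words_Cons)
    with v have "u @ [x] = u\<^sub>1 @ (c @ [x]) \<and> v = word_inv (c @ [x]) @ v\<^sub>1 \<and> u\<^sub>1 @ v\<^sub>1 \<in> reduced_words S"
      by simp
    then show ?thesis by blast
  qed
qed simp

lemma word_eval_Nil [simp]: "word_eval G [] = \<one>\<^bsub>G\<^esub>"
  by (simp add: word_eval_def)

locale free_group = group F for F (structure) +
  fixes S :: "'a set"
  assumes basis: "free_basis F S"
begin

definition letter_val :: "'a \<times> bool \<Rightarrow> 'a" where
  "letter_val l = (if snd l then fst l else inv (fst l))"

abbreviation ev :: "('a \<times> bool) list \<Rightarrow> 'a" where "ev \<equiv> word_eval F"

lemma S_carrier: "S \<subseteq> carrier F"
  using basis by (simp add: free_basis_def)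

lemma S_in_carrier [simp]: "s \<in> S \<Longrightarrow> s \<in> carrier F"
  using S_carrier by blast

lemma ev_Cons [simp]: "ev (l # w) = letter_val l \<otimes> ev w"
  by (simp add: word_eval_def letter_val_def)

lemma letter_val_closed [simp]: "l \<in> S \<times> UNIV \<Longrightarrow> letter_val l \<in> carrier F"
  by (auto simp: letter_val_def)

lemma letter_val_flip: "l \<in> S \<times> UNIV \<Longrightarrow> letter_val (flip_letter l) = inv (letter_val l)"
  by (auto simp: letter_val_def flip_letter_def)

lemma ev_closed [simp]: "set w \<subseteq> S \<times> UNIV \<Longrightarrow> ev w \<in> carrier F"
  by (induction w) auto

lemma ev_append: "set u \<subseteq> S \<times> UNIV \<Longrightarrow> set v \<subseteq> S \<times> UNIV \<Longrightarrow> ev (u @ v) = ev u \<otimes> ev v"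
  by (induction u) (auto simp: m_assoc)

lemma ev_word_inv: "set w \<subseteq> S \<times> UNIV \<Longrightarrow> ev (word_inv w) = inv (ev w)"
proof (induction w)
  case (Cons l w)
  then have "ev (word_inv (l # w)) = inv (ev w) \<otimes> inv (letter_val l)"
    by (subst word_inv_simps, subst ev_append) (auto simp: letter_val_flip simp del: flip_letter_Pair)
  with Cons show ?case by (simp add: inv_mult_group)
qed simp

definition nf :: "'a \<Rightarrow> ('a \<times> bool) list" where
  "nf = the_inv_into (reduced_words S) ev"

definition len :: "'a \<Rightarrow> nat" where
  "len g = length (nf g)"

lemma nf_reduced: "g \<in> carrier F \<Longrightarrow> nf g \<in> reduced_words S"
  using basis unfolding free_basis_def nf_def bij_betw_def
  by (metis subset_refl the_inv_into_into)

lemma nf_subset [simp]: "g \<in> carrier F \<Longrightarrow> set (nf g) \<subseteq> S \<times> UNIV"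
  using nf_reduced reduced_words_subset by blast

lemma ev_nf [simp]: "g \<in> carrier F \<Longrightarrow> ev (nf g) = g"
  using basis unfolding free_basis_def nf_def bij_betw_def
  by (metis f_the_inv_into_f)

lemma nf_ev [simp]: "w \<in> reduced_words S \<Longrightarrow> nf (ev w) = w"
  using basis unfolding free_basis_def nf_def bij_betw_def
  by (metis the_inv_into_f_f)

lemma len_ev: "w \<in> reduced_words S \<Longrightarrow> len (ev w) = length w"
  by (simp add: len_def)

lemma nf_one [simp]: "nf \<one> = []"
  using nf_ev[of "[]"] by simp

lemma len_one [simp]: "len \<one> = 0"
  by (simp add: len_def)

lemma nf_inv: "g \<in> carrier F \<Longrightarrow> nf (inv g) = word_inv (nf g)"
  by (metis ev_nf ev_word_inv nf_ev nf_reduced nf_subset word_inv_reduced)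

lemma len_inv [simp]: "g \<in> carrier F \<Longrightarrow> len (inv g) = len g"
  by (simp add: len_def nf_inv)

text \<open>In the Cayley tree the path of \<open>g\<close> followed by the path of \<open>h\<close>
  backtracks exactly along \<open>c\<close>.\<close>

lemma nf_mult_cancel:
  assumes "g \<in> carrier F" "h \<in> carrier F"
  obtains u c v where "nf g = u @ c" "nf h = word_inv c @ v" "nf (g \<otimes> h) = u @ v"
    "u @ v \<in> reduced_words S"
proof -
  obtain u c v where 1: "nf g = u @ c" "nf h = word_inv c @ v" "u @ v \<in> reduced_words S"
    using reduced_words_cancel[OF nf_reduced[OF assms(1)] nf_reduced[OF assms(2)]] by blast
  have s: "set u \<subseteq> S \<times> UNIV" "set c \<subseteq> S \<times> UNIV" "set v \<subseteq> S \<times> UNIV"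
    using 1 nf_subset[OF assms(1)] nf_subset[OF assms(2)] by auto
  have "g \<otimes> h = ev (u @ c) \<otimes> ev (word_inv c @ v)"
    using 1 assms ev_nf by metis
  also have "\<dots> = (ev u \<otimes> ev c) \<otimes> (inv (ev c) \<otimes> ev v)"
    using s by (simp add: ev_append ev_word_inv)
  also have "\<dots> = ev u \<otimes> ev v"
    using s by (simp add: m_assoc inv_solve_left' flip: m_assoc[of "ev c" "inv (ev c)"])
  also have "\<dots> = ev (u @ v)" using s by (simp add: ev_append)
  finally have "nf (g \<otimes> h) = u @ v" using 1 by simp
  with 1 that show ?thesis by blast
qed

lemma len_mult_le: "g \<in> carrier F \<Longrightarrow> h \<in> carrier F \<Longrightarrow> len (g \<otimes> h) \<le> len g + len h"
  by (erule (1) nf_mult_cancel) (simp add: len_def)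

lemma len_letter: "l \<in> S \<times> UNIV \<Longrightarrow> len (letter_val l) = 1"
  using len_ev[of "[l]"] by (simp add: reduced_words_Cons)

lemma len_ev_le: "set w \<subseteq> S \<times> UNIV \<Longrightarrow> len (ev w) \<le> length w"
proof (induction w)
  case (Cons l w)
  then show ?case using len_mult_le[of "letter_val l" "ev w"] by (auto simp: len_letter simp del: One_nat_def)
qed simp

lemma nf_basis: "s \<in> S \<Longrightarrow> nf s = [(s, True)]"
  using nf_ev[of "[(s, True)]"] by (simp add: reduced_words_Cons letter_val_def)

end

section \<open>Polynomial growth of the lengths of basis elements\<close>

context free_group
begin

text \<open>The length of \<open>cj x g\<close> is the distance in the Cayley tree from the vertex
  \<open>x\<close> to its image under \<open>g\<close>. Bounds on it are bounds on displacements,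
  and conjugating means moving the base point.\<close>

definition cj :: "'a \<Rightarrow> 'a \<Rightarrow> 'a" where
  "cj x g = inv x \<otimes> g \<otimes> x"

lemma cj_closed [simp]: "x \<in> carrier F \<Longrightarrow> g \<in> carrier F \<Longrightarrow> cj x g \<in> carrier F"
  by (simp add: cj_def)

lemma cj_one [simp]: "g \<in> carrier F \<Longrightarrow> cj \<one> g = g"
  by (simp add: cj_def)

lemma cj_mult: "\<lbrakk>x \<in> carrier F; g \<in> carrier F; h \<in> carrier F\<rbrakk> \<Longrightarrow> cj x (g \<otimes> h) = cj x g \<otimes> cj x h"
  by (simp add: cj_def m_assoc inv_solve_left' flip: m_assoc[of x "inv x"])

lemma cj_cj: "\<lbrakk>x \<in> carrier F; y \<in> carrier F; g \<in> carrier F\<rbrakk> \<Longrightarrow> cj y (cj x g) = cj (x \<otimes> y) g"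
  by (simp add: cj_def m_assoc inv_mult_group)

lemma cj_inv_cancel: "\<lbrakk>x \<in> carrier F; g \<in> carrier F\<rbrakk> \<Longrightarrow> cj (inv x) (cj x g) = g"
  by (simp add: cj_cj)

lemma cj_inv: "\<lbrakk>x \<in> carrier F; g \<in> carrier F\<rbrakk> \<Longrightarrow> cj x (inv g) = inv (cj x g)"
  by (simp add: cj_def m_assoc inv_mult_group)

lemma len_cj_le: "x \<in> carrier F \<Longrightarrow> g \<in> carrier F \<Longrightarrow> len (cj x g) \<le> 2 * len x + len g"
  unfolding cj_def using len_mult_le[of "inv x \<otimes> g" x] len_mult_le[of "inv x" g] by simp

text \<open>The powers of a cyclically reduced word stay reduced, so their length grows with
  slope \<open>length w\<close>, and conjugation changes lengths of powers only by a constant.\<close>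

lemma cyclically_reduced_length_le:
  assumes w: "w \<in> cyclically_reduced_words S" and x: "x \<in> carrier F"
  shows "length w \<le> len (cj x (ev w))"
proof (rule ccontr)
  assume less: "\<not> length w \<le> len (cj x (ev w))"
  have wr: "w \<in> reduced_words S" and ws: "set w \<subseteq> S \<times> UNIV"
    using w reduced_words_subset by (auto simp: cyclically_reduced_words_def)
  define c where "c = cj x (ev w)"
  have c: "c \<in> carrier F" using x ws by (simp add: c_def)
  have *: "concat (replicate n w) \<in> reduced_words S \<and> ev (concat (replicate n w)) = cj (inv x) (c [^] n)
     \<and> len (c [^] n) \<le> n * len c" for n
  proof (induction n)
    case 0
    then show ?case using x by (simp add: cj_def)
  next
    case (Suc n)
    have s: "set (concat (replicate n w)) \<subseteq> S \<times> UNIV"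
      using Suc reduced_words_subset by blast
    have "w @ concat (replicate n w) \<in> reduced_words S"
    proof (cases n)
      case (Suc k)
      then show ?thesis using Suc.IH w wr
        by (auto simp: reduced_words_append cyclically_reduced_words_def)
    qed (use wr in simp)
    moreover have "ev w = cj (inv x) c"
      using x ws by (simp add: c_def cj_inv_cancel)
    then have "ev (w @ concat (replicate n w)) = cj (inv x) (c \<otimes> c [^] n)"
      using Suc x ws c s by (simp add: ev_append cj_mult)
    moreover have comm: "c [^] n \<otimes> c = c \<otimes> c [^] n"
      using c by (metis nat_pow_Suc nat_pow_Suc2)
    then have "len (c [^] Suc n) \<le> Suc n * len c"
      using len_mult_le[of c "c [^] n"] Suc c by simp
    ultimately show ?case using comm by simp
  qed
  \<comment> \<open>Conjugation by \<open>x\<close> changes a length by at most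
    \<open>2 * len x\<close>, which is less than \<open>n\<close>; a gain of one letter per period
    would exceed this.\<close>
  define n where "n = 2 * len x + 1"
  have "length (concat (replicate n w)) = n * length w"
    by (simp add: length_concat sum_list_replicate)
  then have "n * length w = len (cj (inv x) (c [^] n))"
    using *[of n] len_ev[of "concat (replicate n w)"] by simp
  also have "\<dots> \<le> 2 * len x + n * len c"
    using len_cj_le[of "inv x" "c [^] n"] *[of n] x c by simp
  also have "\<dots> < n * (len c + 1)" by (simp add: n_def)
  also have "\<dots> \<le> n * length w" using less by (intro mult_left_mono) (auto simp: c_def)
  finally show False by simp
qed

lemma not_cyclically_reduced:
  assumes "g \<in> carrier F" "nf g \<notin> cyclically_reduced_words S"
  obtains l w where "l \<in> S \<times> UNIV" "nf g = l # w @ [flip_letter l]"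
proof -
  have ne: "nf g \<noteq> []" and h: "hd (nf g) = flip_letter (last (nf g))"
    using assms nf_reduced by (auto simp: cyclically_reduced_words_def)
  then obtain l w' where lw: "nf g = l # w'" by (cases "nf g") auto
  have "w' \<noteq> []" using h lw by auto
  then obtain w k where "w' = w @ [k]" by (metis append_butlast_last_id)
  with h lw have "nf g = l # w @ [flip_letter l]" by auto
  moreover have "l \<in> S \<times> UNIV" using nf_subset[OF assms(1)] lw by auto
  ultimately show ?thesis using that by blast
qed

lemma len_cj_shorten:
  assumes "g \<in> carrier F" "l \<in> S \<times> UNIV" "nf g = l # w @ [flip_letter l]"
  shows "len (cj (letter_val l) g) + 2 \<le> len g"
proof -
  have w: "set w \<subseteq> S \<times> UNIV" using nf_subset[OF assms(1)] assms(3) by auto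
  have fl: "set [flip_letter l] \<subseteq> S \<times> UNIV" using assms(2) by (cases l) auto
  have l: "letter_val l \<in> carrier F" using assms(2) by simp
  have "g = letter_val l \<otimes> (ev w \<otimes> inv (letter_val l))"
    using ev_nf[OF assms(1)] w fl assms(2) l unfolding assms(3)
    by (simp add: ev_append letter_val_flip del: ev_nf)
  then have "cj (letter_val l) g = ev w"
    using l w by (simp add: cj_def m_assoc inv_solve_left' flip: m_assoc[of "inv (letter_val l)" "letter_val l"])
  then show ?thesis using len_ev_le[OF w] assms(3) by (simp add: len_def)
qed

text \<open>A Helly type argument: two elements that are far from being cyclically reduced and have
  different first letters would have a cyclically reduced, hence too long, product.\<close>

lemma simultaneous_conjugation_aux:
  assumes "\<And>u. u \<in> U \<Longrightarrow> u \<in> carrier F \<and> (\<exists>x \<in> carrier F. len (cj x u) \<le> L)"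
    and "\<And>u v. u \<in> U \<Longrightarrow> v \<in> U \<Longrightarrow> \<exists>x \<in> carrier F. len (cj x (u \<otimes> v)) \<le> L"
    and "\<And>u. u \<in> U \<Longrightarrow> len u \<le> M"
  shows "\<exists>x \<in> carrier F. \<forall>u \<in> U. len (cj x u) \<le> L + 2"
  using assms
proof (induction M arbitrary: U)
  case 0
  then have "len (cj \<one> u) \<le> L + 2" if "u \<in> U" for u
    using that by (metis cj_one le_zero_eq zero_le)
  then show ?case by blast
next
  case (Suc M)
  note car = Suc.prems(1)
  show ?case
  proof (cases "Suc M \<le> L + 2 \<or> (\<forall>u \<in> U. len u \<le> L)")
    case True
    then have "len (cj \<one> u) \<le> L + 2" if "u \<in> U" for u
      using that Suc.prems(3)[OF that] car[OF that] by auto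
    then show ?thesis by blast
  next
    case False
    then obtain u\<^sub>0 where u0: "u\<^sub>0 \<in> U" "L < len u\<^sub>0" by force
    have long: "nf u \<notin> cyclically_reduced_words S" if "u \<in> U" "L < len u" for u
    proof
      assume "nf u \<in> cyclically_reduced_words S"
      moreover obtain x where "x \<in> carrier F" "len (cj x u) \<le> L" using car \<open>u \<in> U\<close> by blast
      ultimately show False
        using cyclically_reduced_length_le[of "nf u" x] car that by (simp add: len_def)
    qed
    obtain l w where l: "l \<in> S \<times> UNIV" and w: "nf u\<^sub>0 = l # w @ [flip_letter l]"
      using not_cyclically_reduced[OF _ long[OF u0]] car u0 by blast
    \<comment> \<open>The long elements share the first letter \<open>l\<close>, so conjugation by
      it shortens them by two. The others become at most two longer and stay within
      \<open>L + 2\<close>, which is at most \<open>M\<close> here.\<close>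
    have short: "len (cj (letter_val l) u) \<le> M" if u: "u \<in> U" for u
    proof (cases "L < len u")
      case True
      obtain k v where k: "k \<in> S \<times> UNIV" and v: "nf u = k # v @ [flip_letter k]"
        using not_cyclically_reduced[OF _ long[OF u True]] car u by blast
      have "k = l"
      proof (rule ccontr)
        assume "k \<noteq> l"
        then have red: "nf u\<^sub>0 @ nf u \<in> reduced_words S"
          using nf_reduced[of u\<^sub>0] nf_reduced[of u] car u u0 w v by (subst reduced_words_append) auto
        with \<open>k \<noteq> l\<close> have "nf u\<^sub>0 @ nf u \<in> cyclically_reduced_words S"
          using w v by (auto simp: cyclically_reduced_words_def)
        moreover have "ev (nf u\<^sub>0 @ nf u) = u\<^sub>0 \<otimes> u" using car u u0 by (simp add: ev_append)
        moreover obtain x where "x \<in> carrier F" "len (cj x (u\<^sub>0 \<otimes> u)) \<le> L"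
          using Suc.prems(2) u u0 by blast
        ultimately show False using cyclically_reduced_length_le[of "nf u\<^sub>0 @ nf u" x] u0
          by (simp add: len_def)
      qed
      then show ?thesis using len_cj_shorten[OF _ k v] car[OF u] Suc.prems(3)[OF u] by simp
    next
      case False
      then show ?thesis using len_cj_le[of "letter_val l" u] l car[OF u] \<open>\<not> (_ \<or> _)\<close>
        by (simp add: len_letter)
    qed
    let ?y = "letter_val l"
    have y: "?y \<in> carrier F" using l by simp
    have "\<exists>x \<in> carrier F. \<forall>u \<in> cj ?y ` U. len (cj x u) \<le> L + 2"
    proof (rule Suc.IH)
      fix u assume "u \<in> cj ?y ` U"
      then obtain v where v: "v \<in> U" "u = cj ?y v" by blast
      obtain x where "x \<in> carrier F" "len (cj x v) \<le> L" using car v by blast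
      then have "inv ?y \<otimes> x \<in> carrier F \<and> len (cj (inv ?y \<otimes> x) u) \<le> L"
        using v car[OF v(1)] y cj_cj[of "inv ?y" x u] cj_inv_cancel[of ?y v] by auto
      then show "u \<in> carrier F \<and> (\<exists>x \<in> carrier F. len (cj x u) \<le> L)"
        using v car y by auto
    next
      fix u u' assume "u \<in> cj ?y ` U" "u' \<in> cj ?y ` U"
      then obtain v v' where v: "v \<in> U" "u = cj ?y v" "v' \<in> U" "u' = cj ?y v'" by blast
      obtain x where "x \<in> carrier F" "len (cj x (v \<otimes> v')) \<le> L" using Suc.prems(2) v by blast
      moreover have "u \<otimes> u' = cj ?y (v \<otimes> v')" using v car y by (simp add: cj_mult)
      ultimately have "inv ?y \<otimes> x \<in> carrier F \<and> len (cj (inv ?y \<otimes> x) (u \<otimes> u')) \<le> L"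
        using car v y cj_cj[of "inv ?y" x "cj ?y (v \<otimes> v')"] cj_inv_cancel[of ?y "v \<otimes> v'"] by auto
      then show "\<exists>x \<in> carrier F. len (cj x (u \<otimes> u')) \<le> L" by blast
    next
      show "len u \<le> M" if "u \<in> cj ?y ` U" for u using short that by blast
    qed
    then obtain x where "x \<in> carrier F" "\<forall>u \<in> U. len (cj x (cj ?y u)) \<le> L + 2" by blast
    then have "?y \<otimes> x \<in> carrier F" "\<forall>u \<in> U. len (cj (?y \<otimes> x) u) \<le> L + 2"
      using y car by (auto simp: cj_cj)
    then show ?thesis by blast
  qed
qed

lemma simultaneous_conjugation:
  assumes "finite U"
    and "\<And>u. u \<in> U \<Longrightarrow> u \<in> carrier F \<and> (\<exists>x \<in> carrier F. len (cj x u) \<le> L)"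
    and "\<And>u v. u \<in> U \<Longrightarrow> v \<in> U \<Longrightarrow> \<exists>x \<in> carrier F. len (cj x (u \<otimes> v)) \<le> L"
  shows "\<exists>x \<in> carrier F. \<forall>u \<in> U. len (cj x u) \<le> L + 2"
proof (rule simultaneous_conjugation_aux[where M = "\<Sum>u\<in>U. len u"])
  show "len u \<le> (\<Sum>u\<in>U. len u)" if "u \<in> U" for u
    using assms(1) that by (simp add: member_le_sum)
qed (use assms in auto)

text \<open>An element that moves both endpoints of a long path by little translates the middle part
  of the path along itself.\<close>

lemma translation_of_middle:
  assumes "u \<in> carrier F" "y \<in> carrier F" "len u \<le> M" "len (cj y u) \<le> M"
  obtains \<tau> :: int where "\<bar>\<tau>\<bar> \<le> int M"
    "\<And>j. M \<le> j \<Longrightarrow> int j + \<tau> + int M \<le> int (len y) \<Longrightarrow>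
       u \<otimes> ev (take j (nf y)) = ev (take (nat (int j + \<tau>)) (nf y))"
proof -
  obtain a c b where 1: "nf u = a @ c" "nf y = word_inv c @ b" "nf (u \<otimes> y) = a @ b"
    by (rule nf_mult_cancel[OF assms(1,2)]) blast
  have v: "cj y u \<in> carrier F" using assms by simp
  \<comment> \<open>The product \<open>u \<otimes> y\<close> is read a second time from the far end
    of \<open>y\<close>. It agrees with \<open>y\<close> except for the last
    \<open>length c'\<close> letters of \<open>y\<close>.\<close>
  have yv: "y \<otimes> cj y u = u \<otimes> y"
    using assms by (simp add: cj_def flip: m_assoc)
  obtain a' c' b' where 2: "nf y = a' @ c'" "nf (cj y u) = word_inv c' @ b'" "nf (u \<otimes> y) = a' @ b'"
    using nf_mult_cancel[OF assms(2) v] unfolding yv by blast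
  \<comment> \<open>Left multiplication by \<open>u\<close> deletes \<open>length c\<close> letters
    of the path and puts \<open>length a\<close> letters in front, so later indices move by
    \<open>\<tau>\<close>.\<close>
  define \<tau> where "\<tau> = int (length a) - int (length c)"
  have sub: "set a \<subseteq> S \<times> UNIV" "set c \<subseteq> S \<times> UNIV" "set b \<subseteq> S \<times> UNIV"
    using 1 nf_subset[OF assms(1)] nf_subset[OF assms(2)] by auto
  have "length a + length c \<le> M" using 1 assms by (simp add: len_def)
  then have "\<bar>\<tau>\<bar> \<le> int M" by (simp add: \<tau>_def)
  moreover have "u \<otimes> ev (take j (nf y)) = ev (take (nat (int j + \<tau>)) (nf y))"
    if j: "M \<le> j" "int j + \<tau> + int M \<le> int (len y)" for j
  proof -
    have cj: "length c \<le> j" and c': "length c' \<le> M" 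
      using 1 2 assms j by (auto simp: len_def)
    let ?t = "take (j - length c) b"
    have t: "set ?t \<subseteq> S \<times> UNIV" using sub(3) set_take_subset by fastforce
    have "u \<otimes> ev (take j (nf y)) = ev (a @ c) \<otimes> ev (word_inv c @ ?t)"
      using 1 cj assms ev_nf[OF assms(1)] by simp
    also have "\<dots> = ev a \<otimes> (ev c \<otimes> (inv (ev c) \<otimes> ev ?t))"
      using sub t by (simp add: ev_append ev_word_inv m_assoc)
    also have "\<dots> = ev (a @ ?t)"
      using sub t by (simp add: ev_append flip: m_assoc[of "ev c"])
    also have "a @ ?t = take (nat (int j + \<tau>)) (a @ b)"
      using cj by (auto simp: \<tau>_def nat_diff_distrib intro!: arg_cong[where f = "\<lambda>n. take n b"])
    also have "a @ b = a' @ b'" using 1 2 by simp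
    also have "take (nat (int j + \<tau>)) (a' @ b') = take (nat (int j + \<tau>)) (nf y)"
    proof -
      have "len y = length a' + length c'" using 2 by (simp add: len_def)
      then have "nat (int j + \<tau>) \<le> length a'" using j c' by linarith
      then show ?thesis using 2 by simp
    qed
    finally show ?thesis .
  qed
  ultimately show ?thesis using that by blast
qed

text \<open>If \<open>y\<close> were long, both \<open>u\<close> and \<open>v\<close> would act on
  the middle of its path as translations along it. Translations commute, so
  \<open>u \<otimes> v\<close> and \<open>v \<otimes> u\<close> would agree at a vertex of the path
  and hence be equal. The start index \<open>2 * M\<close>, two shifts by at most \<open>M\<close>
  and a margin \<open>M\<close> at the end account for the factor \<open>5\<close>.\<close>

lemma drift_bound:
  assumes "u \<in> carrier F" "v \<in> carrier F" "y \<in> carrier F" "u \<otimes> v \<noteq> v \<otimes> u"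
    and "len u \<le> M" "len (cj y u) \<le> M" "len v \<le> M" "len (cj y v) \<le> M"
  shows "len y \<le> 5 * M"
proof (rule ccontr)
  assume long: "\<not> len y \<le> 5 * M"
  obtain \<sigma> where \<sigma>: "\<bar>\<sigma>\<bar> \<le> int M"
    "\<And>j. M \<le> j \<Longrightarrow> int j + \<sigma> + int M \<le> int (len y) \<Longrightarrow>
       u \<otimes> ev (take j (nf y)) = ev (take (nat (int j + \<sigma>)) (nf y))"
    using translation_of_middle[of u y M] assms by metis
  obtain \<tau> where \<tau>: "\<bar>\<tau>\<bar> \<le> int M"
    "\<And>j. M \<le> j \<Longrightarrow> int j + \<tau> + int M \<le> int (len y) \<Longrightarrow>
       v \<otimes> ev (take j (nf y)) = ev (take (nat (int j + \<tau>)) (nf y))"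
    using translation_of_middle[of v y M] assms by metis
  let ?p = "\<lambda>j. ev (take (nat j) (nf y))"
  have p: "?p j \<in> carrier F" for j
    using order_trans[OF set_take_subset nf_subset[OF assms(3)]] by (rule ev_closed)
  have nn: "0 \<le> 2 * int M + \<tau>" "0 \<le> 2 * int M + \<sigma>" "M \<le> nat (2 * int M + \<tau>)"
    "M \<le> nat (2 * int M + \<sigma>)" "2 * int M + \<tau> + \<sigma> + int M \<le> int (len y)"
    "2 * int M + \<sigma> + \<tau> + int M \<le> int (len y)"
    using \<sigma>(1) \<tau>(1) long by linarith+
  have "u \<otimes> (v \<otimes> ?p (2 * M)) = u \<otimes> ?p (2 * M + \<tau>)" 
    using \<tau>(2)[of "2 * M"] \<tau>(1) long by (simp add: nat_mult_distrib)
  also have "\<dots> = ?p (2 * M + \<tau> + \<sigma>)" using \<sigma>(2)[of "nat (2 * M + \<tau>)"] nn by simp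
  also have "\<dots> = ?p (2 * M + \<sigma> + \<tau>)" by (simp add: algebra_simps)
  also have "\<dots> = v \<otimes> ?p (2 * M + \<sigma>)" using \<tau>(2)[of "nat (2 * M + \<sigma>)"] nn by simp
  also have "\<dots> = v \<otimes> (u \<otimes> ?p (2 * M))"
    using \<sigma>(2)[of "2 * M"] \<sigma>(1) long by (simp add: nat_mult_distrib)
  finally have "(u \<otimes> v) \<otimes> ?p (2 * M) = (v \<otimes> u) \<otimes> ?p (2 * M)"
    using assms p by (simp add: m_assoc)
  then show False using assms p by (metis m_closed r_cancel)
qed

lemma commutes_ev:
  assumes "g \<in> carrier F" "\<And>s. s \<in> S \<Longrightarrow> g \<otimes> s = s \<otimes> g" "set w \<subseteq> S \<times> UNIV"
  shows "g \<otimes> ev w = ev w \<otimes> g"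
  using assms(3)
proof (induction w)
  case (Cons l w)
  obtain s b where l: "l = (s, b)" "s \<in> S" using Cons by (cases l) auto
  have "g \<otimes> inv s = inv s \<otimes> (s \<otimes> g) \<otimes> inv s"
    using assms(1) l by (simp flip: m_assoc)
  also have "\<dots> = inv s \<otimes> g"
    using assms(1) l by (simp add: m_assoc flip: assms(2))
  finally have "g \<otimes> letter_val l = letter_val l \<otimes> g"
    using assms(2) l by (simp add: letter_val_def)
  then have "(g \<otimes> letter_val l) \<otimes> ev w = (letter_val l \<otimes> g) \<otimes> ev w"
    by simp
  then show ?case using Cons assms(1) by (auto simp: m_assoc)
qed (use assms in simp)

lemma commutative_if_basis_commutes:
  assumes "\<And>s s'. s \<in> S \<Longrightarrow> s' \<in> S \<Longrightarrow> s \<otimes> s' = s' \<otimes> s" "g \<in> carrier F" "h \<in> carrier F"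
  shows "g \<otimes> h = h \<otimes> g"
proof -
  have "g \<otimes> s = s \<otimes> g" if "s \<in> S" for s
    using commutes_ev[of s "nf g"] assms that by simp
  then show ?thesis using commutes_ev[of g "nf h"] assms by simp
qed

lemma len_cj_hom_le:
  assumes "\<psi> \<in> hom F F" "x \<in> carrier F" "\<And>s. s \<in> S \<Longrightarrow> len (cj x (\<psi> s)) \<le> B" "g \<in> carrier F"
  shows "len (cj x (\<psi> g)) \<le> len g * B"
proof -
  interpret h: group_hom F F \<psi> using assms(1) by unfold_locales
  have "len (cj x (\<psi> (ev w))) \<le> length w * B" if "set w \<subseteq> S \<times> UNIV" for w
    using that
  proof (induction w)
    case Nil
    then show ?case using assms(2) by (simp add: cj_def)
  next
    case (Cons l w)
    obtain s b where l: "l = (s, b)" "s \<in> S" using Cons by (cases l) auto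
    have "len (cj x (\<psi> (letter_val l))) \<le> B"
      using assms(2,3) l by (auto simp: letter_val_def cj_inv)
    moreover have "cj x (\<psi> (ev (l # w))) = cj x (\<psi> (letter_val l)) \<otimes> cj x (\<psi> (ev w))"
      using Cons l assms(2) by (simp add: cj_mult)
    ultimately show ?case
      using Cons l assms(2) len_mult_le[of "cj x (\<psi> (letter_val l))" "cj x (\<psi> (ev w))"] by auto
  qed
  from this[OF nf_subset[OF assms(4)]] assms(4) show ?thesis by (simp add: len_def)
qed

lemma hom_funpow: "\<phi> \<in> hom F F \<Longrightarrow> \<phi> ^^ k \<in> hom F F"
proof (induction k)
  case (Suc k)
  then show ?case by (auto simp: hom_def Pi_iff)
qed (auto simp: hom_def)

text \<open>Let \<open>x k\<close> be a point where all \<open>\<phi>\<^sup>k(s)\<close> have small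
  displacement. The elements \<open>\<phi>\<^sup>k\<^sup>+\<^sup>1(s)\<close> are small at
  \<open>x k\<close> as well as at \<open>x (Suc k)\<close>, so \<open>drift_bound\<close> bounds
  the distance between the two points. Summing over \<open>k\<close> bounds
  \<open>len (x k)\<close>, and conjugating back gives the length; the constant is
  \<open>11 = 2 * 5 + 1\<close>.\<close>

lemma len_iterates_le:
  assumes hom: "\<phi> \<in> hom F F" and inj: "inj_on \<phi> (carrier F)"
    and B: "mono B" "1 \<le> B 0"
    and a: "1 \<le> a" "\<And>s. s \<in> S \<Longrightarrow> len (\<phi> s) \<le> a"
    and conj: "\<And>k. \<exists>x \<in> carrier F. \<forall>s \<in> S. len (cj x ((\<phi> ^^ k) s)) \<le> B k"
    and s: "s \<in> S"
  shows "len ((\<phi> ^^ k) s) \<le> 11 * a * Suc k * B k"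
proof -
  have hk: "\<phi> ^^ k \<in> hom F F" for k by (rule hom_funpow[OF hom])
  have clos: "(\<phi> ^^ k) g \<in> carrier F" if "g \<in> carrier F" for k g
    using hk that by (simp add: hom_def Pi_iff)
  show ?thesis
  proof (cases "\<forall>s \<in> S. \<forall>s' \<in> S. s \<otimes> s' = s' \<otimes> s")
    \<comment> \<open>If the basis commutes, so does the whole group, and the conjugate is the
      element itself.\<close>
    case True
    obtain x where x: "x \<in> carrier F" "\<forall>s \<in> S. len (cj x ((\<phi> ^^ k) s)) \<le> B k" using conj by blast
    have "cj x ((\<phi> ^^ k) s) = (\<phi> ^^ k) s"
      using commutative_if_basis_commutes[OF _ x(1) clos[of s k]] True x s clos[of s k]
      by (simp add: cj_def m_assoc flip: m_assoc[of "inv x" x])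
        (metis S_in_carrier clos inv_closed inv_solve_left m_assoc m_closed)
    then have "len ((\<phi> ^^ k) s) \<le> 1 * B k" using x s by (metis mult_1)
    also have "\<dots> \<le> 11 * a * Suc k * B k" using a(1) by (intro mult_right_mono) auto
    finally show ?thesis .
  next
    case False
    then obtain s\<^sub>1 s\<^sub>2 where s12: "s\<^sub>1 \<in> S" "s\<^sub>2 \<in> S" "s\<^sub>1 \<otimes> s\<^sub>2 \<noteq> s\<^sub>2 \<otimes> s\<^sub>1" by blast
    \<comment> \<open>The normalization \<open>x 0 = \<one>\<close> lets the sum of the drifts start
      at zero; it is admissible because \<open>1 \<le> B 0\<close>.\<close>
    have "\<exists>x \<in> carrier F. \<forall>s \<in> S. len (cj x ((\<phi> ^^ k) s)) \<le> B k \<and> (k = 0 \<longrightarrow> x = \<one>)" for k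
    proof (cases k)
      case 0
      have "len (cj \<one> s) \<le> B 0" if "s \<in> S" for s
        using that B(2) len_letter[of "(s, True)"] by (simp add: letter_val_def)
      then show ?thesis using 0 by (intro bexI[of _ \<one>]) auto
    qed (use conj[of k] in auto)
    then obtain x where x: "\<And>k. x k \<in> carrier F" "\<And>k s. s \<in> S \<Longrightarrow> len (cj (x k) ((\<phi> ^^ k) s)) \<le> B k"
      "x 0 = \<one>" using s by metis
    have inj_k: "inj_on (\<phi> ^^ k) (carrier F)" for k
    proof (induction k)
      case (Suc k)
      show ?case
        using Suc inj clos[of _ k] by (auto simp: inj_on_def)
    qed simp
    have step: "len (x (Suc k)) \<le> len (x k) + 5 * (a * B (Suc k))" for k
    proof -
      \<comment> \<open>\<open>U s\<close> is \<open>\<phi>\<^sup>k\<^sup>+\<^sup>1(s)\<close> seen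
        from \<open>x k\<close>. It is short there because it is the image under
        \<open>\<phi>\<^sup>k\<close> of a word of length at most \<open>a\<close>.\<close>
      define y where "y = inv (x k) \<otimes> x (Suc k)"
      define U where "U s = cj (x k) ((\<phi> ^^ Suc k) s)" for s
      have y: "y \<in> carrier F" and U: "U s \<in> carrier F" if "s \<in> S" for s
        using x that clos[of s "Suc k"] by (auto simp: y_def U_def simp del: funpow.simps)
      have BB: "B k \<le> B (Suc k)" using B(1) by (simp add: mono_def)
      have 1: "len (U s) \<le> a * B (Suc k)" if "s \<in> S" for s
      proof -
        have "len (U s) \<le> len (\<phi> s) * B k"
          unfolding U_def funpow_Suc_right comp_def
          using that hom x by (intro len_cj_hom_le[OF hk x(1)]) (auto simp: hom_def)
        also have "\<dots> \<le> a * B (Suc k)" using a that BB by (intro mult_mono) auto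
        finally show ?thesis .
      qed
      have 2: "len (cj y (U s)) \<le> a * B (Suc k)" if "s \<in> S" for s
      proof -
        have "cj y (U s) = cj (x (Suc k)) ((\<phi> ^^ Suc k) s)"
          using that x clos[of s "Suc k"] y[OF that] unfolding U_def y_def
          by (subst cj_cj) (auto simp del: funpow.simps simp flip: m_assoc)
        then have "len (cj y (U s)) \<le> 1 * B (Suc k)" using x that by (simp del: funpow.simps)
        also have "\<dots> \<le> a * B (Suc k)" using a by (intro mult_right_mono) auto
        finally show ?thesis .
      qed
      have "U s\<^sub>1 \<otimes> U s\<^sub>2 \<noteq> U s\<^sub>2 \<otimes> U s\<^sub>1"
      proof
        assume "U s\<^sub>1 \<otimes> U s\<^sub>2 = U s\<^sub>2 \<otimes> U s\<^sub>1"
        then have "cj (x k) ((\<phi> ^^ Suc k) (s\<^sub>1 \<otimes> s\<^sub>2)) = cj (x k) ((\<phi> ^^ Suc k) (s\<^sub>2 \<otimes> s\<^sub>1))"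
          unfolding U_def using s12 hk[of "Suc k"] clos[of _ "Suc k"] x(1)
          by (simp add: hom_def cj_mult del: funpow.simps)
        then have "(\<phi> ^^ Suc k) (s\<^sub>1 \<otimes> s\<^sub>2) = (\<phi> ^^ Suc k) (s\<^sub>2 \<otimes> s\<^sub>1)"
          using cj_inv_cancel[OF x(1)[of k] clos[of _ "Suc k"]] s12 
          by (metis S_in_carrier m_closed)
        then show False using inj_k[of "Suc k"] s12 by (simp add: inj_on_def del: funpow.simps)
      qed
      then have "len y \<le> 5 * (a * B (Suc k))"
        using drift_bound[of "U s\<^sub>1" "U s\<^sub>2" y] s12 U y 1 2 by blast
      moreover have "x (Suc k) = x k \<otimes> y" using x by (simp add: y_def flip: m_assoc)
      ultimately show ?thesis using len_mult_le[OF x(1)[of k] y[OF s]] by simp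
    qed
    have xk: "len (x k) \<le> 5 * (a * (k * B k))" for k
    proof (induction k)
      case (Suc k)
      have "k * B k \<le> k * B (Suc k)" using B(1) by (intro mult_left_mono) (auto simp: mono_def)
      then have "a * (k * B k) + a * B (Suc k) \<le> a * (Suc k * B (Suc k))"
        by (simp flip: add_mult_distrib2)
      with Suc step[of k] show ?case by linarith
    qed (simp add: x)
    have "len ((\<phi> ^^ k) s) = len (cj (inv (x k)) (cj (x k) ((\<phi> ^^ k) s)))"
      using x clos s by (simp add: cj_inv_cancel)
    also have "\<dots> \<le> 2 * len (x k) + B k"
      using len_cj_le[of "inv (x k)" "cj (x k) ((\<phi> ^^ k) s)"] x(1) x(2)[OF s, of k] clos[of s k] s by simp
    also have "\<dots> \<le> 10 * (a * (k * B k)) + a * B k"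
      using xk[of k] a(1) by (intro add_mono) auto
    also have "\<dots> \<le> 11 * a * Suc k * B k" by (simp add: algebra_simps)
    finally show ?thesis .
  qed
qed

end

section \<open>The outer automorphism and its action on conjugacy classes\<close>

context free_group
begin

lemma auto_props:
  assumes "\<phi> \<in> carrier (AutoGroup F)"
  shows "\<phi> \<in> hom F F" "bij_betw \<phi> (carrier F) (carrier F)" "\<phi> \<in> extensional (carrier F)"
  using assms by (auto simp: AutoGroup_def auto_def Bij_def)

text \<open>These maps, for all \<open>a\<close>, are the representatives of the \<open>n\<close>-th
  power of the outer class. They are restricted to the carrier because elements of
  \<open>AutoGroup\<close> are extensional.\<close>

definition twist :: "('a \<Rightarrow> 'a) \<Rightarrow> nat \<Rightarrow> 'a \<Rightarrow> 'a \<Rightarrow> 'a" where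
  "twist \<phi> n a = (\<lambda>x \<in> carrier F. a \<otimes> (\<phi> ^^ n) x \<otimes> inv a)"

lemma bij_betw_conj:
  assumes "a \<in> carrier F" shows "bij_betw (\<lambda>x. a \<otimes> x \<otimes> inv a) (carrier F) (carrier F)"
proof (rule bij_betwI[where g = "\<lambda>x. inv a \<otimes> x \<otimes> a"])
  show "inv a \<otimes> (a \<otimes> x \<otimes> inv a) \<otimes> a = x" if "x \<in> carrier F" for x
    using cj_inv_cancel[of "inv a" x] that assms by (simp add: cj_def)
  show "a \<otimes> (inv a \<otimes> x \<otimes> a) \<otimes> inv a = x" if "x \<in> carrier F" for x
    using cj_inv_cancel[of a x] that assms by (simp add: cj_def)
qed (use assms in auto)

lemma funpow_closed:
  assumes "\<phi> \<in> hom F F" "x \<in> carrier F" shows "(\<phi> ^^ n) x \<in> carrier F"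
  using hom_funpow[OF assms(1), of n] assms(2) by (auto simp: hom_def)

lemma twist_Bij:
  assumes "\<phi> \<in> carrier (AutoGroup F)" "a \<in> carrier F"
  shows "twist \<phi> n a \<in> Bij (carrier F)"
proof -
  have "bij_betw (\<phi> ^^ n) (carrier F) (carrier F)"
    using bij_betw_funpow[OF auto_props(2)[OF assms(1)]] .
  from bij_betw_trans[OF this bij_betw_conj[OF assms(2)]]
  have "bij_betw (twist \<phi> n a) (carrier F) (carrier F)"
    by (subst bij_betw_cong) (auto simp: twist_def comp_def)
  then show ?thesis by (simp add: Bij_def twist_def)
qed

lemma AutoGroup_mult:
  assumes "f \<in> Bij (carrier F)" "g \<in> Bij (carrier F)"
  shows "f \<otimes>\<^bsub>AutoGroup F\<^esub> g = (\<lambda>x \<in> carrier F. f (g x))"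
  using assms by (simp add: AutoGroup_def BijGroup_def compose_def)

lemma twist_mult:
  assumes "\<phi> \<in> carrier (AutoGroup F)" "a \<in> carrier F" "b \<in> carrier F"
  shows "twist \<phi> m a \<otimes>\<^bsub>AutoGroup F\<^esub> twist \<phi> n b = twist \<phi> (m + n) (a \<otimes> (\<phi> ^^ m) b)"
proof -
  note h = auto_props(1)[OF assms(1)]
  interpret hm: group_hom F F "\<phi> ^^ m" using hom_funpow[OF h] by unfold_locales
  have eq: "twist \<phi> m a (twist \<phi> n b x) = (a \<otimes> (\<phi> ^^ m) b) \<otimes> (\<phi> ^^ (m + n)) x \<otimes> inv (a \<otimes> (\<phi> ^^ m) b)"
    if x: "x \<in> carrier F" for x
  proof -
    define y where "y = (\<phi> ^^ n) x"
    have y: "y \<in> carrier F" using funpow_closed[OF h x] by (simp add: y_def)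
    have "twist \<phi> m a (twist \<phi> n b x) = a \<otimes> (\<phi> ^^ m) (b \<otimes> y \<otimes> inv b) \<otimes> inv a"
      using x y assms by (simp add: twist_def y_def)
    also have "\<dots> = a \<otimes> ((\<phi> ^^ m) b \<otimes> (\<phi> ^^ m) y \<otimes> inv ((\<phi> ^^ m) b)) \<otimes> inv a"
      using y assms by simp
    also have "\<dots> = (a \<otimes> (\<phi> ^^ m) b) \<otimes> (\<phi> ^^ m) y \<otimes> inv (a \<otimes> (\<phi> ^^ m) b)"
      using y assms hm.hom_closed[of y] hm.hom_closed[of b] by (simp add: m_assoc inv_mult_group)
    finally show ?thesis by (simp add: y_def funpow_add)
  qed
  show ?thesis
    unfolding AutoGroup_mult[OF twist_Bij[OF assms(1,2)] twist_Bij[OF assms(1,3)]]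
    by (subst (3) twist_def) (rule restrict_ext, rule eq)
qed

lemma outer_class_eq:
  assumes "\<phi> \<in> carrier (AutoGroup F)"
  shows "outer_class F \<phi> = twist \<phi> 1 ` carrier F" "inner_autos F = twist \<phi> 0 ` carrier F"
proof -
  show 0: "inner_autos F = twist \<phi> 0 ` carrier F"
    by (simp add: inner_autos_def twist_def)
  have "\<phi> = twist \<phi> 1 \<one>"
    using auto_props[OF assms]
    by (intro extensionalityI[of _ "carrier F"]) (auto simp: twist_def hom_def Pi_iff)
  then have "twist \<phi> 0 a \<otimes>\<^bsub>AutoGroup F\<^esub> \<phi> = twist \<phi> 1 a" if "a \<in> carrier F" for a
    using twist_mult[OF assms that, of \<one> 0 1] that by simp
  then show "outer_class F \<phi> = twist \<phi> 1 ` carrier F"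
    by (auto simp: outer_class_def 0 r_coset_def)
qed

text \<open>Powers in \<open>OutGroup\<close> are products of cosets; in such a product the
  conjugating elements merge into one that is again arbitrary.\<close>

lemma outer_class_pow:
  assumes "\<phi> \<in> carrier (AutoGroup F)"
  shows "outer_class F \<phi> [^]\<^bsub>OutGroup F\<^esub> n = twist \<phi> n ` carrier F"
proof (induction n)
  case 0
  show ?case using outer_class_eq[OF assms] by (simp add: OutGroup_def nat_pow_def)
next
  case (Suc n)
  interpret hn: group_hom F F "\<phi> ^^ n"
    using hom_funpow[OF auto_props(1)[OF assms]] by unfold_locales
  have "outer_class F \<phi> [^]\<^bsub>OutGroup F\<^esub> Suc n =
        (twist \<phi> n ` carrier F) <#>\<^bsub>AutoGroup F\<^esub> (twist \<phi> 1 ` carrier F)"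
    using Suc outer_class_eq[OF assms] by (simp add: OutGroup_def nat_pow_def)
  also have "\<dots> = twist \<phi> (Suc n) ` carrier F" (is "?L = ?R")
  proof
    show "?L \<subseteq> ?R"
      using twist_mult[OF assms] hn.hom_closed by (auto simp: set_mult_def)
    show "?R \<subseteq> ?L"
    proof
      fix f assume "f \<in> ?R"
      then obtain a where a: "a \<in> carrier F" "f = twist \<phi> (Suc n) a" by blast
      have "f = twist \<phi> n a \<otimes>\<^bsub>AutoGroup F\<^esub> twist \<phi> 1 \<one>"
        using twist_mult[OF assms a(1) one_closed, of n 1] a by simp
      then show "f \<in> ?L" using a by (auto simp: set_mult_def)
    qed
  qed
  finally show ?case .
qed

lemma outer_action_conj_class:
  assumes "\<phi> \<in> carrier (AutoGroup F)" "g \<in> carrier F"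
  shows "outer_action (outer_class F \<phi> [^]\<^bsub>OutGroup F\<^esub> n) (conj_class F g) =
         (\<lambda>x. cj x ((\<phi> ^^ n) g)) ` carrier F" (is "?L = ?R")
proof -
  interpret hn: group_hom F F "\<phi> ^^ n"
    using hom_funpow[OF auto_props(1)[OF assms(1)]] by unfold_locales
  show ?thesis
  proof
    show "?L \<subseteq> ?R"
    proof
      fix y assume "y \<in> ?L"
      then obtain a h where a: "a \<in> carrier F" "h \<in> carrier F" "y = twist \<phi> n a (h \<otimes> g \<otimes> inv h)"
        by (auto simp: outer_action_def outer_class_pow[OF assms(1)] conj_class_def)
      then have "y = cj (inv (a \<otimes> (\<phi> ^^ n) h)) ((\<phi> ^^ n) g)"
        using assms(2) by (simp add: twist_def cj_def m_assoc inv_mult_group)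
      then show "y \<in> ?R" using a by (auto intro!: imageI)
    qed
    show "?R \<subseteq> ?L"
    proof
      fix y assume "y \<in> ?R"
      then obtain x where x: "x \<in> carrier F" "y = cj x ((\<phi> ^^ n) g)" by blast
      then have "y = twist \<phi> n (inv x) (\<one> \<otimes> g \<otimes> inv \<one>)"
        using assms(2) by (simp add: twist_def cj_def)
      then show "y \<in> ?L" using x assms(2)
        by (auto simp: outer_action_def outer_class_pow[OF assms(1)] conj_class_def
            intro!: bexI[of _ "inv x"] exI[of _ \<one>] imageI)
    qed
  qed
qed

lemma class_grows_poly_len:
  assumes "\<phi> \<in> carrier (AutoGroup F)" "g \<in> carrier F"
    and "class_grows_poly F S (outer_class F \<phi>) (conj_class F g) d"
  shows "\<exists>c::nat. \<forall>n\<ge>1. \<exists>x \<in> carrier F. len (cj x ((\<phi> ^^ n) g)) \<le> c * n ^ d"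
proof -
  obtain c :: real where c: "\<And>n. n \<ge> 1 \<Longrightarrow>
      real (conj_length F S (outer_action (outer_class F \<phi> [^]\<^bsub>OutGroup F\<^esub> n) (conj_class F g)))
        \<le> c * real n ^ d"
    using assms(3) by (auto simp: class_grows_poly_def)
  have "\<exists>x \<in> carrier F. len (cj x ((\<phi> ^^ n) g)) \<le> nat \<lceil>c\<rceil> * n ^ d" if n: "n \<ge> 1" for n
  proof -
    let ?g = "(\<phi> ^^ n) g"
    let ?O = "(\<lambda>x. cj x ?g) ` carrier F"
    have g: "?g \<in> carrier F" using funpow_closed[OF auto_props(1)] assms by blast
    \<comment> \<open>A shortest conjugate is cyclically reduced, since otherwise its first letter
      would shorten it. So the \<open>LEAST\<close> in \<open>conj_length\<close> ranges over a
      nonempty set and is attained.\<close>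
    obtain x where x: "x \<in> carrier F" "\<And>y. y \<in> carrier F \<Longrightarrow> len (cj x ?g) \<le> len (cj y ?g)"
      using ex_has_least_nat[of "\<lambda>x. x \<in> carrier F" \<one> "\<lambda>x. len (cj x ?g)"] by auto
    have "nf (cj x ?g) \<in> cyclically_reduced_words S"
    proof (rule ccontr)
      assume "nf (cj x ?g) \<notin> cyclically_reduced_words S"
      then obtain l w where l: "l \<in> S \<times> UNIV" "nf (cj x ?g) = l # w @ [flip_letter l]"
        using not_cyclically_reduced[of "cj x ?g"] x g by auto
      then show False
        using len_cj_shorten[of "cj x ?g" l w] x(1) g x(2)[OF m_closed[OF x(1) letter_val_closed[OF l(1)]]]
          letter_val_closed[OF l(1)] by (simp add: cj_cj)
    qed
    then have "\<exists>k. \<exists>w \<in> cyclically_reduced_words S. ev w \<in> ?O \<and> length w = k"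
      using x g by (intro exI bexI[of _ "nf (cj x ?g)"]) auto
    from LeastI_ex[OF this] obtain w where
      w: "w \<in> cyclically_reduced_words S" "ev w \<in> ?O" "length w = conj_length F S ?O"
      by (auto simp: conj_length_def)
    then obtain z where z: "z \<in> carrier F" "ev w = cj z ?g" by blast
    have "real (len (cj z ?g)) \<le> c * real n ^ d"
      using c[OF n] w z len_ev[of w] outer_action_conj_class[OF assms(1,2), of n]
      by (simp add: cyclically_reduced_words_def)
    also have "\<dots> \<le> real (nat \<lceil>c\<rceil>) * real n ^ d" by (intro mult_right_mono zero_le_power) linarith+
    finally have "len (cj z ?g) \<le> nat \<lceil>c\<rceil> * n ^ d" by (simp flip: of_nat_power of_nat_mult)
    then show ?thesis using z by blast
  qed
  then show ?thesis by blast
qed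

theorem polynomially_growing_len:
  assumes "finite S" "\<phi> \<in> carrier (AutoGroup F)" "polynomially_growing F S \<phi>"
  obtains K d :: nat where "\<And>k s. s \<in> S \<Longrightarrow> len ((\<phi> ^^ k) s) \<le> K * Suc k ^ d"
proof -
  note h = auto_props(1)[OF assms(2)]
  obtain d where d: "\<And>C. C \<in> conj_classes F - {{\<one>}} \<Longrightarrow>
      \<exists>d'\<le>d. class_grows_poly F S (outer_class F \<phi>) C d'"
    using assms(3) by (auto simp: polynomially_growing_def outer_poly_growing_of_degree_def)
  \<comment> \<open>Products of two basis elements are included because
    \<open>simultaneous_conjugation\<close> asks for short conjugates of pairwise products.\<close>
  define V where "V = S \<union> (\<lambda>(s, s'). s \<otimes> s') ` (S \<times> S)"
  have finV: "finite V" using assms(1) by (simp add: V_def)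
  have V: "g \<in> carrier F" "g \<noteq> \<one>" "len g \<le> 2" if gV: "g \<in> V" for g
  proof -
    obtain w where "w \<in> reduced_words S" "ev w = g" "w \<noteq> []" "length w \<le> 2"
    proof (cases "g \<in> S")
      case True
      with that[of "[(g, True)]"] show thesis by (simp add: reduced_words_Cons letter_val_def)
    next
      case False
      then obtain s s' where "s \<in> S" "s' \<in> S" "g = s \<otimes> s'" using gV by (auto simp: V_def)
      with that[of "[(s, True), (s', True)]"] show thesis
        by (simp add: reduced_words_Cons letter_val_def)
    qed
    then show "g \<in> carrier F" "g \<noteq> \<one>" "len g \<le> 2"
      using reduced_words_subset[of w S] nf_ev[of w] len_ev[of w] by auto
  qed
  have "\<exists>c::nat. \<forall>n\<ge>1. \<exists>x \<in> carrier F. len (cj x ((\<phi> ^^ n) g)) \<le> c * n ^ d" if g: "g \<in> V" for g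
  proof -
    have "g \<in> conj_class F g"
      using V(1)[OF g] by (auto simp: conj_class_def intro!: exI[of _ \<one>])
    then have "conj_class F g \<in> conj_classes F - {{\<one>}}"
      using V[OF g] by (auto simp: conj_classes_def)
    then obtain d' where d': "d' \<le> d" "class_grows_poly F S (outer_class F \<phi>) (conj_class F g) d'"
      using d by blast
    obtain c where c: "\<forall>n\<ge>1. \<exists>x \<in> carrier F. len (cj x ((\<phi> ^^ n) g)) \<le> c * n ^ d'"
      using class_grows_poly_len[OF assms(2) V(1)[OF g] d'(2)] by blast
    have "\<exists>x \<in> carrier F. len (cj x ((\<phi> ^^ n) g)) \<le> c * n ^ d" if n: "n \<ge> 1" for n
    proof -
      have "c * n ^ d' \<le> c * n ^ d" using n d'(1) by (intro mult_left_mono power_increasing) auto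
      with c n show ?thesis by (meson le_trans)
    qed
    then show ?thesis by blast
  qed
  then obtain c where c: "\<And>g n. g \<in> V \<Longrightarrow> n \<ge> 1 \<Longrightarrow>
      \<exists>x \<in> carrier F. len (cj x ((\<phi> ^^ n) g)) \<le> c g * n ^ d" by metis
  \<comment> \<open>The summand \<open>2\<close> covers \<open>n = 0\<close>, where elements of
    \<open>V\<close> have length at most two and the growth bounds say nothing.\<close>
  define C where "C = (\<Sum>g\<in>V. c g) + 2"
  define L where "L n = C * Suc n ^ d" for n
  have L: "\<exists>x \<in> carrier F. len (cj x ((\<phi> ^^ n) g)) \<le> L n" if g: "g \<in> V" for g n
  proof (cases "n = 0")
    case True
    then show ?thesis using V[OF g] by (intro bexI[of _ \<one>]) (auto simp: L_def C_def)
  next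
    case False
    have "c g \<le> C" using member_le_sum[of g V c] g finV by (simp add: C_def)
    then have "c g * n ^ d \<le> L n" unfolding L_def by (intro mult_mono power_mono) auto
    with c[OF g, of n] False show ?thesis by (metis One_nat_def Suc_leI le_trans neq0_conv)
  qed
  have conj: "\<exists>x \<in> carrier F. \<forall>s \<in> S. len (cj x ((\<phi> ^^ n) s)) \<le> L n + 2" for n
  proof -
    interpret hn: group_hom F F "\<phi> ^^ n" using hom_funpow[OF h] by unfold_locales
    have "\<exists>x \<in> carrier F. \<forall>u \<in> (\<phi> ^^ n) ` S. len (cj x u) \<le> L n + 2"
    proof (rule simultaneous_conjugation)
      show "u \<in> carrier F \<and> (\<exists>x\<in>carrier F. len (cj x u) \<le> L n)" if "u \<in> (\<phi> ^^ n) ` S" for u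
        using that L[of _ n] by (auto simp: V_def)
      show "\<exists>x\<in>carrier F. len (cj x (u \<otimes> v)) \<le> L n"
        if uv: "u \<in> (\<phi> ^^ n) ` S" "v \<in> (\<phi> ^^ n) ` S" for u v
      proof -
        obtain s s' where s: "s \<in> S" "s' \<in> S" "u = (\<phi> ^^ n) s" "v = (\<phi> ^^ n) s'" using uv by blast
        then have "s \<otimes> s' \<in> V" "u \<otimes> v = (\<phi> ^^ n) (s \<otimes> s')" by (auto simp: V_def)
        then show ?thesis using L[of "s \<otimes> s'" n] by simp
      qed
    qed (use assms(1) in simp)
    then show ?thesis by blast
  qed
  define a where "a = (\<Sum>s\<in>S. len (\<phi> s)) + 1"
  have a: "len (\<phi> s) \<le> a" if "s \<in> S" for s
    using member_le_sum[of s S "\<lambda>s. len (\<phi> s)"] assms(1) that by (simp add: a_def)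
  have mono: "mono (\<lambda>n. L n + 2)"
    unfolding L_def by (intro monoI add_mono mult_left_mono power_mono) auto
  have "len ((\<phi> ^^ k) s) \<le> 11 * a * (C + 2) * Suc k ^ Suc d" if s: "s \<in> S" for k s
  proof -
    have "len ((\<phi> ^^ k) s) \<le> 11 * a * Suc k * (L k + 2)"
      by (rule len_iterates_le[OF h bij_betw_imp_inj_on[OF auto_props(2)[OF assms(2)]] mono _ _ a conj s])
        (auto simp: a_def)
    also have "L k + 2 \<le> (C + 2) * Suc k ^ d"
      using one_le_power[of "Suc k" d] by (simp only: L_def add_mult_distrib) linarith
    then have "11 * a * Suc k * (L k + 2) \<le> 11 * a * Suc k * ((C + 2) * Suc k ^ d)"
      by (rule mult_left_mono) simp
    also have "\<dots> = 11 * a * (C + 2) * Suc k ^ Suc d" by (simp only: power_Suc mult_ac)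
    finally show ?thesis .
  qed
  then show ?thesis using that by blast
qed

end

section \<open>Determinants of regularized Gram matrices\<close>

definition outer :: "nat \<Rightarrow> (nat \<Rightarrow> 'a::comm_ring_1) \<Rightarrow> (nat \<Rightarrow> 'a) \<Rightarrow> 'a mat" where
  "outer N x y = mat N N (\<lambda>(i, j). x i * y j)"

lemma mat_mult_index:
  assumes "A \<in> carrier_mat n m" "B \<in> carrier_mat m k" "i < n" "j < k"
  shows "(A * B) $$ (i, j) = (\<Sum>l<m. A $$ (i, l) * B $$ (l, j))"
  using assms by (simp add: scalar_prod_def lessThan_atLeast0)

text \<open>The matrix determinant lemma: the two Schur complements of one block matrix give the two
  sides.\<close>

lemma det_one_plus_outer:
  fixes x y :: "nat \<Rightarrow> 'a::idom"
  shows "det (1\<^sub>m N + outer N x y) = 1 + (\<Sum>i<N. y i * x i)"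
proof -
  define U where "U = mat N 1 (\<lambda>(i, j). - x i)"
  define V where "V = mat 1 N (\<lambda>(i, j). y j)"
  define c where "c = 1 + (\<Sum>i<N. y i * x i)"
  have U: "U \<in> carrier_mat N 1" and V: "V \<in> carrier_mat 1 N" by (simp_all add: U_def V_def)
  define M where "M = four_block_mat (1\<^sub>m 1) V U (1\<^sub>m N)"
  have 1: "M = four_block_mat (1\<^sub>m 1) (0\<^sub>m 1 N) U (1\<^sub>m N) *
      four_block_mat (1\<^sub>m 1) V (0\<^sub>m N 1) (1\<^sub>m N + outer N x y)"
  proof -
    have "U * V + (1\<^sub>m N + outer N x y) = 1\<^sub>m N"
      by (rule eq_matI) (auto simp: U_def V_def outer_def scalar_prod_def)
    then show ?thesis
      unfolding M_def using U V
      by (subst mult_four_block_mat[of _ 1 1 _ N _ N _ _ 1 _ N]) (auto simp: outer_def)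
  qed
  have 2: "M = four_block_mat (c \<cdot>\<^sub>m 1\<^sub>m 1) V (0\<^sub>m N 1) (1\<^sub>m N) *
      four_block_mat (1\<^sub>m 1) (0\<^sub>m 1 N) U (1\<^sub>m N)"
  proof -
    have "c \<cdot>\<^sub>m 1\<^sub>m 1 + V * U = 1\<^sub>m 1"
      by (rule eq_matI) (auto simp: U_def V_def c_def scalar_prod_def lessThan_atLeast0 sum_negf)
    then show ?thesis
      unfolding M_def using U V
      by (subst mult_four_block_mat[of _ 1 1 _ N _ N _ _ 1 _ N]) auto
  qed
  have o: "outer N x y \<in> carrier_mat N N" by (simp add: outer_def)
  have dX: "det (four_block_mat (1\<^sub>m 1) (0\<^sub>m 1 N) U (1\<^sub>m N)) = 1"
    using U by (subst det_four_block_mat_upper_right_zero[of _ 1 _ N]) auto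
  have "det M = det (1\<^sub>m N + outer N x y)"
    unfolding 1 using U V o dX
    by (subst det_mult[of _ "1 + N"])
       (auto simp: det_four_block_mat_lower_left_zero[of _ 1 _ N] simp del: One_nat_def)
  moreover have "det M = c"
    unfolding 2 using U V dX
    by (subst det_mult[of _ "1 + N"])
       (auto simp: det_four_block_mat_lower_left_zero[of _ 1 _ N] simp del: One_nat_def)
  ultimately show ?thesis by (simp add: c_def)
qed

text \<open>This is \<open>a\<close> plus the product of a matrix with its transpose, where the
  matrix has the rows \<open>f l\<close> for \<open>l\<close> in \<open>I\<close>. The rows are
  indexed by a set so that they can be added and removed one at a time.\<close>

definition gram :: "real \<Rightarrow> nat \<Rightarrow> 'l set \<Rightarrow> ('l \<Rightarrow> nat \<Rightarrow> real) \<Rightarrow> real mat" where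
  "gram a N I f = mat N N (\<lambda>(i, j). (if i = j then a else 0) + (\<Sum>l\<in>I. f l i * f l j))"

lemma gram_carrier [simp]: "gram a N I f \<in> carrier_mat N N" "dim_row (gram a N I f) = N" "dim_col (gram a N I f) = N"
  by (simp_all add: gram_def)

lemma solve_nonsingular:
  fixes A :: "'a::field mat"
  assumes A: "A \<in> carrier_mat N N" and d: "det A \<noteq> 0"
  obtains x where "\<And>i. i < N \<Longrightarrow> (\<Sum>j<N. A $$ (i, j) * x j) = r i"
proof
  fix i assume i: "i < N"
  let ?x = "\<lambda>j. (\<Sum>k<N. adj_mat A $$ (j, k) * r k) / det A"
  have adj: "adj_mat A \<in> carrier_mat N N" "A * adj_mat A = det A \<cdot>\<^sub>m 1\<^sub>m N" using adj_mat[OF A] by auto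
  have "(\<Sum>j<N. A $$ (i, j) * ?x j) = (\<Sum>j<N. \<Sum>k<N. A $$ (i, j) * adj_mat A $$ (j, k) * r k) / det A"
    by (simp add: sum_distrib_left sum_divide_distrib mult.assoc)
  also have "(\<Sum>j<N. \<Sum>k<N. A $$ (i, j) * adj_mat A $$ (j, k) * r k) = (\<Sum>k<N. (A * adj_mat A) $$ (i, k) * r k)"
    by (subst sum.swap) (intro sum.cong refl, simp add: mat_mult_index[OF A adj(1) i] sum_distrib_right del: index_mult_mat)
  also have "\<dots> = (\<Sum>k<N. if k = i then det A * r k else 0)"
    using i by (intro sum.cong) (auto simp: adj(2))
  also have "\<dots> = det A * r i" using i by simp
  finally show "(\<Sum>j<N. A $$ (i, j) * ?x j) = r i" using d by simp
qed

lemma gram_insert: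
  assumes "finite I" "l \<notin> I"
  shows "gram a N (insert l I) f = gram a N I f + outer N (f l) (f l)"
  using assms by (intro eq_matI) (auto simp: gram_def outer_def)

lemma gram_form:
  "(\<Sum>i<N. x i * (\<Sum>j<N. gram a N I f $$ (i, j) * x j)) =
     a * (\<Sum>i<N. (x i)\<^sup>2) + (\<Sum>l\<in>I. (\<Sum>i<N. f l i * x i)\<^sup>2)"
proof -
  have "(\<Sum>i<N. x i * (\<Sum>j<N. gram a N I f $$ (i, j) * x j)) =
      (\<Sum>i<N. \<Sum>j<N. (if j = i then a * (x i)\<^sup>2 else 0) + (\<Sum>l\<in>I. (f l i * x i) * (f l j * x j)))"
    unfolding sum_distrib_left
    by (intro sum.cong refl) (auto simp: gram_def algebra_simps sum_distrib_left sum_distrib_right power2_eq_square)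
  also have "\<dots> = a * (\<Sum>i<N. (x i)\<^sup>2) + (\<Sum>i<N. \<Sum>j<N. \<Sum>l\<in>I. (f l i * x i) * (f l j * x j))"
    by (simp add: sum.distrib sum_distrib_left)
  also have "(\<Sum>i<N. \<Sum>j<N. \<Sum>l\<in>I. (f l i * x i) * (f l j * x j)) = (\<Sum>l\<in>I. \<Sum>i<N. \<Sum>j<N. (f l i * x i) * (f l j * x j))"
    by (simp only: sum.swap[of _ I "{..<N}"])
  also have "\<dots> = (\<Sum>l\<in>I. (\<Sum>i<N. f l i * x i)\<^sup>2)"
    by (simp add: power2_eq_square sum_product)
  finally show ?thesis .
qed

text \<open>If \<open>x\<close> solves \<open>A x = f l\<close> for the old Gram matrix
  \<open>A\<close>, the new row multiplies the determinant by \<open>1 + q\<close> with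
  \<open>q\<close> the scalar product of \<open>f l\<close> and \<open>x\<close>. Since
  \<open>A\<close> is at least \<open>a\<close>, \<open>q\<close> is at least \<open>a\<close> times
  the squared norm of \<open>x\<close>; expanding the square of \<open>x - f l / a\<close> then
  bounds \<open>q\<close> from above.\<close>

lemma det_gram_insert:
  assumes I: "finite I" "l \<notin> I" and a: "a > 0" and pos: "det (gram a N I f) > 0"
  shows "det (gram a N I f) \<le> det (gram a N (insert l I) f)"
    "det (gram a N (insert l I) f) \<le> det (gram a N I f) * (1 + (\<Sum>i<N. (f l i)\<^sup>2) / a)"
proof -
  let ?A = "gram a N I f"
  obtain x where x: "\<And>i. i < N \<Longrightarrow> (\<Sum>j<N. ?A $$ (i, j) * x j) = f l i"
    using solve_nonsingular[of ?A N "f l"] pos by auto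
  define q where "q = (\<Sum>i<N. f l i * x i)"
  have "gram a N (insert l I) f = ?A * (1\<^sub>m N + outer N x (f l))"
    unfolding gram_insert[OF I]
  proof (rule eq_matI)
    fix i j assume ij: "i < dim_row (?A * (1\<^sub>m N + outer N x (f l)))" "j < dim_col (?A * (1\<^sub>m N + outer N x (f l)))"
    then have ij: "i < N" "j < N" by (simp_all add: outer_def)
    have "(?A * (1\<^sub>m N + outer N x (f l))) $$ (i, j) =
        (\<Sum>k<N. ?A $$ (i, k) * (1\<^sub>m N + outer N x (f l)) $$ (k, j))"
      using ij by (intro mat_mult_index[of _ N N _ N]) (auto simp: outer_def)
    also have "\<dots> = (\<Sum>k<N. (if k = j then ?A $$ (i, j) else 0) + ?A $$ (i, k) * x k * f l j)"
      using ij by (intro sum.cong refl) (auto simp: outer_def algebra_simps)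
    also have "\<dots> = ?A $$ (i, j) + f l i * f l j"
      using ij x[OF ij(1)] by (simp add: sum.distrib flip: sum_distrib_right)
    finally show "(?A + outer N (f l) (f l)) $$ (i, j) = (?A * (1\<^sub>m N + outer N x (f l))) $$ (i, j)"
      using ij by (simp add: outer_def)
  qed (auto simp: outer_def)
  then have det: "det (gram a N (insert l I) f) = det ?A * (1 + q)"
    using det_mult[of ?A N "1\<^sub>m N + outer N x (f l)"] det_one_plus_outer[of N x "f l"]
    by (simp add: outer_def q_def)
  have "q = (\<Sum>i<N. x i * (\<Sum>j<N. ?A $$ (i, j) * x j))"
    using x by (simp add: q_def mult.commute)
  then have qge: "a * (\<Sum>i<N. (x i)\<^sup>2) \<le> q"
    by (simp add: gram_form sum_nonneg)
  have "0 \<le> (\<Sum>i<N. (x i)\<^sup>2)" by (simp add: sum_nonneg)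
  then have q0: "0 \<le> q" using qge a by (meson dual_order.trans less_imp_le mult_nonneg_nonneg)
  have "0 \<le> a * (\<Sum>i<N. (x i - f l i / a)\<^sup>2)" using a by (simp add: sum_nonneg)
  also have "\<dots> = (\<Sum>i<N. a * (x i)\<^sup>2 - 2 * (f l i * x i) + (f l i)\<^sup>2 / a)"
    unfolding sum_distrib_left using a by (intro sum.cong refl) (simp add: field_simps power2_eq_square)
  also have "\<dots> = a * (\<Sum>i<N. (x i)\<^sup>2) - 2 * q + (\<Sum>i<N. (f l i)\<^sup>2) / a"
    by (simp add: q_def sum.distrib sum_subtractf sum_distrib_left sum_divide_distrib)
  finally have "q \<le> (\<Sum>i<N. (f l i)\<^sup>2) / a" using qge by linarith
  with q0 pos show "det ?A \<le> det (gram a N (insert l I) f)"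
    "det (gram a N (insert l I) f) \<le> det ?A * (1 + (\<Sum>i<N. (f l i)\<^sup>2) / a)"
    unfolding det by (auto intro!: mult_left_mono)
qed

lemma det_gram_empty: "det (gram a N {} f) = a ^ N"
proof -
  have "gram a N {} f = a \<cdot>\<^sub>m 1\<^sub>m N" by (rule eq_matI) (auto simp: gram_def)
  then show ?thesis by simp
qed

lemma det_gram_pos:
  assumes "finite I" "a > 0" shows "det (gram a N I f) > 0"
  using assms(1)
proof (induction I)
  case empty
  then show ?case using assms(2) by (simp add: det_gram_empty)
next
  case (insert l I)
  then show ?case using det_gram_insert(1)[OF insert(1,2) assms(2) insert(3)] by linarith
qed

lemma det_gram_mono:
  assumes "finite J" "I \<subseteq> J" "a > 0"
  shows "det (gram a N I f) \<le> det (gram a N J f)"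
proof -
  have "finite K \<Longrightarrow> K \<inter> I = {} \<Longrightarrow> det (gram a N I f) \<le> det (gram a N (I \<union> K) f)" for K
  proof (induction K rule: finite_induct)
    case (insert l K)
    have fin: "finite (I \<union> K)" using assms insert finite_subset by auto
    show ?case
      using det_gram_insert(1)[OF fin, of l a N f] insert det_gram_pos[OF fin assms(3), of N f] assms by auto
  qed simp
  from this[of "J - I"] assms show ?thesis by (simp add: Un_absorb1 Int_commute Diff_disjoint)
qed

lemma det_gram_upper:
  assumes "finite J" "I \<subseteq> J" "a > 0" and C: "\<And>l. l \<in> J - I \<Longrightarrow> (\<Sum>i<N. (f l i)\<^sup>2) \<le> C"
  shows "det (gram a N J f) \<le> det (gram a N I f) * (1 + C / a) ^ card (J - I)"
proof -
  have "finite K \<Longrightarrow> K \<subseteq> J - I \<Longrightarrow> det (gram a N (I \<union> K) f) \<le> det (gram a N I f) * (1 + C / a) ^ card K" for K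
  proof (induction K rule: finite_induct)
    case (insert l K)
    have fin: "finite (I \<union> K)" using assms insert finite_subset by auto
    have "det (gram a N (I \<union> insert l K) f) \<le> det (gram a N (I \<union> K) f) * (1 + (\<Sum>i<N. (f l i)\<^sup>2) / a)"
      using det_gram_insert(2)[OF fin, of l a N f] insert det_gram_pos[OF fin assms(3), of N f] assms by auto
    also have "\<dots> \<le> det (gram a N (I \<union> K) f) * (1 + C / a)"
      using C[of l] insert det_gram_pos[OF fin assms(3), of N f] assms(3)
      by (intro mult_left_mono add_left_mono divide_right_mono) auto
    also have "\<dots> \<le> det (gram a N I f) * (1 + C / a) ^ card K * (1 + C / a)"
    proof (rule mult_right_mono)
      have "0 \<le> (\<Sum>i<N. (f l i)\<^sup>2)" by (simp add: sum_nonneg)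
      then have "0 \<le> C" using C[of l] insert by auto
      then show "0 \<le> 1 + C / a" using assms(3) by simp
    qed (use insert in auto)
    finally show ?case using insert by (simp add: mult_ac)
  qed simp
  from this[of "J - I"] assms show ?thesis by (simp add: Un_absorb1)
qed

section \<open>Spectra of Gram matrices and polynomial approximation of the logarithm\<close>

definition tr :: "'a::comm_ring_1 mat \<Rightarrow> 'a" where
  "tr A = (\<Sum>i<dim_row A. A $$ (i, i))"

lemma tr_mult_commute:
  assumes "A \<in> carrier_mat n m" "B \<in> carrier_mat m n"
  shows "tr (A * B) = tr (B * A)"
proof -
  have "tr (A * B) = (\<Sum>i<n. \<Sum>l<m. A $$ (i, l) * B $$ (l, i))"
    using assms by (simp add: tr_def mat_mult_index[OF assms] del: index_mult_mat(1))
  also have "\<dots> = (\<Sum>l<m. \<Sum>i<n. B $$ (l, i) * A $$ (i, l))"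
    by (subst sum.swap) (simp add: mult.commute)
  also have "\<dots> = tr (B * A)"
    using assms by (simp add: tr_def mat_mult_index[OF assms(2,1)] del: index_mult_mat(1))
  finally show ?thesis .
qed

lemma tr_similar:
  assumes "similar_mat_wit A B P Q"
  shows "tr A = tr B"
proof -
  note w = similar_mat_witD[OF refl assms]
  have "tr A = tr (P * (B * Q))" by (subst w(3), subst assoc_mult_mat[OF w(6) w(5) w(7)]) (rule refl)
  also have "\<dots> = tr ((B * Q) * P)" using w(5-7) by (intro tr_mult_commute[of P "dim_row A" "dim_row A"]) auto
  also have "(B * Q) * P = B"
    using w(2) w(5) assoc_mult_mat[OF w(5) w(7) w(6)] by simp
  finally show ?thesis .
qed

lemma upper_triangular_mult:
  fixes A :: "'a::comm_ring_1 mat"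
  assumes A: "A \<in> carrier_mat n n" "upper_triangular A" and B: "B \<in> carrier_mat n n" "upper_triangular B"
  shows "upper_triangular (A * B)" "i < n \<Longrightarrow> (A * B) $$ (i, i) = A $$ (i, i) * B $$ (i, i)"
proof -
  have z: "A $$ (i, l) * B $$ (l, j) = 0" if "i < n" "l < n" "l < i \<or> j < l" for i j l
    using that upper_triangularD[OF A(2), of l i] upper_triangularD[OF B(2), of j l] A B by auto
  show "upper_triangular (A * B)"
  proof (rule upper_triangularI)
    fix i j assume ij: "j < i" "i < dim_row (A * B)"
    then have "(A * B) $$ (i, j) = (\<Sum>l<n. A $$ (i, l) * B $$ (l, j))"
      using A B by (intro mat_mult_index[of A n n B n]) auto
    also have "\<dots> = 0" using ij A by (intro sum.neutral ballI z) auto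
    finally show "(A * B) $$ (i, j) = 0" .
  qed
  show "(A * B) $$ (i, i) = A $$ (i, i) * B $$ (i, i)" if i: "i < n"
  proof -
    have "(A * B) $$ (i, i) = (\<Sum>l<n. A $$ (i, l) * B $$ (l, i))"
      using A B i by (intro mat_mult_index[of A n n B n]) auto
    also have "\<dots> = (\<Sum>l\<in>{i}. A $$ (i, l) * B $$ (l, i))"
      using i by (intro sum.mono_neutral_right) (auto intro!: z)
    finally show ?thesis by simp
  qed
qed

lemma upper_triangular_pow:
  fixes B :: "'a::comm_ring_1 mat"
  assumes "B \<in> carrier_mat n n" "upper_triangular B"
  shows "upper_triangular (B ^\<^sub>m k) \<and> (\<forall>i<n. (B ^\<^sub>m k) $$ (i, i) = B $$ (i, i) ^ k)"
proof (induction k)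
  case (Suc k)
  then show ?case
    using upper_triangular_mult[of "B ^\<^sub>m k" n B] assms by (simp add: mult.commute)
qed (use assms in auto)

text \<open>The Rayleigh quotient of \<open>v\<close> shows that \<open>e\<close> is real and
  nonnegative. The row belonging to an entry of \<open>v\<close> of largest modulus bounds it by
  \<open>R\<close>.\<close>

lemma gram_eigenvalue:
  fixes e :: complex
  assumes "v \<in> carrier_vec N" "v \<noteq> 0\<^sub>v N"
    and eig: "map_mat complex_of_real (gram 0 N I f) *\<^sub>v v = e \<cdot>\<^sub>v v"
    and R: "\<And>i. i < N \<Longrightarrow> (\<Sum>j<N. \<bar>gram 0 N I f $$ (i, j)\<bar>) \<le> R"
  shows "\<exists>h. e = complex_of_real h \<and> 0 \<le> h \<and> h \<le> R"
proof -
  define H where "H i j = gram 0 N I f $$ (i, j)" for i j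
  define T where "T = (\<Sum>i<N. (cmod (v $ i))\<^sup>2)"
  have ev: "(\<Sum>j<N. of_real (H i j) * v $ j) = e * v $ i" if "i < N" for i
    using arg_cong[OF eig, of "\<lambda>w. w $ i"] that assms(1)
    by (simp add: scalar_prod_def lessThan_atLeast0 H_def)
  obtain i0 where i0: "i0 < N" "v $ i0 \<noteq> 0"
    using assms(1,2) by (metis carrier_vecD eq_vecI index_zero_vec)
  have T: "T > 0"
    unfolding T_def by (rule sum_pos2[of _ i0]) (use i0 in auto)
  define w where "w l = (\<Sum>j<N. of_real (f l j) * v $ j)" for l
  have "e * of_real T = (\<Sum>i<N. cnj (v $ i) * (e * v $ i))"
    unfolding T_def of_real_sum sum_distrib_left
    by (intro sum.cong refl) (simp add: complex_norm_square[symmetric] mult_ac flip: complex_norm_square)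
  also have "\<dots> = (\<Sum>i<N. \<Sum>j<N. \<Sum>l\<in>I. cnj (of_real (f l i) * v $ i) * (of_real (f l j) * v $ j))"
    by (intro sum.cong refl)
      (simp add: ev[symmetric] H_def gram_def sum_distrib_left sum_distrib_right mult_ac)
  also have "\<dots> = (\<Sum>l\<in>I. \<Sum>i<N. \<Sum>j<N. cnj (of_real (f l i) * v $ i) * (of_real (f l j) * v $ j))"
    by (simp only: sum.swap[of _ I "{..<N}"])
  also have "\<dots> = (\<Sum>l\<in>I. cnj (w l) * w l)"
    by (simp add: w_def sum_product)
  also have "\<dots> = of_real (\<Sum>l\<in>I. (cmod (w l))\<^sup>2)"
    by (simp add: complex_norm_square mult.commute del: of_real_power)
  finally have e: "e = of_real ((\<Sum>l\<in>I. (cmod (w l))\<^sup>2) / T)" (is "_ = of_real ?h")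
    using T by (simp add: field_simps)
  have h0: "0 \<le> ?h" using T by (simp add: sum_nonneg)
  obtain k where k: "k < N" "\<And>i. i < N \<Longrightarrow> cmod (v $ i) \<le> cmod (v $ k)"
  proof -
    have "Max ((\<lambda>i. cmod (v $ i)) ` {..<N}) \<in> (\<lambda>i. cmod (v $ i)) ` {..<N}"
      using i0 by (intro Max_in) auto
    then obtain k where "k < N" "cmod (v $ k) = Max ((\<lambda>i. cmod (v $ i)) ` {..<N})" by auto
    with that[of k] show ?thesis by auto
  qed
  have pos: "cmod (v $ k) > 0" using k(2)[OF i0(1)] i0(2) by (meson order_less_le_trans zero_less_norm_iff)
  have "?h * cmod (v $ k) = cmod (e * v $ k)" by (simp only: e norm_mult norm_of_real abs_of_nonneg[OF h0])
  also have "\<dots> \<le> (\<Sum>j<N. \<bar>H k j\<bar> * cmod (v $ j))"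
    unfolding ev[OF k(1), symmetric] by (rule order_trans[OF norm_sum]) (simp add: norm_mult)
  also have "\<dots> \<le> (\<Sum>j<N. \<bar>H k j\<bar> * cmod (v $ k))"
    by (intro sum_mono mult_left_mono k(2)) auto
  also have "\<dots> \<le> R * cmod (v $ k)"
    using R[OF k(1)] by (simp add: H_def mult_right_mono flip: sum_distrib_right)
  finally have "?h \<le> R" using pos by (rule mult_right_le_imp_le)
  with e h0 show ?thesis by blast
qed

text \<open>Schur triangulation over the complex numbers. One list of eigenvalues serves all
  \<open>a\<close> and all \<open>k\<close>, because \<open>gram a\<close> is \<open>gram 0\<close>
  shifted by \<open>a\<close>.\<close>

lemma gram_spectrum:
  assumes R: "\<And>i. i < N \<Longrightarrow> (\<Sum>j<N. \<bar>gram 0 N I f $$ (i, j)\<bar>) \<le> R"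
  obtains hs where "length hs = N" "\<And>h. h \<in> set hs \<Longrightarrow> 0 \<le> h \<and> h \<le> R"
    "\<And>a. det (gram a N I f) = (\<Prod>h\<leftarrow>hs. a + h)"
    "\<And>k. tr (gram 0 N I f ^\<^sub>m k) = (\<Sum>h\<leftarrow>hs. h ^ k)"
proof -
  let ?H = "gram 0 N I f"
  let ?c = "map_mat complex_of_real"
  have Hc: "?c ?H \<in> carrier_mat N N" by simp
  obtain es where es: "char_poly (?c ?H) = (\<Prod>e\<leftarrow>es. [:- e, 1:])" "length es = N"
    using char_poly_factorized[OF Hc] by blast
  obtain B P Q where "schur_decomposition (?c ?H) es = (B, P, Q)" by (cases "schur_decomposition (?c ?H) es")
  from schur_decomposition[OF Hc es(1) this]
  have wit: "similar_mat_wit (?c ?H) B P Q" and ut: "upper_triangular B" and dB: "diag_mat B = es" by auto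
  note w = similar_mat_witD2[OF Hc wit]
  have B: "B \<in> carrier_mat N N" and P: "P \<in> carrier_mat N N" and Q: "Q \<in> carrier_mat N N"
    and PQ: "P * Q = 1\<^sub>m N" "Q * P = 1\<^sub>m N" and HB: "?c ?H = P * B * Q" using w by auto
  have Bi: "B $$ (i, i) = es ! i" if "i < N" for i
    using that B es(2) by (simp add: diag_mat_def flip: dB)
  have "\<exists>h. e = complex_of_real h \<and> 0 \<le> h \<and> h \<le> R" if "e \<in> set es" for e
  proof -
    have "poly (char_poly (?c ?H)) e = 0"
      using that unfolding es(1) poly_prod_list by (auto simp: prod_list_zero_iff)
    then have "eigenvalue (?c ?H) e" using eigenvalue_root_char_poly[OF Hc] by simp
    then obtain v where "eigenvector (?c ?H) v e" by (auto simp: eigenvalue_def)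
    then show ?thesis using gram_eigenvalue[of v N I f e R] R by (auto simp: eigenvector_def)
  qed
  then have re: "complex_of_real (Re e) = e" "0 \<le> Re e" "Re e \<le> R" if "e \<in> set es" for e
    using that by fastforce+
  show ?thesis
  proof
    show "length (map Re es) = N" using es by simp
    show "0 \<le> h \<and> h \<le> R" if "h \<in> set (map Re es)" for h using that re by auto
  next
    fix a
    have "?c (gram a N I f) = of_real a \<cdot>\<^sub>m 1\<^sub>m N + ?c ?H"
      by (rule eq_matI) (auto simp: gram_def)
    also have "\<dots> = P * (of_real a \<cdot>\<^sub>m 1\<^sub>m N + B) * Q"
    proof -
      have "P * (of_real a \<cdot>\<^sub>m 1\<^sub>m N + B) * Q = P * (of_real a \<cdot>\<^sub>m 1\<^sub>m N) * Q + P * B * Q"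
        using P B Q
        by (subst mult_add_distrib_mat[of P N N _ N], simp, simp, simp, subst add_mult_distrib_mat[of _ N N _ Q N]) auto
      also have "P * (of_real a \<cdot>\<^sub>m 1\<^sub>m N) * Q = of_real a \<cdot>\<^sub>m (P * Q)"
        using mult_smult_distrib[OF P one_carrier_mat[of N], of "of_real a"] P
          mult_smult_assoc_mat[OF P Q, of "of_real a"] by simp
      finally show ?thesis using PQ HB by simp
    qed
    finally have "similar_mat_wit (?c (gram a N I f)) (of_real a \<cdot>\<^sub>m 1\<^sub>m N + B) P Q"
      using P Q B PQ by (intro similar_mat_witI[of _ _ N]) auto
    then have "det (?c (gram a N I f)) = det (of_real a \<cdot>\<^sub>m 1\<^sub>m N + B)"
      using det_similar similar_mat_def by blast
    also have "\<dots> = prod_list (diag_mat (of_real a \<cdot>\<^sub>m 1\<^sub>m N + B))"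
      using B by (intro det_upper_triangular[of _ N] upper_triangularI) (auto intro: upper_triangularD[OF ut])
    also have "diag_mat (of_real a \<cdot>\<^sub>m 1\<^sub>m N + B) = map (\<lambda>e. of_real a + e) es"
      using B es(2) by (intro nth_equalityI) (auto simp: diag_mat_def Bi)
    also have "prod_list \<dots> = of_real (\<Prod>h\<leftarrow>map Re es. a + h)"
      using re(1) by (induction es) auto
    finally show "det (gram a N I f) = (\<Prod>h\<leftarrow>map Re es. a + h)"
      by (metis of_real_eq_iff of_real_hom.hom_det)
  next
    fix k
    have "complex_of_real (tr (?H ^\<^sub>m k)) = tr (?c (?H ^\<^sub>m k))"
      by (simp add: tr_def)
    also have "?c (?H ^\<^sub>m k) = ?c ?H ^\<^sub>m k"
      by (rule of_real_hom.mat_hom_pow[of _ N]) simp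
    also have "tr (?c ?H ^\<^sub>m k) = tr (B ^\<^sub>m k)"
      by (rule tr_similar[OF similar_mat_wit_pow[OF wit]])
    also have "\<dots> = (\<Sum>i<N. (es ! i) ^ k)"
      using upper_triangular_pow[OF B ut, of k] B by (simp add: tr_def Bi)
    also have "\<dots> = (\<Sum>e\<leftarrow>es. e ^ k)"
      using es(2) by (simp add: sum_list_sum_nth lessThan_atLeast0)
    also have "\<dots> = of_real (\<Sum>h\<leftarrow>map Re es. h ^ k)"
      using re(1) by (induction es) auto
    finally show "tr (?H ^\<^sub>m k) = (\<Sum>h\<leftarrow>map Re es. h ^ k)"
      using of_real_eq_iff by blast
  qed
qed

text \<open>The logarithm series at the point \<open>C = a + R\<close> is used. The substitution
  \<open>y = 1 - (a + x) / C\<close> takes values in the interval from \<open>0\<close> to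
  \<open>q = R / C\<close>, and \<open>q < 1\<close> is where \<open>a > 0\<close> enters.\<close>

lemma ln_polynomial_approximation:
  assumes a: "0 < a" and R: "0 \<le> R" and \<delta>: "0 < \<delta>"
  obtains p :: "real poly" where "\<And>x. 0 \<le> x \<Longrightarrow> x \<le> R \<Longrightarrow> \<bar>ln (a + x) - poly p x\<bar> \<le> \<delta>"
proof -
  define C where "C = a + R"
  define q where "q = R / C"
  have C: "C > 0" and q: "0 \<le> q" "q < 1" and qC: "1 - a / C = q"
    using a R by (auto simp: C_def q_def field_simps)
  obtain J where J: "q ^ J < \<delta> * (1 - q)"
    using real_arch_pow_inv[of "\<delta> * (1 - q)" q] q \<delta> by auto
  \<comment> \<open>The remainder of the logarithm series; its derivative is the tail
    \<open>z ^ J / (1 - z)\<close> of the geometric series, so the mean value theorem bounds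
    it.\<close>
  define g where "g y = - ln (1 - y) - (\<Sum>j<J. y ^ Suc j / real (Suc j))" for y
  have g: "\<bar>g y\<bar> \<le> \<delta>" if y: "0 \<le> y" "y \<le> q" for y
  proof (cases "y = 0")
    case True
    then show ?thesis using \<delta> by (simp add: g_def)
  next
    case False
    have der: "(g has_real_derivative z ^ J / (1 - z)) (at z)" if z: "0 \<le> z" "z \<le> y" for z
    proof -
      have z1: "1 - z > 0" using z y q by simp
      have "((\<lambda>z. z ^ Suc j / real (Suc j)) has_real_derivative z ^ j) (at z)" for j
        using DERIV_cdivide[OF DERIV_pow[of "Suc j" z UNIV], of "real (Suc j)"] by (simp del: of_nat_Suc)
      moreover have "((\<lambda>y. - ln (1 - y)) has_real_derivative 1 / (1 - z)) (at z)"
        using z1 by (auto intro!: derivative_eq_intros)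
      ultimately have "(g has_real_derivative (1 / (1 - z) - (\<Sum>j<J. z ^ j))) (at z)"
        unfolding g_def by (intro DERIV_diff DERIV_sum)
      moreover have "1 / (1 - z) - (\<Sum>j<J. z ^ j) = z ^ J / (1 - z)"
        using z1 by (simp add: geometric_sum field_simps sum_gp_strict)
      ultimately show ?thesis by simp
    qed
    obtain z where z: "0 < z" "z < y" "g y - g 0 = (y - 0) * (z ^ J / (1 - z))"
      using MVT2[of 0 y g "\<lambda>z. z ^ J / (1 - z)"] False y der by auto
    have "\<bar>g y\<bar> = y * (z ^ J / (1 - z))"
      using z y q by (simp add: g_def)
    also have "\<dots> \<le> 1 * (q ^ J / (1 - q))"
      using z y q by (intro mult_mono frac_le power_mono) auto
    also have "\<dots> \<le> \<delta>" using J q by (simp add: field_simps)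
    finally show ?thesis .
  qed
  define l where "l = [:1 - a / C, - 1 / C:]"
  define p where "p = [:ln C:] - (\<Sum>j<J. smult (1 / real (Suc j)) (l ^ Suc j))"
  have "\<bar>ln (a + x) - poly p x\<bar> \<le> \<delta>" if x: "0 \<le> x" "x \<le> R" for x
  proof -
    define y where "y = 1 - (a + x) / C"
    have "a / C \<le> (a + x) / C" "(a + x) / C \<le> 1" using x C by (auto simp: C_def divide_right_mono)
    then have y: "0 \<le> y" "y \<le> q" unfolding y_def qC[symmetric] by linarith+
    have "poly l x = y"
      by (simp add: l_def y_def add_divide_distrib)
    then have "poly p x = ln C - (\<Sum>j<J. y ^ Suc j / real (Suc j))"
      by (simp add: p_def poly_sum del: of_nat_Suc)
    moreover have "ln (a + x) = ln C + ln (1 - y)"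
      using C x a by (simp add: y_def ln_div)
    ultimately have "ln (a + x) - poly p x = - g y" by (simp add: g_def)
    then show ?thesis using g[OF y] by simp
  qed
  then show ?thesis using that by blast
qed

lemma tendsto_det:
  fixes g :: "'b \<Rightarrow> nat \<times> nat \<Rightarrow> real"
  assumes "\<And>i j. i < N \<Longrightarrow> j < N \<Longrightarrow> ((\<lambda>b. g b (i, j)) \<longlongrightarrow> g0 (i, j)) F"
  shows "((\<lambda>b. det (mat N N (g b))) \<longlongrightarrow> det (mat N N g0)) F"
proof -
  have pl: "p i < N" if "p permutes {0..<N}" "i < N" for p i
    using permutes_in_image[OF that(1), of i] that by auto
  have "((\<lambda>b. \<Sum>p\<in>{p. p permutes {0..<N}}. signof p * (\<Prod>i=0..<N. g b (i, p i))) \<longlongrightarrow>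
      (\<Sum>p\<in>{p. p permutes {0..<N}}. signof p * (\<Prod>i=0..<N. g0 (i, p i)))) F"
    by (intro tendsto_intros assms) (auto simp: pl)
  moreover have "det (mat N N h) = (\<Sum>p\<in>{p. p permutes {0..<N}}. signof p * (\<Prod>i=0..<N. h (i, p i)))"
    for h :: "nat \<times> nat \<Rightarrow> real"
    by (auto simp: det_def pl intro!: sum.cong prod.cong)
  ultimately show ?thesis by simp
qed

lemma det_diag:
  "det (mat N N (\<lambda>(i, j). if i = j then d i else 0)) = (\<Prod>i<N. d i :: 'a::comm_ring_1)"
proof -
  have "det (mat N N (\<lambda>(i, j). if i = j then d i else 0)) = prod_list (diag_mat (mat N N (\<lambda>(i, j). if i = j then d i else 0)))"
    by (intro det_upper_triangular[of _ N]) auto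
  also have "diag_mat (mat N N (\<lambda>(i, j). if i = j then d i else 0)) = map d [0..<N]"
    by (auto simp: diag_mat_def)
  also have "prod_list \<dots> = (\<Prod>i<N. d i)"
    by (induction N) (auto simp: lessThan_Suc mult.commute)
  finally show ?thesis .
qed

lemma prod_list_zeros:
  fixes hs :: "real list"
  shows "(\<Prod>h\<leftarrow>hs. b + h) = b ^ length (filter (\<lambda>h. h = 0) hs) * (\<Prod>h\<leftarrow>filter (\<lambda>h. h \<noteq> 0) hs. b + h)"
  by (induction hs) auto

lemma prod_list_upper:
  fixes hs :: "real list"
  assumes "\<And>h. h \<in> set hs \<Longrightarrow> 0 \<le> h \<and> h \<le> R" "0 < a"
  shows "0 \<le> (\<Prod>h\<leftarrow>hs. a + h) \<and> (\<Prod>h\<leftarrow>hs. a + h) \<le> (a + R) ^ length hs"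
  using assms
proof (induction hs)
  case (Cons h hs)
  have h: "0 \<le> h" "h \<le> R" using Cons.prems(1)[of h] by auto
  have IH: "0 \<le> (\<Prod>h\<leftarrow>hs. a + h)" "(\<Prod>h\<leftarrow>hs. a + h) \<le> (a + R) ^ length hs"
    using Cons by auto
  have "(a + h) * (\<Prod>h\<leftarrow>hs. a + h) \<le> (a + R) * (a + R) ^ length hs"
    using h IH assms(2) by (intro mult_mono) auto
  with h IH assms(2) show ?case by simp
qed simp

text \<open>In the coordinates given by \<open>P\<close> the rows vanish at the positions in
  \<open>Z\<close>, so at least \<open>card Z\<close> eigenvalues are zero. Each of these
  contributes a factor \<open>a\<close>, every other eigenvalue at most
  \<open>a + R\<close>.\<close>

lemma det_gram_nullity:
  fixes f c :: "'l \<Rightarrow> nat \<Rightarrow> real"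
  assumes R: "\<And>i. i < N \<Longrightarrow> (\<Sum>j<N. \<bar>gram 0 N I f $$ (i, j)\<bar>) \<le> R" "0 \<le> R"
    and P: "P \<in> carrier_mat N N" "det P \<noteq> 0"
    and f: "\<And>l j. l \<in> I \<Longrightarrow> j < N \<Longrightarrow> f l j = (\<Sum>i<N. c l i * P $$ (i, j))"
    and c: "\<And>l i. l \<in> I \<Longrightarrow> i \<in> Z \<Longrightarrow> c l i = 0" and Z: "Z \<subseteq> {..<N}" and a: "0 < a"
  shows "det (gram a N I f) \<le> a ^ card Z * (a + R) ^ (N - card Z)"
proof -
  obtain hs where hs: "length hs = N" "\<And>h. h \<in> set hs \<Longrightarrow> 0 \<le> h \<and> h \<le> R"
    "\<And>a. det (gram a N I f) = (\<Prod>h\<leftarrow>hs. a + h)"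
    by (rule gram_spectrum[OF R(1)]) blast+
  define G where "G = mat N N (\<lambda>(i, j). \<Sum>l\<in>I. c l i * c l j)"
  define M where "M = P * transpose_mat P * G"
  have G: "G \<in> carrier_mat N N" and M: "M \<in> carrier_mat N N" using P by (auto simp: G_def M_def)
  have finZ: "finite Z" using Z finite_subset by blast
  have MZ: "M $$ (i, j) = 0" if "i < N" "j \<in> Z" for i j
  proof -
    have "M $$ (i, j) = (\<Sum>l<N. (P * transpose_mat P) $$ (i, l) * G $$ (l, j))"
      unfolding M_def using that P G Z by (intro mat_mult_index[of _ N N _ N]) auto
    also have "\<dots> = 0" using that Z c by (intro sum.neutral) (auto simp: G_def)
    finally show ?thesis .
  qed
  have H: "gram 0 N I f = transpose_mat P * G * P"
  proof (rule eq_matI)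
    fix i j assume "i < dim_row (transpose_mat P * G * P)" "j < dim_col (transpose_mat P * G * P)"
    then have ij: "i < N" "j < N" using P by auto
    have "(transpose_mat P * G * P) $$ (i, j) = (\<Sum>k<N. (transpose_mat P * G) $$ (i, k) * P $$ (k, j))"
      using ij P G by (intro mat_mult_index[of _ N N _ N]) auto
    also have "\<dots> = (\<Sum>k<N. (\<Sum>m<N. transpose_mat P $$ (i, m) * G $$ (m, k)) * P $$ (k, j))"
      using ij P G by (intro sum.cong refl arg_cong2[where f = times] mat_mult_index[of _ N N _ N]) auto
    also have "\<dots> = (\<Sum>k<N. \<Sum>m<N. \<Sum>l\<in>I. (c l m * P $$ (m, i)) * (c l k * P $$ (k, j)))"
      using ij P by (intro sum.cong refl)
        (simp add: G_def sum_distrib_left sum_distrib_right mult_ac)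
    also have "\<dots> = (\<Sum>l\<in>I. \<Sum>m<N. \<Sum>k<N. (c l m * P $$ (m, i)) * (c l k * P $$ (k, j)))"
      by (subst sum.swap) (simp only: sum.swap[of _ I "{..<N}"])
    also have "\<dots> = (\<Sum>l\<in>I. f l i * f l j)"
      using ij by (intro sum.cong refl) (simp add: f sum_product)
    finally show "gram 0 N I f $$ (i, j) = (transpose_mat P * G * P) $$ (i, j)"
      using ij by (simp add: gram_def)
  qed (use P in auto)
  have det_b: "det (gram b N I f) = det (b \<cdot>\<^sub>m 1\<^sub>m N + M)" for b
  proof -
    have "gram b N I f = b \<cdot>\<^sub>m 1\<^sub>m N + gram 0 N I f" by (rule eq_matI) (auto simp: gram_def)
    then have "P * gram b N I f = P * (b \<cdot>\<^sub>m 1\<^sub>m N) + P * gram 0 N I f"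
      using mult_add_distrib_mat[OF P(1), of "b \<cdot>\<^sub>m 1\<^sub>m N" N "gram 0 N I f"] by simp
    also have "P * gram 0 N I f = M * P"
      unfolding H M_def using P G by (simp add: assoc_mult_mat[of _ N N _ N _ N])
    also have "P * (b \<cdot>\<^sub>m 1\<^sub>m N) = (b \<cdot>\<^sub>m 1\<^sub>m N) * P"
      using P mult_smult_distrib[OF P(1) one_carrier_mat[of N], of b]
        mult_smult_assoc_mat[OF one_carrier_mat[of N] P(1), of b] by simp
    also have "\<dots> + M * P = (b \<cdot>\<^sub>m 1\<^sub>m N + M) * P"
      using P M by (simp add: add_mult_distrib_mat[of _ N N])
    finally have "det (P * gram b N I f) = det ((b \<cdot>\<^sub>m 1\<^sub>m N + M) * P)" by simp
    then show ?thesis using P M by (simp add: det_mult[of _ N])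
  qed
  \<comment> \<open>This is \<open>b + M\<close> with the factor \<open>b\<close> taken out of the
    columns in \<open>Z\<close>, where \<open>M\<close> vanishes.\<close>
  define g where "g b = (\<lambda>(i, j). if j \<in> Z then (if i = j then 1 else 0) else (if i = j then b else 0) + M $$ (i, j))" for b :: real
  have fac: "det (gram b N I f) = b ^ card Z * det (mat N N (g b))" for b
  proof -
    let ?D = "mat N N (\<lambda>(i, j). if i = j then (if i \<in> Z then b else 1) else 0)"
    have "b \<cdot>\<^sub>m 1\<^sub>m N + M = mat N N (g b) * ?D"
    proof (rule eq_matI)
      fix i j assume "i < dim_row (mat N N (g b) * ?D)" "j < dim_col (mat N N (g b) * ?D)"
      then have ij: "i < N" "j < N" by auto
      have "(mat N N (g b) * ?D) $$ (i, j) = (\<Sum>k<N. mat N N (g b) $$ (i, k) * ?D $$ (k, j))"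
        using ij by (intro mat_mult_index[of _ N N _ N]) auto
      also have "\<dots> = (\<Sum>k<N. if k = j then g b (i, j) * (if j \<in> Z then b else 1) else 0)"
        using ij by (intro sum.cong refl) auto
      also have "\<dots> = (b \<cdot>\<^sub>m 1\<^sub>m N + M) $$ (i, j)"
        using ij M MZ[of i j] by (auto simp: g_def)
      finally show "(b \<cdot>\<^sub>m 1\<^sub>m N + M) $$ (i, j) = (mat N N (g b) * ?D) $$ (i, j)" by simp
    qed (use M in auto)
    then have "det (gram b N I f) = det (mat N N (g b)) * (\<Prod>i<N. if i \<in> Z then b else 1)"
      unfolding det_b by (simp add: det_mult[of _ N] det_diag)
    also have "(\<Prod>i<N. if i \<in> Z then b else 1) = b ^ card Z"
      using Z by (simp add: prod.If_cases Int_absorb1)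
    finally show ?thesis by simp
  qed
  \<comment> \<open>The multiplicity of the eigenvalue zero is compared with \<open>card Z\<close>
    by orders of vanishing at \<open>b = 0\<close>: were it smaller, the product of the nonzero
    eigenvalues would be the limit of an expression tending to zero.\<close>
  define z where "z = length (filter (\<lambda>h. h = 0) hs)"
  have "card Z \<le> z"
  proof (rule ccontr)
    assume "\<not> card Z \<le> z"
    then have zl: "z < card Z" by simp
    let ?nz = "filter (\<lambda>h. h \<noteq> 0) hs"
    have eq: "(\<Prod>h\<leftarrow>?nz. b + h) = b ^ (card Z - z) * det (mat N N (g b))" if b: "b > 0" for b
    proof -
      have "b ^ z * (\<Prod>h\<leftarrow>?nz. b + h) = b ^ z * (b ^ (card Z - z) * det (mat N N (g b)))"
        using fac[of b] hs(3)[of b] prod_list_zeros[of b hs] zl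
        by (simp add: z_def flip: power_add mult.assoc)
      then show ?thesis using b by simp
    qed
    have l1: "((\<lambda>b. \<Prod>h\<leftarrow>?nz. b + h) \<longlongrightarrow> (\<Prod>h\<leftarrow>?nz. 0 + h)) (at_right 0)"
    proof (induction ?nz arbitrary: hs)
      case Nil
      from Nil[symmetric] show ?case by simp
    next
      case (Cons x xs)
      have "((\<lambda>b. \<Prod>h\<leftarrow>ys. b + h) \<longlongrightarrow> (\<Prod>h\<leftarrow>ys. 0 + h)) (at_right (0::real))" for ys
        by (induction ys) (auto intro!: tendsto_eq_intros)
      then show ?case by blast
    qed
    have "((\<lambda>b. g b (i, j)) \<longlongrightarrow> g 0 (i, j)) (at_right 0)" for i j
      by (cases "i = j") (auto simp: g_def intro!: tendsto_eq_intros)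
    then have "((\<lambda>b. b ^ (card Z - z) * det (mat N N (g b))) \<longlongrightarrow> 0 ^ (card Z - z) * det (mat N N (g 0))) (at_right 0)"
      by (intro tendsto_mult tendsto_det tendsto_power tendsto_ident_at)
    then have "((\<lambda>b. \<Prod>h\<leftarrow>?nz. b + h) \<longlongrightarrow> 0 ^ (card Z - z) * det (mat N N (g 0))) (at_right 0)"
      by (rule Lim_transform_eventually) (auto simp: eventually_at_right_less eq intro!: eventually_mono[OF eventually_at_right_less])
    from tendsto_unique[OF _ l1 this] zl have "(\<Prod>h\<leftarrow>?nz. 0 + h) = 0" by simp
    then show False by (auto simp: prod_list_zero_iff)
  qed
  moreover have "z \<le> N" unfolding z_def using hs(1) length_filter_le by metis
  ultimately have le: "card Z \<le> z" "z \<le> N" .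
  have "det (gram a N I f) = a ^ z * (\<Prod>h\<leftarrow>filter (\<lambda>h. h \<noteq> 0) hs. a + h)"
    unfolding hs(3) z_def by (rule prod_list_zeros)
  also have "\<dots> \<le> a ^ z * (a + R) ^ (N - z)"
  proof (rule mult_left_mono)
    have "length (filter (\<lambda>h. h \<noteq> 0) hs) = N - z"
      using sum_length_filter_compl[of "\<lambda>h. h = 0" hs] hs(1) by (simp add: z_def)
    then show "(\<Prod>h\<leftarrow>filter (\<lambda>h. h \<noteq> 0) hs. a + h) \<le> (a + R) ^ (N - z)"
      using prod_list_upper[of "filter (\<lambda>h. h \<noteq> 0) hs" R a] hs(2) a by auto
  qed (use a in simp)
  also have "\<dots> = a ^ card Z * (a ^ (z - card Z) * (a + R) ^ (N - z))"
    using le by (simp flip: power_add mult.assoc)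
  also have "\<dots> \<le> a ^ card Z * ((a + R) ^ (z - card Z) * (a + R) ^ (N - z))"
    using a R(2) by (intro mult_left_mono mult_right_mono power_mono) auto
  also have "\<dots> = a ^ card Z * (a + R) ^ (N - card Z)"
    using le by (simp flip: power_add)
  finally show ?thesis .
qed

text \<open>Choose a nonsingular selection of maximal total weight. If a row \<open>r\<close>
  involved a lighter selected row with coefficient \<open>c k\<close>, exchanging the two would
  multiply the determinant by \<open>c k\<close>, keep it nonzero and raise the weight.\<close>

lemma exchange_maximal_rows:
  fixes f :: "'l \<Rightarrow> nat \<Rightarrow> real" and w :: "'l \<Rightarrow> nat"
  assumes L: "finite L" and \<sigma>0: "\<sigma>\<^sub>0 ` {..<N} \<subseteq> L" "det (mat N N (\<lambda>(i, j). f (\<sigma>\<^sub>0 i) j)) \<noteq> 0"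
  obtains \<sigma> where "\<sigma> ` {..<N} \<subseteq> L" "det (mat N N (\<lambda>(i, j). f (\<sigma> i) j)) \<noteq> 0"
    "\<And>r. r \<in> L \<Longrightarrow> \<exists>c. (\<forall>j<N. f r j = (\<Sum>i<N. c i * f (\<sigma> i) j)) \<and> (\<forall>i<N. c i \<noteq> 0 \<longrightarrow> w r \<le> w (\<sigma> i))"
proof -
  let ?M = "\<lambda>\<sigma>. mat N N (\<lambda>(i, j). f (\<sigma> i) j)"
  let ?ok = "\<lambda>\<sigma>. \<sigma> ` {..<N} \<subseteq> L \<and> det (?M \<sigma>) \<noteq> 0"
  let ?wt = "\<lambda>\<sigma>. \<Sum>i<N. w (\<sigma> i)"
  have "?wt \<sigma> \<le> N * (\<Sum>l\<in>L. w l)" if "?ok \<sigma>" for \<sigma>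
  proof -
    have "w (\<sigma> i) \<le> (\<Sum>l\<in>L. w l)" if "i < N" for i
      using that \<open>?ok \<sigma>\<close> L by (intro member_le_sum) auto
    then have "?wt \<sigma> \<le> (\<Sum>i<N. (\<Sum>l\<in>L. w l))" by (intro sum_mono) auto
    then show ?thesis by simp
  qed
  then have "\<forall>\<sigma>. ?ok \<sigma> \<longrightarrow> ?wt \<sigma> < Suc (N * (\<Sum>l\<in>L. w l))" by (auto simp: less_Suc_eq_le)
  from ex_has_greatest_nat[of ?ok \<sigma>\<^sub>0, OF _ this] \<sigma>0
  obtain \<sigma> where \<sigma>: "?ok \<sigma>" and max: "\<And>\<tau>. ?ok \<tau> \<Longrightarrow> ?wt \<tau> \<le> ?wt \<sigma>" by blast
  have "\<exists>c. (\<forall>j<N. f r j = (\<Sum>i<N. c i * f (\<sigma> i) j)) \<and> (\<forall>i<N. c i \<noteq> 0 \<longrightarrow> w r \<le> w (\<sigma> i))" if r: "r \<in> L" for r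
  proof -
    have "det (transpose_mat (?M \<sigma>)) \<noteq> 0" using \<sigma> by (simp add: det_transpose[of _ N])
    then obtain c where c: "\<And>j. j < N \<Longrightarrow> (\<Sum>i<N. transpose_mat (?M \<sigma>) $$ (j, i) * c i) = f r j"
      using solve_nonsingular[of "transpose_mat (?M \<sigma>)" N "f r"] by auto
    then have c: "f r j = (\<Sum>i<N. c i * f (\<sigma> i) j)" if "j < N" for j
      using that by (simp add: mult.commute flip: c)
    have "w r \<le> w (\<sigma> k)" if k: "k < N" "c k \<noteq> 0" for k
    proof (rule ccontr)
      assume less: "\<not> w r \<le> w (\<sigma> k)"
      let ?\<tau> = "\<sigma>(k := r)"
      let ?x = "\<lambda>i. if i = k then 1 else 0 :: real"
      \<comment> \<open>Multiplication by \<open>?E\<close> replaces row \<open>k\<close> by the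
        combination with coefficients \<open>c\<close>, that is by the row \<open>r\<close>.\<close>
      let ?E = "1\<^sub>m N + outer N ?x (\<lambda>j. c j - ?x j)"
      have "?M ?\<tau> = ?E * ?M \<sigma>"
      proof (rule eq_matI)
        fix i j assume "i < dim_row (?E * ?M \<sigma>)" "j < dim_col (?E * ?M \<sigma>)"
        then have ij: "i < N" "j < N" by (auto simp: outer_def)
        have "(?E * ?M \<sigma>) $$ (i, j) = (\<Sum>l<N. ?E $$ (i, l) * ?M \<sigma> $$ (l, j))"
          using ij by (intro mat_mult_index[of _ N N _ N]) (auto simp: outer_def)
        also have "\<dots> = (\<Sum>l<N. if i = k then c l * f (\<sigma> l) j else (if l = i then f (\<sigma> i) j else 0))"
          using ij by (intro sum.cong refl) (auto simp: outer_def)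
        also have "\<dots> = ?M ?\<tau> $$ (i, j)" using ij c by auto
        finally show "?M ?\<tau> $$ (i, j) = (?E * ?M \<sigma>) $$ (i, j)" by simp
      qed (auto simp: outer_def)
      then have "det (?M ?\<tau>) = det ?E * det (?M \<sigma>)"
        by (simp add: det_mult[of _ N] outer_def)
      also have "det ?E = c k"
        unfolding det_one_plus_outer using k by (simp add: if_distrib cong: if_cong)
      finally have "?ok ?\<tau>" using k \<sigma> r by auto
      then have "?wt ?\<tau> \<le> ?wt \<sigma>" by (rule max)
      moreover have "?wt \<sigma> < ?wt ?\<tau>"
        using k less by (intro sum_strict_mono_ex1) auto
      ultimately show False by simp
    qed
    with c show ?thesis by blast
  qed
  with \<sigma> that show ?thesis by blast
qed

section \<open>Torsion of cokernels of integer matrices\<close>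

text \<open>The index of the column lattice of \<open>M\<close> is bounded through a Hermite basis.
  The pivot \<open>piv k\<close> is the least positive \<open>k\<close>-th coordinate of a lattice
  vector whose earlier coordinates vanish, and division with remainder moves every vector into a box
  of volume the product of the pivots.\<close>

lemma lattice_representatives:
  fixes M :: "int mat"
  assumes M: "M \<in> carrier_mat N N" and d: "det M \<noteq> 0"
  obtains rep :: "(nat \<Rightarrow> int) \<Rightarrow> nat \<Rightarrow> int" where
    "finite (range rep)" "int (card (range rep)) \<le> \<bar>det M\<bar>"
    "\<And>u u'. rep u = rep u' \<Longrightarrow> \<exists>y. \<forall>i<N. u i - u' i = (\<Sum>j<N. M $$ (i, j) * y j)"
proof -
  define Lat where "Lat v \<longleftrightarrow> (\<exists>y. \<forall>i<N. v i = (\<Sum>j<N. M $$ (i, j) * y j))" for v :: "nat \<Rightarrow> int"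
  have Lat_diff: "Lat (\<lambda>i. u i - c * v i)" if Lu: "Lat u" and Lv: "Lat v" for u v c
  proof -
    obtain y where "\<forall>i<N. u i = (\<Sum>j<N. M $$ (i, j) * y j)"
      using Lu unfolding Lat_def by blast
    moreover obtain z where "\<forall>i<N. v i = (\<Sum>j<N. M $$ (i, j) * z j)"
      using Lv unfolding Lat_def by blast
    ultimately have "\<forall>i<N. u i - c * v i = (\<Sum>j<N. M $$ (i, j) * (y j - c * z j))"
      by (simp add: algebra_simps sum_subtractf sum_distrib_left)
    then show ?thesis unfolding Lat_def by (intro exI)
  qed
  have Lat_sum: "Lat (\<lambda>i. \<Sum>k<m. q k * v k i)" if "\<And>k. k < m \<Longrightarrow> Lat (v k)" for m :: nat and q v
  proof -
    have "Lat (\<lambda>i. - (\<Sum>k<m. q k * v k i))"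
      using that
    proof (induction m)
      case 0
      show ?case unfolding Lat_def by (intro exI[of _ "\<lambda>_. 0"]) simp
    next
      case (Suc m)
      have "(\<lambda>i. - (\<Sum>k<Suc m. q k * v k i)) = (\<lambda>i. - (\<Sum>k<m. q k * v k i) - q m * v m i)"
        by (simp add: fun_eq_iff)
      then show ?case using Suc Lat_diff[of "\<lambda>i. - (\<Sum>k<m. q k * v k i)" "v m" "q m"] by simp
    qed
    moreover have "Lat (\<lambda>_. 0)" unfolding Lat_def by (intro exI[of _ "\<lambda>_. 0"]) simp
    ultimately show ?thesis using Lat_diff[of "\<lambda>_. 0" _ 1] by fastforce
  qed
  let ?P = "\<lambda>k n. 0 < n \<and> (\<exists>h. Lat h \<and> (\<forall>i<k. h i = 0) \<and> h k = int n)"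
  \<comment> \<open>The adjugate shows that \<open>\<bar>det M\<bar>\<close> times any unit vector
    lies in the lattice, so pivots exist.\<close>
  have ex: "?P k (nat \<bar>det M\<bar>)" if k: "k < N" for k
  proof -
    have adj: "adj_mat M \<in> carrier_mat N N" "M * adj_mat M = det M \<cdot>\<^sub>m 1\<^sub>m N" using adj_mat[OF M] by auto
    have "(\<Sum>j<N. M $$ (i, j) * (sgn (det M) * adj_mat M $$ (j, k))) = (if i = k then \<bar>det M\<bar> else 0)" if "i < N" for i
    proof -
      have "(\<Sum>j<N. M $$ (i, j) * (sgn (det M) * adj_mat M $$ (j, k))) = sgn (det M) * (M * adj_mat M) $$ (i, k)"
        unfolding mat_mult_index[OF M adj(1) that k] by (simp add: sum_distrib_left mult_ac)
      then show ?thesis using that k by (simp add: adj(2) abs_sgn mult.commute)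
    qed
    then have "Lat (\<lambda>i. if i = k then \<bar>det M\<bar> else 0)"
      unfolding Lat_def by (intro exI[of _ "\<lambda>j. sgn (det M) * adj_mat M $$ (j, k)"]) auto
    then show ?thesis using d by (auto intro!: exI[of _ "\<lambda>i. if i = k then \<bar>det M\<bar> else 0"])
  qed
  define piv where "piv k = (LEAST n. ?P k n)" for k
  have piv: "?P k (piv k)" if "k < N" for k
    unfolding piv_def by (rule LeastI[of "?P k"], rule ex[OF that])
  have piv_least: "piv k \<le> n" if "?P k n" for k n
    unfolding piv_def by (rule Least_le[of "?P k"], rule that)
  obtain hh where hh: "\<And>k. k < N \<Longrightarrow> Lat (hh k) \<and> (\<forall>i<k. hh k i = 0) \<and> hh k k = int (piv k)"
    using piv by metis
  have division: "\<exists>q r. (\<forall>i. v i - r i = (\<Sum>k<m. q k * hh k i)) \<and> (\<forall>i<m. 0 \<le> r i \<and> r i < int (piv i))"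
    if "m \<le> N" for m v
    using that
  proof (induction m)
    case 0
    show ?case by (intro exI[of _ v] exI) simp
  next
    case (Suc m)
    then obtain q r where qr: "\<forall>i. v i - r i = (\<Sum>k<m. q k * hh k i)" "\<forall>i<m. 0 \<le> r i \<and> r i < int (piv i)" by auto
    define c where "c = r m div int (piv m)"
    define r' where "r' i = r i - c * hh m i" for i
    have m: "m < N" using Suc by simp
    have "\<forall>i. v i - r' i = (\<Sum>k<Suc m. (q(m := c)) k * hh k i)"
      using qr(1) by (simp add: r'_def algebra_simps)
    moreover have "0 \<le> r' i \<and> r' i < int (piv i)" if "i < Suc m" for i
    proof (cases "i = m")
      case True
      have "r' m = r m mod int (piv m)"
        using hh[OF m] by (simp add: r'_def c_def minus_div_mult_eq_mod)
      then show ?thesis using True piv[OF m] by simp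
    next
      case False
      then show ?thesis using that qr(2) hh[OF m] by (simp add: r'_def)
    qed
    ultimately show ?case by blast
  qed
  have "\<forall>v. \<exists>q r. (\<forall>i. v i - r i = (\<Sum>k<N. q k * hh k i)) \<and> (\<forall>i<N. 0 \<le> r i \<and> r i < int (piv i))"
    using division[OF order_refl] by blast
  then obtain quo rm where qr: "\<And>v i. v i - rm v i = (\<Sum>k<N. quo v k * hh k i)"
      "\<And>v i. i < N \<Longrightarrow> 0 \<le> rm v i \<and> rm v i < int (piv i)" by metis
  define rep where "rep v = restrict (rm v) {..<N}" for v
  let ?R = "PiE {..<N} (\<lambda>i. {0..<int (piv i)})"
  have sub: "range rep \<subseteq> ?R" using qr(2) by (auto simp: rep_def)
  have finR: "finite ?R" by (intro finite_PiE) auto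
  have cardR: "card ?R = (\<Prod>i<N. piv i)" by (simp add: card_PiE)
  have "int (\<Prod>i<N. piv i) \<le> \<bar>det M\<bar>"
  proof -
    \<comment> \<open>A first nonzero coordinate of the remainder of a lattice vector would be a
      smaller pivot.\<close>
    have zero: "rm v i = 0" if "Lat v" "i < N" for v i
      using that(2)
    proof (induction i rule: less_induct)
      case (less i)
      have "Lat (\<lambda>i. v i - 1 * (\<Sum>k<N. quo v k * hh k i))"
        using hh by (intro Lat_diff that Lat_sum) auto
      also have "(\<lambda>i. v i - 1 * (\<Sum>k<N. quo v k * hh k i)) = rm v"
        by (simp flip: qr(1))
      finally have L: "Lat (rm v)" .
      show ?case
      proof (rule ccontr)
        assume "rm v i \<noteq> 0"
        then have pos: "0 < rm v i" using qr(2)[OF less.prems, of v] by simp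
        have "?P i (nat (rm v i))"
          using L pos less.IH less.prems by (auto intro!: exI[of _ "rm v"])
        from piv_least[OF this] show False using qr(2)[OF less.prems, of v] pos by linarith
      qed
    qed
    \<comment> \<open>Remainders of lattice vectors vanish, so the columns of \<open>M\<close> are
      integer combinations of the pivot vectors. Thus the triangular determinant of
      \<open>?H\<close> divides \<open>det M\<close>.\<close>
    let ?H = "mat N N (\<lambda>(i, k). hh k i)" and ?Q = "mat N N (\<lambda>(k, j). quo (\<lambda>i. M $$ (i, j)) k)"
    have "M = ?H * ?Q"
    proof (rule eq_matI)
      fix i j assume "i < dim_row (?H * ?Q)" "j < dim_col (?H * ?Q)"
      then have ij: "i < N" "j < N" by auto
      have "Lat (\<lambda>i. M $$ (i, j))"
        unfolding Lat_def using ij by (intro exI[of _ "\<lambda>k. if k = j then 1 else 0"]) (simp add: if_distrib cong: if_cong)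
      then have "M $$ (i, j) = (\<Sum>k<N. quo (\<lambda>i. M $$ (i, j)) k * hh k i)"
        using zero[of "\<lambda>i. M $$ (i, j)" i] qr(1)[of "\<lambda>i. M $$ (i, j)" i] ij by simp
      also have "\<dots> = (\<Sum>k<N. ?H $$ (i, k) * ?Q $$ (k, j))"
        using ij by (intro sum.cong refl) (simp add: mult.commute)
      also have "\<dots> = (?H * ?Q) $$ (i, j)"
        using ij by (intro mat_mult_index[symmetric, of _ N N _ N]) auto
      finally show "M $$ (i, j) = (?H * ?Q) $$ (i, j)" .
    qed (use M in auto)
    then have "det M = det (?H * ?Q)" by (rule arg_cong)
    also have "\<dots> = det ?H * det ?Q" by (rule det_mult[of _ N]) auto
    finally have "det M = det ?H * det ?Q" .
    moreover have "det ?H = int (\<Prod>i<N. piv i)"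
    proof -
      have "det ?H = prod_list (diag_mat ?H)"
        using hh by (intro det_lower_triangular[of N]) auto
      also have "diag_mat ?H = map (\<lambda>i. int (piv i)) [0..<N]"
        using hh by (auto simp: diag_mat_def)
      also have "prod_list \<dots> = int (\<Prod>i<N. piv i)"
        by (induction N) (auto simp: lessThan_Suc mult.commute)
      finally show ?thesis .
    qed
    moreover have "1 \<le> \<bar>det ?Q\<bar>" using d calculation by auto
    ultimately show ?thesis
      using mult_left_mono[of 1 "\<bar>det ?Q\<bar>" "int (\<Prod>i<N. piv i)"] by (simp add: abs_mult del: of_nat_prod)
  qed
  then have "int (card (range rep)) \<le> \<bar>det M\<bar>"
    using card_mono[OF finR sub] unfolding cardR by linarith
  moreover have "\<exists>y. \<forall>i<N. u i - u' i = (\<Sum>j<N. M $$ (i, j) * y j)" if eq: "rep u = rep u'" for u u'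
  proof -
    have "rm u i = rm u' i" if "i < N" for i
      using fun_cong[OF eq, of i] that by (simp add: rep_def)
    then have "u i - u' i = (\<Sum>k<N. quo u k * hh k i) - 1 * (\<Sum>k<N. quo u' k * hh k i)" if "i < N" for i
      using that qr(1)[of u i] qr(1)[of u' i] by simp
    moreover have "Lat (\<lambda>i. (\<Sum>k<N. quo u k * hh k i) - 1 * (\<Sum>k<N. quo u' k * hh k i))"
      using hh by (intro Lat_diff Lat_sum) auto
    ultimately show ?thesis unfolding Lat_def by simp
  qed
  ultimately show ?thesis using that[of rep] finite_subset[OF sub finR] by blast
qed

text \<open>At \<open>a = 0\<close> this is an equality, and adding \<open>a\<close> only enlarges
  the nonnegative eigenvalues.\<close>

lemma det_square_le_gram:
  fixes f :: "nat \<Rightarrow> nat \<Rightarrow> real"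
  assumes "0 < a"
  shows "(det (mat N N (\<lambda>(i, j). f i j)))\<^sup>2 \<le> det (gram a N {..<N} f)"
proof -
  let ?M = "mat N N (\<lambda>(i, j). f i j)"
  define R where "R = (\<Sum>i<N. \<Sum>j<N. \<bar>gram 0 N {..<N} f $$ (i, j)\<bar>)"
  have R: "(\<Sum>j<N. \<bar>gram 0 N {..<N} f $$ (i, j)\<bar>) \<le> R" if "i < N" for i
    unfolding R_def using that
    by (intro member_le_sum[of i "{..<N}" "\<lambda>i. \<Sum>j<N. \<bar>gram 0 N {..<N} f $$ (i, j)\<bar>"]) (auto intro: sum_nonneg)
  obtain hs where hs: "length hs = N" "\<And>h. h \<in> set hs \<Longrightarrow> 0 \<le> h \<and> h \<le> R"
    "\<And>a. det (gram a N {..<N} f) = (\<Prod>h\<leftarrow>hs. a + h)"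
    by (rule gram_spectrum[OF R]) blast+
  have "gram 0 N {..<N} f = transpose_mat ?M * ?M"
  proof (rule eq_matI)
    fix i j assume "i < dim_row (transpose_mat ?M * ?M)" "j < dim_col (transpose_mat ?M * ?M)"
    then have ij: "i < N" "j < N" by auto
    have "(transpose_mat ?M * ?M) $$ (i, j) = (\<Sum>k<N. transpose_mat ?M $$ (i, k) * ?M $$ (k, j))"
      using ij by (intro mat_mult_index[of _ N N _ N]) auto
    then show "gram 0 N {..<N} f $$ (i, j) = (transpose_mat ?M * ?M) $$ (i, j)"
      using ij by (simp add: gram_def)
  qed auto
  then have "(det ?M)\<^sup>2 = det (gram 0 N {..<N} f)"
    by (simp add: det_mult[of _ N] det_transpose[of _ N] power2_eq_square)
  also have "\<dots> \<le> det (gram a N {..<N} f)"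
  proof -
    have "0 \<le> (\<Prod>h\<leftarrow>hs'. 0 + h) \<and> (\<Prod>h\<leftarrow>hs'. 0 + h) \<le> (\<Prod>h\<leftarrow>hs'. a + h)"
      if "set hs' \<subseteq> set hs" for hs'
      using that
    proof (induction hs')
      case (Cons h hs')
      have h: "0 \<le> h" using Cons hs(2)[of h] by auto
      have "h * (\<Prod>h\<leftarrow>hs'. 0 + h) \<le> (a + h) * (\<Prod>h\<leftarrow>hs'. a + h)"
        using Cons h assms by (intro mult_mono) auto
      with Cons h show ?case by simp
    qed simp
    then show ?thesis unfolding hs(3) by blast
  qed
  finally show ?thesis .
qed

text \<open>The torsion of the cokernel of an integer matrix embeds into a lattice quotient given by a
  nonsingular square matrix made of rows of the matrix and unit vectors.  The weights make sure
  that as many rows as possible come from \<open>L\<^sub>1\<close>; \<open>\<nu>\<close> counts the others.\<close>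

theorem torsion_lattice_bound:
  fixes f :: "'l \<Rightarrow> nat \<Rightarrow> int"
  assumes fin: "finite L\<^sub>1" "finite L\<^sub>2" and disj: "L\<^sub>1 \<inter> L\<^sub>2 = {}"
    and C: "1 \<le> C" "\<And>l. l \<in> L\<^sub>1 \<union> L\<^sub>2 \<Longrightarrow> (\<Sum>i<N. (real_of_int (f l i))\<^sup>2) \<le> C"
    and R: "\<And>i. i < N \<Longrightarrow> (\<Sum>j<N. \<bar>gram 0 N L\<^sub>1 (\<lambda>l i. real_of_int (f l i)) $$ (i, j)\<bar>) \<le> R" "0 \<le> R"
  obtains \<nu> and rep :: "('l \<Rightarrow> int) \<Rightarrow> nat \<Rightarrow> int" where
    "\<nu> \<le> N" "finite (range rep)"
    "\<And>a. 0 < a \<Longrightarrow> det (gram a N L\<^sub>1 (\<lambda>l i. real_of_int (f l i))) \<le> a ^ \<nu> * (a + R) ^ (N - \<nu>)"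
    "\<And>a. 0 < a \<Longrightarrow> (real (card (range rep)))\<^sup>2 \<le> det (gram a N L\<^sub>1 (\<lambda>l i. real_of_int (f l i))) * (1 + C / a) ^ \<nu>"
    "\<And>v v' k y. rep v = rep v' \<Longrightarrow> 0 < (k::int) \<Longrightarrow>
       (\<And>l. l \<in> L\<^sub>1 \<union> L\<^sub>2 \<Longrightarrow> k * (v l - v' l) = (\<Sum>j<N. f l j * y j)) \<Longrightarrow>
       \<exists>z. \<forall>l \<in> L\<^sub>1 \<union> L\<^sub>2. v l - v' l = (\<Sum>j<N. f l j * z j)"
proof -
  \<comment> \<open>Unit vectors join the rows of \<open>f\<close>, so that a nonsingular selection
    exists whatever the rank of \<open>f\<close> is.\<close>
  define g :: "'l + nat \<Rightarrow> nat \<Rightarrow> int" where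
    "g r j = (case r of Inl l \<Rightarrow> f l j | Inr i \<Rightarrow> if i = j then 1 else 0)" for r j
  define gr where "gr r j = real_of_int (g r j)" for r j
  \<comment> \<open>With these weights a row from \<open>L\<^sub>1\<close> is a combination of
    selected rows from \<open>L\<^sub>1\<close> alone, and any row of \<open>f\<close> is one of
    selected rows of \<open>f\<close> without unit vectors.\<close>
  define w :: "'l + nat \<Rightarrow> nat" where
    "w r = (case r of Inl l \<Rightarrow> if l \<in> L\<^sub>1 then 2 else 1 | Inr i \<Rightarrow> 0)" for r
  define L where "L = Inl ` (L\<^sub>1 \<union> L\<^sub>2) \<union> Inr ` {..<N}"
  have "mat N N (\<lambda>(i, j). gr (Inr i) j) = 1\<^sub>m N"
    by (rule eq_matI) (auto simp: gr_def g_def)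
  then have d0: "det (mat N N (\<lambda>(i, j). gr (Inr i) j)) \<noteq> 0" by simp
  have "finite L" "Inr ` {..<N} \<subseteq> L" using fin by (auto simp: L_def)
  from exchange_maximal_rows[where f = gr and w = w, OF this d0]
  obtain \<sigma> where \<sigma>: "\<sigma> ` {..<N} \<subseteq> L" "det (mat N N (\<lambda>(i, j). gr (\<sigma> i) j)) \<noteq> 0"
    "\<And>r. r \<in> L \<Longrightarrow> \<exists>c. (\<forall>j<N. gr r j = (\<Sum>i<N. c i * gr (\<sigma> i) j)) \<and> (\<forall>i<N. c i \<noteq> 0 \<longrightarrow> w r \<le> w (\<sigma> i))"
    by blast
  define M where "M = mat N N (\<lambda>(i, j). g (\<sigma> i) j)"
  have M: "M \<in> carrier_mat N N" by (simp add: M_def)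
  have Mr: "map_mat real_of_int M = mat N N (\<lambda>(i, j). gr (\<sigma> i) j)"
    by (rule eq_matI) (auto simp: M_def gr_def)
  have detM: "real_of_int (det M) = det (mat N N (\<lambda>(i, j). gr (\<sigma> i) j))"
    using of_int_hom.hom_det[of M, where ?'a = real] by (simp add: Mr)
  then have "det M \<noteq> 0" using \<sigma>(2) by auto
  then obtain rep0 :: "(nat \<Rightarrow> int) \<Rightarrow> nat \<Rightarrow> int" where rep0: "finite (range rep0)"
    "int (card (range rep0)) \<le> \<bar>det M\<bar>"
    "\<And>u u'. rep0 u = rep0 u' \<Longrightarrow> \<exists>y. \<forall>i<N. u i - u' i = (\<Sum>j<N. M $$ (i, j) * y j)"
    using lattice_representatives[OF M] by blast
  have inj: "inj_on \<sigma> {..<N}"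
  proof (rule inj_onI, rule ccontr)
    fix i i' assume i: "i \<in> {..<N}" "i' \<in> {..<N}" "\<sigma> i = \<sigma> i'" "i \<noteq> i'"
    have "det (mat N N (\<lambda>(i, j). gr (\<sigma> i) j)) = 0"
      by (rule det_identical_rows[of _ N i i']) (use i in \<open>auto simp: row_def\<close>)
    with \<sigma>(2) show False by blast
  qed
  \<comment> \<open>The positions not filled from \<open>L\<^sub>1\<close>; their number is
    \<open>\<nu>\<close>.\<close>
  define Z where "Z = {i \<in> {..<N}. w (\<sigma> i) \<noteq> 2}"
  have Z: "Z \<subseteq> {..<N}" by (auto simp: Z_def)
  \<comment> \<open>Positions filled by a unit vector get the coordinate \<open>0\<close>, so two
    chains are compared only at rows of \<open>f\<close>.\<close>
  define u where "u v i = (case \<sigma> i of Inl l \<Rightarrow> v l | Inr _ \<Rightarrow> 0)" for v :: "'l \<Rightarrow> int" and i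
  define rep where "rep v = rep0 (u v)" for v
  let ?f = "\<lambda>l i. real_of_int (f l i)"
  have "card Z \<le> N" using card_mono[OF _ Z] by simp
  moreover have "range rep \<subseteq> range rep0" by (auto simp: rep_def)
  then have finrep: "finite (range rep)" and cardrep: "card (range rep) \<le> card (range rep0)"
    using rep0(1) by (auto intro: finite_subset card_mono)
  moreover have "det (gram a N L\<^sub>1 ?f) \<le> a ^ card Z * (a + R) ^ (N - card Z)" if a: "0 < a" for a
  proof -
    have "\<exists>c. (\<forall>j<N. ?f l j = (\<Sum>i<N. c i * gr (\<sigma> i) j)) \<and> (\<forall>i\<in>Z. c i = 0)" if "l \<in> L\<^sub>1" for l
    proof -
      have "Inl l \<in> L" using that by (simp add: L_def)
      from \<sigma>(3)[OF this] obtain c where "\<forall>j<N. gr (Inl l) j = (\<Sum>i<N. c i * gr (\<sigma> i) j)" "\<forall>i<N. c i \<noteq> 0 \<longrightarrow> w (Inl l) \<le> w (\<sigma> i)"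
        by blast
      moreover have "w r \<le> 2" for r by (auto simp: w_def split: sum.split)
      ultimately show ?thesis using that
        by (intro exI[of _ c]) (auto simp: gr_def g_def w_def[of "Inl l"] Z_def intro: le_antisym)
    qed
    then obtain c where c: "\<And>l. l \<in> L\<^sub>1 \<Longrightarrow> (\<forall>j<N. ?f l j = (\<Sum>i<N. c l i * gr (\<sigma> i) j)) \<and> (\<forall>i\<in>Z. c l i = 0)" by metis
    show ?thesis
      by (rule det_gram_nullity[where P = "mat N N (\<lambda>(i, j). gr (\<sigma> i) j)" and c = c])
        (use R \<sigma>(2) c Z a in auto)
  qed
  moreover have "(real (card (range rep)))\<^sup>2 \<le> det (gram a N L\<^sub>1 ?f) * (1 + C / a) ^ card Z" if a: "0 < a" for a
  proof -
    have "(real (card (range rep)))\<^sup>2 \<le> (real_of_int \<bar>det M\<bar>)\<^sup>2"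
      using cardrep rep0(2) by (intro power_mono) linarith+
    also have "\<dots> = (det (mat N N (\<lambda>(i, j). gr (\<sigma> i) j)))\<^sup>2" by (simp add: detM)
    also have "\<dots> \<le> det (gram a N {..<N} (\<lambda>i. gr (\<sigma> i)))" by (rule det_square_le_gram[OF a])
    \<comment> \<open>Each discarded row costs a factor \<open>1 + C / a\<close>; for unit vectors
      the norm bound is \<open>1 \<le> C\<close>.\<close>
    also have "\<dots> \<le> det (gram a N ({..<N} - Z) (\<lambda>i. gr (\<sigma> i))) * (1 + C / a) ^ card ({..<N} - ({..<N} - Z))"
    proof (rule det_gram_upper)
      fix i assume "i \<in> {..<N} - ({..<N} - Z)"
      then have "\<sigma> i \<in> L" using \<sigma>(1) by auto
      moreover have "(gr (Inr k) j)\<^sup>2 = (if j = k then 1 else 0)" for k j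
        by (simp add: gr_def g_def)
      ultimately show "(\<Sum>j<N. (gr (\<sigma> i) j)\<^sup>2) \<le> C"
        using C by (auto simp: L_def) (simp_all add: gr_def g_def)
    qed (use a in auto)
    also have "{..<N} - ({..<N} - Z) = Z" using Z by auto
    also have "gram a N ({..<N} - Z) (\<lambda>i. gr (\<sigma> i)) = gram a N (\<sigma> ` ({..<N} - Z)) gr"
      unfolding gram_def using inj
      by (intro cong_mat refl) (auto simp: sum.reindex inj_on_diff comp_def)
    also have "det \<dots> \<le> det (gram a N (Inl ` L\<^sub>1) gr)"
    proof (rule det_gram_mono)
      show "\<sigma> ` ({..<N} - Z) \<subseteq> Inl ` L\<^sub>1"
        using \<sigma>(1) by (auto simp: Z_def w_def L_def image_iff split: sum.splits if_splits)
    qed (use fin a in auto)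
    also have "gram a N (Inl ` L\<^sub>1) gr = gram a N L\<^sub>1 ?f"
      unfolding gram_def by (intro cong_mat refl) (auto simp: sum.reindex comp_def gr_def g_def)
    finally show ?thesis using C a by (simp add: mult_right_mono)
  qed
  moreover have "\<exists>z. \<forall>l \<in> L\<^sub>1 \<union> L\<^sub>2. v l - v' l = (\<Sum>j<N. f l j * z j)"
    if eq: "rep v = rep v'" and k: "0 < k"
      and tor: "\<And>l. l \<in> L\<^sub>1 \<union> L\<^sub>2 \<Longrightarrow> k * (v l - v' l) = (\<Sum>j<N. f l j * y j)" for v v' k y
  proof -
    obtain z where z: "\<And>i. i < N \<Longrightarrow> u v i - u v' i = (\<Sum>j<N. M $$ (i, j) * z j)"
      using rep0(3)[of "u v" "u v'"] eq by (auto simp: rep_def)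
    \<comment> \<open>At the selected rows of \<open>f\<close> the torsion relation and the lattice
      relation agree, so these rows annihilate \<open>t\<close>. All rows of \<open>f\<close> are
      combinations of them, hence annihilate \<open>t\<close> too, and \<open>k\<close> can be
      cancelled.\<close>
    define t where "t j = y j - k * z j" for j
    have van: "(\<Sum>j<N. gr (\<sigma> i) j * real_of_int (t j)) = 0" if i: "i < N" and wi: "w (\<sigma> i) \<ge> 1" for i
    proof -
      obtain l where l: "\<sigma> i = Inl l" "l \<in> L\<^sub>1 \<union> L\<^sub>2"
        using wi \<sigma>(1) i by (auto simp: w_def L_def split: sum.splits)
      have "k * (v l - v' l) = k * (\<Sum>j<N. f l j * z j)"
        using z[OF i] i l by (simp add: u_def M_def g_def)
      then have "(\<Sum>j<N. f l j * t j) = 0"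
        using tor[OF l(2)] by (simp add: t_def algebra_simps sum_subtractf sum_distrib_left)
      moreover have "(\<Sum>j<N. gr (\<sigma> i) j * real_of_int (t j)) = real_of_int (\<Sum>j<N. f l j * t j)"
        using l by (simp add: gr_def g_def)
      ultimately show ?thesis by simp
    qed
    have "v l - v' l = (\<Sum>j<N. f l j * z j)" if l: "l \<in> L\<^sub>1 \<union> L\<^sub>2" for l
    proof -
      have "Inl l \<in> L" using l by (simp add: L_def)
      from \<sigma>(3)[OF this] obtain c where c: "\<forall>j<N. gr (Inl l) j = (\<Sum>i<N. c i * gr (\<sigma> i) j)" "\<forall>i<N. c i \<noteq> 0 \<longrightarrow> w (Inl l) \<le> w (\<sigma> i)"
        by blast
      have "real_of_int (\<Sum>j<N. f l j * t j) = (\<Sum>j<N. gr (Inl l) j * real_of_int (t j))"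
        by (simp add: gr_def g_def)
      also have "\<dots> = (\<Sum>j<N. \<Sum>i<N. c i * (gr (\<sigma> i) j * real_of_int (t j)))"
        using c(1) by (intro sum.cong refl) (simp add: sum_distrib_left mult_ac)
      also have "\<dots> = (\<Sum>i<N. c i * (\<Sum>j<N. gr (\<sigma> i) j * real_of_int (t j)))"
        by (subst sum.swap) (simp add: sum_distrib_left)
      also have "\<dots> = 0"
      proof (intro sum.neutral ballI)
        fix i assume i: "i \<in> {..<N}"
        have "w (Inl l) \<ge> 1" by (simp add: w_def)
        then show "c i * (\<Sum>j<N. gr (\<sigma> i) j * real_of_int (t j)) = 0"
          using van[of i] c(2) i by (cases "c i = 0") (auto intro: le_trans)
      qed
      finally have "(\<Sum>j<N. f l j * t j) = 0" by (simp only: of_int_eq_0_iff)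
      then have "k * (v l - v' l) = k * (\<Sum>j<N. f l j * z j)"
        using tor[OF l] by (simp add: t_def algebra_simps sum_subtractf sum_distrib_left)
      then show ?thesis using k by simp
    qed
    then show ?thesis by blast
  qed
  ultimately show ?thesis using that[of "card Z" rep] by blast
qed

section \<open>Gram determinants near unimodular matrices\<close>

lemma sum_set_nth:
  "distinct xs \<Longrightarrow> (\<Sum>x\<in>set xs. g x) = (\<Sum>i<length xs. g (xs ! i))"
  using sum.reindex_bij_betw[OF bij_betw_nth[of xs "{..<length xs}" "set xs"], of g] by simp

lemma det_in_Ints:
  assumes "\<And>i j. i < N \<Longrightarrow> j < N \<Longrightarrow> g (i, j) \<in> (\<int> :: real set)"
  shows "det (mat N N g) \<in> \<int>"
proof -
  have "mat N N g = map_mat real_of_int (mat N N (\<lambda>ij. \<lfloor>g ij\<rfloor>))"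
    using assms by (intro eq_matI) (auto simp: Ints_def)
  then show ?thesis by (simp add: of_int_hom.hom_det)
qed

lemma sum_squares_le_square_sum:
  fixes g :: "'i \<Rightarrow> real"
  assumes "finite I"
  shows "(\<Sum>i\<in>I. (g i)\<^sup>2) \<le> (\<Sum>i\<in>I. \<bar>g i\<bar>)\<^sup>2"
  using assms
proof (induction I)
  case (insert x I)
  have "0 \<le> (\<Sum>i\<in>I. \<bar>g i\<bar>)" by (rule sum_nonneg) simp
  then have "0 \<le> 2 * \<bar>g x\<bar> * (\<Sum>i\<in>I. \<bar>g i\<bar>)" by simp
  moreover have "(\<bar>g x\<bar> + (\<Sum>i\<in>I. \<bar>g i\<bar>))\<^sup>2 =
      (g x)\<^sup>2 + (\<Sum>i\<in>I. \<bar>g i\<bar>)\<^sup>2 + 2 * \<bar>g x\<bar> * (\<Sum>i\<in>I. \<bar>g i\<bar>)"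
    by (simp add: power2_sum)
  ultimately show ?case unfolding sum.insert[OF insert.hyps] using insert.IH by linarith
qed simp

text \<open>For \<open>U\<close> unimodular with inverse \<open>K\<close>, the determinant of
  \<open>a\<close> plus the Gram matrix of \<open>U\<close> equals that of \<open>1\<close> plus
  \<open>a\<close> times the Gram matrix of \<open>K\<close>, which lies between \<open>1\<close>
  and \<open>(1 + a * q) ^ N\<close>. The matrix \<open>V\<close> has the same rows outside
  \<open>J\<close>, and passing between the two costs a factor \<open>1 + C / a\<close> per row of
  \<open>J\<close>.\<close>

lemma det_gram_near_unimodular:
  fixes V U K :: "'i \<Rightarrow> 'i \<Rightarrow> real"
  assumes xs: "distinct xs" and a: "0 < a"
    and UK: "\<And>r c. r \<in> set xs \<Longrightarrow> c \<in> set xs \<Longrightarrow> (\<Sum>x\<in>set xs. U r x * K x c) = (if r = c then 1 else 0)"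
    and ints: "\<And>r c. U r c \<in> \<int>" "\<And>r c. K r c \<in> \<int>"
    and J: "J \<subseteq> set xs" and XU: "\<And>r c. r \<in> set xs - J \<Longrightarrow> c \<in> set xs \<Longrightarrow> V r c = U r c"
    and CX: "\<And>r. r \<in> set xs \<Longrightarrow> (\<Sum>x\<in>set xs. (V r x)\<^sup>2) \<le> C"
    and CU: "\<And>r. r \<in> set xs \<Longrightarrow> (\<Sum>x\<in>set xs. (U r x)\<^sup>2) \<le> C"
    and q: "\<And>r. r \<in> set xs \<Longrightarrow> (\<Sum>x\<in>set xs. (K r x)\<^sup>2) \<le> q" "0 \<le> q"
  defines "N \<equiv> length xs"
  shows "det (gram a N (set xs) (\<lambda>r i. V r (xs ! i))) \<le> (1 + a * q) ^ N * (1 + C / a) ^ card J"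
    "1 \<le> det (gram a N (set xs) (\<lambda>r i. V r (xs ! i))) * (1 + C / a) ^ card J"
proof -
  let ?I = "set xs"
  \<comment> \<open>The factor \<open>sqrt a\<close> turns \<open>1\<close> plus \<open>a\<close>
    times the Gram matrix of \<open>K\<close> into a regularized Gram matrix with parameter
    \<open>1\<close>.\<close>
  let ?fX = "\<lambda>r i. V r (xs ! i)" and ?fU = "\<lambda>r i. U r (xs ! i)" and ?fK = "\<lambda>r i. sqrt a * K r (xs ! i)"
  define MU where "MU = mat N N (\<lambda>(i, j). U (xs ! i) (xs ! j))"
  define MK where "MK = mat N N (\<lambda>(i, j). K (xs ! i) (xs ! j))"
  have car: "MU \<in> carrier_mat N N" "MK \<in> carrier_mat N N" by (simp_all add: MU_def MK_def)
  have in_I: "xs ! i \<in> ?I" if "i < N" for i using that by (simp add: N_def)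
  have sumI: "(\<Sum>x\<in>?I. g x) = (\<Sum>i<N. g (xs ! i))" for g :: "'i \<Rightarrow> real"
    unfolding N_def by (rule sum_set_nth[OF xs])
  have MUK: "MU * MK = 1\<^sub>m N"
  proof (rule eq_matI)
    fix i j assume "i < dim_row (1\<^sub>m N)" "j < dim_col (1\<^sub>m N)"
    then have ij: "i < N" "j < N" by auto
    have "(MU * MK) $$ (i, j) = (\<Sum>l<N. MU $$ (i, l) * MK $$ (l, j))"
      using ij car by (intro mat_mult_index[of _ N N _ N]) auto
    also have "\<dots> = (\<Sum>x\<in>?I. U (xs ! i) x * K x (xs ! j))"
      unfolding sumI using ij by (intro sum.cong refl) (simp add: MU_def MK_def)
    also have "\<dots> = (1\<^sub>m N :: real mat) $$ (i, j)"
      using UK[OF in_I[OF ij(1)] in_I[OF ij(2)]] ij xs by (simp add: nth_eq_iff_index_eq N_def)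
    finally show "(MU * MK) $$ (i, j) = (1\<^sub>m N :: real mat) $$ (i, j)" .
  qed (use car in auto)
  then have MKU: "MK * MU = 1\<^sub>m N" using mat_mult_left_right_inverse[OF car] by simp
  \<comment> \<open>Two integers with product one are both \<open>1\<close> or both
    \<open>-1\<close>.\<close>
  have detsq: "(det MU)\<^sup>2 = 1"
  proof -
    have 1: "det MU * det MK = 1" using arg_cong[OF MUK, of det] car by (simp add: det_mult[of _ N])
    moreover have "det MU \<in> \<int>" "det MK \<in> \<int>"
      unfolding MU_def MK_def by (rule det_in_Ints, simp add: ints)+
    then obtain m n where "det MU = of_int m" "det MK = of_int n" by (auto elim!: Ints_cases)
    moreover from this 1 have "m * n = 1" by (simp flip: of_int_mult)
    then have "m\<^sup>2 = 1" using zmult_eq_1_iff[of m n] by auto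
    ultimately show ?thesis by (simp flip: of_int_power)
  qed
  have gU: "gram a N ?I ?fU = transpose_mat MU * gram 1 N ?I ?fK * MU"
  proof -
    have sq: "sqrt a * (sqrt a * z) = a * z" for z using a by (simp flip: mult.assoc)
    have 1: "gram 1 N ?I ?fK = 1\<^sub>m N + a \<cdot>\<^sub>m (transpose_mat MK * MK)"
    proof (rule eq_matI)
      fix i j assume "i < dim_row (1\<^sub>m N + a \<cdot>\<^sub>m (transpose_mat MK * MK))" "j < dim_col (1\<^sub>m N + a \<cdot>\<^sub>m (transpose_mat MK * MK))"
      then have ij: "i < N" "j < N" using car by auto
      have "(transpose_mat MK * MK) $$ (i, j) = (\<Sum>l<N. transpose_mat MK $$ (i, l) * MK $$ (l, j))"
        using ij car by (intro mat_mult_index[of _ N N _ N]) auto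
      then show "gram 1 N ?I ?fK $$ (i, j) = (1\<^sub>m N + a \<cdot>\<^sub>m (transpose_mat MK * MK)) $$ (i, j)"
        using ij by (simp add: gram_def sumI MK_def sum_distrib_left mult_ac sq)
    qed (use car in auto)
    have 2: "gram a N ?I ?fU = transpose_mat MU * MU + a \<cdot>\<^sub>m 1\<^sub>m N"
    proof (rule eq_matI)
      fix i j assume "i < dim_row (transpose_mat MU * MU + a \<cdot>\<^sub>m 1\<^sub>m N)" "j < dim_col (transpose_mat MU * MU + a \<cdot>\<^sub>m 1\<^sub>m N)"
      then have ij: "i < N" "j < N" using car by auto
      have "(transpose_mat MU * MU) $$ (i, j) = (\<Sum>l<N. transpose_mat MU $$ (i, l) * MU $$ (l, j))"
        using ij car by (intro mat_mult_index[of _ N N _ N]) auto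
      then show "gram a N ?I ?fU $$ (i, j) = (transpose_mat MU * MU + a \<cdot>\<^sub>m 1\<^sub>m N) $$ (i, j)"
        using ij by (simp add: gram_def sumI MU_def)
    qed (use car in auto)
    have t: "transpose_mat MU * transpose_mat MK = 1\<^sub>m N"
      using transpose_mult[OF car(2,1)] MKU by simp
    have c: "transpose_mat MU \<in> carrier_mat N N" "transpose_mat MK \<in> carrier_mat N N" using car by auto
    have "transpose_mat MU * gram 1 N ?I ?fK = transpose_mat MU + a \<cdot>\<^sub>m (transpose_mat MU * (transpose_mat MK * MK))"
      unfolding 1 using mult_add_distrib_mat[OF c(1) one_carrier_mat[of N] smult_carrier_mat[OF mult_carrier_mat[OF c(2) car(2)]], of a]
        mult_smult_distrib[OF c(1) mult_carrier_mat[OF c(2) car(2)], of a] c(1) by simp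
    also have "transpose_mat MU * (transpose_mat MK * MK) = MK"
      using assoc_mult_mat[OF c(1) c(2) car(2)] t car by simp
    finally have "transpose_mat MU * gram 1 N ?I ?fK * MU = transpose_mat MU * MU + a \<cdot>\<^sub>m (MK * MU)"
      using add_mult_distrib_mat[OF c(1) smult_carrier_mat[OF car(2)] car(1), of a]
        mult_smult_assoc_mat[OF car(2,1), of a] by simp
    with 2 MKU show ?thesis by simp
  qed
  have detU: "det (gram a N ?I ?fU) = det (gram 1 N ?I ?fK)"
    unfolding gU using car detsq
    by (simp add: det_mult[of _ N] det_transpose[of _ N] power2_eq_square)
  have K1: "1 \<le> det (gram 1 N ?I ?fK)"
    using det_gram_mono[of ?I "{}" 1 N ?fK] by (simp add: det_gram_empty)
  have K2: "det (gram 1 N ?I ?fK) \<le> (1 + a * q) ^ N"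
  proof -
    have "det (gram 1 N ?I ?fK) \<le> det (gram 1 N {} ?fK) * (1 + a * q / 1) ^ card (?I - {})"
    proof (rule det_gram_upper)
      fix r assume "r \<in> ?I - {}"
      then have "a * (\<Sum>x\<in>?I. (K r x)\<^sup>2) \<le> a * q" using q a by (intro mult_left_mono) auto
      then show "(\<Sum>i<N. (?fK r i)\<^sup>2) \<le> a * q"
        using a by (simp add: sumI[of "\<lambda>x. (K r x)\<^sup>2"] power_mult_distrib sum_distrib_left)
    qed auto
    then show ?thesis using xs by (simp add: det_gram_empty N_def distinct_card)
  qed
  have finJ: "finite J" using J finite_subset by auto
  have C0: "0 \<le> C" if ne: "J \<noteq> {}"
  proof -
    obtain r where "r \<in> ?I" using ne J by auto
    moreover have "0 \<le> (\<Sum>x\<in>?I. (V r x)\<^sup>2)" by (simp add: sum_nonneg)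
    ultimately show ?thesis using CX[of r] by linarith
  qed
  have pw: "0 \<le> (1 + C / a) ^ card J" using C0 a by (cases "J = {}") auto
  \<comment> \<open>The rows outside \<open>J\<close> are common to both matrices; each of the two
    determinants is compared with theirs.\<close>
  have com: "gram a N (?I - J) ?fX = gram a N (?I - J) ?fU"
    unfolding gram_def using XU in_I by (intro cong_mat refl) auto
  have CX': "(\<Sum>i<N. (?fX r i)\<^sup>2) \<le> C" and CU': "(\<Sum>i<N. (?fU r i)\<^sup>2) \<le> C" if "r \<in> ?I" for r
    using CX[OF that] CU[OF that] sumI[of "\<lambda>x. (V r x)\<^sup>2"] sumI[of "\<lambda>x. (U r x)\<^sup>2"] by simp_all
  have dJ: "?I - (?I - J) = J" using J by auto
  have "det (gram a N ?I ?fX) \<le> det (gram a N (?I - J) ?fX) * (1 + C / a) ^ card (?I - (?I - J))"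
    using CX' J a by (intro det_gram_upper) auto
  also have "\<dots> \<le> det (gram a N ?I ?fU) * (1 + C / a) ^ card J"
    unfolding com dJ using a pw by (intro mult_right_mono det_gram_mono) auto
  also have "\<dots> \<le> (1 + a * q) ^ N * (1 + C / a) ^ card J"
    unfolding detU by (intro mult_right_mono K2 pw)
  finally show "det (gram a N ?I ?fX) \<le> (1 + a * q) ^ N * (1 + C / a) ^ card J" .
  have "1 \<le> det (gram a N ?I ?fU)" using K1 detU by simp
  also have "\<dots> \<le> det (gram a N (?I - J) ?fU) * (1 + C / a) ^ card (?I - (?I - J))"
    using CU' J a by (intro det_gram_upper) auto
  also have "\<dots> \<le> det (gram a N ?I ?fX) * (1 + C / a) ^ card J"
    unfolding com[symmetric] dJ using a pw by (intro mult_right_mono det_gram_mono) auto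
  finally show "1 \<le> det (gram a N ?I ?fX) * (1 + C / a) ^ card J" .
qed

text \<open>Summing \<open>p\<close> over the eigenvalues gives the traces of powers, and each of
  the \<open>N\<close> eigenvalues contributes an error of at most \<open>\<delta>\<close>.\<close>

lemma ln_det_gram_polynomial:
  assumes R: "\<And>i. i < N \<Longrightarrow> (\<Sum>j<N. \<bar>gram 0 N I f $$ (i, j)\<bar>) \<le> R" and a: "0 < a"
    and p: "\<And>x. 0 \<le> x \<Longrightarrow> x \<le> R \<Longrightarrow> \<bar>ln (a + x) - poly p x\<bar> \<le> \<delta>"
  shows "\<bar>ln (det (gram a N I f)) - (\<Sum>i\<le>degree p. coeff p i * tr (gram 0 N I f ^\<^sub>m i))\<bar> \<le> \<delta> * real N"
proof -
  have "\<exists>hs. length hs = N \<and> (\<forall>h\<in>set hs. 0 \<le> h \<and> h \<le> R) \<and>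
      (\<forall>a. det (gram a N I f) = (\<Prod>h\<leftarrow>hs. a + h)) \<and>
      (\<forall>k. tr (gram 0 N I f ^\<^sub>m k) = (\<Sum>h\<leftarrow>hs. h ^ k))"
    (is "\<exists>hs. ?Q hs")
  proof (rule gram_spectrum[OF R])
    show "\<And>i. i < N \<Longrightarrow> i < N" by assumption
    fix hs assume 1: "length hs = N" "\<And>h. h \<in> set hs \<Longrightarrow> 0 \<le> h \<and> h \<le> R"
      "\<And>a. det (gram a N I f) = (\<Prod>h\<leftarrow>hs. a + h)"
      "\<And>k. tr (gram 0 N I f ^\<^sub>m k) = (\<Sum>h\<leftarrow>hs. h ^ k)"
    show "\<exists>hs. ?Q hs"
      by (rule exI[of _ hs], rule conjI[OF 1(1)], rule conjI, rule ballI, erule 1(2), rule conjI,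
          rule allI, rule 1(3), rule allI, rule 1(4))
  qed
  then obtain hs where Q: "?Q hs" ..
  have hs1: "length hs = N" by (rule Q[THEN conjunct1])
  have hs2: "0 \<le> h \<and> h \<le> R" if "h \<in> set hs" for h
    by (rule Q[THEN conjunct2, THEN conjunct1, THEN bspec, OF that])
  have hs3: "det (gram a N I f) = (\<Prod>h\<leftarrow>hs. a + h)"
    by (rule Q[THEN conjunct2, THEN conjunct2, THEN conjunct1, THEN spec])
  have hs4: "tr (gram 0 N I f ^\<^sub>m k) = (\<Sum>h\<leftarrow>hs. h ^ k)" for k
    by (rule Q[THEN conjunct2, THEN conjunct2, THEN conjunct2, THEN spec])
  have "(\<Sum>i\<le>degree p. coeff p i * tr (gram 0 N I f ^\<^sub>m i)) = (\<Sum>h\<leftarrow>hs. poly p h)"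
  proof -
    have "(\<Sum>i\<le>d. c i * (\<Sum>h\<leftarrow>hs. h ^ i)) = (\<Sum>h\<leftarrow>hs. \<Sum>i\<le>d. c i * h ^ i)" for c :: "nat \<Rightarrow> real" and d
      by (induction hs) (simp_all add: sum.distrib distrib_left)
    then show ?thesis by (simp only: hs4 poly_altdef)
  qed
  moreover have "0 < (\<Prod>h\<leftarrow>hs. a + h) \<and> \<bar>ln (\<Prod>h\<leftarrow>hs. a + h) - (\<Sum>h\<leftarrow>hs. poly p h)\<bar> \<le> \<delta> * real (length hs)"
    using hs2
  proof (induction hs)
    case (Cons h hs)
    have h: "0 \<le> h" "h \<le> R" using Cons.prems[of h] by auto
    have IH: "0 < (\<Prod>h\<leftarrow>hs. a + h)" "\<bar>ln (\<Prod>h\<leftarrow>hs. a + h) - (\<Sum>h\<leftarrow>hs. poly p h)\<bar> \<le> \<delta> * real (length hs)"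
      using Cons by auto
    have "ln ((a + h) * (\<Prod>h\<leftarrow>hs. a + h)) = ln (a + h) + ln (\<Prod>h\<leftarrow>hs. a + h)"
      using h a IH by (intro ln_mult_pos) auto
    then have "\<bar>ln ((a + h) * (\<Prod>h\<leftarrow>hs. a + h)) - (poly p h + (\<Sum>h\<leftarrow>hs. poly p h))\<bar> \<le> \<delta> + \<delta> * real (length hs)"
      using p[OF h] IH(2) by linarith
    moreover have "0 < (a + h) * (\<Prod>h\<leftarrow>hs. a + h)" using h a IH by simp
    moreover have "\<delta> * real (length (h # hs)) = \<delta> + \<delta> * real (length hs)" by (simp add: algebra_simps)
    ultimately show ?case by (simp only: list.map prod_list.Cons sum_list.Cons)
  qed simp
  ultimately show ?thesis using hs1 hs3 by simp
qed

section \<open>Path sums for free-by-cyclic groups\<close>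

locale free_by_cyclic = free_group F S for F (structure) and S :: "'a set" +
  fixes \<phi> :: "'a \<Rightarrow> 'a"
  assumes phi: "\<phi> \<in> carrier (AutoGroup F)" and finite_S: "finite S"
begin

definition autpow :: "int \<Rightarrow> 'a \<Rightarrow> 'a" where
  "autpow k = \<phi> [^]\<^bsub>AutoGroup F\<^esub> k"

lemma autpow_carrier: "autpow k \<in> carrier (AutoGroup F)"
  unfolding autpow_def using group.int_pow_closed[OF AutoGroup phi] .

lemma AutoGroup_mult_apply:
  assumes "f \<in> carrier (AutoGroup F)" "g \<in> carrier (AutoGroup F)" "x \<in> carrier F"
  shows "(f \<otimes>\<^bsub>AutoGroup F\<^esub> g) x = f (g x)"
  using assms AutoGroup_mult[of f g] by (simp add: AutoGroup_def auto_def)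

lemma autpow_add: "x \<in> carrier F \<Longrightarrow> autpow (i + j) x = autpow i (autpow j x)"
  using AutoGroup_mult_apply[OF autpow_carrier autpow_carrier, of x i j]
    group.int_pow_mult[OF AutoGroup phi, of i j] by (simp add: autpow_def)

lemma autpow_0 [simp]: "x \<in> carrier F \<Longrightarrow> autpow 0 x = x"
  by (simp add: autpow_def int_pow_def nat_pow_def) (simp add: AutoGroup_def BijGroup_def)

lemma autpow_1: "autpow 1 = \<phi>"
  using group.int_pow_1[OF AutoGroup phi] by (simp add: autpow_def)

lemma autpow_hom: "autpow k \<in> hom F F"
  using auto_props(1)[OF autpow_carrier] .

lemma autpow_closed [simp]: "x \<in> carrier F \<Longrightarrow> autpow k x \<in> carrier F"
  using autpow_hom[of k] by (auto simp: hom_def)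

lemma autpow_mult [simp]: "x \<in> carrier F \<Longrightarrow> y \<in> carrier F \<Longrightarrow> autpow k (x \<otimes> y) = autpow k x \<otimes> autpow k y"
  using autpow_hom[of k] by (auto simp: hom_def)

lemma autpow_one [simp]: "autpow k \<one> = \<one>"
  using hom_one[OF autpow_hom is_group is_group] .

definition G :: "('a \<times> int) monoid" where "G = semidirect_Z F \<phi>"

lemma carrier_G: "carrier G = carrier F \<times> UNIV"
  by (simp add: G_def semidirect_Z_def semidirect_product_def integer_group_def)

lemma mult_G: "x \<otimes>\<^bsub>G\<^esub> y = (fst x \<otimes> autpow (snd x) (fst y), snd x + snd y)"
  by (cases x; cases y) (simp add: G_def semidirect_Z_def semidirect_product_def integer_group_def autpow_def)

lemma one_G: "\<one>\<^bsub>G\<^esub> = (\<one>, 0)"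
  by (simp add: G_def semidirect_Z_def semidirect_product_def integer_group_def)

lemma group_G: "group G"
proof (rule groupI)
  fix x y z assume "x \<in> carrier G" "y \<in> carrier G" "z \<in> carrier G"
  then show "x \<otimes>\<^bsub>G\<^esub> y \<otimes>\<^bsub>G\<^esub> z = x \<otimes>\<^bsub>G\<^esub> (y \<otimes>\<^bsub>G\<^esub> z)"
    by (auto simp: carrier_G mult_G m_assoc autpow_add)
next
  fix x assume x: "x \<in> carrier G"
  have "autpow (- snd x) (fst x) \<in> carrier F" using x by (auto simp: carrier_G)
  then show "\<exists>y\<in>carrier G. y \<otimes>\<^bsub>G\<^esub> x = \<one>\<^bsub>G\<^esub>"
    by (intro bexI[of _ "(inv (autpow (- snd x) (fst x)), - snd x)"]) (use x in \<open>auto simp: carrier_G mult_G one_G\<close>)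
qed (auto simp: carrier_G mult_G one_G)

sublocale GG: group G by (rule group_G)

definition emb :: "'a \<Rightarrow> 'a \<times> int" where "emb a = (a, 0)"
definition tpow :: "int \<Rightarrow> 'a \<times> int" where "tpow k = (\<one>, k)"

lemma emb_closed [simp]: "a \<in> carrier F \<Longrightarrow> emb a \<in> carrier G"
  by (simp add: emb_def carrier_G)

lemma tpow_closed [simp]: "tpow k \<in> carrier G"
  by (simp add: tpow_def carrier_G)

lemma emb_mult: "a \<in> carrier F \<Longrightarrow> b \<in> carrier F \<Longrightarrow> emb a \<otimes>\<^bsub>G\<^esub> emb b = emb (a \<otimes> b)"
  by (simp add: emb_def mult_G)

lemma emb_one: "emb \<one> = \<one>\<^bsub>G\<^esub>" and tpow_0: "tpow 0 = \<one>\<^bsub>G\<^esub>"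
  by (simp_all add: emb_def tpow_def one_G)

lemma tpow_add: "tpow (i + j) = tpow i \<otimes>\<^bsub>G\<^esub> tpow j"
  by (simp add: tpow_def mult_G)

lemma tpow_emb: "a \<in> carrier F \<Longrightarrow> tpow k \<otimes>\<^bsub>G\<^esub> emb a = emb (autpow k a) \<otimes>\<^bsub>G\<^esub> tpow k"
  by (simp add: tpow_def emb_def mult_G)

lemma G_decompose: "a \<in> carrier F \<Longrightarrow> (a, k) = emb a \<otimes>\<^bsub>G\<^esub> tpow k"
  by (simp add: tpow_def emb_def mult_G)

text \<open>Instances are the left multiplication of \<open>G\<close> on itself, the cosets of a
  subgroup, and cosets together with a level in a cyclic group.\<close>

definition action :: "('a \<times> int \<Rightarrow> 'o \<Rightarrow> 'o) \<Rightarrow> 'o set \<Rightarrow> bool" where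
  "action act \<Omega> \<longleftrightarrow> (\<forall>v\<in>\<Omega>. act \<one>\<^bsub>G\<^esub> v = v) \<and> (\<forall>g\<in>carrier G. \<forall>v\<in>\<Omega>. act g v \<in> \<Omega>) \<and>
     (\<forall>g\<in>carrier G. \<forall>h\<in>carrier G. \<forall>v\<in>\<Omega>. act g (act h v) = act (g \<otimes>\<^bsub>G\<^esub> h) v)"

lemma actionD:
  assumes "action act \<Omega>"
  shows "v \<in> \<Omega> \<Longrightarrow> act \<one>\<^bsub>G\<^esub> v = v"
    "g \<in> carrier G \<Longrightarrow> v \<in> \<Omega> \<Longrightarrow> act g v \<in> \<Omega>"
    "g \<in> carrier G \<Longrightarrow> h \<in> carrier G \<Longrightarrow> v \<in> \<Omega> \<Longrightarrow> act g (act h v) = act (g \<otimes>\<^bsub>G\<^esub> h) v"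
  using assms unfolding action_def by auto

text \<open>\<open>e v s\<close> is the weight of the edge from \<open>v\<close> to \<open>s \<cdot> v\<close>.  Words act from the left, so
  the path of a word is read from right to left.\<close>

primrec word_path :: "('a \<times> int \<Rightarrow> 'o \<Rightarrow> 'o) \<Rightarrow> ('o \<Rightarrow> 'a \<Rightarrow> 'c::ab_group_add) \<Rightarrow> ('a \<times> bool) list \<Rightarrow> 'o \<Rightarrow> 'c" where
  "word_path act e [] v = 0"
| "word_path act e (l # w) v = word_path act e w v +
     (if snd l then e (act (emb (ev w)) v) (fst l)
      else - e (act (emb (inv (fst l) \<otimes> ev w)) v) (fst l))"

text \<open>The total weight along the path of \<open>a\<close> from \<open>v\<close> in the
  Schreier graph. With indicator weights these are the Fox derivatives of \<open>a\<close>.\<close>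

definition path :: "('a \<times> int \<Rightarrow> 'o \<Rightarrow> 'o) \<Rightarrow> ('o \<Rightarrow> 'a \<Rightarrow> 'c::ab_group_add) \<Rightarrow> 'a \<Rightarrow> 'o \<Rightarrow> 'c" where
  "path act e a v = word_path act e (nf a) v"

context
  fixes act :: "'a \<times> int \<Rightarrow> 'o \<Rightarrow> 'o" and \<Omega> :: "'o set"
  assumes act: "action act \<Omega>"
begin

lemma act_emb_emb: "a \<in> carrier F \<Longrightarrow> b \<in> carrier F \<Longrightarrow> v \<in> \<Omega> \<Longrightarrow> act (emb a) (act (emb b) v) = act (emb (a \<otimes> b)) v"
  using actionD(3)[OF act, of "emb a" "emb b" v] by (simp add: emb_mult)

lemma act_emb_one: "v \<in> \<Omega> \<Longrightarrow> act (emb \<one>) v = v"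
  using actionD(1)[OF act] by (simp add: emb_one)

lemma word_path_append:
  assumes "set u \<subseteq> S \<times> UNIV" "set w \<subseteq> S \<times> UNIV" "v \<in> \<Omega>"
  shows "word_path act e (u @ w) v = word_path act e w v + word_path act e u (act (emb (ev w)) v)"
  using assms(1)
proof (induction u)
  case (Cons l u)
  obtain s b where l: "l = (s, b)" "s \<in> S" using Cons by (cases l) auto
  have c: "ev u \<in> carrier F" "ev w \<in> carrier F" using Cons assms by auto
  show ?case using Cons l c assms(2,3)
    by (simp add: ev_append act_emb_emb m_assoc)
qed simp

lemma word_path_cancel:
  assumes "set c \<subseteq> S \<times> UNIV" "v \<in> \<Omega>"
  shows "word_path act e (c @ word_inv c) v = 0"
  using assms
proof (induction c arbitrary: v)
  case (Cons l c)
  obtain s b where l: "l = (s, b)" "s \<in> S" using Cons by (cases l) auto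
  have c: "set c \<subseteq> S \<times> UNIV" "set (word_inv c) \<subseteq> S \<times> UNIV" and fl: "set [flip_letter l] \<subseteq> S \<times> UNIV"
    using Cons l by auto
  have ev1: "ev (c @ word_inv c) = \<one>"
    using c by (simp add: ev_append ev_word_inv)
  let ?w = "c @ word_inv c"
  have w: "set ?w \<subseteq> S \<times> UNIV" using c by simp
  let ?u = "act (emb (ev [flip_letter l])) v"
  have u: "?u \<in> \<Omega>" using fl Cons.prems by (intro actionD(2)[OF act] emb_closed ev_closed)
  have "word_path act e ((l # c) @ word_inv (l # c)) v = word_path act e ([l] @ (?w @ [flip_letter l])) v"
    by simp
  also have "\<dots> = word_path act e (?w @ [flip_letter l]) v + word_path act e [l] (act (emb (ev (?w @ [flip_letter l]))) v)"
    using w fl l Cons.prems by (intro word_path_append) auto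
  also have "word_path act e (?w @ [flip_letter l]) v = word_path act e [flip_letter l] v + word_path act e ?w ?u"
    using w fl Cons.prems by (intro word_path_append) auto
  also have "word_path act e ?w ?u = 0" by (rule Cons.IH[OF c(1) u])
  also have "ev (?w @ [flip_letter l]) = ev [flip_letter l]"
    unfolding ev_append[OF w fl] ev1 using fl by (intro l_one ev_closed)
  finally show ?case
    using l Cons.prems by (auto simp: act_emb_one act_emb_emb letter_val_def)
qed simp

text \<open>The product rule of Fox calculus. The part \<open>c\<close> that cancels in the product
  is walked forth and back and contributes zero.\<close>

lemma path_mult:
  assumes "a \<in> carrier F" "b \<in> carrier F" "v \<in> \<Omega>"
  shows "path act e (a \<otimes> b) v = path act e b v + path act e a (act (emb b) v)"
proof -
  obtain u c w where 1: "nf a = u @ c" "nf b = word_inv c @ w" "nf (a \<otimes> b) = u @ w"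
    by (rule nf_mult_cancel[OF assms(1,2)]) blast
  have sub: "set u \<subseteq> S \<times> UNIV" "set c \<subseteq> S \<times> UNIV" "set w \<subseteq> S \<times> UNIV"
    using 1 nf_subset[OF assms(1)] nf_subset[OF assms(2)] by auto
  let ?v = "act (emb (ev w)) v"
  have v: "?v \<in> \<Omega>" using sub assms by (intro actionD(2)[OF act]) auto
  have ev1: "ev (c @ word_inv c) = \<one>"
    using sub by (simp add: ev_append ev_word_inv)
  have "path act e b v + path act e a (act (emb b) v) = word_path act e (nf b) v + word_path act e (nf a) (act (emb (ev (nf b))) v)"
    using assms by (simp add: path_def)
  also have "\<dots> = word_path act e (nf a @ nf b) v"
    using assms by (simp add: word_path_append)
  also have "nf a @ nf b = u @ ((c @ word_inv c) @ w)" by (simp add: 1)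
  also have "word_path act e \<dots> v = word_path act e ((c @ word_inv c) @ w) v + word_path act e u (act (emb (ev ((c @ word_inv c) @ w))) v)"
    using sub assms by (intro word_path_append) auto
  also have "word_path act e ((c @ word_inv c) @ w) v = word_path act e w v + word_path act e (c @ word_inv c) ?v"
    using sub assms by (intro word_path_append) auto
  also have "word_path act e (c @ word_inv c) ?v = 0" by (rule word_path_cancel[OF sub(2) v])
  also have "ev ((c @ word_inv c) @ w) = ev w"
    using sub ev1 ev_append[of "c @ word_inv c" w] by simp
  also have "word_path act e w v + 0 + word_path act e u ?v = word_path act e (u @ w) v"
    using sub assms by (simp add: word_path_append)
  finally show ?thesis by (simp add: path_def 1)
qed

lemma path_basis: "s \<in> S \<Longrightarrow> v \<in> \<Omega> \<Longrightarrow> path act e s v = e v s"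
  by (simp add: path_def nf_basis act_emb_one)

text \<open>A crossed homomorphism is determined by its values on the basis. The transport rules
  below follow by checking that the other side is one.\<close>

lemma path_unique:
  assumes mult: "\<And>a b v. a \<in> carrier F \<Longrightarrow> b \<in> carrier F \<Longrightarrow> v \<in> \<Omega> \<Longrightarrow> \<Psi> (a \<otimes> b) v = \<Psi> b v + \<Psi> a (act (emb b) v)"
    and basis: "\<And>s v. s \<in> S \<Longrightarrow> v \<in> \<Omega> \<Longrightarrow> \<Psi> s v = e v s"
    and a: "a \<in> carrier F" "v \<in> \<Omega>"
  shows "\<Psi> a v = path act e a v"
proof -
  have one: "\<Psi> \<one> v = 0" if "v \<in> \<Omega>" for v
    using mult[of \<one> \<one> v] that by (simp add: act_emb_one)
  have inv: "\<Psi> (inv s) v = - e (act (emb (inv s)) v) s" if "s \<in> S" "v \<in> \<Omega>" for s v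
  proof -
    have "act (emb (inv s)) v \<in> \<Omega>" using that by (intro actionD(2)[OF act]) auto
    then show ?thesis
      using mult[of s "inv s" v] basis[of s "act (emb (inv s)) v"] one that by (simp add: eq_neg_iff_add_eq_0)
  qed
  have "\<Psi> (ev w) v = word_path act e w v" if "set w \<subseteq> S \<times> UNIV" for w
    using that
  proof (induction w)
    case (Cons l w)
    obtain s b where l: "l = (s, b)" "s \<in> S" using Cons by (cases l) auto
    have w: "ev w \<in> carrier F" and u: "act (emb (ev w)) v \<in> \<Omega>"
      using Cons a by (auto intro!: actionD(2)[OF act])
    then show ?case
      using Cons l a mult[of "letter_val l" "ev w" v] basis[OF l(2) u] inv[OF l(2) u]
      by (auto simp: letter_val_def act_emb_emb)
  qed (use one a in simp)
  from this[OF nf_subset[OF a(1)]] a show ?thesis by (simp add: path_def)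
qed

lemma path_cong:
  assumes "\<And>s v. s \<in> S \<Longrightarrow> v \<in> \<Omega> \<Longrightarrow> e v s = e' v s" "a \<in> carrier F" "v \<in> \<Omega>"
  shows "path act e a v = path act e' a v"
  by (rule path_unique) (use assms in \<open>auto simp: path_mult path_basis\<close>)

lemma path_additive:
  assumes h: "\<And>x y. h (x + y) = h x + h y" and a: "a \<in> carrier F" "v \<in> \<Omega>"
  shows "h (path act e a v) = path act (\<lambda>v s. h (e v s)) a v"
  by (rule path_unique[where \<Psi> = "\<lambda>a v. h (path act e a v)"]) (use a h in \<open>auto simp: path_mult path_basis\<close>)

text \<open>The chain rule of Fox calculus for a power of \<open>\<phi>\<close>; the factor
  \<open>tpow k\<close> moves the base point along.\<close>

lemma path_twist:
  assumes a: "a \<in> carrier F" "v \<in> \<Omega>"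
  shows "path act (\<lambda>v s. path act e (autpow k s) (act (tpow k) v)) a v = path act e (autpow k a) (act (tpow k) v)"
proof (rule path_unique[symmetric, where \<Psi> = "\<lambda>a v. path act e (autpow k a) (act (tpow k) v)"])
  fix a b v assume ab: "a \<in> carrier F" "b \<in> carrier F" "v \<in> \<Omega>"
  have t: "act (tpow k) v \<in> \<Omega>" using ab by (intro actionD(2)[OF act]) auto
  have "act (emb (autpow k b)) (act (tpow k) v) = act (tpow k) (act (emb b) v)"
    using actionD(3)[OF act] ab by (simp add: tpow_emb)
  then show "path act e (autpow k (a \<otimes> b)) (act (tpow k) v) =
      path act e (autpow k b) (act (tpow k) v) + path act e (autpow k a) (act (tpow k) (act (emb b) v))"
    using ab t by (simp add: path_mult)
qed (use a in auto)

lemma path_telescope: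
  assumes e: "\<And>s v. s \<in> S \<Longrightarrow> v \<in> \<Omega> \<Longrightarrow> e v s = p (act (emb s) v) - p v" and a: "a \<in> carrier F" "v \<in> \<Omega>"
  shows "path act e a v = p (act (emb a) v) - p v"
  by (rule path_unique[symmetric, where \<Psi> = "\<lambda>a v. p (act (emb a) v) - p v"])
    (use a e in \<open>auto simp: act_emb_emb\<close>)

end

lemma path_equivariant:
  assumes act: "action act \<Omega>" and act': "action act' \<Omega>'"
    and p: "\<And>v. v \<in> \<Omega> \<Longrightarrow> p v \<in> \<Omega>'" "\<And>g v. g \<in> carrier G \<Longrightarrow> v \<in> \<Omega> \<Longrightarrow> p (act g v) = act' g (p v)"
    and a: "a \<in> carrier F" "v \<in> \<Omega>"
  shows "path act (\<lambda>v s. e (p v) s) a v = path act' e a (p v)"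
  by (rule path_unique[OF act, symmetric, where \<Psi> = "\<lambda>a v. path act' e a (p v)"])
    (use a p in \<open>auto simp: path_mult[OF act'] path_basis[OF act']\<close>)

lemma path_sum:
  fixes e :: "'i \<Rightarrow> 'o \<Rightarrow> 'a \<Rightarrow> 'c::comm_ring"
  assumes "action act \<Omega>" "a \<in> carrier F" "v \<in> \<Omega>"
  shows "path act (\<lambda>v s. \<Sum>i\<in>I. k i * e i v s) a v = (\<Sum>i\<in>I. k i * path act (e i) a v)"
  by (rule path_unique[OF assms(1), symmetric, where \<Psi> = "\<lambda>a v. \<Sum>i\<in>I. k i * path act (e i) a v"])
    (use assms in \<open>auto simp: path_mult path_basis sum.distrib distrib_left\<close>)

end

section \<open>Matrices over the group ring and their traces\<close>

definition enum :: "'i set \<Rightarrow> 'i list" where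
  "enum I = (SOME xs. distinct xs \<and> set xs = I)"

lemma enum: "finite I \<Longrightarrow> distinct (enum I)" "finite I \<Longrightarrow> set (enum I) = I"
  using someI_ex[of "\<lambda>xs. distinct xs \<and> set xs = I"] finite_distinct_list[of I]
  unfolding enum_def by blast+

lemma length_enum: "finite I \<Longrightarrow> length (enum I) = card I"
  using enum distinct_card by metis

lemma sum_enum: "finite I \<Longrightarrow> (\<Sum>i<card I. g (enum I ! i)) = (\<Sum>x\<in>I. g x)"
  using sum_set_nth[OF enum(1), of I g] by (simp add: enum(2) length_enum)

lemma sum_list_swap: "(\<Sum>x\<in>A. \<Sum>i\<leftarrow>ys. g x i) = (\<Sum>i\<leftarrow>ys. \<Sum>x\<in>A. (g x i :: real))"
  by (induction ys) (simp_all add: sum.distrib)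

context free_by_cyclic
begin

text \<open>An item \<open>(c, p, g, q)\<close> stands for \<open>c\<close> times the operator sending the edge \<open>(v, q)\<close> to
  \<open>(g \<cdot> v, p)\<close>; lists of items are matrices over the real group ring, independent of the
  space on which the group acts.\<close>

definition symmat :: "('a \<times> int \<Rightarrow> 'o \<Rightarrow> 'o) \<Rightarrow> (real \<times> 'a \<times> ('a \<times> int) \<times> 'a) list \<Rightarrow> 'o \<times> 'a \<Rightarrow> 'o \<times> 'a \<Rightarrow> real" where
  "symmat act y r x = (\<Sum>(c, p, g, q)\<leftarrow>y. if snd r = p \<and> snd x = q \<and> act g (fst x) = fst r then c else 0)"

definition sym_valid :: "(real \<times> 'a \<times> ('a \<times> int) \<times> 'a) list \<Rightarrow> bool" where
  "sym_valid y \<longleftrightarrow> (\<forall>(c, p, g, q) \<in> set y. p \<in> S \<and> q \<in> S \<and> g \<in> carrier G)"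

definition sym_norm :: "(real \<times> 'a \<times> ('a \<times> int) \<times> 'a) list \<Rightarrow> real" where
  "sym_norm y = (\<Sum>(c, p, g, q)\<leftarrow>y. \<bar>c\<bar>)"

definition sym_mult :: "(real \<times> 'a \<times> ('a \<times> int) \<times> 'a) list \<Rightarrow> (real \<times> 'a \<times> ('a \<times> int) \<times> 'a) list \<Rightarrow> (real \<times> 'a \<times> ('a \<times> int) \<times> 'a) list" where
  "sym_mult y z = concat (map (\<lambda>(c, p, g, q). concat (map (\<lambda>(d, q', h, u).
     if q = q' then [(c * d, p, g \<otimes>\<^bsub>G\<^esub> h, u)] else []) z)) y)"

definition sym_adjoint :: "(real \<times> 'a \<times> ('a \<times> int) \<times> 'a) list \<Rightarrow> (real \<times> 'a \<times> ('a \<times> int) \<times> 'a) list" where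
  "sym_adjoint y = map (\<lambda>(c, p, g, q). (c, q, inv\<^bsub>G\<^esub> g, p)) y"

definition sym_id :: "(real \<times> 'a \<times> ('a \<times> int) \<times> 'a) list" where
  "sym_id = map (\<lambda>s. (1, s, \<one>\<^bsub>G\<^esub>, s)) (enum S)"

primrec sym_pow :: "(real \<times> 'a \<times> ('a \<times> int) \<times> 'a) list \<Rightarrow> nat \<Rightarrow> (real \<times> 'a \<times> ('a \<times> int) \<times> 'a) list" where
  "sym_pow y 0 = sym_id"
| "sym_pow y (Suc k) = sym_mult (sym_pow y k) y"

text \<open>The von Neumann trace over the group ring: the coefficient of the identity, summed over
  the diagonal.\<close>

definition sym_trace :: "(real \<times> 'a \<times> ('a \<times> int) \<times> 'a) list \<Rightarrow> real" where
  "sym_trace y = (\<Sum>(c, p, g, q)\<leftarrow>y. if p = q \<and> g = \<one>\<^bsub>G\<^esub> then c else 0)"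

definition gram_sym :: "('a \<times> int \<Rightarrow> 'o \<Rightarrow> 'o) \<Rightarrow> 'o set \<Rightarrow> real \<Rightarrow> (real \<times> 'a \<times> ('a \<times> int) \<times> 'a) list \<Rightarrow> real mat" where
  "gram_sym act \<Omega> a y = gram a (card (\<Omega> \<times> S)) (\<Omega> \<times> S) (\<lambda>r i. symmat act y r (enum (\<Omega> \<times> S) ! i))"

lemma symmat_simps [simp]:
  "symmat act [] r x = 0"
  "symmat act ((c, p, g, q) # y) r x = (if snd r = p \<and> snd x = q \<and> act g (fst x) = fst r then c else 0) + symmat act y r x"
  "symmat act (y @ z) r x = symmat act y r x + symmat act z r x"
  by (simp_all add: symmat_def)

lemma sym_valid_simps [simp]:
  "sym_valid []" "sym_valid (y @ z) \<longleftrightarrow> sym_valid y \<and> sym_valid z"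
  "sym_valid ((c, p, g, q) # y) \<longleftrightarrow> p \<in> S \<and> q \<in> S \<and> g \<in> carrier G \<and> sym_valid y"
  by (simp_all add: sym_valid_def ball_Un)

lemma sym_valid_mult: "sym_valid y \<Longrightarrow> sym_valid z \<Longrightarrow> sym_valid (sym_mult y z)"
  by (fastforce simp: sym_valid_def sym_mult_def split: if_splits)

lemma sym_valid_adjoint: "sym_valid y \<Longrightarrow> sym_valid (sym_adjoint y)"
  by (fastforce simp: sym_valid_def sym_adjoint_def)

lemma sym_valid_id: "sym_valid sym_id"
  using enum[OF finite_S] by (auto simp: sym_valid_def sym_id_def)

lemma sym_valid_pow: "sym_valid y \<Longrightarrow> sym_valid (sym_pow y k)"
  by (induction k) (auto intro: sym_valid_mult sym_valid_id)

context
  fixes act :: "'a \<times> int \<Rightarrow> 'o \<Rightarrow> 'o" and \<Omega> :: "'o set"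
  assumes act: "action act \<Omega>" and fin: "finite \<Omega>"
begin

lemma act_inverse: "g \<in> carrier G \<Longrightarrow> v \<in> \<Omega> \<Longrightarrow> act (inv\<^bsub>G\<^esub> g) (act g v) = v"
  using actionD(3)[OF act, of "inv\<^bsub>G\<^esub> g" g v] actionD(1)[OF act] by simp

lemma act_eq_iff: "g \<in> carrier G \<Longrightarrow> v \<in> \<Omega> \<Longrightarrow> w \<in> \<Omega> \<Longrightarrow> act g v = w \<longleftrightarrow> v = act (inv\<^bsub>G\<^esub> g) w"
  using act_inverse[of g v] act_inverse[of "inv\<^bsub>G\<^esub> g" w] by auto

text \<open>An item has at most one nonzero entry in each row. The bound does not depend on the
  space acted upon, which makes the spectral bounds uniform over all covers.\<close>

lemma symmat_row_sum:
  assumes "sym_valid y" "r \<in> \<Omega> \<times> S"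
  shows "(\<Sum>x\<in>\<Omega> \<times> S. \<bar>symmat act y r x\<bar>) \<le> sym_norm y"
  using assms(1)
proof (induction y)
  case Nil
  show ?case by (simp add: sym_norm_def)
next
  case (Cons i y)
  obtain c p g q where i: "i = (c, p, g, q)" by (metis prod_cases4)
  have v: "q \<in> S" "g \<in> carrier G" "sym_valid y" using Cons.prems by (auto simp: i)
  let ?t = "\<lambda>x. if snd r = p \<and> snd x = q \<and> act g (fst x) = fst r then \<bar>c\<bar> else 0"
  have "(\<Sum>x\<in>\<Omega> \<times> S. ?t x) = (\<Sum>x\<in>\<Omega> \<times> S. if x = (act (inv\<^bsub>G\<^esub> g) (fst r), q) then (if snd r = p then \<bar>c\<bar> else 0) else 0)"
    using assms(2) v by (intro sum.cong refl) (auto simp: act_eq_iff)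
  also have "\<dots> \<le> \<bar>c\<bar>" using fin finite_S by (subst sum.delta) auto
  finally have 1: "(\<Sum>x\<in>\<Omega> \<times> S. ?t x) \<le> \<bar>c\<bar>" .
  have "(\<Sum>x\<in>\<Omega> \<times> S. \<bar>symmat act (i # y) r x\<bar>) \<le> (\<Sum>x\<in>\<Omega> \<times> S. ?t x + \<bar>symmat act y r x\<bar>)"
    by (intro sum_mono) (simp add: i abs_triangle_ineq[THEN order_trans])
  also have "\<dots> \<le> \<bar>c\<bar> + sym_norm y"
    using 1 Cons.IH[OF v(3)] by (simp add: sum.distrib)
  finally show ?case by (simp add: i sym_norm_def)
qed

lemma symmat_mult:
  assumes "sym_valid y" "sym_valid z" "u \<in> \<Omega> \<times> S"
  shows "(\<Sum>x\<in>\<Omega> \<times> S. symmat act y r x * symmat act z x u) = symmat act (sym_mult y z) r u"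
  using assms(1)
proof (induction y)
  case Nil
  show ?case by (simp add: sym_mult_def)
next
  case (Cons i y)
  obtain c p g q where i: "i = (c, p, g, q)" by (metis prod_cases4)
  have v: "q \<in> S" "g \<in> carrier G" "sym_valid y" using Cons.prems by (auto simp: i)
  let ?A = "\<lambda>x. if snd r = p \<and> snd x = q \<and> act g (fst x) = fst r then c else 0"
  let ?m = "\<lambda>z. concat (map (\<lambda>(d, q', h, u). if q = q' then [(c * d, p, g \<otimes>\<^bsub>G\<^esub> h, u)] else []) z)"
  have "(\<Sum>x\<in>\<Omega> \<times> S. ?A x * symmat act z x u) = symmat act (?m z) r u"
    using assms(2)
  proof (induction z)
    case (Cons j z)
    obtain d q' h w where j: "j = (d, q', h, w)" by (metis prod_cases4)
    have vj: "q' \<in> S" "h \<in> carrier G" "sym_valid z" using Cons.prems by (auto simp: j)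
    have u: "fst u \<in> \<Omega>" using assms(3) by (simp add: mem_Times_iff)
    have hu: "act h (fst u) \<in> \<Omega>" by (rule actionD(2)[OF act vj(2) u])
    have gh: "act g (act h (fst u)) = act (g \<otimes>\<^bsub>G\<^esub> h) (fst u)" by (rule actionD(3)[OF act v(2) vj(2) u])
    have "(\<Sum>x\<in>\<Omega> \<times> S. ?A x * (if snd x = q' \<and> snd u = w \<and> act h (fst u) = fst x then d else 0)) =
        (\<Sum>x\<in>\<Omega> \<times> S. if x = (act h (fst u), q') then ?A x * (if snd u = w then d else 0) else 0)"
      by (intro sum.cong refl) auto
    also have "\<dots> = ?A (act h (fst u), q') * (if snd u = w then d else 0)"
      using fin finite_S hu vj by (subst sum.delta) auto
    also have "\<dots> = symmat act (?m [j]) r u"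
      using gh by (simp add: j)
    finally have "(\<Sum>x\<in>\<Omega> \<times> S. ?A x * symmat act (j # z) x u) = symmat act (?m [j]) r u + symmat act (?m z) r u"
      using Cons.IH[OF vj(3)] by (simp add: j distrib_left sum.distrib)
    then show ?case by (simp add: j)
  qed simp
  moreover have "sym_mult (i # y) z = ?m z @ sym_mult y z" by (simp add: sym_mult_def i)
  ultimately show ?case using Cons.IH[OF v(3)] by (simp add: i distrib_right sum.distrib)
qed

lemma symmat_adjoint:
  assumes "sym_valid y" "r \<in> \<Omega> \<times> S" "x \<in> \<Omega> \<times> S"
  shows "symmat act (sym_adjoint y) r x = symmat act y x r"
  using assms(1)
proof (induction y)
  case (Cons i y)
  obtain c p g q where i: "i = (c, p, g, q)" by (metis prod_cases4)
  have "g \<in> carrier G" "sym_valid y" using Cons.prems by (auto simp: i)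
  then show ?case
    using Cons.IH assms(2,3) act_eq_iff[of "g" "fst r" "fst x"] by (auto simp: i sym_adjoint_def)
qed (simp add: sym_adjoint_def)

lemma symmat_id:
  assumes "r \<in> \<Omega> \<times> S" "x \<in> \<Omega> \<times> S"
  shows "symmat act sym_id r x = (if r = x then 1 else 0)"
proof -
  have "symmat act sym_id r x = (\<Sum>s\<leftarrow>enum S. if s = snd x then (if r = x then 1 else 0) else 0)"
    unfolding symmat_def sym_id_def map_map comp_def
    by (intro arg_cong[where f = sum_list] map_cong refl) (use assms actionD(1)[OF act] in \<open>auto simp: prod_eq_iff\<close>)
  also have "\<dots> = (\<Sum>s\<in>S. if s = snd x then (if r = x then 1 else 0) else 0)"
    using enum[OF finite_S] by (simp add: sum_list_distinct_conv_sum_set)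
  finally show ?thesis using assms finite_S by auto
qed

lemma gram_symmat:
  assumes "sym_valid y" "i < card (\<Omega> \<times> S)" "j < card (\<Omega> \<times> S)"
  shows "gram_sym act \<Omega> 0 y $$ (i, j) = symmat act (sym_mult (sym_adjoint y) y) (enum (\<Omega> \<times> S) ! i) (enum (\<Omega> \<times> S) ! j)"
proof -
  have f: "finite (\<Omega> \<times> S)" using fin finite_S by simp
  have e: "enum (\<Omega> \<times> S) ! i \<in> \<Omega> \<times> S" "enum (\<Omega> \<times> S) ! j \<in> \<Omega> \<times> S"
    using assms(2,3) enum[OF f] length_enum[OF f] by (metis nth_mem)+
  have "gram_sym act \<Omega> 0 y $$ (i, j) = (\<Sum>r\<in>\<Omega> \<times> S. symmat act (sym_adjoint y) (enum (\<Omega> \<times> S) ! i) r * symmat act y r (enum (\<Omega> \<times> S) ! j))"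
    using assms e by (simp add: gram_sym_def gram_def symmat_adjoint del: mem_Sigma_iff)
  then show ?thesis using symmat_mult[OF sym_valid_adjoint[OF assms(1)] assms(1) e(2)] by simp
qed

lemma gram_symmat_pow:
  assumes "sym_valid y" "i < card (\<Omega> \<times> S)" "j < card (\<Omega> \<times> S)"
  shows "(gram_sym act \<Omega> 0 y ^\<^sub>m k) $$ (i, j) = symmat act (sym_pow (sym_mult (sym_adjoint y) y) k) (enum (\<Omega> \<times> S) ! i) (enum (\<Omega> \<times> S) ! j)"
  using assms(3)
proof (induction k arbitrary: j)
  case 0
  have f: "finite (\<Omega> \<times> S)" using fin finite_S by simp
  then have "enum (\<Omega> \<times> S) ! i \<in> \<Omega> \<times> S" "enum (\<Omega> \<times> S) ! j \<in> \<Omega> \<times> S"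
    "enum (\<Omega> \<times> S) ! i = enum (\<Omega> \<times> S) ! j \<longleftrightarrow> i = j"
    using assms(2) 0 enum[OF f] length_enum[OF f] nth_eq_iff_index_eq nth_mem by metis+
  then show ?case using assms(2) 0 by (simp add: symmat_id gram_sym_def del: mem_Sigma_iff)
next
  case (Suc k)
  let ?I = "\<Omega> \<times> S" let ?xs = "enum ?I" let ?h = "sym_mult (sym_adjoint y) y"
  have f: "finite ?I" using fin finite_S by simp
  have car: "gram_sym act \<Omega> 0 y \<in> carrier_mat (card ?I) (card ?I)" by (simp add: gram_sym_def)
  have e: "?xs ! j \<in> ?I" using Suc.prems enum[OF f] length_enum[OF f] by (metis nth_mem)
  have vh: "sym_valid ?h" using assms(1) by (intro sym_valid_mult sym_valid_adjoint)
  have "(gram_sym act \<Omega> 0 y ^\<^sub>m Suc k) $$ (i, j) = (\<Sum>l<card ?I. (gram_sym act \<Omega> 0 y ^\<^sub>m k) $$ (i, l) * gram_sym act \<Omega> 0 y $$ (l, j))"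
    using car assms(2) Suc.prems mat_mult_index[OF pow_carrier_mat[OF car] car] by simp
  also have "\<dots> = (\<Sum>l<card ?I. symmat act (sym_pow ?h k) (?xs ! i) (?xs ! l) * symmat act ?h (?xs ! l) (?xs ! j))"
    using Suc assms by (intro sum.cong refl) (simp add: gram_symmat)
  also have "\<dots> = (\<Sum>x\<in>?I. symmat act (sym_pow ?h k) (?xs ! i) x * symmat act ?h x (?xs ! j))"
    by (rule sum_enum[OF f])
  also have "\<dots> = symmat act (sym_pow ?h (Suc k)) (?xs ! i) (?xs ! j)"
    using symmat_mult[OF sym_valid_pow[OF vh] vh e] by simp
  finally show ?case .
qed

text \<open>An item meets the diagonal exactly at the fixed points of its group element.\<close>

lemma trace_gram_symmat:
  assumes "sym_valid y"
  shows "tr (gram_sym act \<Omega> 0 y ^\<^sub>m k) =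
    (\<Sum>(c, p, g, q)\<leftarrow>sym_pow (sym_mult (sym_adjoint y) y) k. if p = q then c * real (card {v \<in> \<Omega>. act g v = v}) else 0)"
proof -
  let ?I = "\<Omega> \<times> S" let ?xs = "enum ?I" let ?z = "sym_pow (sym_mult (sym_adjoint y) y) k"
  have f: "finite ?I" using fin finite_S by simp
  have vz: "sym_valid ?z" using assms by (intro sym_valid_pow sym_valid_mult sym_valid_adjoint)
  have d: "dim_row (gram_sym act \<Omega> 0 y ^\<^sub>m k) = card ?I"
    by (simp add: gram_sym_def)
  have "tr (gram_sym act \<Omega> 0 y ^\<^sub>m k) = (\<Sum>i<card ?I. symmat act ?z (?xs ! i) (?xs ! i))"
    unfolding tr_def d by (intro sum.cong refl gram_symmat_pow[OF assms]) auto
  also have "\<dots> = (\<Sum>x\<in>?I. symmat act ?z x x)"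
    by (rule sum_enum[OF f])
  also have "\<dots> = (\<Sum>i\<leftarrow>?z. \<Sum>x\<in>?I. (case i of (c, p, g, q) \<Rightarrow> if snd x = p \<and> snd x = q \<and> act g (fst x) = fst x then c else 0))"
    unfolding symmat_def by (rule sum_list_swap)
  also have "\<dots> = (\<Sum>(c, p, g, q)\<leftarrow>?z. if p = q then c * real (card {v \<in> \<Omega>. act g v = v}) else 0)"
  proof (intro arg_cong[where f = sum_list] map_cong refl)
    fix i assume "i \<in> set ?z"
    obtain c p g q where i: "i = (c, p, g, q)" by (metis prod_cases4)
    have pS: "p \<in> S" using vz \<open>i \<in> set ?z\<close> by (auto simp: sym_valid_def i)
    have "(\<Sum>x\<in>?I. if snd x = p \<and> snd x = q \<and> act g (fst x) = fst x then c else 0) =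
       (\<Sum>x\<in>?I \<inter> {x. snd x = p \<and> snd x = q \<and> act g (fst x) = fst x}. c)"
      using f by (simp add: sum.inter_restrict[symmetric] sum.If_cases)
    also have "?I \<inter> {x. snd x = p \<and> snd x = q \<and> act g (fst x) = fst x} =
       (if p = q then {v \<in> \<Omega>. act g v = v} \<times> {p} else {})"
      using pS by auto
    finally show "(\<Sum>x\<in>?I. (case i of (c, p, g, q) \<Rightarrow> if snd x = p \<and> snd x = q \<and> act g (fst x) = fst x then c else 0)) =
      (case i of (c, p, g, q) \<Rightarrow> if p = q then c * real (card {v \<in> \<Omega>. act g v = v}) else 0)"
      by (simp add: i card_cartesian_product mult.commute)
  qed
  finally show ?thesis .
qed

lemma gram_symmat_row_sum:
  assumes "sym_valid y" "i < card (\<Omega> \<times> S)"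
  shows "(\<Sum>j<card (\<Omega> \<times> S). \<bar>gram_sym act \<Omega> 0 y $$ (i, j)\<bar>) \<le> sym_norm (sym_mult (sym_adjoint y) y)"
proof -
  let ?I = "\<Omega> \<times> S" let ?xs = "enum ?I" let ?h = "sym_mult (sym_adjoint y) y"
  have f: "finite ?I" using fin finite_S by simp
  have e: "?xs ! i \<in> ?I" using assms(2) enum[OF f] length_enum[OF f] by (metis nth_mem)
  have "(\<Sum>j<card ?I. \<bar>gram_sym act \<Omega> 0 y $$ (i, j)\<bar>) = (\<Sum>j<card ?I. \<bar>symmat act ?h (?xs ! i) (?xs ! j)\<bar>)"
    using assms by (intro sum.cong refl) (simp add: gram_symmat)
  also have "\<dots> = (\<Sum>x\<in>?I. \<bar>symmat act ?h (?xs ! i) x\<bar>)"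
    by (rule sum_enum[OF f])
  also have "\<dots> \<le> sym_norm ?h"
    using e assms(1) by (intro symmat_row_sum sym_valid_mult sym_valid_adjoint)
  finally show ?thesis .
qed

end

text \<open>The Farber condition for finite sets with an action, so that it applies to the cosets
  and to their cyclic covers alike.\<close>

definition farber_family :: "('a \<times> int \<Rightarrow> 'o \<Rightarrow> 'o) \<Rightarrow> (nat \<Rightarrow> 'o set) \<Rightarrow> bool" where
  "farber_family act \<Omega> \<longleftrightarrow> (\<forall>n. action act (\<Omega> n) \<and> finite (\<Omega> n) \<and> \<Omega> n \<noteq> {}) \<and>
     (\<forall>g \<in> carrier G - {\<one>\<^bsub>G\<^esub>}. (\<lambda>n. real (card {v \<in> \<Omega> n. act g v = v}) / real (card (\<Omega> n))) \<longlonglongrightarrow> 0)"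

text \<open>By the Farber condition an item with a non-trivial group element has a vanishing share
  of fixed points; only the identity survives in the limit.\<close>

lemma trace_limit:
  assumes ff: "farber_family act \<Omega>" and y: "sym_valid y"
  shows "(\<lambda>n. tr (gram_sym act (\<Omega> n) 0 y ^\<^sub>m k) / real (card (\<Omega> n))) \<longlonglongrightarrow> sym_trace (sym_pow (sym_mult (sym_adjoint y) y) k)"
proof -
  have F: "action act (\<Omega> n)" "finite (\<Omega> n)" "\<Omega> n \<noteq> {}" for n
    using ff by (auto simp: farber_family_def)
  let ?z = "sym_pow (sym_mult (sym_adjoint y) y) k"
  have vz: "sym_valid ?z" using y by (intro sym_valid_pow sym_valid_mult sym_valid_adjoint)
  have lim: "(\<lambda>n. (\<Sum>(c, p, g, q)\<leftarrow>z. if p = q then c * real (card {v \<in> \<Omega> n. act g v = v}) else 0) / real (card (\<Omega> n)))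
      \<longlonglongrightarrow> sym_trace z" if "sym_valid z" for z
    using that
  proof (induction z)
    case Nil
    show ?case by (simp add: sym_trace_def)
  next
    case (Cons i z)
    obtain c p g q where i: "i = (c, p, g, q)" by (metis prod_cases4)
    have v: "g \<in> carrier G" "sym_valid z" using Cons.prems by (auto simp: i)
    have r: "(\<lambda>n. real (card {v \<in> \<Omega> n. act g v = v}) / real (card (\<Omega> n))) \<longlonglongrightarrow> (if g = \<one>\<^bsub>G\<^esub> then 1 else 0)"
    proof (cases "g = \<one>\<^bsub>G\<^esub>")
      case True
      have "{v \<in> \<Omega> n. act g v = v} = \<Omega> n" for n using True actionD(1)[OF F(1)] by auto
      moreover have "real (card (\<Omega> n)) / real (card (\<Omega> n)) = 1" for n using F[of n] by simp
      ultimately show ?thesis using True by (simp only: simp_thms if_True tendsto_const)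
    next
      case False
      then show ?thesis using ff v by (auto simp: farber_family_def)
    qed
    have "(\<lambda>n. (if p = q then c * (real (card {v \<in> \<Omega> n. act g v = v}) / real (card (\<Omega> n))) else 0) +
        (\<Sum>(c, p, g, q)\<leftarrow>z. if p = q then c * real (card {v \<in> \<Omega> n. act g v = v}) else 0) / real (card (\<Omega> n)))
      \<longlonglongrightarrow> (if p = q then c * (if g = \<one>\<^bsub>G\<^esub> then 1 else 0) else 0) + sym_trace z"
      using tendsto_mult_left[OF r, of c] by (intro tendsto_add Cons.IH[OF v(2)]) (cases "p = q", simp_all)
    moreover have "(if p = q then c * (if g = \<one>\<^bsub>G\<^esub> then 1 else 0) else 0) + sym_trace z = sym_trace (i # z)"
      by (simp add: i sym_trace_def)
    ultimately show ?case
      by (simp add: i add_divide_distrib if_distrib[of "\<lambda>x. x / _"] cong: if_cong)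
  qed
  show ?thesis using lim[OF vz] trace_gram_symmat[OF F(1,2) y] by simp
qed

text \<open>The spectra for all \<open>n\<close> lie in one interval, so a single polynomial
  \<open>p\<close> serves them all. In the error, \<open>card S\<close> counts the eigenvalues per
  vertex, and the extra \<open>1\<close> absorbs the convergence of the traces.\<close>

lemma logdet_eventually:
  assumes ff: "farber_family act \<Omega>" and y: "sym_valid y" and a: "0 < a" and \<delta>: "0 < \<delta>"
    and p: "\<And>x. 0 \<le> x \<Longrightarrow> x \<le> sym_norm (sym_mult (sym_adjoint y) y) \<Longrightarrow> \<bar>ln (a + x) - poly p x\<bar> \<le> \<delta>"
  shows "\<forall>\<^sub>F n in sequentially. \<bar>ln (det (gram_sym act (\<Omega> n) a y)) / real (card (\<Omega> n)) -
     (\<Sum>i\<le>degree p. coeff p i * sym_trace (sym_pow (sym_mult (sym_adjoint y) y) i))\<bar> \<le> \<delta> * (real (card S) + 1)"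
proof -
  have F: "action act (\<Omega> n)" "finite (\<Omega> n)" "\<Omega> n \<noteq> {}" for n
    using ff by (auto simp: farber_family_def)
  let ?t = "\<lambda>n i. tr (gram_sym act (\<Omega> n) 0 y ^\<^sub>m i)"
  let ?L = "\<Sum>i\<le>degree p. coeff p i * sym_trace (sym_pow (sym_mult (sym_adjoint y) y) i)"
  have "(\<lambda>n. \<Sum>i\<le>degree p. coeff p i * (?t n i / real (card (\<Omega> n)))) \<longlonglongrightarrow> ?L"
    by (intro tendsto_sum tendsto_mult_left trace_limit[OF ff y])
  then have "\<forall>\<^sub>F n in sequentially. \<bar>(\<Sum>i\<le>degree p. coeff p i * (?t n i / real (card (\<Omega> n)))) - ?L\<bar> < \<delta>"
    using \<delta> by (auto simp: tendsto_iff dist_real_def)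
  then show ?thesis
  proof eventually_elim
    case (elim n)
    have c: "real (card (\<Omega> n)) > 0" using F[of n] by (simp add: card_gt_0_iff)
    have "\<bar>ln (det (gram_sym act (\<Omega> n) a y)) - (\<Sum>i\<le>degree p. coeff p i * ?t n i)\<bar> \<le> \<delta> * real (card (\<Omega> n \<times> S))"
      unfolding gram_sym_def
      by (rule ln_det_gram_polynomial[where R = "sym_norm (sym_mult (sym_adjoint y) y)", OF _ a],
          rule gram_symmat_row_sum[OF F(1,2) y, unfolded gram_sym_def], assumption, rule p)
    then have "\<bar>ln (det (gram_sym act (\<Omega> n) a y)) - (\<Sum>i\<le>degree p. coeff p i * ?t n i)\<bar> / real (card (\<Omega> n)) \<le> \<delta> * real (card S)"
      using c by (simp add: card_cartesian_product field_simps)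
    moreover have "\<bar>ln (det (gram_sym act (\<Omega> n) a y)) - (\<Sum>i\<le>degree p. coeff p i * ?t n i)\<bar> / real (card (\<Omega> n)) =
       \<bar>ln (det (gram_sym act (\<Omega> n) a y)) / real (card (\<Omega> n)) - (\<Sum>i\<le>degree p. coeff p i * (?t n i / real (card (\<Omega> n))))\<bar>"
    proof -
      have "(\<Sum>i\<le>degree p. coeff p i * (?t n i / real (card (\<Omega> n)))) = (\<Sum>i\<le>degree p. coeff p i * ?t n i) / real (card (\<Omega> n))"
        by (simp add: sum_divide_distrib)
      then show ?thesis using c by (simp only: diff_divide_distrib[symmetric] abs_divide abs_of_pos)
    qed
    ultimately show ?case using elim by (simp add: distrib_left)
  qed
qed

text \<open>The limiting polynomial trace depends only on the matrix over the group ring and not on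
  the family. This carries estimates from a cyclic cover back to the original cosets.\<close>

lemma logdet_difference:
  assumes ff: "farber_family act \<Omega>" "farber_family act' \<Omega>'" and y: "sym_valid y" and a: "0 < a" and \<epsilon>: "0 < \<epsilon>"
  shows "\<forall>\<^sub>F n in sequentially. \<bar>ln (det (gram_sym act (\<Omega> n) a y)) / real (card (\<Omega> n)) -
     ln (det (gram_sym act' (\<Omega>' n) a y)) / real (card (\<Omega>' n))\<bar> \<le> \<epsilon>"
proof -
  define \<delta> where "\<delta> = \<epsilon> / (2 * (real (card S) + 1))"
  have \<delta>: "0 < \<delta>" "\<delta> * (real (card S) + 1) = \<epsilon> / 2" using \<epsilon> by (auto simp: \<delta>_def field_simps)
  have n0: "0 \<le> sym_norm z" for z by (induction z) (auto simp: sym_norm_def)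
  obtain p where p: "\<And>x. 0 \<le> x \<Longrightarrow> x \<le> sym_norm (sym_mult (sym_adjoint y) y) \<Longrightarrow> \<bar>ln (a + x) - poly p x\<bar> \<le> \<delta>"
    using ln_polynomial_approximation[OF a n0 \<delta>(1)] by blast
  have "\<forall>\<^sub>F n in sequentially. \<bar>ln (det (gram_sym act (\<Omega> n) a y)) / real (card (\<Omega> n)) -
     (\<Sum>i\<le>degree p. coeff p i * sym_trace (sym_pow (sym_mult (sym_adjoint y) y) i))\<bar> \<le> \<delta> * (real (card S) + 1)"
    by (rule logdet_eventually[OF ff(1) y a \<delta>(1)]) (rule p)
  moreover have "\<forall>\<^sub>F n in sequentially. \<bar>ln (det (gram_sym act' (\<Omega>' n) a y)) / real (card (\<Omega>' n)) -
     (\<Sum>i\<le>degree p. coeff p i * sym_trace (sym_pow (sym_mult (sym_adjoint y) y) i))\<bar> \<le> \<delta> * (real (card S) + 1)"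
    by (rule logdet_eventually[OF ff(2) y a \<delta>(1)]) (rule p)
  ultimately show ?thesis
    by eventually_elim (use \<delta>(2) in linarith)
qed

end

section \<open>The Fox Jacobian and its powers\<close>

context free_by_cyclic
begin

definition delta :: "'o \<times> 'a \<Rightarrow> 'o \<Rightarrow> 'a \<Rightarrow> 'c::comm_ring_1" where
  "delta r v s = (if r = (v, s) then 1 else 0)"

text \<open>The entry of the \<open>j\<close>-th power of \<open>T\<close>: for the edge
  \<open>x = (v, s)\<close> it counts with sign how often the path of
  \<open>\<phi>\<^sup>j(s)\<close> from \<open>t\<^sup>j v\<close> runs through the edge
  \<open>r\<close>.\<close>

definition shift_entry :: "('a \<times> int \<Rightarrow> 'o \<Rightarrow> 'o) \<Rightarrow> nat \<Rightarrow> 'o \<times> 'a \<Rightarrow> 'o \<times> 'a \<Rightarrow> 'c::comm_ring_1" where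
  "shift_entry act j r x = path act (delta r) ((\<phi> ^^ j) (snd x)) (act (tpow (int j)) (fst x))"

text \<open>The Fox derivatives of a word, as a list of signed group elements with the letter they
  belong to.\<close>

primrec word_items :: "('a \<times> bool) list \<Rightarrow> (real \<times> ('a \<times> int) \<times> 'a) list" where
  "word_items [] = []"
| "word_items (l # w) = (if snd l then (1, emb (ev w), fst l) else (- 1, emb (inv (fst l) \<otimes> ev w), fst l)) # word_items w"

text \<open>This is \<open>1 - T\<close> over the group ring; the Laplacian proper is its Gram
  matrix.\<close>

definition laplace_sym :: "(real \<times> 'a \<times> ('a \<times> int) \<times> 'a) list" where
  "laplace_sym = sym_id @ concat (map (\<lambda>q. map (\<lambda>(c, g, p). (- c, p, g \<otimes>\<^bsub>G\<^esub> tpow 1, q)) (word_items (nf (\<phi> q)))) (enum S))"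

definition iter_length :: "nat \<Rightarrow> nat" where
  "iter_length j = (\<Sum>s\<in>S. len ((\<phi> ^^ j) s))"

lemma phi_pow_closed [simp]: "a \<in> carrier F \<Longrightarrow> (\<phi> ^^ j) a \<in> carrier F"
  using funpow_closed[OF auto_props(1)[OF phi]] .

lemma phi_closed [simp]: "a \<in> carrier F \<Longrightarrow> \<phi> a \<in> carrier F"
  using phi_pow_closed[of a 1] by simp

lemma word_items_valid:
  "set w \<subseteq> S \<times> UNIV \<Longrightarrow> (c, g, p) \<in> set (word_items w) \<Longrightarrow> g \<in> carrier G \<and> p \<in> S"
  by (induction w) (auto split: if_splits)

lemma word_path_items:
  "word_path act e w v = (\<Sum>(c, g, s)\<leftarrow>word_items w. c * e (act g v) s)"
  by (induction w) auto

lemma sym_valid_laplace: "sym_valid laplace_sym"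
proof -
  have "p \<in> S \<and> q \<in> S \<and> g \<otimes>\<^bsub>G\<^esub> tpow 1 \<in> carrier G"
    if "q \<in> S" "(c, g, p) \<in> set (word_items (nf (\<phi> q)))" for c g p q
    using word_items_valid[OF nf_subset that(2)] that(1) by auto
  then show ?thesis
    using sym_valid_id enum[OF finite_S] unfolding laplace_sym_def sym_valid_def by fastforce
qed

context
  fixes act :: "'a \<times> int \<Rightarrow> 'o \<Rightarrow> 'o" and \<Omega> :: "'o set"
  assumes act: "action act \<Omega>" and fin: "finite \<Omega>"
begin

lemma symmat_laplace:
  assumes r: "r \<in> \<Omega> \<times> S" and x: "x \<in> \<Omega> \<times> S"
  shows "symmat act laplace_sym r x = (if r = x then 1 else 0) - shift_entry act 1 r x"
proof -
  obtain v q where xq: "x = (v, q)" "v \<in> \<Omega>" "q \<in> S" using x by auto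
  have items: "symmat act (map (\<lambda>(c, g, p). (- c, p, g \<otimes>\<^bsub>G\<^esub> tpow 1, u)) ys) r x =
      (if u = q then - (\<Sum>(c, g, s)\<leftarrow>ys. c * delta r (act g (act (tpow 1) v)) s) else 0)"
    if "\<And>c g p. (c, g, p) \<in> set ys \<Longrightarrow> g \<in> carrier G" for u ys
    using that
  proof (induction ys)
    case (Cons i ys)
    obtain c g p where i: "i = (c, g, p)" by (metis prod_cases3)
    have "g \<in> carrier G" using Cons.prems[of c g p] by (simp add: i)
    then have "act g (act (tpow 1) v) = act (g \<otimes>\<^bsub>G\<^esub> tpow 1) v"
      using actionD(3)[OF act _ tpow_closed xq(2)] by simp
    moreover have "symmat act (map (\<lambda>(c, g, p). (- c, p, g \<otimes>\<^bsub>G\<^esub> tpow 1, u)) ys) r x =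
      (if u = q then - (\<Sum>(c, g, s)\<leftarrow>ys. c * delta r (act g (act (tpow 1) v)) s) else 0)"
      using Cons.prems by (intro Cons.IH) auto
    ultimately show ?case by (auto simp: i xq delta_def prod_eq_iff)
  qed simp
  have conc: "symmat act (concat ls) r x = (\<Sum>l\<leftarrow>ls. symmat act l r x)" for ls
    by (induction ls) auto
  have "(\<Sum>u\<leftarrow>enum S. symmat act (map (\<lambda>(c, g, p). (- c, p, g \<otimes>\<^bsub>G\<^esub> tpow 1, u)) (word_items (nf (\<phi> u)))) r x) =
      (\<Sum>u\<in>S. symmat act (map (\<lambda>(c, g, p). (- c, p, g \<otimes>\<^bsub>G\<^esub> tpow 1, u)) (word_items (nf (\<phi> u)))) r x)"
    using enum[OF finite_S] by (simp add: sum_list_distinct_conv_sum_set)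
  also have "\<dots> = (\<Sum>u\<in>S. if u = q then - path act (delta r) (\<phi> q) (act (tpow 1) v) else 0)"
  proof (intro sum.cong refl)
    fix u assume u: "u \<in> S"
    have *: "g \<in> carrier G" if "(c, g, p) \<in> set (word_items (nf (\<phi> u)))" for c g p
      using word_items_valid[OF nf_subset that] u by simp
    show "symmat act (map (\<lambda>(c, g, p). (- c, p, g \<otimes>\<^bsub>G\<^esub> tpow 1, u)) (word_items (nf (\<phi> u)))) r x =
      (if u = q then - path act (delta r) (\<phi> q) (act (tpow 1) v) else 0)"
      using items[of "word_items (nf (\<phi> u))" u] * by (auto simp: path_def word_path_items)
  qed
  also have "\<dots> = - shift_entry act 1 r x"
    using finite_S xq by (simp add: shift_entry_def)
  finally show ?thesis
    unfolding laplace_sym_def symmat_simps conc map_map comp_def symmat_id[OF act fin r x] by simp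
qed

text \<open>A letter at a fixed position of the word runs through the edge \<open>r\<close> for at
  most one starting vertex \<open>v\<close>.\<close>

lemma word_path_row_sum:
  fixes r :: "'o \<times> 'a"
  assumes "set w \<subseteq> S \<times> UNIV" "h \<in> carrier G" "fst r \<in> \<Omega>"
  shows "(\<Sum>v\<in>\<Omega>. \<bar>word_path act (delta r) w (act h v) :: real\<bar>) \<le> real (length w)"
  using assms(1)
proof (induction w)
  case (Cons l w)
  obtain s b where l: "l = (s, b)" "s \<in> S" using Cons by (cases l) auto
  have one: "(\<Sum>v\<in>\<Omega>. \<bar>delta r (act g (act h v)) s :: real\<bar>) \<le> 1" if g: "g \<in> carrier G" for g s
  proof -
    have "(\<Sum>v\<in>\<Omega>. \<bar>delta r (act g (act h v)) s :: real\<bar>) \<le> (\<Sum>v\<in>\<Omega>. if v = act (inv\<^bsub>G\<^esub> (g \<otimes>\<^bsub>G\<^esub> h)) (fst r) then 1 else 0)"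
    proof (rule sum_mono)
      fix v assume v: "v \<in> \<Omega>"
      have "act g (act h v) = act (g \<otimes>\<^bsub>G\<^esub> h) v" by (rule actionD(3)[OF act g assms(2) v])
      moreover have "act (g \<otimes>\<^bsub>G\<^esub> h) v = fst r \<longleftrightarrow> v = act (inv\<^bsub>G\<^esub> (g \<otimes>\<^bsub>G\<^esub> h)) (fst r)"
        using act_eq_iff[OF act fin _ v assms(3), of "g \<otimes>\<^bsub>G\<^esub> h"] g assms(2) by blast
      ultimately show "\<bar>delta r (act g (act h v)) s :: real\<bar> \<le> (if v = act (inv\<^bsub>G\<^esub> (g \<otimes>\<^bsub>G\<^esub> h)) (fst r) then 1 else 0)"
        by (auto simp: delta_def)
    qed
    also have "\<dots> \<le> 1" using fin by simp
    finally show ?thesis .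
  qed
  let ?g = "if b then emb (ev w) else emb (inv s \<otimes> ev w)"
  have "?g \<in> carrier G" using Cons.prems l by auto
  from one[OF this, of s] have 1: "(\<Sum>v\<in>\<Omega>. \<bar>delta r (act ?g (act h v)) s :: real\<bar>) \<le> 1" .
  have "(\<Sum>v\<in>\<Omega>. \<bar>word_path act (delta r) (l # w) (act h v) :: real\<bar>) \<le>
      (\<Sum>v\<in>\<Omega>. \<bar>word_path act (delta r) w (act h v)\<bar> + \<bar>delta r (act ?g (act h v)) s\<bar>)"
    by (intro sum_mono) (auto simp: l intro: abs_triangle_ineq order_trans[OF abs_triangle_ineq4])
  also have "\<dots> \<le> real (length w) + 1" using Cons 1 by (simp add: sum.distrib)
  finally show ?case by simp
qed simp

lemma shift_row_sum:
  assumes "fst r \<in> \<Omega>"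
  shows "(\<Sum>x\<in>\<Omega> \<times> S. \<bar>shift_entry act j r x :: real\<bar>) \<le> real (iter_length j)"
proof -
  have "(\<Sum>x\<in>\<Omega> \<times> S. \<bar>shift_entry act j r x :: real\<bar>) =
     (\<Sum>s\<in>S. \<Sum>v\<in>\<Omega>. \<bar>word_path act (delta r) (nf ((\<phi> ^^ j) s)) (act (tpow (int j)) v) :: real\<bar>)"
    by (subst sum.swap) (simp add: sum.cartesian_product shift_entry_def path_def case_prod_beta)
  also have "\<dots> \<le> (\<Sum>s\<in>S. real (len ((\<phi> ^^ j) s)))"
    unfolding len_def by (intro sum_mono word_path_row_sum assms) auto
  finally show ?thesis by (simp add: iter_length_def)
qed

lemma shift_Ints: "shift_entry act j r x \<in> (\<int> :: real set)"
proof -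
  have "word_path act (delta r) w v \<in> (\<int> :: real set)" for w v
    by (induction w) (auto simp: delta_def)
  then show ?thesis by (simp add: shift_entry_def path_def)
qed

lemma shift_0:
  assumes "r \<in> \<Omega> \<times> S" "x \<in> \<Omega> \<times> S"
  shows "shift_entry act 0 r x = (if r = x then 1 else 0)"
proof -
  have "act (tpow 0) (fst x) = fst x" using actionD(1)[OF act] assms by (auto simp: tpow_0)
  then show ?thesis using assms by (auto simp: shift_entry_def path_basis[OF act] delta_def split: if_splits)
qed

text \<open>The chain rule says that the Jacobian of \<open>\<phi>\<^sup>j\<^sup>+\<^sup>1\<close>
  is the product of \<open>T\<close> with the Jacobian of \<open>\<phi>\<^sup>j\<close>.\<close>

lemma shift_Suc:
  assumes x: "x \<in> \<Omega> \<times> S"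
  shows "(\<Sum>y\<in>\<Omega> \<times> S. shift_entry act 1 r y * shift_entry act j y x) = (shift_entry act (Suc j) r x :: real)"
proof -
  obtain v q where xq: "x = (v, q)" "v \<in> \<Omega>" "q \<in> S" using x by auto
  let ?a = "(\<phi> ^^ j) q" and ?v = "act (tpow (int j)) v"
  have a: "?a \<in> carrier F" and v: "?v \<in> \<Omega>" using xq actionD(2)[OF act tpow_closed] by auto
  have "(\<Sum>y\<in>\<Omega> \<times> S. shift_entry act 1 r y * shift_entry act j y x :: real) =
      path act (\<lambda>v s. \<Sum>y\<in>\<Omega> \<times> S. shift_entry act 1 r y * delta y v s) ?a ?v"
    unfolding path_sum[OF act a v] by (simp add: shift_entry_def xq)
  also have "\<dots> = path act (\<lambda>v s. path act (delta r) (autpow 1 s) (act (tpow 1) v)) ?a ?v"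
  proof (rule path_cong[OF act _ a v])
    fix s u assume su: "s \<in> S" "u \<in> \<Omega>"
    have "(\<Sum>y\<in>\<Omega> \<times> S. shift_entry act 1 r y * delta y u s :: real) = (\<Sum>y\<in>\<Omega> \<times> S. if y = (u, s) then shift_entry act 1 r (u, s) else (0::real))"
      by (intro sum.cong refl) (simp add: delta_def)
    also have "\<dots> = shift_entry act 1 r (u, s)" using su fin finite_S by (subst sum.delta) auto
    finally show "(\<Sum>y\<in>\<Omega> \<times> S. shift_entry act 1 r y * delta y u s :: real) = path act (delta r) (autpow 1 s) (act (tpow 1) u)"
      using su by (simp add: shift_entry_def autpow_1)
  qed
  also have "\<dots> = path act (delta r) (autpow 1 ?a) (act (tpow 1) ?v)"
    by (rule path_twist[OF act a v])
  also have "act (tpow 1) ?v = act (tpow (int (Suc j))) v"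
    using actionD(3)[OF act tpow_closed tpow_closed xq(2), of 1 "int j"] tpow_add[of 1 "int j"] by simp
  finally show ?thesis by (simp add: shift_entry_def xq autpow_1)
qed

end

section \<open>Actions on cosets and on their cyclic covers\<close>

definition cact :: "'a \<times> int \<Rightarrow> ('a \<times> int) set \<Rightarrow> ('a \<times> int) set" where
  "cact g C = g <#\<^bsub>G\<^esub> C"

lemma cact_action:
  assumes "subgroup H G" shows "action cact (lcosets\<^bsub>G\<^esub> H)"
proof -
  have sub: "C \<subseteq> carrier G" if "C \<in> lcosets\<^bsub>G\<^esub> H" for C
    using that GG.l_coset_subset_G[OF subgroup.subset[OF assms]] by (auto simp: LCOSETS_def)
  have "g <#\<^bsub>G\<^esub> C \<in> lcosets\<^bsub>G\<^esub> H" if "g \<in> carrier G" "C \<in> lcosets\<^bsub>G\<^esub> H" for g C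
  proof -
    obtain x where x: "x \<in> carrier G" "C = x <#\<^bsub>G\<^esub> H" using \<open>C \<in> _\<close> unfolding LCOSETS_def by blast
    then have "g <#\<^bsub>G\<^esub> C = (g \<otimes>\<^bsub>G\<^esub> x) <#\<^bsub>G\<^esub> H"
      using GG.lcos_m_assoc[OF subgroup.subset[OF assms] \<open>g \<in> _\<close>] by simp
    then show ?thesis using x \<open>g \<in> _\<close> unfolding LCOSETS_def by blast
  qed
  then show ?thesis
    unfolding action_def cact_def using sub GG.lcos_mult_one GG.lcos_m_assoc by auto
qed

text \<open>The product of the coset action with the action on the residues modulo \<open>k\<close>
  through the exponent of the stable letter.\<close>

definition level_act :: "nat \<Rightarrow> 'a \<times> int \<Rightarrow> ('a \<times> int) set \<times> nat \<Rightarrow> ('a \<times> int) set \<times> nat" where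
  "level_act k g v = (cact g (fst v), nat ((int (snd v) + snd g) mod int k))"

lemma level_action:
  assumes "action cact \<L>" "0 < k" shows "action (level_act k) (\<L> \<times> {..<k})"
  unfolding action_def
proof (intro conjI ballI)
  fix v assume v: "v \<in> \<L> \<times> {..<k}"
  then show "level_act k \<one>\<^bsub>G\<^esub> v = v"
    using actionD(1)[OF assms(1)] by (auto simp: level_act_def one_G)
  fix g assume g: "g \<in> carrier G"
  then show "level_act k g v \<in> \<L> \<times> {..<k}"
    using v assms(2) actionD(2)[OF assms(1) g, of "fst v"] by (auto simp: level_act_def nat_less_iff)
  fix h assume h: "h \<in> carrier G"
  have "(((int (snd v) + snd h) mod int k) + snd g) mod int k = (int (snd v) + (snd g + snd h)) mod int k"
    by (subst mod_add_left_eq) (simp add: algebra_simps)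
  moreover have "int (nat ((int (snd v) + snd h) mod int k)) = (int (snd v) + snd h) mod int k"
    using assms(2) by simp
  moreover have "cact g (cact h (fst v)) = cact (g \<otimes>\<^bsub>G\<^esub> h) (fst v)"
    by (rule actionD(3)[OF assms(1) g h]) (use v in auto)
  moreover have "snd (g \<otimes>\<^bsub>G\<^esub> h) = snd g + snd h" by (simp add: mult_G)
  ultimately show "level_act k g (level_act k h v) = level_act k (g \<otimes>\<^bsub>G\<^esub> h) v"
    by (simp only: level_act_def fst_conv snd_conv)
qed

text \<open>Letters of \<open>S\<close> preserve the level and \<open>T\<close> contains the stable
  letter exactly once, so \<open>T\<close> raises the level by one.\<close>

lemma level_shift_entry:
  assumes L: "action cact \<L>" and k: "0 < k" and i: "i < k" "i' < k" and C: "C \<in> \<L>" and q: "q \<in> S"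
  shows "shift_entry (level_act k) 1 ((C', i'), p) ((C, i), q) =
    (if i' = Suc i mod k then shift_entry cact 1 (C', p) (C, q) else (0::real))"
proof -
  note A = level_action[OF L k]
  have "(if snd w = i' then path cact (delta (C', p)) a (fst w) else (0::real)) = path (level_act k) (delta ((C', i'), p)) a w"
    if a: "a \<in> carrier F" "w \<in> \<L> \<times> {..<k}" for a w
  proof (rule path_unique[OF A, where \<Psi> = "\<lambda>a w. if snd w = i' then path cact (delta (C', p)) a (fst w) else (0::real)"])
    fix a b w assume ab: "a \<in> carrier F" "b \<in> carrier F" "w \<in> \<L> \<times> {..<k}"
    then have "level_act k (emb b) w = (cact (emb b) (fst w), snd w)"
      by (auto simp: level_act_def emb_def)
    then show "(if snd w = i' then path cact (delta (C', p)) (a \<otimes> b) (fst w) else (0::real)) =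
        (if snd w = i' then path cact (delta (C', p)) b (fst w) else 0) +
        (if snd (level_act k (emb b) w) = i' then path cact (delta (C', p)) a (fst (level_act k (emb b) w)) else 0)"
      using ab path_mult[OF L, of a b "fst w"] by auto
  qed (use a in \<open>auto simp: path_basis[OF L] delta_def split: if_splits\<close>)
  from this[of "\<phi> q" "level_act k (tpow 1) (C, i)"]
  have "path (level_act k) (delta ((C', i'), p)) (\<phi> q) (level_act k (tpow 1) (C, i)) =
      (if snd (level_act k (tpow 1) (C, i)) = i' then path cact (delta (C', p)) (\<phi> q) (fst (level_act k (tpow 1) (C, i))) else (0::real))"
    using q C i actionD(2)[OF A, of "tpow 1" "(C, i)"] by simp
  moreover have "snd (level_act k (tpow 1) (C, i)) = Suc i mod k"
    by (simp add: level_act_def tpow_def nat_mod_distrib nat_add_distrib)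
  ultimately show ?thesis by (auto simp: shift_entry_def level_act_def)
qed

end

section \<open>Determinants in cyclic covers\<close>

context free_by_cyclic
begin

definition iter_total :: "nat \<Rightarrow> nat" where
  "iter_total k = (\<Sum>j<k. iter_length j)"

text \<open>The bound is stated for any \<open>g\<close> dominated entrywise by \<open>1\<close>
  plus the absolute values of \<open>T\<close>, so that it covers \<open>1 - T\<close> and also what
  remains after cutting entries away.\<close>

lemma symmat_laplace_row:
  assumes act: "action act \<Omega>" and fin: "finite \<Omega>" and r: "r \<in> \<Omega> \<times> S"
    and g: "\<And>x. x \<in> \<Omega> \<times> S \<Longrightarrow> \<bar>g x :: real\<bar> \<le> (if r = x then 1 else 0) + \<bar>shift_entry act 1 r x\<bar>"
  shows "(\<Sum>x\<in>\<Omega> \<times> S. (g x)\<^sup>2) \<le> (1 + real (iter_length 1))\<^sup>2"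
proof -
  have f: "finite (\<Omega> \<times> S)" using fin finite_S by simp
  have "(\<Sum>x\<in>\<Omega> \<times> S. \<bar>g x\<bar>) \<le> (\<Sum>x\<in>\<Omega> \<times> S. (if r = x then 1 else 0) + \<bar>shift_entry act 1 r x\<bar>)"
    by (intro sum_mono g)
  also have "\<dots> \<le> 1 + real (iter_length 1)"
    using f shift_row_sum[OF act fin, of r 1] r by (auto simp: sum.distrib)
  finally have "(\<Sum>x\<in>\<Omega> \<times> S. \<bar>g x\<bar>) \<le> 1 + real (iter_length 1)" .
  then have "(\<Sum>x\<in>\<Omega> \<times> S. \<bar>g x\<bar>)\<^sup>2 \<le> (1 + real (iter_length 1))\<^sup>2"
    by (intro power_mono sum_nonneg) auto
  with sum_squares_le_square_sum[OF f, of g] show ?thesis by linarith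
qed

text \<open>Cutting the cyclic cover of degree \<open>k\<close> open makes the matrix unipotent, with inverse built
  from the first \<open>k\<close> powers of the monodromy.\<close>

lemma level_det_bounds:
  assumes L: "action cact \<L>" and fin: "finite \<L>" and k: "0 < k" and a: "0 < a"
  defines "D \<equiv> det (gram_sym (level_act k) (\<L> \<times> {..<k}) a laplace_sym)"
    and "C \<equiv> (1 + real (iter_length 1))\<^sup>2"
  shows "D \<le> (1 + a * (real (iter_total k))\<^sup>2) ^ (k * card \<L> * card S) * (1 + C / a) ^ (card \<L> * card S)"
    "1 \<le> D * (1 + C / a) ^ (card \<L> * card S)"
proof -
  note A = level_action[OF L k]
  let ?W = "\<L> \<times> {..<k}"
  let ?I = "?W \<times> S"
  have finW: "finite ?W" using fin by simp
  have finI: "finite ?I" using fin finite_S by simp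
  \<comment> \<open>The powers of \<open>T\<close> on the underlying cosets, blind to the
    level.\<close>
  define B where "B j r x = (shift_entry cact j (fst (fst r), snd r) (fst (fst x), snd x) :: real)"
    for j and r x :: "(('a \<times> int) set \<times> nat) \<times> 'a"
  define lev where "lev r = snd (fst r)" for r :: "(('a \<times> int) set \<times> nat) \<times> 'a"
  define V where "V = (symmat (level_act k) laplace_sym)"
  \<comment> \<open>\<open>U\<close> omits the entries that lead from the last level back to level
    \<open>0\<close>. What is subtracted from the identity becomes nilpotent, and the inverse
    \<open>K\<close> is its finite geometric series. Only the rows \<open>J\<close> at level
    \<open>0\<close>, one \<open>k\<close>-th of all, are affected.\<close>
  define U where "U r x = (if r = x then 1 else 0) - (if lev r = Suc (lev x) then B 1 r x else 0)" for r x
  define K where "K r x = (if lev x \<le> lev r then B (lev r - lev x) r x else 0)" for r x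
  define J where "J = (\<L> \<times> {0::nat}) \<times> S"
  have sumI: "(\<Sum>x\<in>?I. h x) = (\<Sum>l<k. \<Sum>y\<in>\<L> \<times> S. h ((fst y, l), snd y))" for h :: "_ \<Rightarrow> real"
  proof -
    have "(\<Sum>x\<in>?I. h x) = (\<Sum>w\<in>?W. \<Sum>s\<in>S. h (w, s))"
      by (simp add: sum.cartesian_product)
    also have "\<dots> = (\<Sum>C\<in>\<L>. \<Sum>l<k. \<Sum>s\<in>S. h ((C, l), s))"
      using sum.cartesian_product[of "\<lambda>C l. \<Sum>s\<in>S. h ((C, l), s)" "{..<k}" \<L>] by (simp add: case_prod_beta)
    also have "\<dots> = (\<Sum>l<k. \<Sum>C\<in>\<L>. \<Sum>s\<in>S. h ((C, l), s))" by (rule sum.swap)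
    finally show ?thesis by (simp add: sum.cartesian_product case_prod_beta)
  qed
  have T: "shift_entry (level_act k) 1 r x = (if lev r = Suc (lev x) mod k then B 1 r x else 0)"
    if "r \<in> ?I" "x \<in> ?I" for r x
    using that level_shift_entry[OF L k, of "lev x" "lev r" "fst (fst x)" "snd x" "fst (fst r)" "snd r"]
    by (auto simp: lev_def B_def)
  have V: "V r x = (if r = x then 1 else 0) - (if lev r = Suc (lev x) mod k then B 1 r x else 0)"
    if "r \<in> ?I" "x \<in> ?I" for r x
    unfolding V_def symmat_laplace[OF A finW that] T[OF that] ..
  have lev: "lev r < k" if "r \<in> ?I" for r using that by (auto simp: lev_def)
  have B0: "B 0 r c = (if fst (fst r) = fst (fst c) \<and> snd r = snd c then 1 else 0)" if "r \<in> ?I" "c \<in> ?I" for r c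
    using shift_0[OF L fin, of "(fst (fst r), snd r)" "(fst (fst c), snd c)"] that by (auto simp: B_def split: if_splits)
  \<comment> \<open>The geometric series telescopes: the powers in \<open>K\<close> cancel except
    for the zeroth one.\<close>
  have UK: "(\<Sum>x\<in>?I. U r x * K x c) = (if r = c then 1 else 0)" if rc: "r \<in> ?I" "c \<in> ?I" for r c
  proof -
    have "(\<Sum>x\<in>?I. U r x * K x c) = (\<Sum>x\<in>?I. (if r = x then K r c else 0) - (if lev r = Suc (lev x) then B 1 r x * K x c else 0))"
      by (intro sum.cong refl) (auto simp: U_def left_diff_distrib)
    also have "\<dots> = K r c - (\<Sum>x\<in>?I. if lev r = Suc (lev x) then B 1 r x * K x c else 0)"
      using finI rc by (simp add: sum_subtractf del: mem_Sigma_iff)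
    also have "(\<Sum>x\<in>?I. if lev r = Suc (lev x) then B 1 r x * K x c else 0) =
        (if lev r \<noteq> 0 \<and> lev c \<le> lev r - 1 then B (lev r - lev c) r c else 0)"
    proof (cases "lev r")
      case 0
      then show ?thesis by simp
    next
      case (Suc i)
      have "(\<Sum>x\<in>?I. if lev r = Suc (lev x) then B 1 r x * K x c else 0) =
         (\<Sum>l<k. if l = i then \<Sum>y\<in>\<L> \<times> S. B 1 r ((fst y, i), snd y) * K ((fst y, i), snd y) c else 0)"
        unfolding sumI by (intro sum.cong refl) (auto simp: Suc[unfolded lev_def] lev_def)
      also have "\<dots> = (\<Sum>y\<in>\<L> \<times> S. B 1 r ((fst y, i), snd y) * K ((fst y, i), snd y) c)"
        using lev[OF rc(1)] Suc by simp
      also have "\<dots> = (if lev c \<le> i then B (Suc (i - lev c)) r c else 0)"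
        using shift_Suc[OF L fin, of "(fst (fst c), snd c)" "(fst (fst r), snd r)" "i - lev c"] rc(2)
        by (auto simp: K_def B_def lev_def)
      finally show ?thesis by (simp add: Suc Suc_diff_le)
    qed
    also have "K r c - \<dots> = (if r = c then 1 else 0)"
    proof (cases "lev r = lev c")
      case True
      then show ?thesis using B0[OF rc] by (auto simp: K_def lev_def prod_eq_iff)
    next
      case False
      then show ?thesis by (auto simp: K_def)
    qed
    finally show ?thesis .
  qed
  have BI: "B j r x \<in> \<int>" for j r x unfolding B_def by (rule shift_Ints[OF L fin])
  have UI: "U r x \<in> \<int>" and KI: "K r x \<in> \<int>" for r x by (simp_all add: U_def K_def BI)
  \<comment> \<open>Level \<open>0\<close> is the only one reached by wrapping around modulo
    \<open>k\<close>.\<close>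
  have VU: "V r x = U r x" if "r \<in> ?I - J" "x \<in> ?I" for r x
  proof -
    have "lev r \<noteq> 0" "lev r < k" "lev x < k" using that lev by (auto simp: J_def lev_def)
    then have "lev r = Suc (lev x) mod k \<longleftrightarrow> lev r = Suc (lev x)"
      by (cases "Suc (lev x) = k") auto
    then show ?thesis using that V[of r x] by (simp add: U_def del: mem_Sigma_iff)
  qed
  have VC: "(\<Sum>x\<in>?I. (V r x)\<^sup>2) \<le> C" if r: "r \<in> ?I" for r
    unfolding C_def
    by (rule symmat_laplace_row[OF A finW r]) (auto simp: V_def symmat_laplace[OF A finW r] simp del: mem_Sigma_iff)
  have UC: "(\<Sum>x\<in>?I. (U r x)\<^sup>2) \<le> C" if r: "r \<in> ?I" for r
    unfolding C_def
  proof (rule symmat_laplace_row[OF A finW r])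
    fix x assume x: "x \<in> ?I"
    have "lev r = Suc (lev x) \<Longrightarrow> lev r = Suc (lev x) mod k" using lev[OF r] by simp
    then show "\<bar>U r x\<bar> \<le> (if r = x then 1 else 0) + \<bar>shift_entry (level_act k) 1 r x\<bar>"
      using T[OF r x] by (auto simp: U_def)
  qed
  have KC: "(\<Sum>x\<in>?I. (K r x)\<^sup>2) \<le> (real (iter_total k))\<^sup>2" if r: "r \<in> ?I" for r
  proof -
    \<comment> \<open>Each level below \<open>lev r\<close> contributes one power of
      \<open>T\<close>, whose row sums are bounded by the lengths of the iterates.\<close>
    have "(\<Sum>x\<in>?I. \<bar>K r x\<bar>) = (\<Sum>l<k. if l \<le> lev r then \<Sum>y\<in>\<L> \<times> S. \<bar>shift_entry cact (lev r - l) (fst (fst r), snd r) y\<bar> else 0)"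
      unfolding sumI by (intro sum.cong refl) (auto simp: K_def B_def lev_def)
    also have "\<dots> \<le> (\<Sum>l<k. if l \<le> lev r then real (iter_length (lev r - l)) else 0)"
      using shift_row_sum[OF L fin, of "(fst (fst r), snd r)"] r by (intro sum_mono) auto
    also have "\<dots> = (\<Sum>l\<in>{..<k} \<inter> {l. l \<le> lev r}. real (iter_length (lev r - l)))"
      by (simp add: sum.If_cases)
    also have "{..<k} \<inter> {l. l \<le> lev r} = {..lev r}" using lev[OF r] by auto
    also have "(\<Sum>l\<le>lev r. real (iter_length (lev r - l))) = (\<Sum>j\<le>lev r. real (iter_length j))"
      by (rule sum.reindex_bij_witness[of _ "\<lambda>j. lev r - j" "\<lambda>j. lev r - j"]) auto
    also have "\<dots> \<le> (\<Sum>j<k. real (iter_length j))"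
      using lev[OF r] by (intro sum_mono2) auto
    finally have "(\<Sum>x\<in>?I. \<bar>K r x\<bar>) \<le> real (iter_total k)" by (simp add: iter_total_def)
    then have "(\<Sum>x\<in>?I. \<bar>K r x\<bar>)\<^sup>2 \<le> (real (iter_total k))\<^sup>2"
      by (intro power_mono sum_nonneg) auto
    with sum_squares_le_square_sum[OF finI, of "K r"] show ?thesis by linarith
  qed
  have xs: "distinct (enum ?I)" "set (enum ?I) = ?I" "length (enum ?I) = card ?I"
    using enum[OF finI] length_enum[OF finI] by auto
  have J: "J \<subseteq> ?I" "card J = card \<L> * card S" using k by (auto simp: J_def card_cartesian_product)
  have cI: "card ?I = k * card \<L> * card S" by (simp add: card_cartesian_product mult_ac)
  have D: "D = det (gram a (length (enum ?I)) (set (enum ?I)) (\<lambda>r i. V r (enum ?I ! i)))"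
    by (simp add: D_def gram_sym_def V_def xs)
  note res = det_gram_near_unimodular[of "enum ?I" a U K J V C "(real (iter_total k))\<^sup>2",
      unfolded xs(2,3), OF xs(1) a UK UI KI J(1) VU VC UC KC zero_le_power2]
  show "D \<le> (1 + a * (real (iter_total k))\<^sup>2) ^ (k * card \<L> * card S) * (1 + C / a) ^ (card \<L> * card S)"
    "1 \<le> D * (1 + C / a) ^ (card \<L> * card S)"
    using res unfolding D xs(2,3) J(2) cI by blast+
qed

end

section \<open>Asymptotics of the regularized determinants\<close>

locale farber_free_by_cyclic = free_by_cyclic F S \<phi> for F (structure) and S :: "'a set" and \<phi> +
  fixes \<Gamma>s :: "nat \<Rightarrow> ('a \<times> int) set" and K e :: nat
  assumes farber: "farber_sequence G \<Gamma>s"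
    and growth: "\<And>k s. s \<in> S \<Longrightarrow> len ((\<phi> ^^ k) s) \<le> K * Suc k ^ e"
begin

abbreviation cosets :: "nat \<Rightarrow> ('a \<times> int) set set" where
  "cosets n \<equiv> lcosets\<^bsub>G\<^esub> (\<Gamma>s n)"

lemma cosets_props: "subgroup (\<Gamma>s n) G" "finite (cosets n)" "cosets n \<noteq> {}" "action cact (cosets n)"
proof -
  show H: "subgroup (\<Gamma>s n) G" "finite (cosets n)" using farber by (auto simp: farber_sequence_def)
  show "cosets n \<noteq> {}" using GG.one_closed unfolding LCOSETS_def by blast
  show "action cact (cosets n)" by (rule cact_action[OF H(1)])
qed

lemma card_cosets_pos: "0 < real (card (cosets n))"
  using cosets_props by (simp add: card_gt_0_iff)

lemma farber_family_cosets: "farber_family cact cosets"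
  using farber cosets_props by (simp add: farber_family_def farber_sequence_def subgroup_index_def cact_def)

text \<open>A fixed point in the cyclic cover lies over a fixed coset, so the proportion of fixed
  points cannot increase.\<close>

lemma farber_family_levels:
  assumes k: "0 < k" shows "farber_family (level_act k) (\<lambda>n. cosets n \<times> {..<k})"
proof -
  have "(\<lambda>n. real (card {v \<in> cosets n \<times> {..<k}. level_act k g v = v}) / real (card (cosets n \<times> {..<k}))) \<longlonglongrightarrow> 0"
    if g: "g \<in> carrier G - {\<one>\<^bsub>G\<^esub>}" for g
  proof (rule tendsto_sandwich[OF _ _ tendsto_const])
    show "(\<lambda>n. real (card {v \<in> cosets n. cact g v = v}) / real (card (cosets n))) \<longlonglongrightarrow> 0"
      using farber_family_cosets g by (simp add: farber_family_def)
    show "\<forall>\<^sub>F n in sequentially. real (card {v \<in> cosets n \<times> {..<k}. level_act k g v = v}) / real (card (cosets n \<times> {..<k}))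
       \<le> real (card {v \<in> cosets n. cact g v = v}) / real (card (cosets n))"
    proof (intro always_eventually allI)
      fix n
      have "card {v \<in> cosets n \<times> {..<k}. level_act k g v = v} \<le> card ({v \<in> cosets n. cact g v = v} \<times> {..<k})"
        using cosets_props(2) by (intro card_mono) (auto simp: level_act_def)
      then have "real (card {v \<in> cosets n \<times> {..<k}. level_act k g v = v}) \<le> real (card {v \<in> cosets n. cact g v = v}) * real k"
        by (simp add: card_cartesian_product flip: of_nat_mult)
      then show "real (card {v \<in> cosets n \<times> {..<k}. level_act k g v = v}) / real (card (cosets n \<times> {..<k}))
         \<le> real (card {v \<in> cosets n. cact g v = v}) / real (card (cosets n))"
        using k card_cosets_pos[of n] by (simp add: card_cartesian_product field_simps)
    qed
  qed auto
  then show ?thesis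
    using cosets_props k level_action[OF cosets_props(4) k] by (auto simp: farber_family_def)
qed

definition base_const :: real where "base_const = (1 + real (iter_length 1))\<^sup>2"

lemma base_const_ge: "1 \<le> base_const"
  by (simp add: base_const_def)

definition logdet :: "real \<Rightarrow> nat \<Rightarrow> real" where
  "logdet a n = ln (det (gram_sym cact (cosets n) a laplace_sym)) / real (card (cosets n))"

text \<open>The normalized logarithm is computed in the cover with \<open>k\<close> times as many
  sheets. The unipotent part has \<open>k\<close> times \<open>card S\<close> rows per coset and
  keeps its weight after division by \<open>k\<close>, while the cut rows, only
  \<open>card S\<close> per coset, gain the factor \<open>1 / k\<close>.\<close>

lemma logdet_level_bounds:
  assumes k: "0 < k" and a: "0 < a" and \<delta>: "0 < \<delta>"
  shows "\<forall>\<^sub>F n in sequentially.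
    logdet a n \<le> card S * ln (1 + a * (real (iter_total k))\<^sup>2) + card S / k * ln (1 + base_const / a) + \<delta> \<and>
    - (card S / k * ln (1 + base_const / a)) - \<delta> \<le> logdet a n"
proof -
  have "\<forall>\<^sub>F n in sequentially. \<bar>logdet a n -
     ln (det (gram_sym (level_act k) (cosets n \<times> {..<k}) a laplace_sym)) / real (card (cosets n \<times> {..<k}))\<bar> \<le> \<delta>"
    unfolding logdet_def
    by (rule logdet_difference[OF farber_family_cosets farber_family_levels[OF k] sym_valid_laplace a \<delta>])
  then show ?thesis
  proof eventually_elim
    case (elim n)
    let ?D = "det (gram_sym (level_act k) (cosets n \<times> {..<k}) a laplace_sym)"
    let ?d = "real (card (cosets n))" and ?q = "1 + base_const / a" and ?u = "1 + a * (real (iter_total k))\<^sup>2"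
    note b = level_det_bounds[OF cosets_props(4)[of n] cosets_props(2)[of n] k a, folded base_const_def]
    have q: "0 < ?q" using base_const_ge a by (simp add: add_pos_nonneg)
    have u: "0 < ?u" using a by (simp add: add_pos_nonneg)
    have D: "0 < ?D" using b(2) q by (smt (verit) zero_less_mult_pos2 zero_less_power)
    have "ln ?D \<le> ln (?u ^ (k * card (cosets n) * card S) * ?q ^ (card (cosets n) * card S))"
      using b(1) D by (simp add: ln_mono)
    also have "\<dots> = real (k * card (cosets n) * card S) * ln ?u + real (card (cosets n) * card S) * ln ?q"
      using q u by (simp add: ln_mult_pos ln_realpow)
    finally have 1: "ln ?D / (?d * k) \<le> (real (k * card (cosets n) * card S) * ln ?u + real (card (cosets n) * card S) * ln ?q) / (?d * k)"
      using card_cosets_pos[of n] k by (intro divide_right_mono) auto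
    have "0 \<le> ln (?D * ?q ^ (card (cosets n) * card S))" using b(2) by simp
    also have "\<dots> = ln ?D + real (card (cosets n) * card S) * ln ?q"
      using q D by (simp add: ln_mult_pos ln_realpow)
    finally have "- (real (card (cosets n) * card S) * ln ?q) \<le> ln ?D" by linarith
    then have 2: "- (real (card (cosets n) * card S) * ln ?q) / (?d * k) \<le> ln ?D / (?d * k)"
      using card_cosets_pos[of n] k by (intro divide_right_mono) auto
    have e: "(real (k * card (cosets n) * card S) * ln ?u + real (card (cosets n) * card S) * ln ?q) / (?d * k) =
       card S * ln ?u + card S / k * ln ?q"
      "- (real (card (cosets n) * card S) * ln ?q) / (?d * k) = - (card S / k * ln ?q)"
      using card_cosets_pos[of n] k by (simp_all add: field_simps)
    have c: "real (card (cosets n \<times> {..<k})) = ?d * k" by (simp add: card_cartesian_product)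
    show ?case using 1 2 elim unfolding e c by linarith
  qed
qed

text \<open>Only the cut rows can lower the determinant. For fixed \<open>a\<close> their share is
  divided by \<open>k\<close>, and \<open>k\<close> is free.\<close>

lemma logdet_lower:
  assumes a: "0 < a" and \<delta>: "0 < \<delta>"
  shows "\<forall>\<^sub>F n in sequentially. - \<delta> \<le> logdet a n"
proof -
  define c where "c = card S * ln (1 + base_const / a)"
  obtain k' :: nat where "2 * c / \<delta> < k'" using reals_Archimedean2 by blast
  then obtain k where k: "2 * c / \<delta> < real k" "0 < k" by (intro that[of "Suc k'"]) auto
  have "card S / k * ln (1 + base_const / a) \<le> \<delta> / 2"
    using k \<delta> by (simp add: c_def field_simps)
  with logdet_level_bounds[OF k(2) a, of "\<delta> / 2"] \<delta> show ?thesis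
    by (auto elim!: eventually_mono)
qed

lemma iter_total_le: "iter_total k \<le> card S * K * k ^ Suc e"
proof -
  have "iter_length j \<le> card S * (K * k ^ e)" if "j < k" for j
  proof -
    have "iter_length j \<le> (\<Sum>s\<in>S. K * k ^ e)"
      unfolding iter_length_def
    proof (rule sum_mono)
      fix s assume "s \<in> S"
      have "K * Suc j ^ e \<le> K * k ^ e" using that by (intro mult_left_mono power_mono) auto
      with growth[OF \<open>s \<in> S\<close>, of j] show "len ((\<phi> ^^ j) s) \<le> K * k ^ e" by linarith
    qed
    then show ?thesis by simp
  qed
  then have "iter_total k \<le> (\<Sum>j<k. card S * (K * k ^ e))" unfolding iter_total_def by (intro sum_mono) auto
  then show ?thesis by (simp add: mult_ac)
qed

text \<open>This is where polynomial growth acts. With \<open>a\<close> a negative power of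
  \<open>k\<close> the unipotent part contributes at most \<open>card S / k\<close>, and the cut
  rows contribute a multiple of \<open>ln k / k\<close> up to terms of order
  \<open>1 / k\<close>.\<close>

lemma logdet_upper:
  assumes \<delta>: "0 < \<delta>"
  obtains a where "0 < a" "\<forall>\<^sub>F n in sequentially. logdet a n \<le> \<delta>"
proof -
  define M where "M = real (card S * K) + 1"
  \<comment> \<open>Twice the exponent of the bound on \<open>iter_total k\<close>, which enters
    squared, plus one power of \<open>k\<close> to gain \<open>1 / k\<close>.\<close>
  define p where "p = 2 * Suc e + 1"
  define b where "b = 1 + base_const * M\<^sup>2"
  \<comment> \<open>The three summands bound the unipotent part, the constant part of
    \<open>ln (1 + base_const / a)\<close> and its part growing like
    \<open>p * ln k\<close>.\<close>
  define h where "h k = card S * (1 / real k) + card S * ln b * (1 / real k) + card S * real p * (ln (real k) / real k)" for k :: nat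
  have M: "M > 0" by (simp add: M_def add_nonneg_pos)
  have b: "b \<ge> 1" using base_const_ge by (simp add: b_def)
  have "h \<longlonglongrightarrow> real (card S) * 0 + real (card S) * ln b * 0 + real (card S) * real p * 0"
    unfolding h_def by (intro tendsto_intros lim_1_over_n filterlim_compose[OF ln_x_over_x_tendsto_0 filterlim_real_sequentially])
  then have "\<forall>\<^sub>F k in sequentially. h k < \<delta> / 2" using \<delta> by (intro order_tendstoD(2)) auto
  then have "\<forall>\<^sub>F k in sequentially. h k < \<delta> / 2 \<and> 0 < k"
    by (intro eventually_conj) (auto simp: eventually_gt_at_top)
  then obtain k where k: "h k < \<delta> / 2" "0 < k" by (auto simp: eventually_sequentially)
  define a where "a = 1 / (M\<^sup>2 * real k ^ p)"
  have a: "a > 0" using M k by (simp add: a_def)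
  have "real (iter_total k) \<le> real (card S * K) * real k ^ Suc e"
    using iter_total_le[of k] by (metis of_nat_le_iff of_nat_mult of_nat_power)
  also have "\<dots> \<le> M * real k ^ Suc e" by (intro mult_right_mono) (auto simp: M_def)
  finally have "(real (iter_total k))\<^sup>2 \<le> (M * real k ^ Suc e)\<^sup>2" by (intro power_mono) auto
  then have "a * (real (iter_total k))\<^sup>2 \<le> a * (M * real k ^ Suc e)\<^sup>2" using a by (intro mult_left_mono) auto
  also have "\<dots> = 1 / real k"
  proof -
    have "real k ^ p = (real k ^ Suc e)\<^sup>2 * real k"
      by (simp only: p_def mult_2 power2_eq_square power_add power_one_right)
    then show ?thesis using M k by (simp add: a_def power_mult_distrib)
  qed
  finally have "ln (1 + a * (real (iter_total k))\<^sup>2) \<le> 1 / real k"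
    using ln_add_one_self_le_self[of "a * (real (iter_total k))\<^sup>2"] a by (simp add: add.commute)
  then have 1: "card S * ln (1 + a * (real (iter_total k))\<^sup>2) \<le> card S * (1 / real k)"
    by (intro mult_left_mono) auto
  have "1 + base_const / a = 1 + base_const * M\<^sup>2 * real k ^ p"
    using M k by (simp add: a_def field_simps)
  also have "\<dots> \<le> b * real k ^ p"
    using k by (simp add: b_def distrib_right)
  finally have "ln (1 + base_const / a) \<le> ln (b * real k ^ p)"
    using base_const_ge a by (intro ln_mono) (auto simp: add_pos_nonneg)
  also have "\<dots> = ln b + p * ln (real k)" using b k by (simp add: ln_mult_pos ln_realpow)
  finally have "card S / k * ln (1 + base_const / a) \<le> card S / k * (ln b + p * ln (real k))"
    by (intro mult_left_mono) auto
  moreover have e: "card S / k * (ln b + p * ln (real k)) = card S * ln b * (1 / real k) + card S * real p * (ln (real k) / real k)"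
    by (simp add: distrib_left)
  ultimately have "card S * ln (1 + a * (real (iter_total k))\<^sup>2) + card S / k * ln (1 + base_const / a) \<le> h k"
    using 1 unfolding h_def by linarith
  with k(1) logdet_level_bounds[OF k(2) a, of "\<delta> / 2"] \<delta> have "\<forall>\<^sub>F n in sequentially. logdet a n \<le> \<delta>"
    by (auto elim!: eventually_mono)
  then show ?thesis using that a by blast
qed

end

section \<open>The boundary matrix of the presentation complex\<close>

context free_by_cyclic
begin

text \<open>The boundary from \<open>2\<close>-cells to edges: \<open>Inl\<close> are the edges labelled by \<open>S\<close>, \<open>Inr\<close> the
  edges labelled by the stable letter.\<close>

definition cell_boundary :: "(('a \<times> int) set \<times> 'a) + ('a \<times> int) set \<Rightarrow> ('a \<times> int) set \<times> 'a \<Rightarrow> int" where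
  "cell_boundary l x = (case l of
     Inl r \<Rightarrow> (if r = x then 1 else 0) - shift_entry cact 1 r x
   | Inr D \<Rightarrow> (if cact (emb (snd x)) (fst x) = D then 1 else 0) - (if fst x = D then 1 else 0))"

definition edges :: "('a \<times> int) set set \<Rightarrow> ((('a \<times> int) set \<times> 'a) + ('a \<times> int) set) set" where
  "edges \<L> = Inl ` (\<L> \<times> S) \<union> Inr ` \<L>"

text \<open>The map \<open>rep\<close> is injective on torsion: chains with equal value whose
  difference is torsion in the cokernel of the boundary differ by a boundary.\<close>

definition torsion_separating :: "('a \<times> int) set set \<Rightarrow> (((('a \<times> int) set \<times> 'a) + ('a \<times> int) set \<Rightarrow> int) \<Rightarrow> 'z) \<Rightarrow> bool" where
  "torsion_separating \<L> rep \<longleftrightarrow> (\<forall>v v' k y. rep v = rep v' \<longrightarrow> 0 < (k::int) \<longrightarrow>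
     (\<forall>l \<in> edges \<L>. k * (v l - v' l) = (\<Sum>x\<in>\<L> \<times> S. cell_boundary l x * y x)) \<longrightarrow>
     (\<exists>z. \<forall>l \<in> edges \<L>. v l - v' l = (\<Sum>x\<in>\<L> \<times> S. cell_boundary l x * z x)))"

lemma of_int_shift_entry:
  assumes "action cact \<L>" "x \<in> \<L> \<times> S"
  shows "real_of_int (shift_entry cact j r x) = shift_entry cact j r x"
proof -
  have "(\<phi> ^^ j) (snd x) \<in> carrier F" "cact (tpow (int j)) (fst x) \<in> \<L>"
    using assms actionD(2)[OF assms(1) tpow_closed] by auto
  from path_additive[OF assms(1) _ this, of real_of_int "delta r"]
  have "real_of_int (shift_entry cact j r x) =
      path cact (\<lambda>v s. real_of_int (delta r v s)) ((\<phi> ^^ j) (snd x)) (cact (tpow (int j)) (fst x))"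
    unfolding shift_entry_def by simp
  moreover have "(\<lambda>v s. real_of_int (delta r v s)) = delta r" by (simp add: delta_def fun_eq_iff)
  ultimately show ?thesis unfolding shift_entry_def by simp
qed

text \<open>The lattice bound with the square block \<open>1 - T\<close> as preferred rows and the
  stable letter rows as the others. In a stable letter row every basis element contributes at most
  two in absolute value, whence the second summand of \<open>C\<close>.\<close>

lemma cell_boundary_rank:
  assumes L: "action cact \<L>" and fin: "finite \<L>"
  defines "R \<equiv> sym_norm (sym_mult (sym_adjoint laplace_sym) laplace_sym)"
    and "C \<equiv> (1 + real (iter_length 1))\<^sup>2 + (2 * real (card S))\<^sup>2"
    and "D \<equiv> \<lambda>a. det (gram_sym cact \<L> a laplace_sym)"
  obtains \<nu> and rep :: "((('a \<times> int) set \<times> 'a) + ('a \<times> int) set \<Rightarrow> int) \<Rightarrow> nat \<Rightarrow> int" where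
    "\<nu> \<le> card (\<L> \<times> S)" "finite (range rep)"
    "\<And>a. 0 < a \<Longrightarrow> D a \<le> a ^ \<nu> * (a + R) ^ (card (\<L> \<times> S) - \<nu>)"
    "\<And>a. 0 < a \<Longrightarrow> (real (card (range rep)))\<^sup>2 \<le> D a * (1 + C / a) ^ \<nu>"
    "torsion_separating \<L> rep"
proof -
  let ?I = "\<L> \<times> S" let ?xs = "enum ?I"
  define N where "N = card ?I"
  define f where "f l i = cell_boundary l (?xs ! i)" for l and i :: nat
  have finI: "finite ?I" using fin finite_S by simp
  have in_I: "?xs ! i \<in> ?I" if "i < N" for i
    using that enum[OF finI] length_enum[OF finI] by (metis nth_mem N_def)
  have sumI: "(\<Sum>i<N. h (?xs ! i)) = (\<Sum>x\<in>?I. h x)" for h :: "_ \<Rightarrow> real"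
    unfolding N_def by (rule sum_enum[OF finI])
  have sumZ: "(\<Sum>i<N. h (?xs ! i)) = (\<Sum>x\<in>?I. h x)" for h :: "_ \<Rightarrow> int"
    using sum_set_nth[OF enum(1)[OF finI], of h] by (simp add: enum(2)[OF finI] length_enum[OF finI] N_def)
  have fl: "real_of_int (cell_boundary (Inl r) x) = symmat cact laplace_sym r x" if "r \<in> ?I" "x \<in> ?I" for r x
    unfolding symmat_laplace[OF L fin that] using of_int_shift_entry[OF L that(2), of 1 r]
    by (simp add: cell_boundary_def)
  have gr: "gram a N (Inl ` ?I) (\<lambda>l i. real_of_int (f l i)) = gram_sym cact \<L> a laplace_sym" for a
    unfolding gram_sym_def gram_def N_def[symmetric]
    by (intro cong_mat refl) (auto simp: sum.reindex f_def fl in_I comp_def simp del: mem_Sigma_iff intro!: sum.cong)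
  have C1: "1 \<le> C"
  proof -
    have "1 \<le> (1 + real (iter_length 1))\<^sup>2" by simp
    moreover have "0 \<le> (2 * real (card S))\<^sup>2" by simp
    ultimately show ?thesis unfolding C_def by linarith
  qed
  have CC: "(\<Sum>i<N. (real_of_int (f l i))\<^sup>2) \<le> C" if l: "l \<in> Inl ` ?I \<union> Inr ` \<L>" for l
  proof (cases l)
    case (Inl r)
    then have r: "r \<in> ?I" using l by auto
    have "(\<Sum>i<N. (real_of_int (f l i))\<^sup>2) = (\<Sum>x\<in>?I. (symmat cact laplace_sym r x)\<^sup>2)"
      unfolding sumI[symmetric] by (intro sum.cong refl) (simp add: f_def Inl fl[OF r] in_I del: mem_Sigma_iff)
    also have "\<dots> \<le> (1 + real (iter_length 1))\<^sup>2"
      by (rule symmat_laplace_row[OF L fin r]) (auto simp: symmat_laplace[OF L fin r] simp del: mem_Sigma_iff)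
    also have "\<dots> \<le> C" by (simp add: C_def)
    finally show ?thesis .
  next
    case (Inr D)
    then have D: "D \<in> \<L>" using l by auto
    let ?h = "\<lambda>x. real_of_int (cell_boundary (Inr D) x)"
    have "(\<Sum>x\<in>?I. \<bar>?h x\<bar>) = (\<Sum>s\<in>S. \<Sum>v\<in>\<L>. \<bar>?h (v, s)\<bar>)"
      by (subst sum.swap) (simp add: sum.cartesian_product case_prod_beta)
    also have "\<dots> \<le> (\<Sum>s\<in>S. 2)"
    proof (rule sum_mono)
      fix s assume s: "s \<in> S"
      have g: "emb s \<in> carrier G" using s by simp
      have "(\<Sum>v\<in>\<L>. \<bar>?h (v, s)\<bar>) \<le> (\<Sum>v\<in>\<L>. (if v = cact (inv\<^bsub>G\<^esub> (emb s)) D then 1 else 0) + (if v = D then 1 else 0))"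
        using act_eq_iff[OF L fin g _ D] by (intro sum_mono) (auto simp: cell_boundary_def)
      also have "\<dots> \<le> 2" using fin by (simp add: sum.distrib)
      finally show "(\<Sum>v\<in>\<L>. \<bar>?h (v, s)\<bar>) \<le> 2" .
    qed
    finally have "(\<Sum>x\<in>?I. \<bar>?h x\<bar>) \<le> 2 * real (card S)" by simp
    then have "(\<Sum>x\<in>?I. \<bar>?h x\<bar>)\<^sup>2 \<le> (2 * real (card S))\<^sup>2" by (intro power_mono sum_nonneg) auto
    with sum_squares_le_square_sum[OF finI, of ?h] have "(\<Sum>x\<in>?I. (?h x)\<^sup>2) \<le> (2 * real (card S))\<^sup>2" by linarith
    then have "(\<Sum>i<N. (real_of_int (f l i))\<^sup>2) \<le> (2 * real (card S))\<^sup>2"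
      using sumI[of "\<lambda>x. (?h x)\<^sup>2"] by (simp add: f_def Inr)
    moreover have "(2 * real (card S))\<^sup>2 \<le> C" by (simp add: C_def)
    ultimately show ?thesis by linarith
  qed
  have RR: "(\<Sum>j<N. \<bar>gram 0 N (Inl ` ?I) (\<lambda>l i. real_of_int (f l i)) $$ (i, j)\<bar>) \<le> R" if "i < N" for i
    unfolding gr R_def using gram_symmat_row_sum[OF L fin sym_valid_laplace, of i] that by (simp add: N_def)
  have R0: "0 \<le> R"
  proof -
    have "0 \<le> sym_norm z" for z by (induction z) (auto simp: sym_norm_def)
    then show ?thesis by (simp add: R_def)
  qed
  have fins: "finite (Inl ` ?I :: ((('a \<times> int) set \<times> 'a) + ('a \<times> int) set) set)"
    "finite (Inr ` \<L> :: ((('a \<times> int) set \<times> 'a) + ('a \<times> int) set) set)" using finI fin by auto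
  have disj: "Inl ` ?I \<inter> Inr ` \<L> = {}" by auto
  show ?thesis
  proof (rule torsion_lattice_bound[where f = f and N = N, OF fins disj C1 CC RR R0], assumption, assumption)
    fix \<nu> and rep :: "((('a \<times> int) set \<times> 'a) + ('a \<times> int) set \<Rightarrow> int) \<Rightarrow> nat \<Rightarrow> int"
    assume 1: "\<nu> \<le> N" "finite (range rep)"
      "\<And>a. 0 < a \<Longrightarrow> det (gram a N (Inl ` ?I) (\<lambda>l i. real_of_int (f l i))) \<le> a ^ \<nu> * (a + R) ^ (N - \<nu>)"
      "\<And>a. 0 < a \<Longrightarrow> (real (card (range rep)))\<^sup>2 \<le> det (gram a N (Inl ` ?I) (\<lambda>l i. real_of_int (f l i))) * (1 + C / a) ^ \<nu>"
      "\<And>v v' k y. rep v = rep v' \<Longrightarrow> 0 < (k::int) \<Longrightarrow>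
         (\<And>l. l \<in> Inl ` ?I \<union> Inr ` \<L> \<Longrightarrow> k * (v l - v' l) = (\<Sum>j<N. f l j * y j)) \<Longrightarrow>
         \<exists>z. \<forall>l \<in> Inl ` ?I \<union> Inr ` \<L>. v l - v' l = (\<Sum>j<N. f l j * z j)"
    have "torsion_separating \<L> rep"
      unfolding torsion_separating_def
    proof (intro allI impI)
      fix v v' k y
      assume eq: "rep v = rep v'" and k: "0 < (k::int)"
        and tor: "\<forall>l \<in> edges \<L>. k * (v l - v' l) = (\<Sum>x\<in>?I. cell_boundary l x * y x)"
      have "\<exists>z. \<forall>l \<in> Inl ` ?I \<union> Inr ` \<L>. v l - v' l = (\<Sum>j<N. f l j * z j)"
      proof (rule 1(5)[OF eq k])
        fix l assume "l \<in> Inl ` ?I \<union> Inr ` \<L>"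
        then show "k * (v l - v' l) = (\<Sum>j<N. f l j * y (?xs ! j))"
          using tor sumZ[of "\<lambda>x. cell_boundary l x * y x"] by (simp add: f_def edges_def)
      qed
      then obtain z where z: "\<forall>l \<in> edges \<L>. v l - v' l = (\<Sum>j<N. f l j * z j)" by (auto simp: edges_def)
      define z' where "z' x = z (inv_into {..<N} (\<lambda>i. ?xs ! i) x)" for x
      have inj: "inj_on (\<lambda>i. ?xs ! i) {..<N}"
        using enum(1)[OF finI] length_enum[OF finI] by (auto simp: inj_on_def nth_eq_iff_index_eq N_def)
      have "(\<Sum>j<N. f l j * z j) = (\<Sum>x\<in>?I. cell_boundary l x * z' x)" for l
        unfolding sumZ[symmetric] by (intro sum.cong refl) (simp add: f_def z'_def inv_into_f_f[OF inj])
      with z show "\<exists>z. \<forall>l \<in> edges \<L>. v l - v' l = (\<Sum>x\<in>?I. cell_boundary l x * z x)" by auto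
    qed
    moreover have "D a \<le> a ^ \<nu> * (a + R) ^ (card ?I - \<nu>)" if "0 < a" for a
      using 1(3)[OF that, unfolded gr] unfolding D_def N_def .
    moreover have "(real (card (range rep)))\<^sup>2 \<le> D a * (1 + C / a) ^ \<nu>" if "0 < a" for a
      using 1(4)[OF that, unfolded gr] unfolding D_def .
    ultimately show thesis using 1(1,2) unfolding N_def by (intro that)
  qed
qed

end

context farber_free_by_cyclic
begin

text \<open>The torsion bound is used at a parameter \<open>a\<close> for which
  \<open>logdet\<close> is small, and the corank bound at another parameter \<open>b\<close>. At
  \<open>b\<close> the determinant is at least \<open>exp (- d)\<close> for \<open>d\<close> cosets
  but has at least \<open>\<nu>\<close> factors \<open>b\<close>, which limits
  \<open>\<nu>\<close>.\<close>

theorem torsion_rate: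
  assumes \<delta>: "0 < \<delta>"
  shows "\<forall>\<^sub>F n in sequentially. \<exists>rep :: ((('a \<times> int) set \<times> 'a) + ('a \<times> int) set \<Rightarrow> int) \<Rightarrow> nat \<Rightarrow> int.
    finite (range rep) \<and> ln (real (card (range rep))) \<le> \<delta> * real (card (cosets n)) \<and> torsion_separating (cosets n) rep"
proof -
  define R where "R = sym_norm (sym_mult (sym_adjoint laplace_sym) laplace_sym)"
  define C where "C = (1 + real (iter_length 1))\<^sup>2 + (2 * real (card S))\<^sup>2"
  have "0 \<le> sym_norm z" for z by (induction z) (auto simp: sym_norm_def)
  then have R0: "0 \<le> R" by (simp add: R_def)
  have C0: "0 \<le> C" by (simp add: C_def)
  obtain a where a: "0 < a" and ev1: "\<forall>\<^sub>F n in sequentially. logdet a n \<le> \<delta>"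
    using logdet_upper[OF \<delta>] by blast
  define q where "q = ln (1 + C / a)"
  have q: "0 \<le> q" using a C0 by (simp add: q_def)
  \<comment> \<open>The summand \<open>1\<close> comes from the lower bound
    \<open>- 1 \<le> logdet b n\<close>, the other from the eigenvalues not counted by
    \<open>\<nu>\<close>.\<close>
  define B where "B = 1 + card S * ln (1 + R)"
  have B: "0 < B" using R0 by (simp add: B_def add_pos_nonneg)
  \<comment> \<open>Chosen so that \<open>\<nu> * T \<le> B * d\<close> becomes
    \<open>\<nu> * (q + 1) \<le> \<delta> * d\<close>, where \<open>\<nu> * q\<close> is the
    logarithmic cost of the corank at \<open>a\<close>.\<close>
  define T where "T = B * (q + 1) / \<delta>"
  have T: "0 < T" using B q \<delta> by (simp add: T_def)
  define b where "b = exp (- T)"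
  have b: "0 < b" "b \<le> 1" "ln b = - T" using T by (auto simp: b_def)
  have ev2: "\<forall>\<^sub>F n in sequentially. - 1 \<le> logdet b n" using logdet_lower[OF b(1), of 1] by simp
  show ?thesis using ev1 ev2
  proof eventually_elim
    case (elim n)
    let ?d = "real (card (cosets n))" and ?N = "card (cosets n \<times> S)"
    have d: "0 < ?d" by (rule card_cosets_pos)
    obtain \<nu> and rep :: "((('a \<times> int) set \<times> 'a) + ('a \<times> int) set \<Rightarrow> int) \<Rightarrow> nat \<Rightarrow> int" where
      r: "\<nu> \<le> ?N" "finite (range rep)"
      "\<And>a. 0 < a \<Longrightarrow> det (gram_sym cact (cosets n) a laplace_sym) \<le> a ^ \<nu> * (a + R) ^ (?N - \<nu>)"
      "\<And>a. 0 < a \<Longrightarrow> (real (card (range rep)))\<^sup>2 \<le> det (gram_sym cact (cosets n) a laplace_sym) * (1 + C / a) ^ \<nu>"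
      "torsion_separating (cosets n) rep"
      using cell_boundary_rank[OF cosets_props(4,2)[of n], folded R_def C_def] by blast
    have pos: "0 < det (gram_sym cact (cosets n) x laplace_sym)" if "0 < x" for x
      unfolding gram_sym_def using cosets_props(2)[of n] finite_S that by (intro det_gram_pos) auto
    have nu: "real \<nu> * q \<le> \<delta> * ?d"
    proof -
      have "ln (det (gram_sym cact (cosets n) b laplace_sym)) \<le> ln (b ^ \<nu> * (b + R) ^ (?N - \<nu>))"
        using r(3)[OF b(1)] pos[OF b(1)] by (intro ln_mono) auto
      also have "\<dots> = real \<nu> * ln b + real (?N - \<nu>) * ln (b + R)"
        using b R0 by (simp add: ln_mult_pos ln_realpow add_pos_nonneg)
      also have "\<dots> \<le> - (real \<nu> * T) + real ?N * ln (1 + R)"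
      proof -
        have "real (?N - \<nu>) * ln (b + R) \<le> real (?N - \<nu>) * ln (1 + R)"
          using b R0 by (intro mult_left_mono ln_mono) auto
        also have "\<dots> \<le> real ?N * ln (1 + R)" using R0 by (intro mult_right_mono) auto
        finally show ?thesis using b(3) by simp
      qed
      finally have "real \<nu> * T \<le> real ?N * ln (1 + R) - ln (det (gram_sym cact (cosets n) b laplace_sym))" by linarith
      also have "\<dots> \<le> real ?N * ln (1 + R) + ?d"
        using elim(2) d by (simp add: logdet_def pos_le_divide_eq)
      also have "\<dots> = B * ?d" by (simp add: B_def card_cartesian_product algebra_simps)
      finally have "B * (real \<nu> * (q + 1)) \<le> B * (\<delta> * ?d)"
        using \<delta> by (simp add: T_def field_simps)
      then have "real \<nu> * (q + 1) \<le> \<delta> * ?d" using B by simp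
      moreover have "real \<nu> * q \<le> real \<nu> * (q + 1)" by (intro mult_left_mono) auto
      ultimately show ?thesis by linarith
    qed
    have "ln (real (card (range rep))) \<le> \<delta> * ?d"
    proof -
      have c: "0 < real (card (range rep))" using r(2) by (simp add: card_gt_0_iff)
      have "2 * ln (real (card (range rep))) = ln ((real (card (range rep)))\<^sup>2)" using c by (simp add: ln_realpow)
      also have "\<dots> \<le> ln (det (gram_sym cact (cosets n) a laplace_sym) * (1 + C / a) ^ \<nu>)"
        using r(4)[OF a] c by (intro ln_mono) auto
      also have "\<dots> = ln (det (gram_sym cact (cosets n) a laplace_sym)) + real \<nu> * q"
        using pos[OF a] a C0 by (simp add: ln_mult_pos ln_realpow q_def add_pos_nonneg)
      also have "ln (det (gram_sym cact (cosets n) a laplace_sym)) \<le> \<delta> * ?d"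
        using elim(1) d by (simp add: logdet_def pos_divide_le_eq)
      finally show ?thesis using nu by linarith
    qed
    then show ?case by (intro exI[of _ rep] conjI r(2,5))
  qed
qed

end

section \<open>Homotopies of the bar complex\<close>

lemma frag_extend_comp:
  "frag_extend f (frag_extend g c) = frag_extend (\<lambda>x. frag_extend f (g x)) c"
  by (rule frag_induction[of c UNIV]) (auto simp: frag_extend_diff)

lemma frag_extend_fun_diff:
  "frag_extend (\<lambda>x. f x - g x) c = frag_extend f c - frag_extend g c"
  by (rule frag_induction[of c UNIV]) (auto simp: frag_extend_diff algebra_simps)

lemma keys_frag_extend_subset:
  assumes "Poly_Mapping.keys c \<subseteq> A" "\<And>x. x \<in> A \<Longrightarrow> Poly_Mapping.keys (f x) \<subseteq> B"
  shows "Poly_Mapping.keys (frag_extend f c) \<subseteq> B"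
  using keys_frag_extend[of f c] assms by blast

lemma keys_diff_subset:
  "Poly_Mapping.keys a \<subseteq> B \<Longrightarrow> Poly_Mapping.keys b \<subseteq> B \<Longrightarrow> Poly_Mapping.keys (a - b :: 'a \<Rightarrow>\<^sub>0 int) \<subseteq> B"
  using keys_diff[of a b] by blast

definition cone :: "'x \<Rightarrow> ('x list \<Rightarrow>\<^sub>0 int) \<Rightarrow> ('x list \<Rightarrow>\<^sub>0 int)" where
  "cone x = frag_extend (\<lambda>ys. frag_of (x # ys))"

text \<open>The boundary of the augmented simplex complex on a set: the alternating sum of the lists
  with one entry deleted.\<close>

primrec simplex_boundary :: "'x list \<Rightarrow> ('x list \<Rightarrow>\<^sub>0 int)" where
  "simplex_boundary [] = 0"
| "simplex_boundary (x # xs) = frag_of xs - cone x (simplex_boundary xs)"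

abbreviation chain_boundary :: "('x list \<Rightarrow>\<^sub>0 int) \<Rightarrow> ('x list \<Rightarrow>\<^sub>0 int)" where
  "chain_boundary \<equiv> frag_extend simplex_boundary"

text \<open>The parameter counts vertices, so the dimension is one less, and the empty list is the
  cell of the augmentation.\<close>

definition simplices :: "nat \<Rightarrow> 'x set \<Rightarrow> 'x list set" where
  "simplices n A = {xs. length xs = n \<and> set xs \<subseteq> A}"

lemma chain_boundary_cone: "chain_boundary (cone x c) = c - cone x (chain_boundary c)"
  unfolding cone_def
  by (rule frag_induction[of c UNIV]) (auto simp: frag_extend_diff cone_def algebra_simps)

lemma chain_boundary_boundary: "chain_boundary (simplex_boundary xs) = 0"
  by (induction xs) (auto simp: frag_extend_diff chain_boundary_cone, simp add: cone_def)

lemma cone_map: "cone (f x) (frag_extend (frag_of \<circ> map f) c) = frag_extend (frag_of \<circ> map f) (cone x c)"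
  unfolding cone_def frag_extend_comp by (simp add: comp_def)

lemma keys_cone: "Poly_Mapping.keys c \<subseteq> simplices n A \<Longrightarrow> x \<in> A \<Longrightarrow> Poly_Mapping.keys (cone x c) \<subseteq> simplices (Suc n) A"
  unfolding cone_def by (erule keys_frag_extend_subset) (auto simp: simplices_def)

lemma keys_simplex_boundary: "xs \<in> simplices (Suc n) A \<Longrightarrow> Poly_Mapping.keys (simplex_boundary xs) \<subseteq> simplices n A"
proof (induction xs arbitrary: n)
  case (Cons x xs)
  have "Poly_Mapping.keys (cone x (simplex_boundary xs)) \<subseteq> simplices n A"
  proof (cases n)
    case 0
    then show ?thesis using Cons.prems by (auto simp: simplices_def cone_def)
  next
    case (Suc m)
    have "xs \<in> simplices (Suc m) A" "x \<in> A" using Cons.prems Suc by (auto simp: simplices_def)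
    then show ?thesis unfolding Suc by (intro keys_cone Cons.IH)
  qed
  moreover have "Poly_Mapping.keys (frag_of xs) \<subseteq> simplices n A" using Cons.prems by (simp add: simplices_def)
  ultimately show ?case by (simp add: keys_diff_subset)
qed (simp add: simplices_def)

lemma simplex_boundary_map: "simplex_boundary (map f xs) = frag_extend (frag_of \<circ> map f) (simplex_boundary xs)"
  by (induction xs) (auto simp: frag_extend_diff cone_def frag_extend_comp comp_def)

lemma simplex_boundary_sum:
  "simplex_boundary xs = (\<Sum>i<length xs. frag_cmul ((- 1) ^ i) (frag_of (take i xs @ drop (Suc i) xs)))"
proof (induction xs)
  case (Cons x xs)
  have "cone x (simplex_boundary xs) = (\<Sum>i<length xs. frag_cmul ((- 1) ^ i) (frag_of (x # take i xs @ drop (Suc i) xs)))"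
    unfolding Cons cone_def by (simp add: frag_extend_sum frag_extend_cmul comp_def)
  moreover have "(\<Sum>i<length (x # xs). frag_cmul ((- 1) ^ i) (frag_of (take i (x # xs) @ drop (Suc i) (x # xs)))) =
      frag_of xs + (\<Sum>i<length xs. - frag_cmul ((- 1) ^ i) (frag_of (x # take i xs @ drop (Suc i) xs)))"
    unfolding length_Cons sum.lessThan_Suc_shift by simp
  ultimately show ?case unfolding simplex_boundary.simps by (simp only: diff_conv_add_uminus sum_negf)
qed simp

text \<open>The usual inductive homotopy from \<open>\<tau>\<close> to the identity: the cycle that
  remains to be filled is coned off. The apex is a vertex of \<open>xs\<close>, which keeps the
  homotopy compatible with translations.\<close>

primrec simplex_homotopy :: "('x list \<Rightarrow> 'x list \<Rightarrow>\<^sub>0 int) \<Rightarrow> nat \<Rightarrow> 'x list \<Rightarrow> ('x list \<Rightarrow>\<^sub>0 int)" where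
  "simplex_homotopy \<tau> 0 xs = 0"
| "simplex_homotopy \<tau> (Suc n) xs =
     cone (last xs) (frag_of xs - \<tau> xs - frag_extend (simplex_homotopy \<tau> n) (simplex_boundary xs))"

text \<open>By induction the chain under the cone is a cycle, and a cycle is the boundary of its
  cone.\<close>

lemma simplex_homotopy_boundary:
  assumes one: "\<And>xs. xs \<in> simplices 1 A \<Longrightarrow> \<tau> xs = frag_of xs"
    and chain: "\<And>n xs. xs \<in> simplices (Suc (Suc n)) A \<Longrightarrow> chain_boundary (\<tau> xs) = frag_extend \<tau> (simplex_boundary xs)"
    and xs: "xs \<in> simplices (Suc (Suc n)) A"
  shows "chain_boundary (simplex_homotopy \<tau> (Suc n) xs) =
    frag_of xs - \<tau> xs - frag_extend (simplex_homotopy \<tau> n) (simplex_boundary xs)"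
  using xs
proof (induction n arbitrary: xs)
  case 0
  have "frag_extend \<tau> (simplex_boundary xs) = frag_extend frag_of (simplex_boundary xs)"
    using keys_simplex_boundary[OF 0] one by (intro frag_extend_eq) auto
  then have "chain_boundary (frag_of xs - \<tau> xs) = 0"
    using chain[OF 0] by (simp add: frag_extend_diff flip: frag_expansion)
  moreover have "frag_extend (simplex_homotopy \<tau> 0) (simplex_boundary xs) = 0"
    by (rule frag_extend_eq_0) simp
  ultimately show ?case by (simp only: simplex_homotopy.simps(2) chain_boundary_cone diff_0_right) (simp add: cone_def)
next
  case (Suc n)
  let ?e = "simplex_boundary xs"
  have "chain_boundary (frag_extend (simplex_homotopy \<tau> (Suc n)) ?e) =
      frag_extend (\<lambda>ys. frag_of ys - \<tau> ys - frag_extend (simplex_homotopy \<tau> n) (simplex_boundary ys)) ?e"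
    unfolding frag_extend_comp using keys_simplex_boundary[OF Suc.prems] Suc.IH by (intro frag_extend_eq) blast
  also have "\<dots> = ?e - frag_extend \<tau> ?e - frag_extend (simplex_homotopy \<tau> n) (chain_boundary ?e)"
    by (simp add: frag_extend_fun_diff frag_extend_comp flip: frag_expansion)
  finally have "chain_boundary (frag_of xs - \<tau> xs - frag_extend (simplex_homotopy \<tau> (Suc n)) ?e) = 0"
    using chain[OF Suc.prems] by (simp add: frag_extend_diff chain_boundary_boundary del: simplex_homotopy.simps)
  then show ?case
    by (subst simplex_homotopy.simps(2)) (simp add: chain_boundary_cone del: simplex_homotopy.simps, simp add: cone_def)
qed

section \<open>The bar complex as a quotient of the simplex complex\<close>

context group
begin

text \<open>The passage from homogeneous to inhomogeneous simplices. Its fibres on nonempty lists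
  are the orbits of right translation.\<close>

fun bar_word :: "'a list \<Rightarrow> 'a list" where
  "bar_word (x # y # xs) = (x \<otimes> inv y) # bar_word (y # xs)"
| "bar_word xs = []"

text \<open>The homogeneous simplex over a bar word whose last vertex is the identity.\<close>

primrec bar_lift :: "'a list \<Rightarrow> 'a list" where
  "bar_lift [] = [\<one>]"
| "bar_lift (g # gs) = (g \<otimes> hd (bar_lift gs)) # bar_lift gs"

definition bar_chain :: "('a list \<Rightarrow>\<^sub>0 int) \<Rightarrow> ('a list \<Rightarrow>\<^sub>0 int)" where
  "bar_chain = frag_extend (frag_of \<circ> bar_word)"

lemma length_bar_word [simp]: "length (bar_word xs) = length xs - 1"
  by (induction xs rule: bar_word.induct) auto

lemma set_bar_word: "set xs \<subseteq> carrier G \<Longrightarrow> set (bar_word xs) \<subseteq> carrier G"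
  by (induction xs rule: bar_word.induct) auto

lemma nth_bar_word: "Suc i < length xs \<Longrightarrow> bar_word xs ! i = xs ! i \<otimes> inv (xs ! Suc i)"
proof (induction xs arbitrary: i rule: bar_word.induct)
  case (1 x y xs)
  then show ?case by (cases i) auto
qed auto

lemma bar_lift_props:
  assumes "set gs \<subseteq> carrier G"
  shows "bar_lift gs \<noteq> [] \<and> length (bar_lift gs) = Suc (length gs) \<and> set (bar_lift gs) \<subseteq> carrier G \<and>
    bar_word (bar_lift gs) = gs"
  using assms
proof (induction gs)
  case (Cons g gs)
  then obtain y ys where y: "bar_lift gs = y # ys" by (cases "bar_lift gs") auto
  with Cons show ?case by (auto simp: m_assoc)
qed simp

lemma bar_word_mult:
  "set xs \<subseteq> carrier G \<Longrightarrow> l \<in> carrier G \<Longrightarrow> bar_word (map (\<lambda>x. x \<otimes> l) xs) = bar_word xs"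
  by (induction xs rule: bar_word.induct)
     (auto simp: inv_mult_group m_assoc simp flip: m_assoc[of l "inv l"])

lemma bar_lift_word:
  "xs \<noteq> [] \<Longrightarrow> set xs \<subseteq> carrier G \<Longrightarrow> xs = map (\<lambda>x. x \<otimes> last xs) (bar_lift (bar_word xs))"
proof (induction xs rule: bar_word.induct)
  case (1 x y xs)
  define ys where "ys = bar_lift (bar_word (y # xs))"
  have IH: "y # xs = map (\<lambda>z. z \<otimes> last (y # xs)) ys" using 1 by (simp add: ys_def)
  then obtain z zs where ys: "ys = z # zs" by (cases ys) auto
  have z: "z \<in> carrier G" using bar_lift_props[OF set_bar_word, of "y # xs"] 1 ys by (auto simp: ys_def)
  have l: "last (y # xs) \<in> carrier G" using 1(3) last_in_set[of "y # xs"] by auto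
  have yz: "y = z \<otimes> last (y # xs)" using IH ys by simp
  have "x \<otimes> inv y \<otimes> z \<otimes> last (y # xs) = x \<otimes> inv y \<otimes> y"
    using 1(3) z l by (subst (4) yz) (simp add: m_assoc)
  then have "x = (x \<otimes> inv y \<otimes> z) \<otimes> last (y # xs)" using 1(3) by (simp add: m_assoc)
  then show ?case using IH ys ys_def by simp
qed auto

lemma bar_face_word:
  assumes xs: "set xs \<subseteq> carrier G" "length xs = Suc (Suc n)" and i: "i \<le> Suc n"
  shows "bar_word (take i xs @ drop (Suc i) xs) = bar_face G i (bar_word xs)"
proof (rule nth_equalityI)
  have l: "length (take i xs @ drop (Suc i) xs) = Suc n" using xs i by simp
  show "length (bar_word (take i xs @ drop (Suc i) xs)) = length (bar_face G i (bar_word xs))"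
    using xs i by (auto simp: bar_face_def)
  have x: "xs ! k \<in> carrier G" if "k < Suc (Suc n)" for k using xs that nth_mem by fastforce
  fix k assume k: "k < length (bar_word (take i xs @ drop (Suc i) xs))"
  then have kn: "k < n" using l by simp
  then have 1: "bar_word (take i xs @ drop (Suc i) xs) ! k =
      (take i xs @ drop (Suc i) xs) ! k \<otimes> inv ((take i xs @ drop (Suc i) xs) ! Suc k)"
    using l by (intro nth_bar_word) simp
  have nb: "bar_word xs ! m = xs ! m \<otimes> inv (xs ! Suc m)" if "m \<le> n" for m
    using that xs by (intro nth_bar_word) simp
  have ne: "(take i xs @ drop (Suc i) xs) ! m = (if m < i then xs ! m else xs ! Suc m)" if "m \<le> n" for m
    using that xs i by (auto simp: nth_append min_def)
  show "bar_word (take i xs @ drop (Suc i) xs) ! k = bar_face G i (bar_word xs) ! k"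
  proof (cases "i = 0 \<or> i = Suc n")
    case True
    then show ?thesis unfolding 1 using ne[of k] ne[of "Suc k"] kn nb[of k] nb[of "Suc k"] xs
      by (auto simp: bar_face_def nth_tl nth_butlast)
  next
    case False
    then obtain m where m: "i = Suc m" "m < n" using i by (cases i) auto
    have face: "bar_face G i (bar_word xs) ! k =
       (if k < m then bar_word xs ! k else if k = m then bar_word xs ! m \<otimes> bar_word xs ! Suc m else bar_word xs ! Suc k)"
      using m kn xs by (auto simp: bar_face_def nth_append min_def)
    have "xs ! m \<otimes> inv (xs ! Suc m) \<otimes> (xs ! Suc m \<otimes> inv (xs ! Suc (Suc m))) = xs ! m \<otimes> inv (xs ! Suc (Suc m))"
      using x[of m] x[of "Suc m"] x[of "Suc (Suc m)"] m
      by (simp add: m_assoc flip: m_assoc[of "inv (xs ! Suc m)" "xs ! Suc m"])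
    then show ?thesis unfolding 1 face using ne[of k] ne[of "Suc k"] kn nb[of k] nb[of "Suc k"] nb[of m] nb[of "Suc m"] m
      by auto
  qed
qed

lemma bar_chain_simplex_boundary:
  assumes "xs \<in> simplices (Suc (Suc n)) (carrier G)"
  shows "bar_chain (simplex_boundary xs) = bar_boundary (Suc n) G (frag_of (bar_word xs))"
proof -
  have "bar_chain (simplex_boundary xs) = (\<Sum>i<Suc (Suc n). frag_cmul ((- 1) ^ i) (frag_of (bar_word (take i xs @ drop (Suc i) xs))))"
    using assms unfolding bar_chain_def simplex_boundary_sum
    by (simp add: frag_extend_sum comp_def frag_extend_cmul simplices_def del: sum.lessThan_Suc)
  also have "\<dots> = (\<Sum>i<Suc (Suc n). frag_cmul ((- 1) ^ i) (frag_of (bar_face G i (bar_word xs))))"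
    using assms by (intro sum.cong refl) (simp add: bar_face_word[of xs n] simplices_def)
  finally show ?thesis by (simp add: bar_boundary_def lessThan_Suc_atMost)
qed

lemma bar_boundary_diff: "bar_boundary n G (a - b) = bar_boundary n G a - bar_boundary n G b"
  by (simp add: bar_boundary_def frag_extend_diff)

lemma bar_boundary_extend: "bar_boundary n G (frag_extend f c) = frag_extend (\<lambda>x. bar_boundary n G (f x)) c"
  by (rule frag_induction[of c UNIV]) (auto simp: frag_extend_diff bar_boundary_diff, simp add: bar_boundary_def)

lemma bar_chain_boundary:
  assumes "Poly_Mapping.keys c \<subseteq> simplices (Suc (Suc n)) (carrier G)"
  shows "bar_chain (chain_boundary c) = bar_boundary (Suc n) G (bar_chain c)"
  unfolding bar_chain_def frag_extend_comp bar_boundary_extend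
  using assms bar_chain_simplex_boundary[of _ n] by (intro frag_extend_eq) (auto simp: bar_chain_def)

lemma bar_lift_chain:
  assumes "Poly_Mapping.keys z \<subseteq> simplices n (carrier G)"
  shows "Poly_Mapping.keys (frag_extend (frag_of \<circ> bar_lift) z) \<subseteq> simplices (Suc n) (carrier G)"
    "bar_chain (frag_extend (frag_of \<circ> bar_lift) z) = z"
proof -
  show "Poly_Mapping.keys (frag_extend (frag_of \<circ> bar_lift) z) \<subseteq> simplices (Suc n) (carrier G)"
    by (rule keys_frag_extend_subset[OF assms]) (use bar_lift_props in \<open>auto simp: simplices_def\<close>)
  have "bar_chain (frag_extend (frag_of \<circ> bar_lift) z) = frag_extend frag_of z"
    unfolding bar_chain_def frag_extend_comp using assms bar_lift_props
    by (intro frag_extend_eq) (auto simp: simplices_def)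
  then show "bar_chain (frag_extend (frag_of \<circ> bar_lift) z) = z" by (simp flip: frag_expansion)
qed

lemma bar_chain_translate:
  assumes "Poly_Mapping.keys c \<subseteq> simplices n (carrier G)" "l \<in> carrier G"
  shows "bar_chain (frag_extend (frag_of \<circ> map (\<lambda>x. x \<otimes> l)) c) = bar_chain c"
  unfolding bar_chain_def frag_extend_comp
  using assms bar_word_mult by (intro frag_extend_eq) (auto simp: simplices_def)

context
  fixes \<tau> :: "'a list \<Rightarrow> 'a list \<Rightarrow>\<^sub>0 int"
  assumes one: "\<And>xs. xs \<in> simplices 1 (carrier G) \<Longrightarrow> \<tau> xs = frag_of xs"
    and chain: "\<And>n xs. xs \<in> simplices (Suc (Suc n)) (carrier G) \<Longrightarrow> chain_boundary (\<tau> xs) = frag_extend \<tau> (simplex_boundary xs)"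
    and supp: "\<And>n xs. xs \<in> simplices (Suc n) (carrier G) \<Longrightarrow> Poly_Mapping.keys (\<tau> xs) \<subseteq> simplices (Suc n) (carrier G)"
    and equiv: "\<And>n xs l. xs \<in> simplices (Suc n) (carrier G) \<Longrightarrow> l \<in> carrier G \<Longrightarrow>
      \<tau> (map (\<lambda>x. x \<otimes> l) xs) = frag_extend (frag_of \<circ> map (\<lambda>x. x \<otimes> l)) (\<tau> xs)"
begin

lemma keys_simplex_homotopy:
  "xs \<in> simplices (Suc n) (carrier G) \<Longrightarrow> Poly_Mapping.keys (simplex_homotopy \<tau> n xs) \<subseteq> simplices (Suc (Suc n)) (carrier G)"
proof (induction n arbitrary: xs)
  case (Suc n)
  have "xs \<noteq> []" "set xs \<subseteq> carrier G" using Suc.prems by (auto simp: simplices_def)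
  then have "last xs \<in> carrier G" using last_in_set by blast
  moreover have "Poly_Mapping.keys (frag_extend (simplex_homotopy \<tau> n) (simplex_boundary xs)) \<subseteq> simplices (Suc (Suc n)) (carrier G)"
    by (rule keys_frag_extend_subset[OF keys_simplex_boundary[OF Suc.prems] Suc.IH])
  ultimately show ?case using supp[OF Suc.prems] Suc.prems
    unfolding simplex_homotopy.simps by (intro keys_cone keys_diff_subset) auto
qed simp

lemma simplex_homotopy_equivariant:
  assumes l: "l \<in> carrier G"
  shows "xs \<in> simplices (Suc n) (carrier G) \<Longrightarrow>
    simplex_homotopy \<tau> n (map (\<lambda>x. x \<otimes> l) xs) = frag_extend (frag_of \<circ> map (\<lambda>x. x \<otimes> l)) (simplex_homotopy \<tau> n xs)"
proof (induction n arbitrary: xs)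
  case (Suc n)
  let ?r = "\<lambda>x. x \<otimes> l"
  have ne: "xs \<noteq> []" using Suc.prems by (auto simp: simplices_def)
  have "frag_extend (simplex_homotopy \<tau> n) (simplex_boundary (map ?r xs)) =
      frag_extend (\<lambda>ys. frag_extend (frag_of \<circ> map ?r) (simplex_homotopy \<tau> n ys)) (simplex_boundary xs)"
    unfolding simplex_boundary_map frag_extend_comp
  proof (rule frag_extend_eq)
    fix ys assume "ys \<in> Poly_Mapping.keys (simplex_boundary xs)"
    then have "ys \<in> simplices (Suc n) (carrier G)" using keys_simplex_boundary[OF Suc.prems] by blast
    from Suc.IH[OF this] show "frag_extend (simplex_homotopy \<tau> n) ((frag_of \<circ> map ?r) ys) =
        frag_extend (frag_of \<circ> map ?r) (simplex_homotopy \<tau> n ys)"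
      by (simp only: comp_def frag_extend_of)
  qed
  also have "\<dots> = frag_extend (frag_of \<circ> map ?r) (frag_extend (simplex_homotopy \<tau> n) (simplex_boundary xs))"
    by (simp add: frag_extend_comp)
  finally have 1: "frag_extend (simplex_homotopy \<tau> n) (simplex_boundary (map ?r xs)) = \<dots>" .
  have "simplex_homotopy \<tau> (Suc n) (map ?r xs) = cone (?r (last xs)) (frag_extend (frag_of \<circ> map ?r)
      (frag_of xs - \<tau> xs - frag_extend (simplex_homotopy \<tau> n) (simplex_boundary xs)))"
    using ne by (simp add: 1 last_map equiv[OF Suc.prems l] frag_extend_diff)
  also have "\<dots> = frag_extend (frag_of \<circ> map ?r) (simplex_homotopy \<tau> (Suc n) xs)"
    unfolding simplex_homotopy.simps(2) by (rule cone_map)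
  finally show ?case .
qed simp

text \<open>Lifting the word of \<open>ys\<close> returns a right translate of \<open>ys\<close>;
  \<open>\<tau>\<close> is equivariant and bar chains do not see translations.\<close>

lemma bar_chain_lift_word:
  assumes ys: "ys \<in> simplices (Suc n) (carrier G)"
  shows "bar_chain (\<tau> (bar_lift (bar_word ys))) = bar_chain (\<tau> ys)"
proof -
  define zs where "zs = bar_lift (bar_word ys)"
  have sy: "set ys \<subseteq> carrier G" "ys \<noteq> []" "length ys = Suc n" using ys by (auto simp: simplices_def)
  have zs: "zs \<in> simplices (Suc n) (carrier G)"
    using bar_lift_props[OF set_bar_word[OF sy(1)]] sy by (simp add: zs_def simplices_def)
  have l: "last ys \<in> carrier G" using sy by (meson last_in_set subsetD)
  have "bar_chain (\<tau> ys) = bar_chain (\<tau> (map (\<lambda>x. x \<otimes> last ys) zs))"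
    using bar_lift_word[OF sy(2,1)] by (simp add: zs_def)
  also have "\<dots> = bar_chain (\<tau> zs)"
    unfolding equiv[OF zs l] by (rule bar_chain_translate[OF supp[OF zs] l])
  finally show ?thesis by (simp add: zs_def)
qed

text \<open>An equivariant chain map on homogeneous simplices descends to the bar complex.\<close>

lemma bar_lift_chain_map:
  assumes w: "w \<in> carrier (bar_chain_group (Suc n) G)"
  shows "frag_extend (\<lambda>gs. bar_chain (\<tau> (bar_lift gs))) (bar_boundary (Suc n) G w) =
    bar_boundary (Suc n) G (frag_extend (\<lambda>gs. bar_chain (\<tau> (bar_lift gs))) w)"
proof -
  have kw: "Poly_Mapping.keys w \<subseteq> simplices (Suc n) (carrier G)"
    using w by (auto simp: bar_chain_group_def simplices_def)
  define e where "e = frag_extend (frag_of \<circ> bar_lift) w"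
  note ke = bar_lift_chain(1)[OF kw, folded e_def] and qe = bar_lift_chain(2)[OF kw, folded e_def]
  have kb: "Poly_Mapping.keys (chain_boundary e) \<subseteq> simplices (Suc n) (carrier G)"
    by (rule keys_frag_extend_subset[OF ke keys_simplex_boundary])
  have kt: "Poly_Mapping.keys (frag_extend \<tau> e) \<subseteq> simplices (Suc (Suc n)) (carrier G)"
    by (rule keys_frag_extend_subset[OF ke supp])
  have "frag_extend (\<lambda>gs. bar_chain (\<tau> (bar_lift gs))) (bar_boundary (Suc n) G w) =
      frag_extend (\<lambda>gs. bar_chain (\<tau> (bar_lift gs))) (bar_chain (chain_boundary e))"
    unfolding bar_chain_boundary[OF ke] qe ..
  also have "\<dots> = frag_extend (\<lambda>ys. bar_chain (\<tau> (bar_lift (bar_word ys)))) (chain_boundary e)"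
    by (simp add: bar_chain_def frag_extend_comp)
  also have "\<dots> = frag_extend (\<lambda>ys. bar_chain (\<tau> ys)) (chain_boundary e)"
    using kb bar_chain_lift_word by (intro frag_extend_eq) blast
  also have "\<dots> = bar_chain (frag_extend \<tau> (chain_boundary e))"
    unfolding bar_chain_def frag_extend_comp[of _ \<tau>] ..
  also have "frag_extend \<tau> (chain_boundary e) = frag_extend (\<lambda>xs. chain_boundary (\<tau> xs)) e"
    unfolding frag_extend_comp using ke chain by (intro frag_extend_eq) (metis subsetD)
  also have "\<dots> = chain_boundary (frag_extend \<tau> e)" by (simp add: frag_extend_comp)
  also have "bar_chain \<dots> = bar_boundary (Suc n) G (bar_chain (frag_extend \<tau> e))"
    by (rule bar_chain_boundary[OF kt])
  also have "bar_chain (frag_extend \<tau> e) = frag_extend (\<lambda>gs. bar_chain (\<tau> (bar_lift gs))) w"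
    by (simp add: e_def bar_chain_def frag_extend_comp)
  finally show ?thesis .
qed

text \<open>The homotopy between \<open>\<tau>\<close> and the identity is equivariant, so it
  descends to bar chains and shows that the induced map does not change homology classes.\<close>

theorem bar_homotopy:
  assumes z: "z \<in> bar_cycles (Suc m) G"
  shows "z - frag_extend (\<lambda>gs. bar_chain (\<tau> (bar_lift gs))) z \<in> bar_boundaries (Suc m) G"
proof -
  have kz: "Poly_Mapping.keys z \<subseteq> simplices (Suc m) (carrier G)" and bz: "bar_boundary (Suc m) G z = 0"
    using z by (auto simp: bar_cycles_def bar_chain_group_def simplices_def)
  define e where "e = frag_extend (frag_of \<circ> bar_lift) z"
  note ke = bar_lift_chain(1)[OF kz, folded e_def] and qe = bar_lift_chain(2)[OF kz, folded e_def]
  define w where "w = frag_extend (simplex_homotopy \<tau> (Suc m)) e"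
  have kw: "Poly_Mapping.keys w \<subseteq> simplices (Suc (Suc (Suc m))) (carrier G)"
    unfolding w_def by (rule keys_frag_extend_subset[OF ke keys_simplex_homotopy])
  have "chain_boundary w = frag_extend (\<lambda>xs. frag_of xs - \<tau> xs - frag_extend (simplex_homotopy \<tau> m) (simplex_boundary xs)) e"
    unfolding w_def frag_extend_comp
  proof (rule frag_extend_eq)
    fix xs assume "xs \<in> Poly_Mapping.keys e"
    then have "xs \<in> simplices (Suc (Suc m)) (carrier G)" using ke by blast
    then show "chain_boundary (simplex_homotopy \<tau> (Suc m) xs) =
      frag_of xs - \<tau> xs - frag_extend (simplex_homotopy \<tau> m) (simplex_boundary xs)"
      by (rule simplex_homotopy_boundary[where A = "carrier G" and \<tau> = \<tau>, rotated 2]) (erule one chain)+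
  qed
  also have "\<dots> = e - frag_extend \<tau> e - frag_extend (simplex_homotopy \<tau> m) (chain_boundary e)"
    by (simp add: frag_extend_fun_diff frag_extend_comp flip: frag_expansion)
  finally have "bar_chain (chain_boundary w) = z - bar_chain (frag_extend \<tau> e) - bar_chain (frag_extend (simplex_homotopy \<tau> m) (chain_boundary e))"
    by (simp add: bar_chain_def frag_extend_diff qe[unfolded bar_chain_def])
  \<comment> \<open>The lift of a cycle need not be a cycle. By equivariance, however, this term
    depends only on the bar image of its boundary, which is zero.\<close>
  moreover have "bar_chain (frag_extend (simplex_homotopy \<tau> m) (chain_boundary e)) = 0"
  proof -
    have kb: "Poly_Mapping.keys (chain_boundary e) \<subseteq> simplices (Suc m) (carrier G)"
      by (rule keys_frag_extend_subset[OF ke keys_simplex_boundary])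
    have "bar_chain (frag_extend (simplex_homotopy \<tau> m) (chain_boundary e)) =
        frag_extend (\<lambda>ys. bar_chain (simplex_homotopy \<tau> m (bar_lift (bar_word ys)))) (chain_boundary e)"
      unfolding bar_chain_def frag_extend_comp[of _ "simplex_homotopy \<tau> m"]
    proof (rule frag_extend_eq)
      fix ys assume "ys \<in> Poly_Mapping.keys (frag_extend simplex_boundary e)"
      then have ys: "ys \<in> simplices (Suc m) (carrier G)" using kb by blast
      define zs where "zs = bar_lift (bar_word ys)"
      have sy: "set ys \<subseteq> carrier G" "ys \<noteq> []" "length ys = Suc m" using ys by (auto simp: simplices_def)
      have zs: "zs \<in> simplices (Suc m) (carrier G)"
        using bar_lift_props[OF set_bar_word[OF sy(1)]] sy by (simp add: zs_def simplices_def)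
      have l: "last ys \<in> carrier G" using sy by (meson last_in_set subsetD)
      have "bar_chain (simplex_homotopy \<tau> m ys) = bar_chain (simplex_homotopy \<tau> m (map (\<lambda>x. x \<otimes> last ys) zs))"
        using bar_lift_word[OF sy(2,1)] by (simp add: zs_def)
      also have "\<dots> = bar_chain (simplex_homotopy \<tau> m zs)"
        unfolding simplex_homotopy_equivariant[OF l zs] by (rule bar_chain_translate[OF keys_simplex_homotopy[OF zs] l])
      finally show "frag_extend (frag_of \<circ> bar_word) (simplex_homotopy \<tau> m ys) =
          frag_extend (frag_of \<circ> bar_word) (simplex_homotopy \<tau> m (bar_lift (bar_word ys)))"
        by (simp add: bar_chain_def zs_def)
    qed
    also have "\<dots> = frag_extend (\<lambda>gs. bar_chain (simplex_homotopy \<tau> m (bar_lift gs))) (bar_chain (chain_boundary e))"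
      by (simp add: bar_chain_def frag_extend_comp)
    also have "bar_chain (chain_boundary e) = 0"
      using bar_chain_boundary[OF ke] by (simp add: qe bz)
    finally show ?thesis by simp
  qed
  moreover have "bar_chain (frag_extend \<tau> e) = frag_extend (\<lambda>gs. bar_chain (\<tau> (bar_lift gs))) z"
    by (simp add: e_def bar_chain_def frag_extend_comp)
  moreover have "bar_chain (chain_boundary w) = bar_boundary (Suc (Suc m)) G (bar_chain w)"
    by (rule bar_chain_boundary[OF kw])
  moreover have "bar_chain w \<in> carrier (bar_chain_group (Suc (Suc m)) G)"
  proof -
    have "Poly_Mapping.keys (bar_chain w) \<subseteq> simplices (Suc (Suc m)) (carrier G)"
      unfolding bar_chain_def
      by (rule keys_frag_extend_subset[OF kw]) (use set_bar_word in \<open>auto simp: simplices_def\<close>)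
    then show ?thesis by (simp add: bar_chain_group_def simplices_def)
  qed
  ultimately show ?thesis unfolding bar_boundaries_def by (simp add: image_iff) metis
qed

end

lemma bar_boundaries_closed:
  "0 \<in> bar_boundaries n G" "a \<in> bar_boundaries n G \<Longrightarrow> b \<in> bar_boundaries n G \<Longrightarrow> a - b \<in> bar_boundaries n G"
proof -
  have 0: "bar_boundary (Suc n) G 0 = 0" by (simp add: bar_boundary_def)
  show "0 \<in> bar_boundaries n G"
    unfolding bar_boundaries_def by (rule image_eqI[of _ _ 0]) (simp_all add: 0 bar_chain_group_def)
  assume "a \<in> bar_boundaries n G" "b \<in> bar_boundaries n G"
  then obtain c d where "a = bar_boundary (Suc n) G c" "b = bar_boundary (Suc n) G d"
    "c \<in> carrier (bar_chain_group (Suc n) G)" "d \<in> carrier (bar_chain_group (Suc n) G)"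
    by (auto simp: bar_boundaries_def)
  moreover from this have "c - d \<in> carrier (bar_chain_group (Suc n) G)"
    by (simp add: bar_chain_group_def keys_diff_subset)
  ultimately show "a - b \<in> bar_boundaries n G"
    unfolding bar_boundaries_def by (intro image_eqI[of _ _ "c - d"]) (simp_all add: bar_boundary_diff)
qed

lemma carrier_cycles: "carrier (subgroup_generated (bar_chain_group n G) (bar_cycles n G)) = bar_cycles n G"
proof -
  have "subgroup (bar_cycles n G) (bar_chain_group n G)"
  proof (rule group.subgroupI)
    show "group (bar_chain_group n G)" by (simp add: bar_chain_group_def)
    show "bar_cycles n G \<subseteq> carrier (bar_chain_group n G)" by (auto simp: bar_cycles_def)
    show "bar_cycles n G \<noteq> {}" by (auto simp: bar_cycles_def bar_boundary_def bar_chain_group_def intro!: exI[of _ 0])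
    have m: "bar_boundary n G (- a) = - bar_boundary n G a" for a
      using bar_boundary_diff[of n 0 a] by (simp add: bar_boundary_def split: if_splits)
    show "inv\<^bsub>bar_chain_group n G\<^esub> a \<in> bar_cycles n G" if "a \<in> bar_cycles n G" for a
      using that by (auto simp: bar_cycles_def bar_chain_group_def m)
    show "a \<otimes>\<^bsub>bar_chain_group n G\<^esub> b \<in> bar_cycles n G" if "a \<in> bar_cycles n G" "b \<in> bar_cycles n G" for a b
      using that bar_boundary_diff[of n a "- b"] m[of b] keys_diff_subset[of a _ "- b"]
      by (auto simp: bar_cycles_def bar_chain_group_def)
  qed
  then show ?thesis by (rule subgroup.carrier_subgroup_generated_subgroup)
qed

text \<open>Choose a cycle in every torsion class. If \<open>k\<close> and \<open>l\<close>
  annihilate two classes, then \<open>k * l\<close> annihilates their difference, so by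
  \<open>sep\<close> the choice followed by \<open>rep\<close> is injective. The trivial class keeps
  \<open>T\<close> nonempty, which makes the logarithm of its cardinality nonnegative later
  on.\<close>

lemma torsion_homology_card:
  fixes rep :: "('a list \<Rightarrow>\<^sub>0 int) \<Rightarrow> 'z"
  assumes fin: "finite (range rep)"
    and sep: "\<And>z z' k. z \<in> bar_cycles j G \<Longrightarrow> z' \<in> bar_cycles j G \<Longrightarrow> 0 < k \<Longrightarrow>
      frag_cmul k (z - z') \<in> bar_boundaries j G \<Longrightarrow> rep z = rep z' \<Longrightarrow> z - z' \<in> bar_boundaries j G"
  defines "T \<equiv> torsion_subgroup (integral_homology j G)"
  shows "finite T" "T \<noteq> {}" "card T \<le> card (range rep)"
proof -
  let ?A = "subgroup_generated (bar_chain_group j G) (bar_cycles j G)"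
  let ?B = "bar_boundaries j G"
  have mult: "x \<otimes>\<^bsub>?A\<^esub> y = x + y" "x \<otimes>\<^bsub>bar_chain_group j G\<^esub> y = x + y" for x y
    by (simp_all add: subgroup_generated_def bar_chain_group_def)
  have B: "0 \<in> ?B" "\<And>a b. a \<in> ?B \<Longrightarrow> b \<in> ?B \<Longrightarrow> a - b \<in> ?B" using bar_boundaries_closed by auto
  have Bm: "- a \<in> ?B" if "a \<in> ?B" for a using B(2)[OF B(1) that] by simp
  have Bp: "a + b \<in> ?B" if "a \<in> ?B" "b \<in> ?B" for a b using B(2)[OF that(1) Bm[OF that(2)]] by simp
  have Bk: "frag_cmul k a \<in> ?B" if "a \<in> ?B" for k a
    by (rule frag_closure_minus_cmul[where P = "\<lambda>x. x \<in> ?B"]) (use B that in auto)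
  have coset: "?B #>\<^bsub>?A\<^esub> z = {b + z | b. b \<in> ?B}" for z by (auto simp: r_coset_def mult)
  have mem: "x \<in> ?B #>\<^bsub>?A\<^esub> z \<longleftrightarrow> x - z \<in> ?B" for x z
    unfolding coset by (auto intro: exI[of _ "x - z"])
  have pw: "(?B #>\<^bsub>?A\<^esub> z) [^]\<^bsub>?A Mod ?B\<^esub> k = ?B #>\<^bsub>?A\<^esub> frag_cmul (int k) z" for z and k :: nat
  proof (induction k)
    case 0
    show ?case by (auto simp: nat_pow_def coset)
  next
    case (Suc k)
    have "(?B #>\<^bsub>?A\<^esub> z) [^]\<^bsub>?A Mod ?B\<^esub> Suc k = (?B #>\<^bsub>?A\<^esub> frag_cmul (int k) z) <#>\<^bsub>?A\<^esub> (?B #>\<^bsub>?A\<^esub> z)"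
      using Suc by (simp add: nat_pow_def)
    also have "\<dots> = {b + (frag_cmul (int k) z + z) | b. b \<in> ?B}"
    proof
      show "(?B #>\<^bsub>?A\<^esub> frag_cmul (int k) z) <#>\<^bsub>?A\<^esub> (?B #>\<^bsub>?A\<^esub> z) \<subseteq> {b + (frag_cmul (int k) z + z) | b. b \<in> ?B}"
      proof
        fix x assume "x \<in> (?B #>\<^bsub>?A\<^esub> frag_cmul (int k) z) <#>\<^bsub>?A\<^esub> (?B #>\<^bsub>?A\<^esub> z)"
        then obtain b c where "b \<in> ?B" "c \<in> ?B" "x = (b + frag_cmul (int k) z) + (c + z)"
          by (auto simp: set_mult_def mult coset)
        then show "x \<in> {b + (frag_cmul (int k) z + z) | b. b \<in> ?B}"
          using Bp[of b c] by (auto intro!: exI[of _ "b + c"] simp: algebra_simps)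
      qed
      show "{b + (frag_cmul (int k) z + z) | b. b \<in> ?B} \<subseteq> (?B #>\<^bsub>?A\<^esub> frag_cmul (int k) z) <#>\<^bsub>?A\<^esub> (?B #>\<^bsub>?A\<^esub> z)"
      proof
        fix x assume "x \<in> {b + (frag_cmul (int k) z + z) | b. b \<in> ?B}"
        then obtain b where b: "b \<in> ?B" "x = (b + frag_cmul (int k) z) + z" by (auto simp: add.assoc)
        moreover have "z \<in> ?B #>\<^bsub>?A\<^esub> z" using B(1) by (simp add: mem)
        moreover have "b + frag_cmul (int k) z \<in> ?B #>\<^bsub>?A\<^esub> frag_cmul (int k) z" using b by (simp add: mem)
        ultimately show "x \<in> (?B #>\<^bsub>?A\<^esub> frag_cmul (int k) z) <#>\<^bsub>?A\<^esub> (?B #>\<^bsub>?A\<^esub> z)"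
          by (auto simp: set_mult_def mult)
      qed
    qed
    also have "frag_cmul (int k) z + z = frag_cmul (int (Suc k)) z"
      using frag_cmul_distrib[of "int k" 1 z] by (simp add: add.commute)
    finally show ?case by (simp add: coset)
  qed
  have H: "integral_homology j G = ?A Mod ?B" by (simp add: integral_homology_def)
  have carH: "carrier (?A Mod ?B) = (\<lambda>z. ?B #>\<^bsub>?A\<^esub> z) ` bar_cycles j G"
    unfolding carrier_FactGroup carrier_cycles ..
  have "\<exists>z. x = ?B #>\<^bsub>?A\<^esub> z \<and> z \<in> bar_cycles j G \<and> (\<exists>k>0. frag_cmul k z \<in> ?B)" if x: "x \<in> T" for x
  proof -
    obtain k :: nat and z where k: "k > 0" "x [^]\<^bsub>?A Mod ?B\<^esub> k = ?B" "x = ?B #>\<^bsub>?A\<^esub> z" "z \<in> bar_cycles j G"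
      using x by (auto simp: T_def torsion_subgroup_def H carH)
    have "frag_cmul (int k) z \<in> ?B #>\<^bsub>?A\<^esub> frag_cmul (int k) z" using B(1) by (simp add: mem)
    also have "\<dots> = ?B" using k pw by simp
    finally show ?thesis using k by (intro exI[of _ z] conjI exI[of _ "int k"]) auto
  qed
  then obtain c where c: "\<And>x. x \<in> T \<Longrightarrow> x = ?B #>\<^bsub>?A\<^esub> c x \<and> c x \<in> bar_cycles j G \<and> (\<exists>k>0. frag_cmul k (c x) \<in> ?B)"
    by metis
  have inj: "inj_on (\<lambda>x. rep (c x)) T"
  proof (rule inj_onI)
    fix x y assume xy: "x \<in> T" "y \<in> T" "rep (c x) = rep (c y)"
    obtain k l where kl: "k > 0" "frag_cmul k (c x) \<in> ?B" "l > 0" "frag_cmul l (c y) \<in> ?B" using c xy by blast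
    have "frag_cmul (k * l) (c x - c y) = frag_cmul l (frag_cmul k (c x)) - frag_cmul k (frag_cmul l (c y))"
      by (rule poly_mapping_eqI) (simp add: lookup_minus algebra_simps)
    moreover have "frag_cmul l (frag_cmul k (c x)) - frag_cmul k (frag_cmul l (c y)) \<in> ?B" by (intro B(2) Bk kl)
    ultimately have "frag_cmul (k * l) (c x - c y) \<in> ?B" by (simp only:)
    then have d: "c x - c y \<in> ?B" using sep[of "c x" "c y" "k * l"] c xy kl by simp
    have "w - c x \<in> ?B \<longleftrightarrow> w - c y \<in> ?B" for w
      using Bp[OF _ d, of "w - c x"] B(2)[OF _ d, of "w - c y"] by auto
    then have "?B #>\<^bsub>?A\<^esub> c x = ?B #>\<^bsub>?A\<^esub> c y" by (auto simp: mem)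
    then show "x = y" using c xy by metis
  qed
  show "finite T" by (rule inj_on_finite[OF inj _ fin]) auto
  show "card T \<le> card (range rep)" by (rule card_inj_on_le[OF inj _ fin]) auto
  have "?B #>\<^bsub>?A\<^esub> 0 = ?B" using B(1) by (auto simp: coset)
  moreover have "0 \<in> bar_cycles j G" by (simp add: bar_cycles_def bar_boundary_def bar_chain_group_def)
  ultimately have "?B \<in> T" using pw[of 0 1]
    by (auto simp: T_def torsion_subgroup_def H carH intro!: exI[of _ 1] image_eqI[of _ _ 0])
  then show "T \<noteq> {}" by blast
qed

end

section \<open>Paths and strips\<close>

text \<open>The sum from \<open>0\<close> to \<open>j\<close>, oriented like an integral, since the
  exponent of the stable letter may be negative.\<close>

definition ssum :: "(int \<Rightarrow> 'c::ab_group_add) \<Rightarrow> int \<Rightarrow> 'c" where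
  "ssum g j = (if 0 \<le> j then sum g {0..<j} else - sum g {j..<0})"

lemma ssum_0 [simp]: "ssum g 0 = 0"
  by (simp add: ssum_def)

lemma ssum_step: "ssum g (j + 1) = ssum g j + g j"
proof (cases "0 \<le> j")
  case True
  then have "{0..<j + 1} = insert j {0..<j}" by auto
  then show ?thesis using True by (simp add: ssum_def add.commute)
next
  case False
  then have "{j..<0} = insert j {j + 1..<0}" by auto
  then have "ssum g j = - (g j + sum g {j + 1..<0})" using False by (simp add: ssum_def)
  moreover have "ssum g (j + 1) = - sum g {j + 1..<0}" using False by (cases "j = -1") (simp_all add: ssum_def)
  ultimately show ?thesis by simp
qed

text \<open>The counterpart of \<open>path_unique\<close> for powers of the stable letter.\<close>

lemma ssum_unique:
  assumes 0: "h 0 = 0" and step: "\<And>j. h (j + 1) = h j + g j"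
  shows "h j = ssum g j"
proof (induction j rule: int_induct[where k = 0])
  case base
  show ?case using 0 by simp
next
  case (step1 i)
  then show ?case by (simp add: step ssum_step)
next
  case (step2 i)
  then show ?case using step[of "i - 1"] ssum_step[of g "i - 1"] by simp
qed

lemma ssum_add: "ssum g (i + j) = ssum g i + ssum (\<lambda>l. g (l + i)) j"
proof -
  have "ssum g (i + j) - ssum g i = ssum (\<lambda>l. g (l + i)) j"
  proof (rule ssum_unique[where h = "\<lambda>j. ssum g (i + j) - ssum g i"])
    fix j show "ssum g (i + (j + 1)) - ssum g i = ssum g (i + j) - ssum g i + g (j + i)"
      using ssum_step[of g "i + j"] by (simp add: add.assoc add.commute[of j i])
  qed simp
  then show ?thesis by (simp add: algebra_simps)
qed

lemma ssum_plus: "ssum (\<lambda>l. f l + g l) j = ssum f j + ssum g j"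
  by (rule ssum_unique[symmetric, where h = "\<lambda>j. ssum f j + ssum g j"]) (simp_all add: ssum_step algebra_simps)

lemma ssum_additive:
  assumes "\<And>x y. h (x + y) = h x + h y" shows "h (ssum g j) = ssum (\<lambda>l. h (g l)) j"
proof -
  have "h 0 = 0" using assms[of 0 0] by simp
  then show ?thesis by (intro ssum_unique[where h = "\<lambda>j. h (ssum g j)"]) (simp_all add: ssum_step assms)
qed

context free_by_cyclic
begin

text \<open>\<open>e\<close> and \<open>u\<close> are the weights of the edges labelled by \<open>S\<close> and by the stable letter, and the path
  of \<open>g = a t\<^sup>i\<close> first follows \<open>t\<^sup>i\<close> and then the word of \<open>a\<close>.\<close>

definition edge_path :: "('a \<times> int \<Rightarrow> 'o \<Rightarrow> 'o) \<Rightarrow> ('o \<Rightarrow> 'a \<Rightarrow> 'c::ab_group_add) \<Rightarrow> ('o \<Rightarrow> 'c) \<Rightarrow> 'a \<times> int \<Rightarrow> 'o \<Rightarrow> 'c" where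
  "edge_path act e u g x = ssum (\<lambda>l. u (act (tpow l) x)) (snd g) + path act e (fst g) (act (tpow (snd g)) x)"

text \<open>The boundary of the cell at \<open>v\<close> for the relation
  \<open>t s = \<phi>(s) t\<close>: forward along \<open>s\<close> and \<open>t\<close>, back along
  \<open>\<phi>(s)\<close> and \<open>t\<close>.\<close>

definition relator :: "('a \<times> int \<Rightarrow> 'o \<Rightarrow> 'o) \<Rightarrow> ('o \<Rightarrow> 'a \<Rightarrow> 'c::ab_group_add) \<Rightarrow> ('o \<Rightarrow> 'c) \<Rightarrow> 'o \<Rightarrow> 'a \<Rightarrow> 'c" where
  "relator act e u v s = e v s + u (act (emb s) v) - u v - path act e (\<phi> s) (act (tpow 1) v)"

text \<open>The strip of \<open>2\<close>-cells between the path of \<open>h \<otimes> g\<close> and the concatenation of the paths of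
  \<open>g\<close> and \<open>h\<close>; \<open>c\<close> weighs the cells.\<close>

definition strip :: "('a \<times> int \<Rightarrow> 'o \<Rightarrow> 'o) \<Rightarrow> ('o \<Rightarrow> 'a \<Rightarrow> 'c::ab_group_add) \<Rightarrow> 'a \<times> int \<Rightarrow> 'a \<times> int \<Rightarrow> 'o \<Rightarrow> 'c" where
  "strip act c g h x = ssum (\<lambda>l. path act c (autpow l (fst g)) (act (tpow (l + snd g)) x)) (snd h)"

lemma fst_in_F [simp]: "g \<in> carrier G \<Longrightarrow> fst g \<in> carrier F"
  by (auto simp: carrier_G)

context
  fixes act :: "'a \<times> int \<Rightarrow> 'o \<Rightarrow> 'o" and \<Omega> :: "'o set"
  assumes act: "action act \<Omega>"
begin

lemma act_closed [simp]: "g \<in> carrier G \<Longrightarrow> v \<in> \<Omega> \<Longrightarrow> act g v \<in> \<Omega>"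
  by (rule actionD(2)[OF act])

lemma act_shift:
  assumes "g \<in> carrier G" "x \<in> \<Omega>"
  shows "act (tpow l) (act g x) = act (emb (autpow l (fst g))) (act (tpow (l + snd g)) x)"
proof -
  have "tpow l \<otimes>\<^bsub>G\<^esub> g = emb (autpow l (fst g)) \<otimes>\<^bsub>G\<^esub> tpow (l + snd g)"
    using assms by (auto simp: tpow_def emb_def mult_G carrier_G)
  then show ?thesis using actionD(3)[OF act] assms by simp
qed

lemma act_shift_emb:
  assumes "a \<in> carrier F" "v \<in> \<Omega>"
  shows "act (tpow l) (act (emb a) v) = act (emb (autpow l a)) (act (tpow l) v)"
  using act_shift[OF emb_closed[OF assms(1)] assms(2), of l] by (simp add: emb_def)

lemma act_tpow_add: "x \<in> \<Omega> \<Longrightarrow> act (tpow i) (act (tpow j) x) = act (tpow (i + j)) x"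
  using actionD(3)[OF act] by (simp add: tpow_add)

text \<open>The cells along the word of \<open>a\<close> form a row in which the inner stable edges
  cancel; the outer boundary is left.\<close>

lemma path_relator:
  fixes e :: "'o \<Rightarrow> 'a \<Rightarrow> 'c::ab_group_add"
  assumes "a \<in> carrier F" "v \<in> \<Omega>"
  shows "path act (relator act e u) a v =
    path act e a v + u (act (emb a) v) - u v - path act e (autpow 1 a) (act (tpow 1) v)"
proof (rule path_unique[OF act, symmetric,
    where \<Psi> = "\<lambda>a v. path act e a v + u (act (emb a) v) - u v - path act e (autpow 1 a) (act (tpow 1) v)"])
  fix a b v assume ab: "a \<in> carrier F" "b \<in> carrier F" "v \<in> \<Omega>"
  have alg: "(A + B) + X' - V - (C + D) = (A + Y - V - C) + (B + X' - Y - D)" for A B C D X' Y V :: 'c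
    by (simp add: algebra_simps)
  have m: "path act e (autpow 1 (a \<otimes> b)) (act (tpow 1) v) = path act e (autpow 1 b) (act (tpow 1) v) +
      path act e (autpow 1 a) (act (emb (autpow 1 b)) (act (tpow 1) v))"
    unfolding autpow_mult[OF ab(1,2)] using ab by (intro path_mult[OF act]) auto
  show "path act e (a \<otimes> b) v + u (act (emb (a \<otimes> b)) v) - u v - path act e (autpow 1 (a \<otimes> b)) (act (tpow 1) v) =
      (path act e b v + u (act (emb b) v) - u v - path act e (autpow 1 b) (act (tpow 1) v)) +
      (path act e a (act (emb b) v) + u (act (emb a) (act (emb b) v)) - u (act (emb b) v)
       - path act e (autpow 1 a) (act (tpow 1) (act (emb b) v)))"
    unfolding act_emb_emb[OF act ab] path_mult[OF act ab] m act_shift_emb[OF ab(2,3)]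
    by (rule alg)
qed (use assms in \<open>auto simp: relator_def path_basis[OF act] autpow_1\<close>)

text \<open>The powers of \<open>t\<close> in \<open>h\<close> are moved past \<open>fst g\<close>
  one at a time. Each move sweeps out one row of cells, and adjacent rows cancel along their common
  side.\<close>

lemma edge_path_mult:
  assumes g: "g \<in> carrier G" and h: "h \<in> carrier G" and x: "x \<in> \<Omega>"
  shows "edge_path act e u h (act g x) - edge_path act e u (h \<otimes>\<^bsub>G\<^esub> g) x + edge_path act e u g x =
    strip act (relator act e u) g h x"
proof -
  define w where "w l = act (tpow (l + snd g)) x" for l
  define y where "y l = act (emb (autpow l (fst g))) (w l)" for l
  have w: "w l \<in> \<Omega>" for l using x by (simp add: w_def)
  have y: "act (tpow l) (act g x) = y l" for l using act_shift[OF g x] by (simp add: y_def w_def)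
  have step: "act (tpow 1) (w l) = w (l + 1)" for l
    using act_tpow_add[OF x, of 1 "l + snd g"] by (simp add: w_def algebra_simps)
  have r: "path act (relator act e u) (autpow l (fst g)) (w l) =
      path act e (autpow l (fst g)) (w l) + u (y l) - u (w l) - path act e (autpow (l + 1) (fst g)) (w (l + 1))" for l
    using path_relator[of "autpow l (fst g)" "w l" e u] autpow_add[of "fst g" 1 l] g w step
    by (simp add: y_def add.commute)
  have "strip act (relator act e u) g h x =
      ssum (\<lambda>l. path act e (autpow l (fst g)) (w l) + u (y l) - u (w l) - path act e (autpow (l + 1) (fst g)) (w (l + 1))) (snd h)"
    by (simp only: strip_def r flip: w_def)
  also have "\<dots> = ssum (\<lambda>l. u (y l)) (snd h) - ssum (\<lambda>l. u (w l)) (snd h)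
      - path act e (autpow (snd h) (fst g)) (w (snd h)) + path act e (autpow 0 (fst g)) (w 0)"
    by (rule ssum_unique[symmetric, where h = "\<lambda>j. ssum (\<lambda>l. u (y l)) j - ssum (\<lambda>l. u (w l)) j
      - path act e (autpow j (fst g)) (w j) + path act e (autpow 0 (fst g)) (w 0)"])
      (simp_all add: ssum_step algebra_simps)
  finally have 1: "strip act (relator act e u) g h x = \<dots>" .
  have "edge_path act e u (h \<otimes>\<^bsub>G\<^esub> g) x =
     ssum (\<lambda>l. u (act (tpow l) x)) (snd g + snd h) + path act e (fst h \<otimes> autpow (snd h) (fst g)) (w (snd h))"
    by (simp add: edge_path_def mult_G w_def add.commute)
  also have "\<dots> = ssum (\<lambda>l. u (act (tpow l) x)) (snd g) + ssum (\<lambda>l. u (w l)) (snd h) +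
     (path act e (autpow (snd h) (fst g)) (w (snd h)) + path act e (fst h) (y (snd h)))"
    using g h w by (simp add: ssum_add path_mult[OF act] w_def y_def)
  finally show ?thesis
    using g by (simp add: 1) (simp add: edge_path_def y, simp add: w_def)
qed

text \<open>The strips over the four faces of a tetrahedron cancel already as chains of cells. This
  allows the chain map below to be zero from dimension three on.\<close>

lemma strip_cocycle:
  assumes g: "g \<in> carrier G" and h: "h \<in> carrier G" and k: "k \<in> carrier G" and x: "x \<in> \<Omega>"
  shows "strip act c h k (act g x) - strip act c (h \<otimes>\<^bsub>G\<^esub> g) k x + strip act c g (k \<otimes>\<^bsub>G\<^esub> h) x - strip act c g h x = 0"
proof -
  define w where "w l = act (tpow (l + snd g)) x" for l
  have w: "w l \<in> \<Omega>" for l using x by (simp add: w_def)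
  have y: "act (tpow l) (act g x) = act (emb (autpow l (fst g))) (w l)" for l
    using act_shift[OF g x] by (simp add: w_def)
  let ?P = "\<lambda>l. path act c (autpow (l + snd h) (fst g)) (w (l + snd h))"
  let ?Q = "\<lambda>l. path act c (autpow l (fst h)) (act (emb (autpow (l + snd h) (fst g))) (w (l + snd h)))"
  have PQ: "path act c (autpow l (fst (h \<otimes>\<^bsub>G\<^esub> g))) (act (tpow (l + snd (h \<otimes>\<^bsub>G\<^esub> g))) x) = ?P l + ?Q l" for l
  proof -
    have "autpow l (fst (h \<otimes>\<^bsub>G\<^esub> g)) = autpow l (fst h) \<otimes> autpow (l + snd h) (fst g)"
      using g h by (simp add: mult_G autpow_add)
    moreover have "act (tpow (l + snd (h \<otimes>\<^bsub>G\<^esub> g))) x = w (l + snd h)"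
      by (simp add: w_def mult_G add.assoc)
    ultimately show ?thesis using g h w by (simp add: path_mult[OF act])
  qed
  have "strip act c (h \<otimes>\<^bsub>G\<^esub> g) k x = ssum (\<lambda>l. ?P l + ?Q l) (snd k)"
    unfolding strip_def PQ ..
  also have "\<dots> = ssum ?P (snd k) + ssum ?Q (snd k)" by (rule ssum_plus)
  finally have 1: "strip act c (h \<otimes>\<^bsub>G\<^esub> g) k x = \<dots>" .
  have 2: "strip act c g (k \<otimes>\<^bsub>G\<^esub> h) x = strip act c g h x + ssum ?P (snd k)"
    using ssum_add[of "\<lambda>l. path act c (autpow l (fst g)) (w l)" "snd h" "snd k"]
    by (simp add: strip_def mult_G w_def add.commute)
  have 3: "strip act c h k (act g x) = ssum ?Q (snd k)"
    unfolding strip_def y ..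
  show ?thesis unfolding 1 2 3 by simp
qed

lemma edge_path_telescope:
  assumes g: "g \<in> carrier G" and x: "x \<in> \<Omega>"
    and e: "\<And>v s. v \<in> \<Omega> \<Longrightarrow> s \<in> S \<Longrightarrow> e v s = q (act (emb s) v) - q v" and u: "\<And>v. v \<in> \<Omega> \<Longrightarrow> u v = q (act (tpow 1) v) - q v"
  shows "edge_path act e u g x = q (act g x) - q x"
proof -
  have u': "u (act (tpow l) x) = q (act (tpow (l + 1)) x) - q (act (tpow l) x)" for l
    using u[of "act (tpow l) x"] x act_tpow_add[OF x, of 1 l] by (simp add: add.commute)
  have s: "q (act (tpow j) x) - q x = ssum (\<lambda>l. u (act (tpow l) x)) j" for j
    unfolding u' using actionD(1)[OF act x]
    by (intro ssum_unique[where h = "\<lambda>j. q (act (tpow j) x) - q x"]) (simp_all add: tpow_0)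
  have "path act e (fst g) (act (tpow (snd g)) x) = q (act (emb (fst g)) (act (tpow (snd g)) x)) - q (act (tpow (snd g)) x)"
    using g x e by (intro path_telescope[OF act]) auto
  moreover have "act (emb (fst g)) (act (tpow (snd g)) x) = act g x"
    using g x G_decompose[of "fst g" "snd g"] actionD(3)[OF act] by simp
  ultimately show ?thesis unfolding edge_path_def s[symmetric] by simp
qed

lemma relator_telescope:
  assumes s: "s \<in> S" and v: "v \<in> \<Omega>"
    and e: "\<And>v s. v \<in> \<Omega> \<Longrightarrow> s \<in> S \<Longrightarrow> e v s = q (act (emb s) v) - q v" and u: "\<And>v. v \<in> \<Omega> \<Longrightarrow> u v = q (act (tpow 1) v) - q v"
  shows "relator act e u v s = 0"
proof -
  have "path act e (\<phi> s) (act (tpow 1) v) = q (act (emb (\<phi> s)) (act (tpow 1) v)) - q (act (tpow 1) v)"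
    using s v e by (intro path_telescope[OF act]) auto
  moreover have "act (tpow 1) (act (emb s) v) = act (emb (\<phi> s)) (act (tpow 1) v)"
    using act_shift_emb[of s v 1] s v by (simp add: autpow_1)
  ultimately show ?thesis using s v by (simp add: relator_def e u)
qed

end

context
  fixes act :: "'a \<times> int \<Rightarrow> 'o \<Rightarrow> 'o" and \<Omega> :: "'o set" and act' :: "'a \<times> int \<Rightarrow> 'p \<Rightarrow> 'p" and \<Omega>' :: "'p set"
    and p :: "'o \<Rightarrow> 'p" and h :: "'c::ab_group_add \<Rightarrow> 'd::ab_group_add"
    and e :: "'o \<Rightarrow> 'a \<Rightarrow> 'c" and e' :: "'p \<Rightarrow> 'a \<Rightarrow> 'd"
  assumes act: "action act \<Omega>" and act': "action act' \<Omega>'"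
    and p: "\<And>v. v \<in> \<Omega> \<Longrightarrow> p v \<in> \<Omega>'" "\<And>g v. g \<in> carrier G \<Longrightarrow> v \<in> \<Omega> \<Longrightarrow> p (act g v) = act' g (p v)"
    and h: "\<And>x y. h (x + y) = h x + h y"
    and e: "\<And>v s. v \<in> \<Omega> \<Longrightarrow> s \<in> S \<Longrightarrow> e' (p v) s = h (e v s)"
begin

text \<open>Naturality in the space, through \<open>p\<close>, and in the coefficients, through
  \<open>h\<close>, in one statement. Boundaries, supports, translations and the projection to
  cosets are all instances.\<close>

lemma path_map:
  assumes a: "a \<in> carrier F" "v \<in> \<Omega>"
  shows "path act' e' a (p v) = h (path act e a v)"
proof -
  have "path act' e' a (p v) = path act (\<lambda>v s. e' (p v) s) a v"
    by (rule path_equivariant[where p = p and e = e', OF act act' p a, symmetric])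
  also have "\<dots> = path act (\<lambda>v s. h (e v s)) a v"
    by (rule path_cong[OF act _ a]) (simp add: e)
  also have "\<dots> = h (path act e a v)" by (rule path_additive[where h = h and e = e, OF act h a, symmetric])
  finally show ?thesis .
qed

lemma strip_map:
  assumes "g \<in> carrier G" "x \<in> \<Omega>"
  shows "strip act' e' g k (p x) = h (strip act e g k x)"
proof -
  have "path act' e' (autpow l (fst g)) (act' (tpow (l + snd g)) (p x)) = h (path act e (autpow l (fst g)) (act (tpow (l + snd g)) x))" for l
    using assms path_map[of "autpow l (fst g)" "act (tpow (l + snd g)) x"] actionD(2)[OF act] by (simp add: p)
  then show ?thesis unfolding strip_def by (simp add: ssum_additive[of h, OF h])
qed

context
  fixes u :: "'o \<Rightarrow> 'c" and u' :: "'p \<Rightarrow> 'd"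
  assumes u: "\<And>v. v \<in> \<Omega> \<Longrightarrow> u' (p v) = h (u v)"
begin

lemma edge_path_map:
  assumes "g \<in> carrier G" "x \<in> \<Omega>"
  shows "edge_path act' e' u' g (p x) = h (edge_path act e u g x)"
proof -
  have "path act' e' (fst g) (act' (tpow (snd g)) (p x)) = h (path act e (fst g) (act (tpow (snd g)) x))"
    using assms path_map[of "fst g" "act (tpow (snd g)) x"] actionD(2)[OF act] by (simp add: p)
  moreover have "u' (act' (tpow l) (p x)) = h (u (act (tpow l) x))" for l
    using assms u[of "act (tpow l) x"] actionD(2)[OF act] by (simp add: p)
  ultimately show ?thesis unfolding edge_path_def by (simp add: h ssum_additive[of h, OF h])
qed

lemma relator_map:
  assumes "s \<in> S" "v \<in> \<Omega>"
  shows "relator act' e' u' (p v) s = h (relator act e u v s)"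
proof -
  have hd: "h (x - y) = h x - h y" for x y using h[of "x - y" y] by simp
  have "path act' e' (\<phi> s) (act' (tpow 1) (p v)) = h (path act e (\<phi> s) (act (tpow 1) v))"
    using assms path_map[of "\<phi> s" "act (tpow 1) v"] actionD(2)[OF act] by (simp add: p)
  moreover have "u' (act' (emb s) (p v)) = h (u (act (emb s) v))"
    using assms u[of "act (emb s) v"] actionD(2)[OF act] by (simp add: p)
  ultimately show ?thesis using assms unfolding relator_def by (simp add: h hd e u)
qed

end

end

end

text \<open>An additive projection. With it a support statement about edge paths or strips becomes
  an instance of naturality.\<close>

definition restrict_chain :: "'x set \<Rightarrow> ('x \<Rightarrow>\<^sub>0 int) \<Rightarrow> ('x \<Rightarrow>\<^sub>0 int)" where
  "restrict_chain A = frag_extend (\<lambda>x. if x \<in> A then frag_of x else 0)"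

lemma keys_restrict_chain: "Poly_Mapping.keys (restrict_chain A c) \<subseteq> A"
  unfolding restrict_chain_def by (rule keys_frag_extend_subset[of c UNIV]) auto

lemma restrict_chain_id: "Poly_Mapping.keys c \<subseteq> A \<Longrightarrow> restrict_chain A c = c"
proof -
  assume "Poly_Mapping.keys c \<subseteq> A"
  then have "restrict_chain A c = frag_extend frag_of c"
    unfolding restrict_chain_def by (intro frag_extend_eq) auto
  then show ?thesis by (simp flip: frag_expansion)
qed

lemma frag_extend_eq_lookup:
  assumes "\<And>l. l \<in> A \<Longrightarrow> Poly_Mapping.lookup c l = Poly_Mapping.lookup c' l" "\<And>l. l \<notin> A \<Longrightarrow> m l = 0"
  shows "frag_extend m c = frag_extend m c'"
proof -
  have "frag_extend m (c - c') = 0"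
  proof (rule frag_extend_eq_0)
    fix l assume "l \<in> Poly_Mapping.keys (c - c')"
    then have "l \<notin> A" using assms(1)[of l] by (auto simp: in_keys_iff lookup_minus)
    then show "m l = 0" by (rule assms(2))
  qed
  then show ?thesis by (simp add: frag_extend_diff)
qed

lemma lookup_frag_extend_sum:
  assumes A: "finite A" "\<And>x. x \<notin> A \<Longrightarrow> m x = 0"
  shows "Poly_Mapping.lookup (frag_extend m c) l = (\<Sum>x\<in>A. Poly_Mapping.lookup (m x) l * Poly_Mapping.lookup c x)"
  by (rule frag_induction[of c UNIV])
    (use A in \<open>auto simp: frag_extend_diff lookup_minus right_diff_distrib sum_subtractf if_distrib cong: if_cong\<close>)

section \<open>The cellular chain map of a subgroup\<close>

locale free_by_cyclic_subgroup = free_by_cyclic F S \<phi> for F (structure) and S :: "'a set" and \<phi> +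
  fixes H :: "('a \<times> int) set"
  assumes H: "subgroup H G"
begin

abbreviation KH :: "('a \<times> int) monoid" where "KH \<equiv> G\<lparr>carrier := H\<rparr>"

sublocale KH: group KH
  by (rule subgroup.subgroup_is_group[OF H group_G])

abbreviation lmult :: "'a \<times> int \<Rightarrow> 'a \<times> int \<Rightarrow> 'a \<times> int" where "lmult \<equiv> monoid.mult G"
abbreviation cosets_H :: "('a \<times> int) set set" where "cosets_H \<equiv> lcosets\<^bsub>G\<^esub> H"
abbreviation coset :: "'a \<times> int \<Rightarrow> ('a \<times> int) set" where "coset v \<equiv> v <#\<^bsub>G\<^esub> H"

text \<open>The coset \<open>H\<close> gets the base point \<open>\<one>\<close>, so that the
  retraction fixes the elements of \<open>H\<close>.\<close>

definition base_point :: "('a \<times> int) set \<Rightarrow> 'a \<times> int" where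
  "base_point C = (if C = H then \<one>\<^bsub>G\<^esub> else SOME v. v \<in> C)"

text \<open>A retraction of \<open>G\<close> onto \<open>H\<close> that commutes with right
  multiplication by \<open>H\<close>. It moves chains of \<open>G\<close> into simplices of
  \<open>H\<close>.\<close>

definition retract :: "'a \<times> int \<Rightarrow> 'a \<times> int" where
  "retract v = inv\<^bsub>G\<^esub> (base_point (coset v)) \<otimes>\<^bsub>G\<^esub> v"

lemma H_sub: "x \<in> H \<Longrightarrow> x \<in> carrier G"
  using subgroup.subset[OF H] by blast

lemma mult_H: "v \<in> carrier G \<Longrightarrow> l \<in> H \<Longrightarrow> v \<otimes>\<^bsub>G\<^esub> l \<in> carrier G"
  using H_sub by simp

lemma lmult_action: "action lmult (carrier G)"
  by (auto simp: action_def GG.m_assoc)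

lemma coset_action: "action cact cosets_H"
  by (rule cact_action[OF H])

lemma coset_in: "v \<in> carrier G \<Longrightarrow> coset v \<in> cosets_H"
  unfolding LCOSETS_def by blast

lemma coset_lmult: "g \<in> carrier G \<Longrightarrow> v \<in> carrier G \<Longrightarrow> coset (g \<otimes>\<^bsub>G\<^esub> v) = cact g (coset v)"
  by (simp add: cact_def GG.lcos_m_assoc[OF subgroup.subset[OF H]])

lemma coset_H: "l \<in> H \<Longrightarrow> coset l = H"
  using GG.coset_join3[OF H_sub H] by blast

lemma H_in: "H \<in> cosets_H"
  using coset_in[of "\<one>\<^bsub>G\<^esub>"] coset_H[OF subgroup.one_closed[OF H]] by simp

lemma coset_mult_H:
  assumes "v \<in> carrier G" "l \<in> H" shows "coset (v \<otimes>\<^bsub>G\<^esub> l) = coset v"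
  using coset_lmult[OF assms(1) H_sub[OF assms(2)]] coset_H[OF assms(2)] by (simp add: cact_def)

lemma in_cosetE:
  assumes "w \<in> coset v" obtains l where "l \<in> H" "w = v \<otimes>\<^bsub>G\<^esub> l"
  using assms by (auto simp: l_coset_def)

lemma self_in_coset: "v \<in> carrier G \<Longrightarrow> v \<in> coset v"
  using subgroup.one_closed[OF H] unfolding l_coset_def by force

lemma retract_in:
  assumes v: "v \<in> carrier G" shows "retract v \<in> H"
proof -
  have "base_point (coset v) \<in> coset v"
    using self_in_coset[OF v] someI[of "\<lambda>w. w \<in> coset v" v] subgroup.one_closed[OF H] by (auto simp: base_point_def)
  then obtain l where l: "l \<in> H" "base_point (coset v) = v \<otimes>\<^bsub>G\<^esub> l" by (rule in_cosetE)
  then have "retract v = inv\<^bsub>G\<^esub> l"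
    using v H_sub by (simp add: retract_def GG.inv_mult_group GG.m_assoc)
  then show ?thesis using subgroup.m_inv_closed[OF H] l by simp
qed

lemma base_point_closed: "v \<in> carrier G \<Longrightarrow> base_point (coset v) \<in> carrier G"
proof -
  assume v: "v \<in> carrier G"
  have "base_point (coset v) = \<one>\<^bsub>G\<^esub> \<or> base_point (coset v) \<in> coset v"
    using self_in_coset[OF v] someI[of "\<lambda>w. w \<in> coset v" v] by (auto simp: base_point_def)
  then show ?thesis using GG.l_coset_subset_G[OF subgroup.subset[OF H] v] by auto
qed

lemma retract_mult: "v \<in> carrier G \<Longrightarrow> l \<in> H \<Longrightarrow> retract (v \<otimes>\<^bsub>G\<^esub> l) = retract v \<otimes>\<^bsub>G\<^esub> l"
  using H_sub base_point_closed by (simp add: retract_def coset_mult_H GG.m_assoc)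

lemma retract_H: "l \<in> H \<Longrightarrow> retract l = l"
  using H_sub by (simp add: retract_def coset_H base_point_def)

text \<open>The edge from \<open>v\<close> to \<open>s v\<close>, pushed into \<open>H\<close> by
  the retraction.\<close>

definition edge :: "'a \<times> int \<Rightarrow> 'a \<Rightarrow> ('a \<times> int) list \<Rightarrow>\<^sub>0 int" where
  "edge v s = frag_of [retract v, retract (emb s \<otimes>\<^bsub>G\<^esub> v)]"

definition stable_edge :: "'a \<times> int \<Rightarrow> ('a \<times> int) list \<Rightarrow>\<^sub>0 int" where
  "stable_edge v = frag_of [retract v, retract (tpow 1 \<otimes>\<^bsub>G\<^esub> v)]"

text \<open>A filling of the relator, which is a cycle; the apex is chosen so that the filling is
  compatible with right translation.\<close>

definition cell :: "'a \<times> int \<Rightarrow> 'a \<Rightarrow> ('a \<times> int) list \<Rightarrow>\<^sub>0 int" where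
  "cell v s = cone (retract v) (relator lmult edge stable_edge v s)"

text \<open>A chain endomorphism of the complex of simplices that factors through the \<open>2\<close>-dimensional
  complex of paths and strips.\<close>

definition cellular :: "('a \<times> int) list \<Rightarrow> ('a \<times> int) list \<Rightarrow>\<^sub>0 int" where
  "cellular xs = (case xs of [x] \<Rightarrow> frag_of [x]
     | [x, y] \<Rightarrow> edge_path lmult edge stable_edge (y \<otimes>\<^bsub>G\<^esub> inv\<^bsub>G\<^esub> x) x
     | [x, y, z] \<Rightarrow> strip lmult cell (y \<otimes>\<^bsub>G\<^esub> inv\<^bsub>G\<^esub> x) (z \<otimes>\<^bsub>G\<^esub> inv\<^bsub>G\<^esub> y) x
     | _ \<Rightarrow> 0)"

lemma cellular_simps:
  "cellular [x] = frag_of [x]"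
  "cellular [x, y] = edge_path lmult edge stable_edge (y \<otimes>\<^bsub>G\<^esub> inv\<^bsub>G\<^esub> x) x"
  "cellular [x, y, z] = strip lmult cell (y \<otimes>\<^bsub>G\<^esub> inv\<^bsub>G\<^esub> x) (z \<otimes>\<^bsub>G\<^esub> inv\<^bsub>G\<^esub> y) x"
  "cellular (x # y # z # w # ws) = 0"
  by (simp_all add: cellular_def)

lemma cellular_long: "4 \<le> length xs \<Longrightarrow> cellular xs = 0"
  by (cases xs; cases "tl xs"; cases "tl (tl xs)"; cases "tl (tl (tl xs))") (auto simp: cellular_simps)

lemma simplices_cases:
  assumes "xs \<in> simplices (Suc n) H"
  obtains x where "xs = [x]" "x \<in> H" | x y where "xs = [x, y]" "x \<in> H" "y \<in> H"
  | x y z where "xs = [x, y, z]" "x \<in> H" "y \<in> H" "z \<in> H"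
  | x y z w ws where "xs = x # y # z # w # ws" "set xs \<subseteq> H"
  using assms unfolding simplices_def
  by (cases xs; cases "tl xs"; cases "tl (tl xs)"; cases "tl (tl (tl xs))") auto

lemma chain_boundary_edge:
  "chain_boundary (edge v s) = frag_of [retract (emb s \<otimes>\<^bsub>G\<^esub> v)] - frag_of [retract v]"
  "chain_boundary (stable_edge v) = frag_of [retract (tpow 1 \<otimes>\<^bsub>G\<^esub> v)] - frag_of [retract v]"
  by (simp_all add: edge_def stable_edge_def cone_def)

lemma chain_boundary_edge_path:
  assumes g: "g \<in> carrier G" and v: "v \<in> carrier G"
  shows "chain_boundary (edge_path lmult edge stable_edge g v) = frag_of [retract (g \<otimes>\<^bsub>G\<^esub> v)] - frag_of [retract v]"
proof -
  have "chain_boundary (edge_path lmult edge stable_edge g v) =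
      edge_path lmult (\<lambda>v s. chain_boundary (edge v s)) (\<lambda>v. chain_boundary (stable_edge v)) g v"
    by (rule edge_path_map[where p = "\<lambda>v. v" and h = chain_boundary, OF lmult_action lmult_action, symmetric])
      (simp_all add: g v frag_extend_add)
  also have "\<dots> = frag_of [retract (g \<otimes>\<^bsub>G\<^esub> v)] - frag_of [retract v]"
    by (rule edge_path_telescope[where q = "\<lambda>v. frag_of [retract v]", OF lmult_action g v])
      (simp_all add: chain_boundary_edge)
  finally show ?thesis .
qed

lemma chain_boundary_relator:
  assumes s: "s \<in> S" and v: "v \<in> carrier G"
  shows "chain_boundary (relator lmult edge stable_edge v s) = 0"
proof -
  have "chain_boundary (relator lmult edge stable_edge v s) =
      relator lmult (\<lambda>v s. chain_boundary (edge v s)) (\<lambda>v. chain_boundary (stable_edge v)) v s"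
    by (rule relator_map[where p = "\<lambda>v. v" and h = chain_boundary, OF lmult_action lmult_action, symmetric])
      (simp_all add: s v frag_extend_add)
  also have "\<dots> = 0"
    by (rule relator_telescope[where q = "\<lambda>v. frag_of [retract v]", OF lmult_action s v])
      (simp_all add: chain_boundary_edge)
  finally show ?thesis .
qed

lemma chain_boundary_cell:
  assumes "s \<in> S" "v \<in> carrier G"
  shows "chain_boundary (cell v s) = relator lmult edge stable_edge v s"
  unfolding cell_def chain_boundary_cone chain_boundary_relator[OF assms] by (simp add: cone_def)

lemma chain_boundary_strip:
  assumes g: "g \<in> carrier G" and v: "v \<in> carrier G"
  shows "chain_boundary (strip lmult cell g h v) = strip lmult (relator lmult edge stable_edge) g h v"
  by (rule strip_map[where p = "\<lambda>v. v" and h = chain_boundary, OF lmult_action lmult_action, symmetric])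
    (simp_all add: g v frag_extend_add chain_boundary_cell)

lemma keys_edge:
  assumes "v \<in> carrier G" "s \<in> S"
  shows "Poly_Mapping.keys (edge v s) \<subseteq> simplices 2 H"
  using assms retract_in by (simp add: edge_def simplices_def)

lemma keys_stable_edge:
  assumes "v \<in> carrier G"
  shows "Poly_Mapping.keys (stable_edge v) \<subseteq> simplices 2 H"
  using assms retract_in by (simp add: stable_edge_def simplices_def)

lemma restrict_chain_add: "restrict_chain A (x + y) = restrict_chain A x + restrict_chain A y"
  by (simp add: restrict_chain_def frag_extend_add)

lemma keys_edge_path:
  assumes g: "g \<in> carrier G" and v: "v \<in> carrier G"
  shows "Poly_Mapping.keys (edge_path lmult edge stable_edge g v) \<subseteq> simplices 2 H"
proof -
  have "edge_path lmult edge stable_edge g v = restrict_chain (simplices 2 H) (edge_path lmult edge stable_edge g v)"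
    by (rule edge_path_map[where p = "\<lambda>v. v", OF lmult_action lmult_action])
      (simp_all add: g v restrict_chain_add restrict_chain_id keys_edge keys_stable_edge)
  then show ?thesis using keys_restrict_chain by metis
qed

lemma keys_relator:
  assumes s: "s \<in> S" and v: "v \<in> carrier G"
  shows "Poly_Mapping.keys (relator lmult edge stable_edge v s) \<subseteq> simplices 2 H"
proof -
  have "relator lmult edge stable_edge v s = restrict_chain (simplices 2 H) (relator lmult edge stable_edge v s)"
    by (rule relator_map[where p = "\<lambda>v. v", OF lmult_action lmult_action])
      (simp_all add: s v restrict_chain_add restrict_chain_id keys_edge keys_stable_edge)
  then show ?thesis using keys_restrict_chain by metis
qed

lemma keys_cell:
  assumes "v \<in> carrier G" "s \<in> S"
  shows "Poly_Mapping.keys (cell v s) \<subseteq> simplices 3 H"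
  using keys_cone[OF keys_relator[OF assms(2,1)] retract_in[OF assms(1)]] by (simp add: cell_def numeral_3_eq_3)

lemma keys_strip:
  assumes g: "g \<in> carrier G" and v: "v \<in> carrier G"
  shows "Poly_Mapping.keys (strip lmult cell g h v) \<subseteq> simplices 3 H"
proof -
  have "strip lmult cell g h v = restrict_chain (simplices 3 H) (strip lmult cell g h v)"
    by (rule strip_map[where p = "\<lambda>v. v", OF lmult_action lmult_action])
      (simp_all add: g v restrict_chain_add restrict_chain_id keys_cell)
  then show ?thesis using keys_restrict_chain by metis
qed

context
  fixes l assumes l: "l \<in> H"
begin

lemma translate_closed: "v \<in> carrier G \<Longrightarrow> v \<otimes>\<^bsub>G\<^esub> l \<in> carrier G"
  using mult_H l by blast

lemma translate_assoc: "g \<in> carrier G \<Longrightarrow> v \<in> carrier G \<Longrightarrow> g \<otimes>\<^bsub>G\<^esub> v \<otimes>\<^bsub>G\<^esub> l = g \<otimes>\<^bsub>G\<^esub> (v \<otimes>\<^bsub>G\<^esub> l)"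
  using H_sub l by (simp add: GG.m_assoc)

abbreviation translate :: "(('a \<times> int) list \<Rightarrow>\<^sub>0 int) \<Rightarrow> (('a \<times> int) list \<Rightarrow>\<^sub>0 int)" where
  "translate \<equiv> frag_extend (frag_of \<circ> map (\<lambda>x. x \<otimes>\<^bsub>G\<^esub> l))"

lemma edge_translate:
  "v \<in> carrier G \<Longrightarrow> s \<in> S \<Longrightarrow> edge (v \<otimes>\<^bsub>G\<^esub> l) s = translate (edge v s)"
  "v \<in> carrier G \<Longrightarrow> stable_edge (v \<otimes>\<^bsub>G\<^esub> l) = translate (stable_edge v)"
  using l by (simp_all add: edge_def stable_edge_def retract_mult flip: translate_assoc)

lemma edge_path_translate:
  assumes "g \<in> carrier G" "v \<in> carrier G"
  shows "edge_path lmult edge stable_edge g (v \<otimes>\<^bsub>G\<^esub> l) = translate (edge_path lmult edge stable_edge g v)"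
  by (rule edge_path_map[where p = "\<lambda>v. v \<otimes>\<^bsub>G\<^esub> l", OF lmult_action lmult_action])
    (simp_all add: assms translate_closed translate_assoc frag_extend_add edge_translate comp_def)

lemma cell_translate:
  assumes "v \<in> carrier G" "s \<in> S"
  shows "cell (v \<otimes>\<^bsub>G\<^esub> l) s = translate (cell v s)"
proof -
  have "relator lmult edge stable_edge (v \<otimes>\<^bsub>G\<^esub> l) s = translate (relator lmult edge stable_edge v s)"
    by (rule relator_map[where p = "\<lambda>v. v \<otimes>\<^bsub>G\<^esub> l", OF lmult_action lmult_action])
      (simp_all add: assms translate_closed translate_assoc frag_extend_add edge_translate comp_def)
  then show ?thesis
    using cone_map[of "\<lambda>x. x \<otimes>\<^bsub>G\<^esub> l" "retract v"] assms l by (simp only: cell_def retract_mult)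
qed

lemma strip_translate:
  assumes "g \<in> carrier G" "v \<in> carrier G"
  shows "strip lmult cell g h (v \<otimes>\<^bsub>G\<^esub> l) = translate (strip lmult cell g h v)"
  by (rule strip_map[where p = "\<lambda>v. v \<otimes>\<^bsub>G\<^esub> l", OF lmult_action lmult_action])
    (simp_all add: assms translate_closed translate_assoc frag_extend_add cell_translate comp_def)

lemma quotient_translate:
  "x \<in> H \<Longrightarrow> y \<in> H \<Longrightarrow> y \<otimes>\<^bsub>G\<^esub> l \<otimes>\<^bsub>G\<^esub> inv\<^bsub>G\<^esub> (x \<otimes>\<^bsub>G\<^esub> l) = y \<otimes>\<^bsub>G\<^esub> inv\<^bsub>G\<^esub> x"
  using H_sub l GG.r_inv[of l] by (simp add: GG.inv_mult_group GG.m_assoc flip: GG.m_assoc[of l "inv\<^bsub>G\<^esub> l"])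

end

lemma quotient_closed: "x \<in> H \<Longrightarrow> y \<in> H \<Longrightarrow> y \<otimes>\<^bsub>G\<^esub> inv\<^bsub>G\<^esub> x \<in> carrier G"
  using H_sub by simp

lemma quotient_mult:
  assumes "x \<in> H" "y \<in> H" "z \<in> H"
  shows "z \<otimes>\<^bsub>G\<^esub> inv\<^bsub>G\<^esub> y \<otimes>\<^bsub>G\<^esub> (y \<otimes>\<^bsub>G\<^esub> inv\<^bsub>G\<^esub> x) = z \<otimes>\<^bsub>G\<^esub> inv\<^bsub>G\<^esub> x"
    "y \<otimes>\<^bsub>G\<^esub> inv\<^bsub>G\<^esub> x \<otimes>\<^bsub>G\<^esub> x = y"
  using H_sub[OF assms(1)] H_sub[OF assms(2)] H_sub[OF assms(3)]
  by (simp_all add: GG.m_assoc flip: GG.m_assoc[of "inv\<^bsub>G\<^esub> y" y])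

lemma cellular_triangle:
  assumes "x \<in> H" "y \<in> H" "z \<in> H"
  shows "cellular [y, z] - cellular [x, z] + cellular [x, y] =
    strip lmult (relator lmult edge stable_edge) (y \<otimes>\<^bsub>G\<^esub> inv\<^bsub>G\<^esub> x) (z \<otimes>\<^bsub>G\<^esub> inv\<^bsub>G\<^esub> y) x"
  using edge_path_mult[OF lmult_action quotient_closed[OF assms(1,2)] quotient_closed[OF assms(2,3)] H_sub[OF assms(1)],
      of edge stable_edge]
  unfolding quotient_mult[OF assms] cellular_simps .

lemma cellular_tetrahedron:
  assumes "x \<in> H" "y \<in> H" "z \<in> H" "w \<in> H"
  shows "cellular [y, z, w] - cellular [x, z, w] + cellular [x, y, w] - cellular [x, y, z] = 0"
  using strip_cocycle[OF lmult_action quotient_closed[OF assms(1,2)] quotient_closed[OF assms(2,3)]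
      quotient_closed[OF assms(3,4)] H_sub[OF assms(1)], of cell]
  unfolding quotient_mult[OF assms(1-3)] quotient_mult[OF assms(2-4)] cellular_simps .

lemma cellular_one: "xs \<in> simplices 1 (carrier KH) \<Longrightarrow> cellular xs = frag_of xs"
  by (auto simp: simplices_def length_Suc_conv cellular_simps)

text \<open>In dimension one the weights telescope, in dimension two the strip formula for products
  applies, in dimension three the cocycle rule for strips; above that both sides vanish.\<close>

lemma cellular_chain:
  assumes xs: "xs \<in> simplices (Suc (Suc n)) (carrier KH)"
  shows "chain_boundary (cellular xs) = frag_extend cellular (simplex_boundary xs)"
proof -
  have len: "length xs = Suc (Suc n)" and xs': "xs \<in> simplices (Suc (Suc n)) H"
    using xs by (auto simp: simplices_def)
  show ?thesis
  proof (cases rule: simplices_cases[OF xs'])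
    case (1 x)
    then show ?thesis using len by simp
  next
    case (2 x y)
    then show ?thesis using chain_boundary_edge_path[OF quotient_closed[OF 2(2,3)] H_sub[OF 2(2)]]
      by (simp add: cellular_simps quotient_mult[of x y x] retract_H cone_def frag_extend_diff)
  next
    case (3 x y z)
    have "frag_extend cellular (simplex_boundary [x, y, z]) = cellular [y, z] - cellular [x, z] + cellular [x, y]"
      by (simp add: cone_def frag_extend_diff frag_extend_add algebra_simps)
    also have "\<dots> = chain_boundary (strip lmult cell (y \<otimes>\<^bsub>G\<^esub> inv\<^bsub>G\<^esub> x) (z \<otimes>\<^bsub>G\<^esub> inv\<^bsub>G\<^esub> y) x)"
      unfolding cellular_triangle[OF 3(2-4)]
      by (rule chain_boundary_strip[OF quotient_closed[OF 3(2,3)] H_sub[OF 3(2)], symmetric])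
    finally show ?thesis by (simp add: 3(1) cellular_simps)
  next
    case (4 x y z w ws)
    show ?thesis
    proof (cases ws)
      case Nil
      have "frag_extend cellular (simplex_boundary [x, y, z, w]) =
          cellular [y, z, w] - cellular [x, z, w] + cellular [x, y, w] - cellular [x, y, z]"
        by (simp add: cone_def frag_extend_diff frag_extend_add algebra_simps)
      also have "\<dots> = 0" using 4 by (intro cellular_tetrahedron) auto
      finally show ?thesis by (simp add: 4(1) Nil cellular_simps)
    next
      case (Cons v vs)
      have "frag_extend cellular (simplex_boundary xs) = 0"
      proof (rule frag_extend_eq_0)
        fix ys assume "ys \<in> Poly_Mapping.keys (simplex_boundary xs)"
        then have "length ys = Suc n" using keys_simplex_boundary[OF xs'] by (auto simp: simplices_def)
        moreover have "4 \<le> Suc n" using len by (simp add: 4(1) Cons)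
        ultimately show "cellular ys = 0" by (intro cellular_long) simp
      qed
      then show ?thesis by (simp add: 4(1) cellular_simps)
    qed
  qed
qed

lemma cellular_supp:
  assumes xs: "xs \<in> simplices (Suc n) (carrier KH)"
  shows "Poly_Mapping.keys (cellular xs) \<subseteq> simplices (Suc n) (carrier KH)"
proof -
  have len: "length xs = Suc n" and xs': "xs \<in> simplices (Suc n) H"
    using xs by (auto simp: simplices_def)
  show ?thesis
  proof (cases rule: simplices_cases[OF xs'])
    case (1 x)
    then show ?thesis using xs by (simp add: cellular_simps)
  next
    case (2 x y)
    then show ?thesis using len keys_edge_path[OF quotient_closed[OF 2(2,3)] H_sub[OF 2(2)]]
      by (simp add: cellular_simps numeral_2_eq_2)
  next
    case (3 x y z)
    then show ?thesis using len keys_strip[OF quotient_closed[OF 3(2,3)] H_sub[OF 3(2)]]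
      by (simp add: cellular_simps numeral_3_eq_3)
  qed (simp add: cellular_simps)
qed

lemma cellular_equiv:
  assumes xs: "xs \<in> simplices (Suc n) (carrier KH)" and l: "l \<in> carrier KH"
  shows "cellular (map (\<lambda>x. x \<otimes>\<^bsub>KH\<^esub> l) xs) = frag_extend (frag_of \<circ> map (\<lambda>x. x \<otimes>\<^bsub>KH\<^esub> l)) (cellular xs)"
proof -
  have xs': "xs \<in> simplices (Suc n) H" and l': "l \<in> H" using xs l by (auto simp: simplices_def)
  show ?thesis
  proof (cases rule: simplices_cases[OF xs'])
    case (1 x)
    then show ?thesis by (simp add: cellular_simps)
  next
    case (2 x y)
    then show ?thesis using edge_path_translate[OF l' quotient_closed[OF 2(2,3)] H_sub[OF 2(2)]]
      by (simp add: cellular_simps quotient_translate[OF l'])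
  next
    case (3 x y z)
    then show ?thesis using strip_translate[OF l' quotient_closed[OF 3(2,3)] H_sub[OF 3(2)]]
      by (simp add: cellular_simps quotient_translate[OF l'])
  qed (simp add: cellular_simps)
qed

end

context group
begin

lemma bar_boundaries_add: "a \<in> bar_boundaries n G \<Longrightarrow> b \<in> bar_boundaries n G \<Longrightarrow> a + b \<in> bar_boundaries n G"
  using bar_boundaries_closed(2)[OF _ bar_boundaries_closed(2)[OF bar_boundaries_closed(1)], of a n b] by simp

lemma bar_boundaries_cmul: "a \<in> bar_boundaries n G \<Longrightarrow> frag_cmul k a \<in> bar_boundaries n G"
  by (rule frag_closure_minus_cmul[where P = "\<lambda>x. x \<in> bar_boundaries n G"]) (auto intro: bar_boundaries_closed)

lemma bar_boundaries_sum:
  "(\<And>i. i \<in> I \<Longrightarrow> f i \<in> bar_boundaries n G) \<Longrightarrow> sum f I \<in> bar_boundaries n G"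
  by (induction I rule: infinite_finite_induct) (auto intro: bar_boundaries_closed bar_boundaries_add)

end

section \<open>Comparison of the homology with the boundary matrix on cosets\<close>

context free_by_cyclic_subgroup
begin

abbreviation bar_cellular :: "('a \<times> int) list \<Rightarrow> ('a \<times> int) list \<Rightarrow>\<^sub>0 int" where
  "bar_cellular gs \<equiv> KH.bar_chain (cellular (KH.bar_lift gs))"

lemma cellular_homotopy:
  "z \<in> bar_cycles (Suc m) KH \<Longrightarrow> z - frag_extend bar_cellular z \<in> bar_boundaries (Suc m) KH"
  by (rule KH.bar_homotopy[where \<tau> = cellular, rotated 4])
    (assumption | erule cellular_one cellular_chain cellular_supp | erule (1) cellular_equiv)+

lemma cellular_chain_map:
  "w \<in> carrier (bar_chain_group (Suc n) KH) \<Longrightarrow>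
    frag_extend bar_cellular (bar_boundary (Suc n) KH w) = bar_boundary (Suc n) KH (frag_extend bar_cellular w)"
  by (rule KH.bar_lift_chain_map[where \<tau> = cellular, rotated 4])
    (assumption | erule cellular_one cellular_chain cellular_supp | erule (1) cellular_equiv)+

definition descend :: "('a \<times> int \<Rightarrow> 'c) \<Rightarrow> ('a \<times> int) set \<Rightarrow> 'c" where
  "descend \<psi> C = \<psi> (SOME v. v \<in> carrier G \<and> coset v = C)"

lemma descend:
  assumes inv: "\<And>v l. v \<in> carrier G \<Longrightarrow> l \<in> H \<Longrightarrow> \<psi> (v \<otimes>\<^bsub>G\<^esub> l) = \<psi> v" and v: "v \<in> carrier G"
  shows "descend \<psi> (coset v) = \<psi> v"
proof -
  define w where "w = (SOME w. w \<in> carrier G \<and> coset w = coset v)"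
  have w: "w \<in> carrier G \<and> coset w = coset v"
    unfolding w_def by (rule someI[of _ v]) (use v in simp)
  then have "v \<in> coset w" using self_in_coset[OF v] by simp
  then obtain l where "l \<in> H" "v = w \<otimes>\<^bsub>G\<^esub> l" by (rule in_cosetE)
  then have "\<psi> v = \<psi> w" using inv w by auto
  then show ?thesis by (simp add: descend_def w_def)
qed

definition free_edge :: "('a \<times> int) set \<Rightarrow> 'a \<Rightarrow> (('a \<times> int) set \<times> 'a) + ('a \<times> int) set \<Rightarrow>\<^sub>0 int" where
  "free_edge C s = frag_of (Inl (C, s))"

definition free_stable_edge :: "('a \<times> int) set \<Rightarrow> (('a \<times> int) set \<times> 'a) + ('a \<times> int) set \<Rightarrow>\<^sub>0 int" where
  "free_stable_edge C = frag_of (Inr C)"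

text \<open>The map from cellular edge chains on cosets to bar chains, evaluated at any
  representative. The value \<open>0\<close> off the edges means that chains need to be compared
  only on \<open>edges\<close>.\<close>

definition realize :: "(('a \<times> int) set \<times> 'a) + ('a \<times> int) set \<Rightarrow> ('a \<times> int) list \<Rightarrow>\<^sub>0 int" where
  "realize l = (if l \<in> edges cosets_H then
     (case l of Inl x \<Rightarrow> descend (\<lambda>v. KH.bar_chain (edge v (snd x))) (fst x)
      | Inr C \<Rightarrow> descend (\<lambda>v. KH.bar_chain (stable_edge v)) C) else 0)"

lemma bar_chain_add: "KH.bar_chain (x + y) = KH.bar_chain x + KH.bar_chain y"
  by (simp add: KH.bar_chain_def frag_extend_add)

lemma bar_chain_edge_mult:
  assumes "v \<in> carrier G" "l \<in> H"
  shows "s \<in> S \<Longrightarrow> KH.bar_chain (edge (v \<otimes>\<^bsub>G\<^esub> l) s) = KH.bar_chain (edge v s)"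
    "KH.bar_chain (stable_edge (v \<otimes>\<^bsub>G\<^esub> l)) = KH.bar_chain (stable_edge v)"
  using KH.bar_chain_translate[of "edge v s" 2 l] KH.bar_chain_translate[of "stable_edge v" 2 l]
    keys_edge[of v s] keys_stable_edge[of v] assms
  by (simp_all add: edge_translate)

lemma realize_edges:
  assumes "v \<in> carrier G"
  shows "s \<in> S \<Longrightarrow> realize (Inl (coset v, s)) = KH.bar_chain (edge v s)"
    "realize (Inr (coset v)) = KH.bar_chain (stable_edge v)"
  using assms coset_in descend[of "\<lambda>v. KH.bar_chain (edge v s)" v, OF bar_chain_edge_mult(1)]
    descend[of "\<lambda>v. KH.bar_chain (stable_edge v)" v, OF bar_chain_edge_mult(2)]
  by (simp_all add: realize_def edges_def)

text \<open>Naturality twice: once for the coefficient map \<open>realize\<close> on the cosets,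
  once for the projection of \<open>G\<close> to the cosets.\<close>

lemma realize_edge_path:
  assumes g: "g \<in> carrier G" and v: "v \<in> carrier G"
  shows "frag_extend realize (edge_path cact free_edge free_stable_edge g (coset v)) =
    KH.bar_chain (edge_path lmult edge stable_edge g v)"
proof -
  have "frag_extend realize (edge_path cact free_edge free_stable_edge g (coset v)) =
      edge_path cact (\<lambda>C s. realize (Inl (C, s))) (\<lambda>C. realize (Inr C)) g (coset v)"
    by (rule edge_path_map[where p = "\<lambda>v. v" and h = "frag_extend realize", OF coset_action coset_action, symmetric])
      (simp_all add: g coset_in v frag_extend_add free_edge_def free_stable_edge_def)
  also have "\<dots> = KH.bar_chain (edge_path lmult edge stable_edge g v)"
    by (rule edge_path_map[where p = coset and h = KH.bar_chain, OF lmult_action coset_action])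
      (simp_all add: g v coset_in coset_lmult bar_chain_add realize_edges)
  finally show ?thesis .
qed

lemma realize_relator:
  assumes s: "s \<in> S" and v: "v \<in> carrier G"
  shows "frag_extend realize (relator cact free_edge free_stable_edge (coset v) s) =
    KH.bar_chain (relator lmult edge stable_edge v s)"
proof -
  have "frag_extend realize (relator cact free_edge free_stable_edge (coset v) s) =
      relator cact (\<lambda>C s. realize (Inl (C, s))) (\<lambda>C. realize (Inr C)) (coset v) s"
    by (rule relator_map[where p = "\<lambda>v. v" and h = "frag_extend realize", OF coset_action coset_action, symmetric])
      (simp_all add: s coset_in v frag_extend_add free_edge_def free_stable_edge_def)
  also have "\<dots> = KH.bar_chain (relator lmult edge stable_edge v s)"
    by (rule relator_map[where p = coset and h = KH.bar_chain, OF lmult_action coset_action])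
      (simp_all add: s v coset_in coset_lmult bar_chain_add realize_edges)
  finally show ?thesis .
qed

text \<open>In the bar complex a relator is filled by the image of its cone.\<close>

lemma realize_relator_boundary:
  assumes x: "x \<in> cosets_H \<times> S"
  shows "frag_extend realize (relator cact free_edge free_stable_edge (fst x) (snd x)) \<in> bar_boundaries 1 KH"
proof -
  obtain v where v: "v \<in> carrier G" "fst x = coset v" using x unfolding LCOSETS_def by auto
  have s: "snd x \<in> S" using x by auto
  have keys: "Poly_Mapping.keys (cell v (snd x)) \<subseteq> simplices (Suc (Suc (Suc 0))) (carrier KH)"
    using keys_cell[OF v(1) s] by (simp add: numeral_3_eq_3)
  have "KH.bar_chain (relator lmult edge stable_edge v (snd x)) = bar_boundary (Suc 1) KH (KH.bar_chain (cell v (snd x)))"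
    using KH.bar_chain_boundary[OF keys] by (simp add: chain_boundary_cell[OF s v(1)])
  moreover have "KH.bar_chain (cell v (snd x)) \<in> carrier (bar_chain_group (Suc 1) KH)"
  proof -
    have "Poly_Mapping.keys (KH.bar_chain (cell v (snd x))) \<subseteq> simplices (Suc 1) (carrier KH)"
      unfolding KH.bar_chain_def
      by (rule keys_frag_extend_subset[OF keys]) (use KH.set_bar_word in \<open>auto simp: simplices_def\<close>)
    then show ?thesis by (simp add: bar_chain_group_def simplices_def)
  qed
  ultimately show ?thesis
    unfolding v(2) realize_relator[OF s v(1)] bar_boundaries_def by blast
qed

text \<open>The inverse appears because the lift of the bar word \<open>[g]\<close> is the edge from
  \<open>g\<close> to \<open>\<one>\<close>, which is traversed by \<open>inv g\<close>; the coset
  of its initial vertex \<open>g\<close> is \<open>H\<close>.\<close>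

definition first_coords :: "(('a \<times> int) list \<Rightarrow>\<^sub>0 int) \<Rightarrow> (('a \<times> int) set \<times> 'a) + ('a \<times> int) set \<Rightarrow>\<^sub>0 int" where
  "first_coords = frag_extend (\<lambda>gs. edge_path cact free_edge free_stable_edge (inv\<^bsub>G\<^esub> (hd gs)) H)"

lemma realize_first_coords:
  assumes z: "z \<in> bar_cycles 1 KH"
  shows "frag_extend bar_cellular z = frag_extend realize (first_coords z)"
  unfolding first_coords_def frag_extend_comp
proof (rule frag_extend_eq)
  fix gs assume "gs \<in> Poly_Mapping.keys z"
  then have "gs \<in> simplices 1 H" using z by (auto simp: bar_cycles_def bar_chain_group_def simplices_def)
  then obtain g where g: "gs = [g]" "g \<in> H" by (auto simp: simplices_def length_Suc_conv)
  have g': "g \<in> carrier G" "inv\<^bsub>G\<^esub> g \<in> carrier G" using H_sub[OF g(2)] by auto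
  show "bar_cellular gs = frag_extend realize (edge_path cact free_edge free_stable_edge (inv\<^bsub>G\<^esub> (hd gs)) H)"
    using realize_edge_path[OF g'(2,1)] g g' by (simp add: coset_H cellular_simps)
qed

text \<open>The boundary of a bar simplex becomes the boundary of the strip over its triangle, hence
  a combination of relators.\<close>

lemma first_coords_boundary:
  assumes w: "w \<in> carrier (bar_chain_group (Suc 1) KH)"
  obtains y where "first_coords (bar_boundary (Suc 1) KH w) =
    frag_extend (\<lambda>x. if x \<in> cosets_H \<times> S then relator cact free_edge free_stable_edge (fst x) (snd x) else 0) y"
proof
  let ?m = "\<lambda>x. if x \<in> cosets_H \<times> S then relator cact free_edge free_stable_edge (fst x) (snd x) else 0"
  let ?y = "\<lambda>gs. strip cact (\<lambda>C s. frag_of (C, s)) (inv\<^bsub>G\<^esub> (hd gs)) (inv\<^bsub>G\<^esub> (hd (tl gs))) H"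
  let ?E = "\<lambda>g. edge_path cact free_edge free_stable_edge (inv\<^bsub>G\<^esub> g) H"
  have "first_coords (bar_boundary (Suc 1) KH w) =
      frag_extend (\<lambda>gs. first_coords (\<Sum>i\<le>Suc 1. frag_cmul ((- 1) ^ i) (frag_of (bar_face KH i gs)))) w"
    by (simp add: bar_boundary_def first_coords_def frag_extend_comp del: sum.atMost_Suc)
  also have "\<dots> = frag_extend (\<lambda>gs. frag_extend ?m (?y gs)) w"
  proof (rule frag_extend_eq)
    fix gs assume "gs \<in> Poly_Mapping.keys w"
    then have "gs \<in> simplices (Suc 1) H" using w by (auto simp: bar_chain_group_def simplices_def)
    then obtain g h where gh: "gs = [g, h]" "g \<in> H" "h \<in> H" by (auto simp: simplices_def length_Suc_conv)
    have c: "g \<in> carrier G" "h \<in> carrier G" using H_sub gh by auto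
    have f: "cact (inv\<^bsub>G\<^esub> g) H = H" using coset_H[OF subgroup.m_inv_closed[OF H gh(2)]] by (simp add: cact_def)
    have "first_coords (\<Sum>i\<le>Suc 1. frag_cmul ((- 1) ^ i) (frag_of (bar_face KH i gs))) = ?E h - ?E (g \<otimes>\<^bsub>G\<^esub> h) + ?E g"
      by (simp add: gh(1) bar_face_def first_coords_def frag_extend_add frag_extend_diff frag_extend_minus numeral_2_eq_2)
    also have "\<dots> = strip cact (relator cact free_edge free_stable_edge) (inv\<^bsub>G\<^esub> g) (inv\<^bsub>G\<^esub> h) H"
      using edge_path_mult[OF coset_action _ _ H_in, of "inv\<^bsub>G\<^esub> g" "inv\<^bsub>G\<^esub> h" free_edge free_stable_edge] c
      by (simp add: f GG.inv_mult_group)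
    also have "\<dots> = frag_extend ?m (strip cact (\<lambda>C s. frag_of (C, s)) (inv\<^bsub>G\<^esub> g) (inv\<^bsub>G\<^esub> h) H)"
      by (rule strip_map[where p = "\<lambda>v. v", OF coset_action coset_action])
        (simp_all add: c H_in frag_extend_add)
    finally show "first_coords (\<Sum>i\<le>Suc 1. frag_cmul ((- 1) ^ i) (frag_of (bar_face KH i gs))) = frag_extend ?m (?y gs)"
      by (simp add: gh(1))
  qed
  finally show "first_coords (bar_boundary (Suc 1) KH w) = frag_extend ?m (frag_extend ?y w)"
    by (simp add: frag_extend_comp)
qed

lemma torsion_separatingD:
  assumes "torsion_separating \<L> rep" "rep v = rep v'" "0 < k"
    "\<And>l. l \<in> edges \<L> \<Longrightarrow> k * (v l - v' l) = (\<Sum>x\<in>\<L> \<times> S. cell_boundary l x * y x)"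
  shows "\<exists>z. \<forall>l \<in> edges \<L>. v l - v' l = (\<Sum>x\<in>\<L> \<times> S. cell_boundary l x * z x)"
  using assms unfolding torsion_separating_def by blast

text \<open>Identifies the relators on cosets with the columns of the integer matrix whose torsion
  has been estimated.\<close>

lemma lookup_relator:
  assumes x: "x \<in> cosets_H \<times> S"
  shows "Poly_Mapping.lookup (relator cact free_edge free_stable_edge (fst x) (snd x)) l = cell_boundary l x"
proof -
  have C: "fst x \<in> cosets_H" and s: "snd x \<in> S" using x by auto
  have a: "\<phi> (snd x) \<in> carrier F" "cact (tpow 1) (fst x) \<in> cosets_H"
    using s actionD(2)[OF coset_action tpow_closed C] by auto
  let ?h = "\<lambda>c. Poly_Mapping.lookup c l"
  have p: "?h (path cact free_edge (\<phi> (snd x)) (cact (tpow 1) (fst x))) =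
      path cact (\<lambda>C s. ?h (free_edge C s)) (\<phi> (snd x)) (cact (tpow 1) (fst x))"
    by (rule path_additive[OF coset_action _ a]) (simp add: lookup_add)
  show ?thesis
  proof (cases l)
    case (Inl r)
    have "(\<lambda>C s. ?h (free_edge C s)) = delta r" by (auto simp: fun_eq_iff free_edge_def delta_def Inl)
    then show ?thesis
      using p by (simp add: relator_def lookup_add lookup_minus cell_boundary_def shift_entry_def Inl free_edge_def
        free_stable_edge_def prod_eq_iff)
  next
    case (Inr D)
    have "(\<lambda>C s. ?h (free_edge C s)) = (\<lambda>C s. 0)" by (auto simp: fun_eq_iff free_edge_def Inr)
    moreover have "path cact (\<lambda>C s. 0::int) (\<phi> (snd x)) (cact (tpow 1) (fst x)) = 0"
      using path_additive[where h = "\<lambda>_. 0 :: int" and e = "\<lambda>_ _. 0::int", OF coset_action _ a] by simp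
    ultimately show ?thesis
      using p by (auto simp: relator_def lookup_add lookup_minus cell_boundary_def Inr free_edge_def free_stable_edge_def)
  qed
qed

text \<open>By \<open>first_coords\<close> the torsion relation between cycles becomes one in the
  cokernel of the boundary matrix, where \<open>rep\<close> separates. The resulting combination of
  relators is carried back by \<open>realize\<close>, and the homotopy replaces the cellular images
  by the cycles themselves.\<close>

lemma first_homology_separation:
  assumes fin: "finite cosets_H" and sep: "torsion_separating cosets_H rep"
    and z: "z \<in> bar_cycles 1 KH" and z': "z' \<in> bar_cycles 1 KH" and k: "0 < (k :: int)"
    and tor: "frag_cmul k (z - z') \<in> bar_boundaries 1 KH"
    and eq: "rep (Poly_Mapping.lookup (first_coords z)) = rep (Poly_Mapping.lookup (first_coords z'))"
  shows "z - z' \<in> bar_boundaries 1 KH"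
proof -
  let ?I = "cosets_H \<times> S"
  let ?r = "\<lambda>x. relator cact free_edge free_stable_edge (fst x) (snd x)"
  let ?v = "Poly_Mapping.lookup (first_coords z)" and ?v' = "Poly_Mapping.lookup (first_coords z')"
  have finI: "finite ?I" using fin finite_S by simp
  obtain w where w: "w \<in> carrier (bar_chain_group (Suc 1) KH)" "frag_cmul k (z - z') = bar_boundary (Suc 1) KH w"
    using tor by (auto simp: bar_boundaries_def)
  obtain y where y: "first_coords (bar_boundary (Suc 1) KH w) = frag_extend (\<lambda>x. if x \<in> ?I then ?r x else 0) y"
    by (rule first_coords_boundary[OF w(1)])
  have kv: "k * (?v l - ?v' l) = (\<Sum>x\<in>?I. cell_boundary l x * Poly_Mapping.lookup y x)" for l
  proof -
    have "k * (?v l - ?v' l) = Poly_Mapping.lookup (first_coords (frag_cmul k (z - z'))) l"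
      by (simp add: first_coords_def frag_extend_cmul frag_extend_diff lookup_minus)
    also have "\<dots> = (\<Sum>x\<in>?I. Poly_Mapping.lookup (if x \<in> ?I then ?r x else 0) l * Poly_Mapping.lookup y x)"
      unfolding w(2) y by (rule lookup_frag_extend_sum[OF finI]) simp
    also have "\<dots> = (\<Sum>x\<in>?I. cell_boundary l x * Poly_Mapping.lookup y x)"
      by (intro sum.cong refl) (simp add: lookup_relator del: mem_Sigma_iff)
    finally show ?thesis .
  qed
  obtain c where c: "\<forall>l \<in> edges cosets_H. ?v l - ?v' l = (\<Sum>x\<in>?I. cell_boundary l x * c x)"
    using torsion_separatingD[where v = ?v and v' = ?v' and y = "Poly_Mapping.lookup y", OF sep eq k kv] by blast
  define d where "d = (\<Sum>x\<in>?I. frag_cmul (c x) (?r x))"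
  \<comment> \<open>The relation from \<open>sep\<close> is known only on \<open>edges\<close>;
    \<open>realize\<close> vanishes elsewhere.\<close>
  have "frag_extend realize (first_coords z - first_coords z') = frag_extend realize d"
  proof (rule frag_extend_eq_lookup[where A = "edges cosets_H"])
    fix l assume l: "l \<in> edges cosets_H"
    have "Poly_Mapping.lookup d l = (\<Sum>x\<in>?I. cell_boundary l x * c x)"
      unfolding d_def lookup_sum by (intro sum.cong refl) (simp add: lookup_relator del: mem_Sigma_iff)
    then show "Poly_Mapping.lookup (first_coords z - first_coords z') l = Poly_Mapping.lookup d l"
      using c l by (simp add: lookup_minus)
  qed (simp add: realize_def)
  also have "\<dots> = (\<Sum>x\<in>?I. frag_cmul (c x) (frag_extend realize (?r x)))"
    unfolding d_def using finI by (simp add: frag_extend_sum frag_extend_cmul comp_def)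
  also have "\<dots> \<in> bar_boundaries 1 KH"
    by (intro KH.bar_boundaries_sum KH.bar_boundaries_cmul realize_relator_boundary)
  finally have 1: "frag_extend bar_cellular z - frag_extend bar_cellular z' \<in> bar_boundaries 1 KH"
    by (simp add: realize_first_coords[OF z] realize_first_coords[OF z'] frag_extend_diff)
  have 2: "z - frag_extend bar_cellular z \<in> bar_boundaries 1 KH" "z' - frag_extend bar_cellular z' \<in> bar_boundaries 1 KH"
    using cellular_homotopy[of _ 0] z z' by simp_all
  from KH.bar_boundaries_add[OF KH.bar_boundaries_closed(2)[OF 2] 1] show ?thesis by (simp add: algebra_simps)
qed

text \<open>A chain \<open>w\<close> of degree at least three has zero cellular image. So the image
  of \<open>k\<close> times \<open>z\<close> vanishes, hence that of \<open>z\<close> because chains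
  are torsion free, and \<open>z\<close> is homologous to its image.\<close>

lemma higher_homology_torsion_free:
  assumes z: "z \<in> bar_cycles (Suc m) KH" and m: "1 \<le> m" and k: "0 < k"
    and tor: "frag_cmul k z \<in> bar_boundaries (Suc m) KH"
  shows "z \<in> bar_boundaries (Suc m) KH"
proof -
  obtain w where w: "w \<in> carrier (bar_chain_group (Suc (Suc m)) KH)" "frag_cmul k z = bar_boundary (Suc (Suc m)) KH w"
    using tor by (auto simp: bar_boundaries_def)
  have "frag_extend bar_cellular w = 0"
  proof (rule frag_extend_eq_0)
    fix gs assume "gs \<in> Poly_Mapping.keys w"
    then have gs: "set gs \<subseteq> carrier KH" "length gs = Suc (Suc m)"
      using w(1) by (auto simp: bar_chain_group_def)
    then have "cellular (KH.bar_lift gs) = 0"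
      using KH.bar_lift_props[OF gs(1)] m by (intro cellular_long) simp
    then show "bar_cellular gs = 0" by (simp add: KH.bar_chain_def)
  qed
  then have "frag_extend bar_cellular (frag_cmul k z) = 0"
    using cellular_chain_map[OF w(1)] by (simp add: w(2)) (simp add: bar_boundary_def)
  then have "frag_extend bar_cellular z = 0" using k by (simp add: frag_extend_cmul)
  then show ?thesis using cellular_homotopy[OF z] by simp
qed

theorem torsion_card_bound:
  fixes rep :: "((('a \<times> int) set \<times> 'a) + ('a \<times> int) set \<Rightarrow> int) \<Rightarrow> 'z" and j :: nat
  assumes fin: "finite cosets_H" and sep: "torsion_separating cosets_H rep" and rep: "finite (range rep)"
  defines "T \<equiv> torsion_subgroup (integral_homology j KH)"
  shows "finite T \<and> T \<noteq> {} \<and> card T \<le> card (range rep)"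
proof (cases "j = 1")
  case True
  let ?rep = "\<lambda>z. rep (Poly_Mapping.lookup (first_coords z))"
  have sub: "range ?rep \<subseteq> range rep" by auto
  have "finite T \<and> T \<noteq> {} \<and> card T \<le> card (range ?rep)"
    unfolding T_def True
    using KH.torsion_homology_card[where rep = ?rep and j = 1, OF finite_subset[OF sub rep]]
      first_homology_separation[OF fin sep] by blast
  then show ?thesis using card_mono[OF rep sub] by linarith
next
  case False
  have "z - z' \<in> bar_boundaries j KH"
    if *: "z \<in> bar_cycles j KH" "z' \<in> bar_cycles j KH" "0 < k" "frag_cmul k (z - z') \<in> bar_boundaries j KH" for z z' k
  proof (cases j)
    case 0
    \<comment> \<open>Both faces of a bar simplex of degree one are the empty word, with opposite
      signs.\<close>
    have "bar_boundary (Suc 0) KH w = 0" if "w \<in> carrier (bar_chain_group (Suc 0) KH)" for w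
      using that by (auto simp: bar_boundary_def bar_face_def bar_chain_group_def length_Suc_conv intro!: frag_extend_eq_0)
    then have "frag_cmul k (z - z') = 0" using *(4) by (auto simp: bar_boundaries_def 0)
    then show ?thesis using *(3) KH.bar_boundaries_closed(1) by auto
  next
    case (Suc m)
    have "z - z' \<in> bar_cycles j KH"
      using *(1,2) by (auto simp: bar_cycles_def KH.bar_boundary_diff bar_chain_group_def keys_diff_subset)
    then show ?thesis using higher_homology_torsion_free[of "z - z'" m k] *(3,4) False Suc by simp
  qed
  \<comment> \<open>Outside degree one a constant map separates torsion, so the torsion subgroup is
    trivial.\<close>
  then have "finite T \<and> T \<noteq> {} \<and> card T \<le> card (range (\<lambda>_ :: ('a \<times> int) list \<Rightarrow>\<^sub>0 int. 0 :: nat))"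
    unfolding T_def using KH.torsion_homology_card[where rep = "\<lambda>_. 0 :: nat" and j = j] by simp
  moreover have "card (range (\<lambda>_ :: ('a \<times> int) list \<Rightarrow>\<^sub>0 int. 0 :: nat)) = 1" by simp
  moreover have "1 \<le> card (range rep)" using rep by (simp add: card_gt_0_iff Suc_le_eq)
  ultimately show ?thesis by auto
qed

end

section \<open>Vanishing of the torsion growth\<close>

context farber_free_by_cyclic
begin

lemma torsion_growth_rate:
  fixes j :: nat
  assumes \<delta>: "0 < \<delta>"
  defines "T \<equiv> \<lambda>n. torsion_subgroup (integral_homology j (G\<lparr>carrier := \<Gamma>s n\<rparr>))"
  shows "\<forall>\<^sub>F n in sequentially. finite (T n) \<and> 0 \<le> ln (real (card (T n))) \<and>
    ln (real (card (T n))) \<le> \<delta> * real (card (cosets n))"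
  using torsion_rate[OF \<delta>]
proof eventually_elim
  case (elim n)
  then obtain rep :: "((('a \<times> int) set \<times> 'a) + ('a \<times> int) set \<Rightarrow> int) \<Rightarrow> nat \<Rightarrow> int" where
    rep: "finite (range rep)" "ln (real (card (range rep))) \<le> \<delta> * real (card (cosets n))" "torsion_separating (cosets n) rep"
    by blast
  interpret sub: free_by_cyclic_subgroup F S \<phi> "\<Gamma>s n"
    by (rule free_by_cyclic_subgroup.intro[OF free_by_cyclic_axioms]) (rule free_by_cyclic_subgroup_axioms.intro, rule cosets_props(1))
  have T: "finite (T n)" "T n \<noteq> {}" "card (T n) \<le> card (range rep)"
    using sub.torsion_card_bound[OF cosets_props(2) rep(3,1), of j] by (auto simp: T_def)
  have "0 < card (T n)" using T by (simp add: card_gt_0_iff)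
  then have "0 \<le> ln (real (card (T n)))" "ln (real (card (T n))) \<le> ln (real (card (range rep)))"
    using T(3) by (simp_all add: Suc_le_eq)
  then show ?case using T(1) rep(2) by linarith
qed

lemma torsion_growth_zero: "torsion_growth j G \<Gamma>s = 0"
proof -
  let ?T = "\<lambda>n. torsion_subgroup (integral_homology j (G\<lparr>carrier := \<Gamma>s n\<rparr>))"
  let ?d = "\<lambda>n. real (card (cosets n))"
  have "(\<lambda>n. ln (real (card (?T n))) / ?d n) \<longlonglongrightarrow> 0"
  proof (rule tendstoI)
    fix \<epsilon> :: real assume "0 < \<epsilon>"
    then have "0 < \<epsilon> / 2" by simp
    from torsion_growth_rate[OF this, of j]
    show "\<forall>\<^sub>F n in sequentially. dist (ln (real (card (?T n))) / ?d n) 0 < \<epsilon>"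
    proof eventually_elim
      case (elim n)
      have "ln (real (card (?T n))) / ?d n \<le> \<epsilon> / 2"
        using elim card_cosets_pos[of n] by (simp add: pos_divide_le_eq)
      moreover have "0 \<le> ln (real (card (?T n))) / ?d n" using elim card_cosets_pos[of n] by simp
      ultimately show ?case using \<open>0 < \<epsilon>\<close> by (simp only: dist_real_def diff_0_right abs_of_nonneg)
    qed
  qed
  then have "(\<lambda>n. ereal (ln (real (card (?T n))) / ?d n)) \<longlonglongrightarrow> ereal 0" by (rule tendsto_ereal)
  moreover have "\<forall>\<^sub>F n in sequentially. ereal (ln (real (card (?T n))) / ?d n) =
      log_card (?T n) / ereal (real (subgroup_index G (\<Gamma>s n)))"
    \<comment> \<open>The instance with rate \<open>1\<close> supplies finiteness, which turns
      \<open>log_card\<close> into a real logarithm.\<close>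
    using torsion_growth_rate[of 1 j, simplified]
  proof eventually_elim
    case (elim n)
    then show ?case using card_cosets_pos[of n] by (simp add: log_card_def subgroup_index_def)
  qed
  ultimately have "(\<lambda>n. log_card (?T n) / ereal (real (subgroup_index G (\<Gamma>s n)))) \<longlonglongrightarrow> ereal 0"
    by (rule Lim_transform_eventually)
  from lim_imp_Limsup[OF _ this] show ?thesis by (simp add: torsion_growth_def zero_ereal_def)
qed

end

theorem theoremA:
  fixes F :: "('a, 'b) monoid_scheme"
    and S :: "'a set"
    and m :: nat
    and \<phi> :: "'a \<Rightarrow> 'a"
    and \<Gamma> :: "('a \<times> int) monoid"
  assumes "group F"
    and "free_basis F S"
    and "finite S"
    and "card S = m"
    and "\<phi> \<in> carrier (AutoGroup F)"
    and "\<Gamma> = semidirect_Z F \<phi>"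
    and "polynomially_growing F S \<phi>"
  shows "\<forall>\<Gamma>s. farber_sequence \<Gamma> \<Gamma>s \<longrightarrow>
           (\<forall>j::nat. torsion_growth j \<Gamma> \<Gamma>s = 0)"
proof (intro allI impI)
  fix \<Gamma>s j assume farber: "farber_sequence \<Gamma> \<Gamma>s"
  interpret group F by fact
  interpret free_group F S by unfold_locales fact
  interpret free_by_cyclic F S \<phi> by unfold_locales fact+
  have \<Gamma>: "\<Gamma> = G" using assms(6) by (simp add: G_def)
  obtain K e where "\<And>k s. s \<in> S \<Longrightarrow> len ((\<phi> ^^ k) s) \<le> K * Suc k ^ e"
    using polynomially_growing_len[OF assms(3,5,7)] by blast
  then interpret farber_free_by_cyclic F S \<phi> \<Gamma>s K e
    using farber by unfold_locales (simp_all add: \<Gamma>)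
  show "torsion_growth j \<Gamma> \<Gamma>s = 0" unfolding \<Gamma> by (rule torsion_growth_zero)
qed

end
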